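(* Let $K$ be a number field and let $k>1$ be an odd positive integer. If the Extended Riemann Hypothesis holds for $\zeta_K$, then \[ \frac{(-1)^{(k-1)/2}}{k!}\left(\frac{\Xi_K'}{\Xi_K}\right)^{(k)}\!\left(\tfrac12\right)=\sum_{\rho_K\neq 1/2}\frac{1}{|1/2-\rho_K|^{k+1}}, \] where the sum runs over all nontrivial zeros $\rho_K$ of $\zeta_K(s)$ distinct from $1/2$ (counted with multiplicity). Conversely, if this equality holds, then every nontrivial zero $\rho_K=\beta_K+i\gamma_K$ of $\zeta_K$ with $|\gamma_K|>\tfrac12\cot\!\big(2\pi/(k+1)\big)$ satisfies $\beta_K=1/2$.
   Context: For a number field $K$ of degree $n=r_1+2r_2$ over $\mathbb{Q}$ ($r_1$ real embeddings, $r_2$ pairs of complex embeddings) with discriminant $\Delta_K$, the Dedekind zeta function is $\zeta_K(s)=\sum_{\mathfrak a}N(\mathfrak a)^{-s}$ for $\Re s>1$ (sum over nonzero ideals of $\mathcal{O}_K$), meromorphically continued to $\mathbb{C}$ with a simple pole at $s=1$. Define the entire function \[ \xi_K(s)=\tfrac12 s(s-1)|\Delta_K|^{s/2}2^{(1-s)r_2}\pi^{-ns/2}\Gamma(s/2)^{r_1}\Gamma(s)^{r_2}\zeta_K(s), \] which satisfies $\xi_K(s)=\xi_K(1-s)$. Let $m\ge 0$ be the order of vanishing of $\zeta_K$ at $s=1/2$, and set $\Xi_K(s)=(s-1/2)^{-m}\xi_K(s)$. Nontrivial zeros of $\zeta_K$ are its zeros $\rho_K=\beta_K+i\gamma_K$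 with $0<\beta_K<1$. The Extended Riemann Hypothesis (ERH) for $\zeta_K$ asserts that every nontrivial zero has $\beta_K=1/2$. *)

theory Defs
  imports "HOL-Complex_Analysis.Complex_Analysis"
begin

(* A number field is modelled as a subfield K of the complex numbers of finite
   dimension over Q (every number field embeds into C; all quantities below are
   invariant under isomorphism). *)

definition is_complex_subfield :: "complex set \<Rightarrow> bool" where
  "is_complex_subfield K \<longleftrightarrow> 0 \<in> K \<and> 1 \<in> K \<and>
     (\<forall>x\<in>K. \<forall>y\<in>K. x + y \<in> K \<and> x * y \<in> K) \<and>
     (\<forall>x\<in>K. - x \<in> K) \<and> (\<forall>x\<in>K. x \<noteq> 0 \<longrightarrow> inverse x \<in> K)"

definition Q_span :: "complex set \<Rightarrow> complex set" where
  "Q_span B = {x. \<exists>c. x = (\<Sum>b\<in>B. of_rat (c b) * b)}"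

definition Q_indep :: "complex set \<Rightarrow> bool" where
  "Q_indep B \<longleftrightarrow> (\<forall>c. (\<Sum>b\<in>B. of_rat (c b) * b) = 0 \<longrightarrow> (\<forall>b\<in>B. c b = 0))"

definition Q_basis :: "complex set \<Rightarrow> complex set \<Rightarrow> bool" where
  "Q_basis K B \<longleftrightarrow> finite B \<and> B \<subseteq> K \<and> Q_indep B \<and> Q_span B = K"

definition number_field :: "complex set \<Rightarrow> bool" where
  "number_field K \<longleftrightarrow> is_complex_subfield K \<and> (\<exists>B. Q_basis K B)"

definition field_degree :: "complex set \<Rightarrow> nat" where
  "field_degree K = card (SOME B. Q_basis K B)"

definition embeddings :: "complex set \<Rightarrow> (complex \<Rightarrow> complex) set" where
  "embeddings K = {\<sigma>. (\<forall>x\<in>K. \<forall>y\<in>K. \<sigma> (x + y) = \<sigma> x + \<sigma> y \<and> \<sigma> (x * y) = \<sigma> x * \<sigma> y)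
       \<and> \<sigma> 1 = 1 \<and> (\<forall>x. x \<notin> K \<longrightarrow> \<sigma> x = 0)}"

definition real_embeddings :: "complex set \<Rightarrow> (complex \<Rightarrow> complex) set" where
  "real_embeddings K = {\<sigma>\<in>embeddings K. \<forall>x\<in>K. \<sigma> x \<in> \<real>}"

definition nf_r1 :: "complex set \<Rightarrow> nat" where
  "nf_r1 K = card (real_embeddings K)"

definition nf_r2 :: "complex set \<Rightarrow> nat" where
  "nf_r2 K = card (embeddings K - real_embeddings K) div 2"

definition algebraic_integer :: "complex \<Rightarrow> bool" where
  "algebraic_integer x \<longleftrightarrow> (\<exists>p :: int poly. lead_coeff p = 1 \<and> poly (map_poly of_int p) x = 0)"

definition ring_of_integers :: "complex set \<Rightarrow> complex set" where
  "ring_of_integers K = {x\<in>K. algebraic_integer x}"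

definition integral_basis :: "complex set \<Rightarrow> complex list \<Rightarrow> bool" where
  "integral_basis K bs \<longleftrightarrow> set bs \<subseteq> ring_of_integers K \<and>
     (\<forall>x\<in>ring_of_integers K. \<exists>c::nat \<Rightarrow> int. x = (\<Sum>i<length bs. of_int (c i) * bs ! i)) \<and>
     (\<forall>c::nat \<Rightarrow> int. (\<Sum>i<length bs. of_int (c i) * bs ! i) = 0 \<longrightarrow> (\<forall>i<length bs. c i = 0))"

definition det_fun :: "nat \<Rightarrow> (nat \<Rightarrow> nat \<Rightarrow> complex) \<Rightarrow> complex" where
  "det_fun n M = (\<Sum>p | p permutes {..<n}. of_int (sign p) * (\<Prod>i<n. M i (p i)))"

definition discriminant :: "complex set \<Rightarrow> complex" where
  "discriminant K = (SOME d. \<exists>bs \<sigma>s. integral_basis K bs \<and> distinct \<sigma>s \<and>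
        set \<sigma>s = embeddings K \<and> length \<sigma>s = length bs \<and>
        d = (det_fun (length bs) (\<lambda>i j. (\<sigma>s ! i) (bs ! j)))\<^sup>2)"

definition nonzero_ideals :: "complex set \<Rightarrow> complex set set" where
  "nonzero_ideals K = {I. I \<subseteq> ring_of_integers K \<and> 0 \<in> I \<and>
      (\<forall>x\<in>I. \<forall>y\<in>I. x + y \<in> I) \<and> (\<forall>x\<in>I. - x \<in> I) \<and>
      (\<forall>r\<in>ring_of_integers K. \<forall>x\<in>I. r * x \<in> I) \<and> I \<noteq> {0}}"

definition ideal_norm :: "complex set \<Rightarrow> complex set \<Rightarrow> nat" where
  "ideal_norm K I = card (ring_of_integers K //
      {(x, y). x \<in> ring_of_integers K \<and> y \<in> ring_of_integers K \<and> x - y \<in> I})"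

definition dedekind_series :: "complex set \<Rightarrow> complex \<Rightarrow> complex" where
  "dedekind_series K s = infsum (\<lambda>I. (of_nat (ideal_norm K I) :: complex) powr (- s)) (nonzero_ideals K)"

(* meromorphic continuation; value at the pole s = 1 is fixed to 0 by convention *)
definition dedekind_zeta :: "complex set \<Rightarrow> complex \<Rightarrow> complex" where
  "dedekind_zeta K = (THE f. f holomorphic_on (- {1}) \<and> f 1 = 0 \<and>
       (\<forall>s. 1 < Re s \<longrightarrow> f s = dedekind_series K s))"

definition completed_zeta :: "complex set \<Rightarrow> complex \<Rightarrow> complex" where
  "completed_zeta K = (THE f. f holomorphic_on UNIV \<and>
     (\<forall>s. 1 < Re s \<longrightarrow> f s =
        1/2 * s * (s - 1) * (complex_of_real (cmod (discriminant K))) powr (s / 2)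
        * (2::complex) powr ((1 - s) * of_nat (nf_r2 K))
        * (complex_of_real pi) powr (- of_nat (field_degree K) * s / 2)
        * Gamma (s / 2) ^ nf_r1 K * Gamma s ^ nf_r2 K * dedekind_zeta K s))"

definition central_order :: "complex set \<Rightarrow> nat" where
  "central_order K = nat (zorder (dedekind_zeta K) (1/2))"

definition Xi :: "complex set \<Rightarrow> complex \<Rightarrow> complex" where
  "Xi K = (THE g. g holomorphic_on UNIV \<and>
     (\<forall>s. s \<noteq> 1/2 \<longrightarrow> g s = completed_zeta K s / (s - 1/2) ^ central_order K))"

definition nontrivial_zeros :: "complex set \<Rightarrow> complex set" where
  "nontrivial_zeros K = {\<rho>. 0 < Re \<rho> \<and> Re \<rho> < 1 \<and> dedekind_zeta K \<rho> = 0}"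

definition ERH :: "complex set \<Rightarrow> bool" where
  "ERH K \<longleftrightarrow> (\<forall>\<rho>\<in>nontrivial_zeros K. Re \<rho> = 1/2)"

end

theory Submission
 imports Defs "Jordan_Normal_Form.Char_Poly" "HOL-Computational_Algebra.Field_as_Ring"
  "HOL-Probability.Characteristic_Functions" "HOL-Real_Asymp.Real_Asymp"
begin

text \<open>Hecke's continuation of the zeta function is obtained without fundamental domains. On the space
of pairs (fractional ideal, Euclidean metric at the archimedean places), the Gaussian theta function is
invariant under the multiplicative group of \<open>K\<close>, and Poisson summation describes it under duality.
Integrating over the quotient and recording only the logarithm of the covolume gives a measure on the real
line whose Laplace transform is the completed zeta function; the Euler product makes this finite for
\<open>s > 1\<close>, and this alone bounds the volume of the quotient, so neither the unit theorem nor the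
finiteness of the class number enters. The same integral gives the growth \<open>exp (C * (1 + cmod s)^2)\<close>
of \<open>Xi\<close>, so that Borel--Caratheodory on large circles expresses the \<open>k\<close>-th derivative of
\<open>Xi' / Xi\<close>, \<open>k \<ge> 3\<close>, as a sum over zeros, whose terms have modulus
\<open>1 / cmod (1/2 - \<rho>) ^ (k + 1)\<close>. Equality with the sum of the moduli
forces every term to be a positive real, which restricts the argument of \<open>\<rho> - 1/2\<close>.\<close>

section \<open>Poisson summation for Gaussians\<close>

text \<open>\<open>weight\<close> is the theta term of the vector 1. Its translates under
  \<open>K - {0}\<close> run through all nonzero vectors of a lattice, so they sum to theta minus 1;
  conversely the unfolded integral sees only fractional ideals containing 1, that is, inverses of
  integral ideals, and this is the source of the Dirichlet series. Where the covolume is small,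
  Poisson summation makes theta large, so the invariant density lies below \<open>weight\<close> and
  the transform at 2 bounds the volume. The constants 1 in \<open>1 + P\<close> produce the poles at
  0 and 1, with the volume as residue up to sign. The expansion over zeros sees every zero of the
  completed function, while \<open>nontrivial_zeros\<close> lies in the open strip; hence the
  nonvanishing on \<open>Re s = 1\<close> by the 3-4-1 inequality, and the functional equation for
  \<open>Re s \<le> 0\<close>. A growth bound of order two allows about \<open>R^2\<close> zeros
  within distance \<open>R\<close>, which the exponent \<open>k + 1 \<ge> 4\<close> absorbs. The
  threshold \<open>1/2 * cot (2 * pi / (k + 1))\<close> is where the ray of argument
  \<open>2 * pi / (k + 1)\<close> leaves a strip of half-width 1/2.\<close>

lemma periodic_orthogonal_polynomials_eq_0:
 fixes D :: "real \<Rightarrow> real"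
 assumes cont: "continuous_on UNIV D" and per: "\<And>x. D (x + 1) = D x"
  and int0: "\<And>p. real_polynomial_function p \<Longrightarrow> integral {0..1} (\<lambda>x. D x * p (cis (2 * pi * x))) = 0"
 shows "D x = 0"
proof -
 have per_int: "D (x + of_int n) = D x" for x and n :: int
 proof -
  have nat: "D (y + of_nat n) = D y" for y and n :: nat
  proof (induction n)
   case (Suc n)
   thus ?case using per[of "y + of_nat n"] by (simp add: add_ac)
  qed auto
  show ?thesis
  proof (cases "n \<ge> 0")
   case True
   thus ?thesis using nat[of x "nat n"] by simp
  next
   case False
   thus ?thesis using nat[of "x + of_int n" "nat (- n)"] by simp
  qed
 qed
 \<comment> \<open>\<open>D\<close> is transported to the unit circle, a compact set in the plane on
   which Stone-Weierstrass applies to polynomial functions.\<close>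
 define d where "d z = D (Arg z / (2 * pi))" for z
 have d_cis: "d (cis (2 * pi * x)) = D x" for x
 proof -
  have "cis (Arg (cis (2 * pi * x))) = cis (2 * pi * x)"
   using is_Arg_Arg[of "cis (2 * pi * x)"] by (simp add: is_Arg_def cis_conv_exp)
  hence "sin (Arg (cis (2 * pi * x))) = sin (2 * pi * x) \<and> cos (Arg (cis (2 * pi * x))) = cos (2 * pi * x)"
   by (simp add: complex_eq_iff)
  then obtain n :: int where "Arg (cis (2 * pi * x)) = 2 * pi * x + 2 * pi * of_int n"
   unfolding sin_cos_eq_iff by auto
  hence "Arg (cis (2 * pi * x)) / (2 * pi) = x + of_int n" by (simp add: field_simps)
  thus ?thesis using per_int by (simp add: d_def)
 qed
 \<comment> \<open>\<open>Arg\<close> jumps on the negative real axis. The same function written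
   with \<open>Arg (- z)\<close> and a shift by 1/2 is continuous there, so the two formulas
   together cover the circle.\<close>
 have d_alt: "d z = D (Arg (- z) / (2 * pi) + 1 / 2)" if "norm z = 1" for z
 proof -
  have "cis (Arg (- z)) = - z"
  proof -
   have "z \<noteq> 0" using that by auto
   thus ?thesis using is_Arg_Arg[of "- z"] that by (simp add: is_Arg_def cis_conv_exp)
  qed
  hence "cis (2 * pi * (Arg (- z) / (2 * pi) + 1 / 2)) = z"
   by (simp add: algebra_simps flip: cis_mult)
  thus ?thesis using d_cis by metis
 qed
 have "continuous_on (sphere 0 1) d"
 proof (rule continuous_on_eq_continuous_within[THEN iffD2], rule ballI)
  fix z :: complex assume z: "z \<in> sphere 0 1"
  have D': "isCont D y" for y using cont by (simp add: continuous_on_eq_continuous_at)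
  show "continuous (at z within sphere 0 1) d"
  proof (cases "z \<in> \<real>\<^sub>\<le>\<^sub>0")
   case False
   have "isCont (D \<circ> (\<lambda>z. Arg z / (2 * pi))) z"
    using False by (intro continuous_at_compose D' continuous_intros continuous_at_Arg) auto
   hence "isCont d z" by (simp add: d_def[abs_def] o_def)
   thus ?thesis by (rule continuous_at_imp_continuous_at_within)
  next
   case True
   hence "- z \<notin> \<real>\<^sub>\<le>\<^sub>0" using z by (auto simp: complex_nonpos_Reals_iff cmod_def)
   hence "isCont (Arg \<circ> uminus) z"
    by (intro continuous_at_compose continuous_at_Arg continuous_intros) auto
   hence A: "isCont (\<lambda>z. Arg (- z)) z" by (simp add: o_def)
   have "isCont (D \<circ> (\<lambda>z. Arg (- z) / (2 * pi) + 1 / 2)) z"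
    by (intro continuous_at_compose D' continuous_intros A) auto
   hence *: "continuous (at z within sphere 0 1) (\<lambda>z. D (Arg (- z) / (2 * pi) + 1 / 2))"
    by (simp add: o_def continuous_at_imp_continuous_at_within)
   show ?thesis using z by (intro continuous_transform_within[OF *, of 1]) (auto simp: d_alt)
  qed
 qed
 note contd = this
 have cD: "continuous_on {0..1} D" by (rule continuous_on_subset[OF cont]) auto
 have "bounded (D ` {0..1})" by (intro compact_imp_bounded compact_continuous_image cD compact_Icc)
 then obtain B where B: "\<And>x. x \<in> {0..1} \<Longrightarrow> \<bar>D x\<bar> \<le> B"
  unfolding bounded_iff by (metis imageI real_norm_def)
 have B0: "B \<ge> 0" using B[of 0] by auto
 \<comment> \<open>By orthogonality, the integral of \<open>D * D\<close> equals that of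
   \<open>D * (D - p)\<close> for every polynomial \<open>p\<close>, and this is at most
   \<open>B * e\<close> when \<open>p\<close> approximates within \<open>e\<close>.\<close>
 have small: "integral {0..1} (\<lambda>x. D x * D x) \<le> B * e" if e: "e > 0" for e
 proof -
  obtain p where p: "real_polynomial_function p" "\<And>z. z \<in> sphere 0 1 \<Longrightarrow> \<bar>d z - p z\<bar> < e"
   using Stone_Weierstrass_real_polynomial_function[OF compact_sphere contd e] by blast
  have "continuous_on {0..1} (\<lambda>x. p (cis (2 * pi * x)))"
  proof (rule continuous_on_compose2[where t = UNIV and g = p])
   show "continuous_on UNIV p"
    by (simp add: continuous_at_imp_continuous_on continuous_real_polymonial_function p(1))
  qed (auto intro!: continuous_intros)
  note cp = this
  have "integral {0..1} (\<lambda>x. D x * D x) = integral {0..1} (\<lambda>x. D x * D x) - integral {0..1} (\<lambda>x. D x * p (cis (2 * pi * x)))"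
   by (simp add: int0 p)
  also have "\<dots> = integral {0..1} (\<lambda>x. D x * D x - D x * p (cis (2 * pi * x)))"
   by (intro Henstock_Kurzweil_Integration.integral_diff[symmetric] integrable_continuous_real continuous_intros cD cp)
  also have "\<dots> \<le> integral {0..1} (\<lambda>x::real. B * e)"
  proof (rule integral_le)
   fix x :: real assume x: "x \<in> {0..1}"
   have "D x * D x - D x * p (cis (2 * pi * x)) = D x * (d (cis (2 * pi * x)) - p (cis (2 * pi * x)))"
    by (simp only: d_cis right_diff_distrib)
   also have "\<dots> \<le> \<bar>D x\<bar> * \<bar>d (cis (2 * pi * x)) - p (cis (2 * pi * x))\<bar>"
    by (simp add: abs_mult[symmetric])
   also have "\<dots> \<le> B * e"
    using B[OF x] p(2)[of "cis (2 * pi * x)"] B0 by (intro mult_mono) auto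
   finally show "D x * D x - D x * p (cis (2 * pi * x)) \<le> B * e" .
  qed (auto intro!: integrable_continuous_real continuous_intros cD cp)
  finally show ?thesis by simp
 qed
 have "integral {0..1} (\<lambda>x. D x * D x) \<le> 0"
 proof (rule field_le_epsilon)
  fix e :: real assume "e > 0"
  thus "integral {0..1} (\<lambda>x. D x * D x) \<le> 0 + e"
   using small[of "e / (B + 1)"] B0 by (auto simp: field_simps intro: order_trans[of _ "B * (e / (B + 1))"])
 qed
 moreover have "integral {0..1} (\<lambda>x. D x * D x) \<ge> 0"
  by (intro Henstock_Kurzweil_Integration.integral_nonneg integrable_continuous_real continuous_intros cD) auto
 ultimately have "integral {0..1} (\<lambda>x. D x * D x) = 0" by simp
 hence zero: "D x = 0" if "x \<in> {0..1}" for x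
 proof -
  have "(integral {0..1} (\<lambda>x. D x * D x) = 0) = (\<forall>x\<in>{0..1}. D x * D x = 0)"
   by (rule integral_eq_0_iff) (simp_all add: continuous_on_mult cD)
  thus ?thesis using that \<open>integral {0..1} (\<lambda>x. D x * D x) = 0\<close> by (metis mult_eq_0_iff)
 qed
 have "D x = D (frac x)" using per_int[of "frac x" "\<lfloor>x\<rfloor>"] by (simp add: frac_def)
 also have "\<dots> = 0" using frac_lt_1[of x] by (intro zero) (auto simp: frac_ge_0)
 finally show ?thesis .
qed

text \<open>Polynomials in the real and imaginary part of \<open>cis (2 * pi * x)\<close> are
  trigonometric polynomials, so vanishing coefficients give the orthogonality demanded by the
  preceding lemma, which is applied to \<open>Re\<close> and \<open>Im\<close> separately.\<close>

lemma fourier_uniqueness: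
 fixes D :: "real \<Rightarrow> complex"
 assumes cont: "continuous_on UNIV D" and per: "\<And>x. D (x + 1) = D x"
  and coeff: "\<And>k::int. integral {0..1} (\<lambda>x. D x * cis (2 * pi * of_int k * x)) = 0"
 shows "D x = 0"
proof -
 have cD: "continuous_on {0..1} D" by (rule continuous_on_subset[OF cont]) auto
 \<comment> \<open>Orthogonality is demanded against \<open>Q\<close> times every character, with
   \<open>Q\<close> arbitrary. In this form it passes to products, which the induction over
   polynomial functions needs.\<close>
 define Z where "Z Q \<longleftrightarrow> continuous_on {0..1} Q \<and>
  (\<forall>k::int. integral {0..1} (\<lambda>x. D x * (Q x * cis (2 * pi * of_int k * x))) = 0)" for Q
 have Z_add: "Z (\<lambda>x. P x + Q x)" if "Z P" "Z Q" for P Q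
 proof -
  have "integral {0..1} (\<lambda>x. D x * (P x * cis (2 * pi * of_int k * x)) + D x * (Q x * cis (2 * pi * of_int k * x))) = 0" for k :: int
   using that unfolding Z_def by (subst Henstock_Kurzweil_Integration.integral_add)
    (auto intro!: integrable_continuous_real continuous_intros cD)
  thus ?thesis using that by (auto simp: Z_def algebra_simps intro!: continuous_intros)
 qed
 have Z_cis: "Z (\<lambda>x. c * cis (2 * pi * of_int j * x) * Q x)" if "Z Q" for c j Q
 proof -
  have "integral {0..1} (\<lambda>x. D x * (c * cis (2 * pi * of_int j * x) * Q x * cis (2 * pi * of_int k * x))) =
    c * integral {0..1} (\<lambda>x. D x * (Q x * cis (2 * pi * of_int (j + k) * x)))" for k
   unfolding integral_mult_right[symmetric] by (simp add: distrib_left distrib_right mult_ac flip: cis_mult)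
  thus ?thesis using that unfolding Z_def by (auto intro!: continuous_intros simp del: of_int_add)
 qed
 have Z_poly: "Z (\<lambda>x. of_real (p (cis (2 * pi * x))) * Q x)" if "real_polynomial_function p" "Z Q" for p Q
  using that
 proof (induction arbitrary: Q)
  case (linear f)
  interpret bounded_linear f by fact
  have f: "f z = Re z * f 1 + Im z * f \<i>" for z
  proof -
   have "f z = f (Re z *\<^sub>R 1 + Im z *\<^sub>R \<i>)"
    by (rule arg_cong[where f = f]) (simp add: complex_eq_iff)
   thus ?thesis by (simp add: add scaleR)
  qed
  \<comment> \<open>A linear form restricted to the circle is a combination of the characters of
    index 1 and -1.\<close>
  have "complex_of_real (f (cis (2 * pi * x))) =
    (complex_of_real (f 1) - \<i> * complex_of_real (f \<i>)) / 2 * cis (2 * pi * of_int 1 * x) +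
    (complex_of_real (f 1) + \<i> * complex_of_real (f \<i>)) / 2 * cis (2 * pi * of_int (-1) * x)" for x
   by (subst f) (simp add: complex_eq_iff field_simps)
  thus ?case using Z_add[OF Z_cis Z_cis, OF linear.prems linear.prems] unfolding distrib_right[symmetric] by presburger
 next
  case (const c)
  thus ?case using Z_cis[of Q "of_real c" 0] by simp
 next
  case (add f g)
  thus ?case using Z_add[OF add.IH, OF add.prems add.prems] by (simp add: distrib_right)
 next
  case (mult f g)
  thus ?case using mult.IH(1)[OF mult.IH(2)[OF mult.prems]] by (simp add: mult.assoc)
 qed
 have 0: "integral {0..1} (\<lambda>x. h (D x) * p (cis (2 * pi * x))) = 0"
  if p: "real_polynomial_function p" and h: "bounded_linear h" for p and h :: "complex \<Rightarrow> real"
 proof -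
  have Z: "Z (\<lambda>x. of_real (p (cis (2 * pi * x))) * 1)" by (rule Z_poly[OF p]) (auto simp: Z_def coeff)
  have "(\<lambda>x. D x * of_real (p (cis (2 * pi * x)))) integrable_on {0..1}"
   using Z by (intro integrable_continuous_real continuous_intros cD) (simp add: Z_def)
  from integral_linear[OF this h]
  have "integral {0..1} (h \<circ> (\<lambda>x. D x * of_real (p (cis (2 * pi * x))))) = 0"
   using Z h by (auto simp: Z_def linear_0 bounded_linear.linear dest!: spec[of _ "0::int"])
  moreover have "h (D x * of_real (p (cis (2 * pi * x)))) = h (D x) * p (cis (2 * pi * x))" for x
   using linear_scale[OF bounded_linear.linear[OF h], of "p (cis (2 * pi * x))" "D x"]
   by (simp add: scaleR_conv_of_real mult.commute)
  ultimately show ?thesis by (simp add: o_def)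
 qed
 have "h (D x) = 0" if h: "bounded_linear h" for h :: "complex \<Rightarrow> real"
  by (rule periodic_orthogonal_polynomials_eq_0[of "\<lambda>x. h (D x)"])
    (auto intro!: 0 h bounded_linear.continuous_on[OF h] cont simp: per)
 from this[OF bounded_linear_Re] this[OF bounded_linear_Im] show ?thesis by (simp add: complex_eq_iff)
qed

lemma uniform_series_integral:
 fixes f :: "'i \<Rightarrow> real \<Rightarrow> complex"
 assumes M: "M summable_on UNIV" and le: "\<And>m x. x \<in> {0..1} \<Longrightarrow> norm (f m x) \<le> M m"
  and cont: "\<And>m. continuous_on {0..1} (f m)"
 shows "((\<lambda>m. integral {0..1} (f m)) has_sum integral {0..1} (\<lambda>x. \<Sum>\<^sub>\<infinity>m. f m x)) UNIV"
  and "continuous_on {0..1} (\<lambda>x. \<Sum>\<^sub>\<infinity>m. f m x)"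
proof -
 have ul: "uniform_limit {0..1} (\<lambda>X x. \<Sum>m\<in>X. f m x) (\<lambda>x. \<Sum>\<^sub>\<infinity>m. f m x) (finite_subsets_at_top UNIV)"
  by (rule Weierstrass_m_test_general[OF le M]) auto
 have c: "\<forall>\<^sub>F X in finite_subsets_at_top UNIV. continuous_on {0..1} (\<lambda>x. \<Sum>m\<in>X. f m x)"
  by (intro always_eventually allI continuous_on_sum cont)
 show "continuous_on {0..1} (\<lambda>x. \<Sum>\<^sub>\<infinity>m. f m x)"
  by (rule uniform_limit_theorem[OF c ul]) simp
 have "((\<lambda>X. integral {0..1} (\<lambda>x. \<Sum>m\<in>X. f m x)) \<longlongrightarrow> integral {0..1} (\<lambda>x. \<Sum>\<^sub>\<infinity>m. f m x)) (finite_subsets_at_top UNIV)"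
 proof -
  obtain I J where IJ: "\<And>X. ((\<lambda>x. \<Sum>m\<in>X. f m x) has_integral I X) {0..1}"
    "((\<lambda>x. \<Sum>\<^sub>\<infinity>m. f m x) has_integral J) {0..1}" "(I \<longlongrightarrow> J) (finite_subsets_at_top UNIV)"
   by (rule uniform_limit_integral[OF ul]) (auto intro!: continuous_on_sum cont)
  thus ?thesis by (simp add: integral_unique[OF IJ(1)] integral_unique[OF IJ(2)])
 qed
 also have "(\<lambda>X. integral {0..1} (\<lambda>x. \<Sum>m\<in>X. f m x)) = (\<lambda>X. \<Sum>m\<in>X. integral {0..1} (f m))"
 proof
  fix X :: "'i set"
  show "integral {0..1} (\<lambda>x. \<Sum>m\<in>X. f m x) = (\<Sum>m\<in>X. integral {0..1} (f m))"
   by (cases "finite X") (simp_all add: Henstock_Kurzweil_Integration.integral_sum integrable_continuous_real cont)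
 qed
 finally show "((\<lambda>m. integral {0..1} (f m)) has_sum integral {0..1} (\<lambda>x. \<Sum>\<^sub>\<infinity>m. f m x)) UNIV"
  by (simp add: has_sum_def)
qed

lemma summable_on_int_geometric:
 fixes r :: real
 assumes "0 \<le> r" "r < 1"
 shows "(\<lambda>m::int. r ^ nat \<bar>m\<bar>) summable_on UNIV"
proof -
 have s: "(\<lambda>n::nat. r ^ n) summable_on UNIV"
  using assms by (intro norm_summable_imp_summable_on) (auto simp: summable_geometric)
 have "(\<lambda>m::int. r ^ nat \<bar>m\<bar>) summable_on (int ` UNIV)"
  by (subst summable_on_reindex) (auto simp: o_def s)
 moreover have "(\<lambda>m::int. r ^ nat \<bar>m\<bar>) summable_on ((\<lambda>n. - int n) ` UNIV)"
  by (subst summable_on_reindex) (auto simp: o_def s inj_on_def)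
 ultimately have "(\<lambda>m::int. r ^ nat \<bar>m\<bar>) summable_on (int ` UNIV \<union> (\<lambda>n. - int n) ` UNIV)"
  by (rule summable_on_union)
 also have "int ` UNIV \<union> (\<lambda>n. - int n) ` UNIV = UNIV"
  proof (intro equalityI subsetI)
  show "m \<in> int ` UNIV \<union> (\<lambda>n. - int n) ` UNIV" for m :: int
   by (cases m rule: int_cases2) auto
 qed auto
 finally show ?thesis .
qed

text \<open>A square dominates a linear function, \<open>y^2 \<ge> \<bar>y\<bar> - 1/4\<close>,
  which turns Gaussian tails into geometric ones.\<close>

lemma gaussian_le_geometric:
 fixes a x :: real and m :: int
 assumes a: "a > 0"
 shows "exp (- pi * a * (of_int m + x)\<^sup>2) \<le> exp (pi * a * (\<bar>x\<bar> + 1 / 4)) * exp (- pi * a) ^ nat \<bar>m\<bar>"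
proof -
 have "(\<bar>of_int m + x\<bar> - 1 / 2)\<^sup>2 \<ge> 0" by simp
 hence "(of_int m + x)\<^sup>2 \<ge> \<bar>of_int m + x\<bar> - 1 / 4"
  by (simp add: power2_eq_square algebra_simps abs_mult_self_eq)
 hence "(of_int m + x)\<^sup>2 \<ge> \<bar>of_int m\<bar> - \<bar>x\<bar> - 1 / 4" by linarith
 hence "pi * a * (\<bar>of_int m\<bar> - \<bar>x\<bar> - 1 / 4) \<le> pi * a * (of_int m + x)\<^sup>2"
  using a by (intro mult_left_mono) auto
 hence "exp (- pi * a * (of_int m + x)\<^sup>2) \<le> exp (pi * a * (\<bar>x\<bar> + 1 / 4) + of_nat (nat \<bar>m\<bar>) * (- pi * a))"
  by (simp add: algebra_simps)
 also have "\<dots> = exp (pi * a * (\<bar>x\<bar> + 1 / 4)) * exp (- pi * a) ^ nat \<bar>m\<bar>"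
  unfolding exp_add exp_of_nat_mult ..
 finally show ?thesis .
qed

lemma gaussian_summable_int:
 assumes "a > 0"
 shows "(\<lambda>m::int. exp (- pi * a * (of_int m + x)\<^sup>2)) summable_on UNIV"
proof (rule summable_on_comparison_test)
 show "(\<lambda>m::int. exp (pi * a * (\<bar>x\<bar> + 1 / 4)) * exp (- pi * a) ^ nat \<bar>m\<bar>) summable_on UNIV"
  using assms by (intro summable_on_cmult_right summable_on_int_geometric) auto
qed (use gaussian_le_geometric[OF assms] in auto)

text \<open>This is the characteristic function of the standard normal distribution after the
  substitution by \<open>b * x\<close> with \<open>b = sqrt (2 * pi * a)\<close>.\<close>

lemma gaussian_fourier_transform:
 fixes a t :: real
 assumes a: "a > 0"
 shows "has_bochner_integral lborel (\<lambda>x. complex_of_real (exp (- pi * a * x\<^sup>2)) * cis (2 * pi * t * x))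
   (complex_of_real (exp (- pi * t\<^sup>2 / a) / sqrt a))"
proof -
 define b where "b = sqrt (2 * pi * a)"
 have b: "b > 0" "b\<^sup>2 = 2 * pi * a" using a by (auto simp: b_def)
 interpret real_distribution std_normal_distribution by (rule real_dist_normal_dist)
 have int: "integrable lborel (\<lambda>x. std_normal_density x *\<^sub>R iexp (s * x))" for s
 proof -
  have "integrable std_normal_distribution (\<lambda>x. iexp (s * x))"
   by (rule integrable_iexp) auto
  thus ?thesis by (subst (asm) integrable_density) auto
 qed
 have val: "(\<integral>x. std_normal_density x *\<^sub>R iexp (s * x) \<partial>lborel) = complex_of_real (exp (- s\<^sup>2 / 2))" for s
 proof -
  have "char std_normal_distribution s = (\<integral>x. std_normal_density x *\<^sub>R iexp (s * x) \<partial>lborel)"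
   unfolding char_def by (rule integral_density) auto
  thus ?thesis by (simp add: char_std_normal_distribution)
 qed
 let ?s = "2 * pi * t / b"
 have eq: "std_normal_density (0 + b * x) *\<^sub>R iexp (?s * (0 + b * x)) = (1 / sqrt (2 * pi)) *\<^sub>R (complex_of_real (exp (- pi * a * x\<^sup>2)) * cis (2 * pi * t * x))" for x
 proof -
  have "- (b * x)\<^sup>2 / 2 = - pi * a * x\<^sup>2" by (simp add: power_mult_distrib b(2))
  thus ?thesis using b(1)
   by (simp add: std_normal_density_def cis_conv_exp scaleR_conv_of_real field_simps)
 qed
 have hb: "has_bochner_integral lborel (\<lambda>x. std_normal_density (0 + b * x) *\<^sub>R iexp (?s * (0 + b * x)))
   (complex_of_real (exp (- ?s\<^sup>2 / 2)) /\<^sub>R \<bar>b\<bar>)"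
  using lborel_has_bochner_integral_real_affine_iff[of b "\<lambda>x. std_normal_density x *\<^sub>R iexp (?s * x)" "complex_of_real (exp (- ?s\<^sup>2 / 2))" 0]
   int[of ?s] val[of ?s] b by (auto simp: has_bochner_integral_iff)
 have "- ?s\<^sup>2 / 2 = - pi * t\<^sup>2 / a"
  unfolding power_divide b(2) using a by (simp add: field_simps power2_eq_square)
 moreover have "has_bochner_integral lborel (\<lambda>x. sqrt (2 * pi) *\<^sub>R ((1 / sqrt (2 * pi)) *\<^sub>R (complex_of_real (exp (- pi * a * x\<^sup>2)) * cis (2 * pi * t * x))))
   (sqrt (2 * pi) *\<^sub>R (complex_of_real (exp (- ?s\<^sup>2 / 2)) /\<^sub>R \<bar>b\<bar>))"
  using hb unfolding eq by (rule has_bochner_integral_scaleR_right)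
 moreover have "sqrt (2 * pi) *\<^sub>R (complex_of_real r /\<^sub>R \<bar>b\<bar>) = complex_of_real (r / sqrt a)" for r
  using a by (simp add: scaleR_conv_of_real b_def real_sqrt_mult field_simps)
 moreover have "sqrt (2 * pi) *\<^sub>R ((1 / sqrt (2 * pi)) *\<^sub>R z) = z" for z :: complex
  by simp
 ultimately show ?thesis by (simp only:)
qed

text \<open>The index range is half open because the unit intervals starting at \<open>m\<close>
  with \<open>- N \<le> m < N\<close> tile the interval from \<open>- N\<close> to
  \<open>N\<close>.\<close>

lemma integral_unfold_symmetric:
 fixes f :: "real \<Rightarrow> complex"
 assumes "\<And>a b. f integrable_on {a..b}"
 shows "integral {- real N..real N} f = (\<Sum>m\<in>{- int N..<int N}. integral {0..1} (\<lambda>x. f (x + of_int m)))"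
proof (induction N)
 case (Suc N)
 have sh: "integral {0..1} (\<lambda>x. f (x + c)) = integral {c..c + 1} f" for c
  using integral_shift_real_ivl[where a = c and c = c and b = "c + 1" and f = f] by simp
 have "{- int (Suc N)..<int (Suc N)} = insert (- int (Suc N)) (insert (int N) {- int N..<int N})"
  by auto
 hence "(\<Sum>m\<in>{- int (Suc N)..<int (Suc N)}. integral {0..1} (\<lambda>x. f (x + of_int m)))
   = integral {- real (Suc N)..- real (Suc N) + 1} f + (integral {real N..real N + 1} f + integral {- real N..real N} f)"
  by (simp add: Suc sh)
 also have "\<dots> = integral {- real (Suc N)..- real N} f + integral {- real N..real N} f + integral {real N..real (Suc N)} f"
  by (simp add: add_ac)
 also have "\<dots> = integral {- real (Suc N)..real (Suc N)} f"
  using Henstock_Kurzweil_Integration.integral_combine[where a = "- real (Suc N)" and c = "- real N" and b = "real N" and f = f]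
   Henstock_Kurzweil_Integration.integral_combine[where a = "- real (Suc N)" and c = "real N" and b = "real (Suc N)" and f = f] assms
  by simp
 finally show ?case ..
qed auto

lemma has_sum_int_imp_tendsto:
 fixes f :: "int \<Rightarrow> 'a::{comm_monoid_add, topological_space}"
 assumes "(f has_sum s) UNIV"
 shows "(\<lambda>N. \<Sum>m\<in>{- int N..<int N}. f m) \<longlonglongrightarrow> s"
proof -
 have "filterlim (\<lambda>N. {- int N..<int N}) (finite_subsets_at_top UNIV) sequentially"
  unfolding filterlim_finite_subsets_at_top
 proof (intro allI impI)
  fix X :: "int set" assume "finite X \<and> X \<subseteq> UNIV"
  hence "finite (abs ` X)" by simp
  then obtain B where "\<And>x. x \<in> abs ` X \<Longrightarrow> x \<le> B" using bdd_above_finite[of "abs ` X"] unfolding bdd_above_def by blast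
  hence B: "\<bar>x\<bar> \<le> B" if "x \<in> X" for x using that by blast
  show "\<forall>\<^sub>F N in sequentially. finite {- int N..<int N} \<and> X \<subseteq> {- int N..<int N} \<and> {- int N..<int N} \<subseteq> UNIV"
   using eventually_gt_at_top[of "nat (\<bar>B\<bar>)"]
  proof eventually_elim
   case (elim N)
   show ?case
   proof (intro conjI subsetI)
    fix x assume "x \<in> X"
    thus "x \<in> {- int N..<int N}" using B[of x] elim by auto
   qed auto
  qed
 qed
 thus ?thesis using assms unfolding has_sum_def by (rule filterlim_compose[rotated])
qed

text \<open>The periodization of the twisted Gaussian and the candidate Fourier series are
  continuous with equal coefficients, hence equal. Both shifts \<open>x\<close> and \<open>w\<close>
  are carried for the sake of the induction on the dimension: completing a square puts the remaining
  variables into \<open>x\<close>, and the character of the last variable into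
  \<open>w\<close>.\<close>

theorem poisson_gaussian_1:
 fixes a x w :: real
 assumes a: "a > 0"
 shows "((\<lambda>k::int. complex_of_real (exp (- pi * (of_int k + w)\<^sup>2 / a)) * cis (- 2 * pi * (of_int k + w) * x))
  has_sum (complex_of_real (sqrt a) * (\<Sum>\<^sub>\<infinity>m::int. complex_of_real (exp (- pi * a * (of_int m + x)\<^sup>2)) * cis (2 * pi * w * of_int m)))) UNIV"
proof -
 define f where "f t = complex_of_real (exp (- pi * a * t\<^sup>2)) * cis (2 * pi * w * t)" for t
 define c where "c k = complex_of_real (exp (- pi * (of_int k + w)\<^sup>2 / a) / sqrt a)" for k :: int
 define F where "F x = (\<Sum>\<^sub>\<infinity>m::int. f (x + of_int m))" for x
 define H where "H x = (\<Sum>\<^sub>\<infinity>k::int. c k * cis (- 2 * pi * of_int k * x))" for x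
 have contf: "continuous_on S f" for S unfolding f_def by (intro continuous_intros)
 have c_sum: "(\<lambda>k. norm (c k)) summable_on UNIV"
 proof -
  have "(\<lambda>k. (1 / sqrt a) * exp (- pi * (1 / a) * (of_int k + w)\<^sup>2)) summable_on UNIV"
   using a by (intro summable_on_cmult_right gaussian_summable_int) auto
  thus ?thesis using a unfolding c_def by (simp add: norm_divide norm_mult field_simps)
 qed
 \<comment> \<open>One majorant serves all \<open>x\<close> with
   \<open>\<bar>x\<bar> \<le> \<bar>y\<bar> + 1\<close>, in particular a unit interval translated by
   \<open>y\<close>; the convergence is uniform there.\<close>
 define M where "M y m = exp (pi * a * (\<bar>y\<bar> + 1 + 1 / 4)) * exp (- pi * a) ^ nat \<bar>m\<bar>" for y :: real and m :: int
 have M_sum: "M y summable_on UNIV" for y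
  unfolding M_def using a by (intro summable_on_cmult_right summable_on_int_geometric) auto
 have M_le: "norm (f (x + of_int m)) \<le> M y m" if "\<bar>x\<bar> \<le> \<bar>y\<bar> + 1" for x y m
 proof -
  have "norm (f (x + of_int m)) = exp (- pi * a * (of_int m + x)\<^sup>2)"
   by (simp add: f_def norm_mult add_ac)
  also have "\<dots> \<le> exp (pi * a * (\<bar>x\<bar> + 1 / 4)) * exp (- pi * a) ^ nat \<bar>m\<bar>"
   by (rule gaussian_le_geometric[OF a])
  also have "\<dots> \<le> M y m" unfolding M_def using a that by (intro mult_right_mono) auto
  finally show ?thesis .
 qed
 have F_per: "F (x + 1) = F x" for x unfolding F_def
  by (rule infsum_reindex_bij_witness[of _ "\<lambda>m. m - 1" "\<lambda>m. m + 1"]) (auto simp: algebra_simps)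
 have H_per: "H (x + 1) = H x" for x
 proof -
  have "cis (- 2 * pi * of_int k * (x + 1)) = cis (- 2 * pi * of_int k * x)" for k :: int
  proof -
   have "- 2 * pi * of_int k * (x + 1) = - 2 * pi * of_int k * x + 2 * pi * of_int (- k)"
    by (simp add: algebra_simps)
   thus ?thesis by (simp only: cis_mult[symmetric] cis_multiple_2pi[OF Ints_of_int]) simp
  qed
  thus ?thesis by (simp add: H_def)
 qed
 have per_cont: "continuous_on UNIV h" if c: "\<And>y. continuous_on {0..1} (\<lambda>x. h (x + y))" for h :: "real \<Rightarrow> complex"
 proof (rule continuous_at_imp_continuous_on, rule ballI)
  fix x :: real
  have "continuous_on {x - 1/2..x + 1/2} (\<lambda>u. (\<lambda>v. h (v + (x - 1/2))) (u - (x - 1/2)))"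
   by (rule continuous_on_compose2[OF c]) (auto intro!: continuous_intros)
  hence "continuous_on {x - 1/2..x + 1/2} h" by simp
  thus "isCont h x" by (rule continuous_on_interior) (simp add: interior_atLeastAtMost_real)
 qed
 have F_cont: "continuous_on UNIV F"
 proof (rule per_cont)
  show "continuous_on {0..1} (\<lambda>x. F (x + y))" for y
   unfolding F_def by (rule uniform_series_integral(2)[OF M_sum[of y]])
    (auto intro!: M_le continuous_intros continuous_on_compose2[OF contf[of UNIV]])
 qed
 have H_cont: "continuous_on UNIV H"
  by (rule per_cont, unfold H_def, rule uniform_series_integral(2)[OF c_sum])
   (auto simp: norm_mult intro!: continuous_intros)
 \<comment> \<open>A character of integral frequency is unchanged by integral shifts. The
   coefficient of the periodization therefore unfolds to the Fourier transform of \<open>f\<close>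
   on the whole line.\<close>
 have F_coeff: "integral {0..1} (\<lambda>x. F x * cis (2 * pi * of_int k * x)) = c k" for k :: int
 proof -
  define fk where "fk t = f t * cis (2 * pi * of_int k * t)" for t
  have fk: "fk t = complex_of_real (exp (- pi * a * t\<^sup>2)) * cis (2 * pi * (of_int k + w) * t)" for t
   by (simp add: fk_def f_def algebra_simps flip: cis_mult)
  have fk_shift: "f (x + of_int m) * cis (2 * pi * of_int k * x) = fk (x + of_int m)" for x and m :: int
  proof -
   have "2 * pi * of_int k * (x + of_int m) = 2 * pi * of_int k * x + 2 * pi * of_int (k * m)"
    by (simp add: algebra_simps)
   thus ?thesis by (simp only: fk_def cis_mult[symmetric] cis_multiple_2pi[OF Ints_of_int]) simp
  qed
  have contfk: "continuous_on S fk" for S unfolding fk_def by (intro continuous_intros contf)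
  have fk_hs: "((\<lambda>m. integral {0..1} (\<lambda>x. fk (x + of_int m))) has_sum integral {0..1} (\<lambda>x. \<Sum>\<^sub>\<infinity>m. fk (x + of_int m))) UNIV"
  proof (rule uniform_series_integral(1)[OF M_sum[of 0]])
   show "norm (fk (x + of_int m)) \<le> M 0 m" if "x \<in> {0..1}" for x and m :: int
    using M_le[of x 0 m] that by (simp add: fk_def norm_mult)
   show "continuous_on {0..1} (\<lambda>x. fk (x + of_int m))" for m :: int
    by (rule continuous_on_compose2[OF contfk[of UNIV]]) (auto intro!: continuous_intros)
  qed
  hence lim1: "(\<lambda>N. integral {- real N..real N} fk) \<longlonglongrightarrow> integral {0..1} (\<lambda>x. \<Sum>\<^sub>\<infinity>m. fk (x + of_int m))"
   using has_sum_int_imp_tendsto[OF fk_hs] integral_unfold_symmetric[of fk] contfk by (simp add: integrable_continuous_real)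
  have hb: "has_bochner_integral lborel fk (c k)"
   using gaussian_fourier_transform[OF a, of "of_int k + w"] by (simp add: fk[abs_def] c_def)
  have "(\<lambda>N. \<integral>x. indicator {- real N..real N} x *\<^sub>R fk x \<partial>lborel) \<longlonglongrightarrow> (\<integral>x. fk x \<partial>lborel)"
  proof (rule integral_dominated_convergence[where w = "\<lambda>x. norm (fk x)"])
   show "integrable lborel (\<lambda>x. norm (fk x))" using hb by (auto simp: has_bochner_integral_iff)
   show "AE x in lborel. (\<lambda>N. indicator {- real N..real N} x *\<^sub>R fk x) \<longlonglongrightarrow> fk x"
   proof (intro AE_I2 tendsto_eventually)
    fix x :: real
    show "\<forall>\<^sub>F N in sequentially. indicator {- real N..real N} x *\<^sub>R fk x = fk x"
     using eventually_ge_at_top[of "nat \<lceil>\<bar>x\<bar>\<rceil>"]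
     by eventually_elim (auto simp: indicator_def)
   qed
   show "fk \<in> borel_measurable lborel" using hb by (auto simp: has_bochner_integral_iff)
   thus "(\<lambda>x. indicator {- real N..real N} x *\<^sub>R fk x) \<in> borel_measurable lborel" for N by simp
   show "AE x in lborel. norm (indicator {- real N..real N} x *\<^sub>R fk x) \<le> norm (fk x)" for N
    by (auto simp: indicator_def)
  qed
  moreover have "(\<integral>x. indicator {- real N..real N} x *\<^sub>R fk x \<partial>lborel) = integral {- real N..real N} fk" for N
  proof -
   have "set_integrable lborel {- real N..real N} fk"
    by (rule borel_integrable_atLeastAtMost') (rule contfk)
   thus ?thesis using set_borel_integral_eq_integral(2) by (auto simp: set_lebesgue_integral_def)
  qed
  ultimately have "(\<lambda>N. integral {- real N..real N} fk) \<longlonglongrightarrow> c k"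
   using hb by (simp add: has_bochner_integral_iff)
  with lim1 have "integral {0..1} (\<lambda>x. \<Sum>\<^sub>\<infinity>m. fk (x + of_int m)) = c k"
   by (rule LIMSEQ_unique)
  moreover have "(\<Sum>\<^sub>\<infinity>m. fk (x + of_int m)) = F x * cis (2 * pi * of_int k * x)" for x
   unfolding F_def fk_shift[symmetric] by (rule infsum_cmult_left')
  ultimately show ?thesis by simp
 qed
 have int_cis: "integral {0..1} (\<lambda>x. cis (2 * pi * of_int j * x)) = (if j = 0 then 1 else 0)" for j :: int
 proof (cases "j = 0")
  case False
  have "((\<lambda>x. cis (2 * pi * of_int j * x)) has_integral (cis (2 * pi * of_int j * 1) / (2 * pi * of_int j * \<i>) - cis (2 * pi * of_int j * 0) / (2 * pi * of_int j * \<i>))) {0..1}"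
  proof (rule fundamental_theorem_of_calculus)
   show "((\<lambda>x. cis (2 * pi * of_int j * x) / (2 * pi * of_int j * \<i>)) has_vector_derivative cis (2 * pi * of_int j * x)) (at x within {0..1})" for x
    unfolding cis_conv_exp using False
    by (auto intro!: derivative_eq_intros has_vector_derivative_real_field simp: field_simps)
  qed auto
  moreover have "cis (2 * pi * of_int j) = 1" by (rule cis_multiple_2pi) simp
  ultimately show ?thesis using False by (simp add: integral_unique)
 qed simp
 have H_coeff: "integral {0..1} (\<lambda>x. H x * cis (2 * pi * of_int k * x)) = c k" for k :: int
 proof -
  have e: "H x * cis (2 * pi * of_int k * x) = (\<Sum>\<^sub>\<infinity>j. c j * cis (2 * pi * of_int (k - j) * x))" for x
  proof -
   have "H x * cis (2 * pi * of_int k * x) = (\<Sum>\<^sub>\<infinity>j. c j * cis (- 2 * pi * of_int j * x) * cis (2 * pi * of_int k * x))"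
    unfolding H_def by (rule infsum_cmult_left'[symmetric])
   thus ?thesis by (simp add: cis_mult mult.assoc algebra_simps)
  qed
  have "((\<lambda>j. integral {0..1} (\<lambda>x. c j * cis (2 * pi * of_int (k - j) * x))) has_sum integral {0..1} (\<lambda>x. \<Sum>\<^sub>\<infinity>j. c j * cis (2 * pi * of_int (k - j) * x))) UNIV"
   by (rule uniform_series_integral(1)[OF c_sum]) (auto simp: norm_mult intro!: continuous_intros)
  hence "((\<lambda>j. if j = k then c k else 0) has_sum integral {0..1} (\<lambda>x. H x * cis (2 * pi * of_int k * x))) UNIV"
   unfolding e[symmetric] by (rule has_sum_cong[THEN iffD1, rotated]) (simp only: integral_mult_right int_cis, auto)
  moreover have "((\<lambda>j. if j = k then c k else 0) has_sum c k) UNIV"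
   by (rule has_sum_finite_neutralI[of "{k}"]) auto
  ultimately show ?thesis by (rule has_sum_unique)
 qed
 have FH: "F x - H x = 0"
 proof (rule fourier_uniqueness[of "\<lambda>x. F x - H x"])
  show "integral {0..1} (\<lambda>x. (F x - H x) * cis (2 * pi * of_int k * x)) = 0" for k :: int
   unfolding left_diff_distrib by (subst Henstock_Kurzweil_Integration.integral_diff)
     (auto simp: F_coeff H_coeff intro!: integrable_continuous_real continuous_intros continuous_on_subset[OF F_cont] continuous_on_subset[OF H_cont])
 qed (auto intro!: continuous_intros F_cont H_cont simp: F_per H_per)
 have "((\<lambda>k. c k * cis (- 2 * pi * of_int k * x)) has_sum H x) UNIV" unfolding H_def
  by (rule has_sum_infsum, rule abs_summable_summable, rule summable_on_comparison_test[OF c_sum]) (auto simp: norm_mult)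
 hence "((\<lambda>k. (complex_of_real (sqrt a) * cis (- 2 * pi * w * x)) * (c k * cis (- 2 * pi * of_int k * x)))
   has_sum (complex_of_real (sqrt a) * cis (- 2 * pi * w * x)) * H x) UNIV"
  by (rule has_sum_cmult_right)
 moreover have "(complex_of_real (sqrt a) * cis (- 2 * pi * w * x)) * (c k * cis (- 2 * pi * of_int k * x))
   = complex_of_real (exp (- pi * (of_int k + w)\<^sup>2 / a)) * cis (- 2 * pi * (of_int k + w) * x)" for k
 proof -
  have "- 2 * pi * (of_int k + w) * x = - 2 * pi * w * x + (- 2 * pi * of_int k * x)"
   by (simp add: algebra_simps)
  thus ?thesis using a by (simp only: cis_mult[symmetric]) (simp add: c_def)
 qed
 moreover have "cis (- 2 * pi * w * x) * H x = (\<Sum>\<^sub>\<infinity>m::int. complex_of_real (exp (- pi * a * (of_int m + x)\<^sup>2)) * cis (2 * pi * w * of_int m))"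
 proof -
  have "cis (- 2 * pi * w * x) * H x = (\<Sum>\<^sub>\<infinity>m::int. cis (- 2 * pi * w * x) * f (x + of_int m))"
   using FH by (simp add: F_def infsum_cmult_right')
  also have "\<dots> = (\<Sum>\<^sub>\<infinity>m::int. complex_of_real (exp (- pi * a * (of_int m + x)\<^sup>2)) * cis (2 * pi * w * of_int m))"
   by (intro infsum_cong) (simp add: f_def cis_mult algebra_simps)
  finally show ?thesis .
 qed
 ultimately show ?thesis by (simp add: mult.assoc)
qed

hide_const (open) Finite_Cartesian_Product.mat Finite_Cartesian_Product.vec Determinants.det

section \<open>Poisson summation for positive definite quadratic forms\<close>

definition int_vecs :: "nat \<Rightarrow> (nat \<Rightarrow> int) set" where
 "int_vecs n = {m. \<forall>i\<ge>n. m i = 0}"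

definition quad :: "nat \<Rightarrow> (nat \<Rightarrow> nat \<Rightarrow> real) \<Rightarrow> (nat \<Rightarrow> real) \<Rightarrow> real" where
 "quad n g x = (\<Sum>i<n. \<Sum>j<n. g i j * x i * x j)"

definition apply_mat :: "nat \<Rightarrow> (nat \<Rightarrow> nat \<Rightarrow> real) \<Rightarrow> (nat \<Rightarrow> real) \<Rightarrow> nat \<Rightarrow> real" where
 "apply_mat n g x i = (\<Sum>j<n. g i j * x j)"

lemma infsum_complex_of_real: "(\<Sum>\<^sub>\<infinity>x\<in>A. complex_of_real (f x)) = complex_of_real (\<Sum>\<^sub>\<infinity>x\<in>A. f x)"
proof (cases "f summable_on A")
 case True
 thus ?thesis by (intro infsumI has_sum_of_real has_sum_infsum)
next
 case False
 hence "\<not> (\<lambda>x. complex_of_real (f x)) summable_on A"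
  using summable_on_Re[of "\<lambda>x. complex_of_real (f x)" A] by auto
 with False show ?thesis by (simp add: infsum_not_exists)
qed

lemma bij_betw_int_vecs_Suc:
 "bij_betw (\<lambda>(m, t). m(n := t)) (int_vecs n \<times> UNIV) (int_vecs (Suc n))"
 by (rule bij_betw_byWitness[where f' = "\<lambda>m. (m(n := 0), m n)"])
   (auto simp: int_vecs_def fun_eq_iff)

text \<open>Eliminating the last variable is multiplication by a unipotent block matrix; what
  remains is block triangular with the Schur complement and the pivot on its diagonal.\<close>

lemma schur_det:
 fixes g :: "nat \<Rightarrow> nat \<Rightarrow> real"
 assumes sym: "\<And>i. i < n \<Longrightarrow> g n i = g i n" and a: "g n n \<noteq> 0"
 shows "det (mat (Suc n) (Suc n) (\<lambda>(i, j). g i j))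
   = g n n * det (mat n n (\<lambda>(i, j). g i j - g i n * g j n / g n n))"
proof -
 let ?a = "g n n"
 let ?G = "mat n n (\<lambda>(i, j). g i j - g i n * g j n / ?a)"
 let ?U = "four_block_mat (1\<^sub>m n) (mat n 1 (\<lambda>(i, j). g i n / ?a)) (0\<^sub>m 1 n) (1\<^sub>m 1)"
 let ?L = "four_block_mat ?G (0\<^sub>m n 1) (mat 1 n (\<lambda>(i, j). g j n)) (mat 1 1 (\<lambda>_. ?a))"
 have "?U * ?L = four_block_mat (1\<^sub>m n * ?G + mat n 1 (\<lambda>(i, j). g i n / ?a) * mat 1 n (\<lambda>(i, j). g j n))
   (1\<^sub>m n * 0\<^sub>m n 1 + mat n 1 (\<lambda>(i, j). g i n / ?a) * mat 1 1 (\<lambda>_. ?a))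
   (0\<^sub>m 1 n * ?G + 1\<^sub>m 1 * mat 1 n (\<lambda>(i, j). g j n)) (0\<^sub>m 1 n * 0\<^sub>m n 1 + 1\<^sub>m 1 * mat 1 1 (\<lambda>_. ?a))"
  by (rule mult_four_block_mat) auto
 also have "\<dots> = mat (Suc n) (Suc n) (\<lambda>(i, j). g i j)"
 proof (intro eq_matI)
  fix i j assume "i < dim_row (mat (Suc n) (Suc n) (\<lambda>(i, j). g i j))" "j < dim_col (mat (Suc n) (Suc n) (\<lambda>(i, j). g i j))"
  hence "i < n \<or> i = n" "j < n \<or> j = n" by auto
  thus "four_block_mat (1\<^sub>m n * ?G + mat n 1 (\<lambda>(i, j). g i n / ?a) * mat 1 n (\<lambda>(i, j). g j n))
   (1\<^sub>m n * 0\<^sub>m n 1 + mat n 1 (\<lambda>(i, j). g i n / ?a) * mat 1 1 (\<lambda>_. ?a))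
   (0\<^sub>m 1 n * ?G + 1\<^sub>m 1 * mat 1 n (\<lambda>(i, j). g j n)) (0\<^sub>m 1 n * 0\<^sub>m n 1 + 1\<^sub>m 1 * mat 1 1 (\<lambda>_. ?a)) $$ (i, j)
   = mat (Suc n) (Suc n) (\<lambda>(i, j). g i j) $$ (i, j)"
   using a sym by (elim disjE) (simp_all add: scalar_prod_def)
 qed auto
 finally have "det (mat (Suc n) (Suc n) (\<lambda>(i, j). g i j)) = det (?U * ?L)" by simp
 also have "\<dots> = det ?U * det ?L"
  by (rule det_mult[of _ "n + 1"]) auto
 also have "det ?U = det (1\<^sub>m n) * det (1\<^sub>m 1)"
  by (rule det_four_block_mat_lower_left_zero) auto
 also have "det ?L = det ?G * det (mat 1 1 (\<lambda>_. ?a))"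
  by (rule det_four_block_mat_upper_right_zero) auto
 also have "det (mat 1 1 (\<lambda>_. ?a)) = ?a" by (subst det_single) auto
 finally show ?thesis by simp
qed

text \<open>By Poisson summation the sum is a Fourier series in \<open>x\<close> whose coefficients
  are independent of \<open>x\<close>, so the sum of their absolute values bounds it
  uniformly.\<close>

lemma gaussian_sum_bounded:
 assumes a: "a > 0"
 obtains C where "\<And>x. (\<Sum>\<^sub>\<infinity>m::int. exp (- pi * a * (of_int m + x)\<^sup>2)) \<le> C"
proof
 fix x
 let ?S = "\<Sum>\<^sub>\<infinity>m::int. exp (- pi * a * (of_int m + x)\<^sup>2)"
 have sm: "(\<lambda>k::int. exp (- pi * (1 / a) * (of_int k + 0)\<^sup>2)) summable_on UNIV"
  using a by (intro gaussian_summable_int) auto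
 have S0: "?S \<ge> 0" by (intro infsum_nonneg) auto
 have "complex_of_real (sqrt a * ?S) = (\<Sum>\<^sub>\<infinity>k::int. complex_of_real (exp (- pi * (of_int k + 0)\<^sup>2 / a)) * cis (- 2 * pi * (of_int k + 0) * x))"
  using infsumI[OF poisson_gaussian_1[OF a, of 0 x]] by (simp add: infsum_complex_of_real)
 hence "norm (complex_of_real (sqrt a * ?S)) \<le> (\<Sum>\<^sub>\<infinity>k::int. norm (complex_of_real (exp (- pi * (of_int k + 0)\<^sup>2 / a)) * cis (- 2 * pi * (of_int k + 0) * x)))"
  using sm by (simp only:) (intro norm_infsum_bound, simp add: norm_mult)
 thus "?S \<le> (\<Sum>\<^sub>\<infinity>k::int. exp (- pi * (of_int k)\<^sup>2 / a)) / sqrt a"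
  using a S0 by (simp add: norm_mult field_simps)
qed

text \<open>\<open>Q\<close> is the form of the inverse matrix, pinned down by its values on vectors
  \<open>g x\<close>, which is how it is evaluated later. Induction on the dimension: complete the
  square in the last variable, apply the one-dimensional formula, then the induction hypothesis. The
  frequency \<open>z\<close> must be arbitrary because each dual value of the last variable shifts
  the frequencies of the others.\<close>

theorem poisson_gaussian:
 fixes g :: "nat \<Rightarrow> nat \<Rightarrow> real"
 assumes sym: "\<And>i j. i < n \<Longrightarrow> j < n \<Longrightarrow> g i j = g j i"
  and pos: "\<And>x. \<exists>i<n. x i \<noteq> 0 \<Longrightarrow> quad n g x > 0"
 shows "det (mat n n (\<lambda>(i, j). g i j)) > 0 \<and>
  (\<lambda>m. exp (- pi * quad n g (\<lambda>i. of_int (m i)))) summable_on int_vecs n \<and>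
  (\<exists>Q. (\<forall>x y. (\<forall>i<n. x i = y i) \<longrightarrow> Q x = Q y) \<and> (\<forall>x. Q (apply_mat n g x) = quad n g x) \<and>
   (\<forall>z. (\<lambda>k. exp (- pi * Q (\<lambda>i. of_int (k i) + z i))) summable_on int_vecs n) \<and>
   (\<forall>z. (\<Sum>\<^sub>\<infinity>m\<in>int_vecs n. complex_of_real (exp (- pi * quad n g (\<lambda>i. of_int (m i)))) * cis (2 * pi * (\<Sum>i<n. z i * of_int (m i))))
     = complex_of_real ((\<Sum>\<^sub>\<infinity>k\<in>int_vecs n. exp (- pi * Q (\<lambda>i. of_int (k i) + z i))) / sqrt (det (mat n n (\<lambda>(i, j). g i j))))))"
 using assms
proof (induction n arbitrary: g)
 case 0
 have "int_vecs 0 = {\<lambda>_. 0}" by (auto simp: int_vecs_def)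
 thus ?case by (intro conjI exI[of _ "\<lambda>_. 0"]) (auto simp: quad_def)
next
 case (Suc n)
 \<comment> \<open>Pivot \<open>a\<close>, shear \<open>l\<close> that completes the square, and
   Schur complement \<open>g'\<close> of the remaining variables.\<close>
 define a where "a = g n n"
 define l where "l i = g i n / a" for i
 define g' where "g' i j = g i j - g i n * g j n / a" for i j
 have a: "a > 0"
  using Suc.prems(2)[of "\<lambda>i. if i = n then 1 else 0"] by (auto simp: quad_def a_def if_distrib cong: if_cong)
 have gin: "g i n = a * l i" for i using a by (simp add: l_def)
 have gni: "g n i = a * l i" if "i < n" for i using Suc.prems(1)[of n i] that gin[of i] by simp
 have gij: "g i j = g' i j + a * l i * l j" for i j using a by (simp add: g'_def l_def)
 have quad_Suc: "quad (Suc n) g x = quad n g' x + a * (x n + (\<Sum>i<n. l i * x i))\<^sup>2" for x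
 proof -
  let ?L = "\<Sum>i<n. l i * x i"
  have "quad (Suc n) g x = (\<Sum>i<n. (\<Sum>j<n. g i j * x i * x j)) + (\<Sum>i<n. g i n * x i * x n) + ((\<Sum>j<n. g n j * x n * x j) + g n n * x n * x n)"
   by (simp add: quad_def sum.distrib)
  also have "(\<Sum>i<n. (\<Sum>j<n. g i j * x i * x j)) = quad n g' x + a * ?L * ?L"
   unfolding gij quad_def by (simp add: distrib_right distrib_left sum.distrib sum_product sum_distrib_left mult_ac)
  also have "(\<Sum>i<n. g i n * x i * x n) = a * ?L * x n"
   unfolding gin by (simp add: sum_distrib_left sum_distrib_right mult_ac)
  also have "(\<Sum>j<n. g n j * x n * x j) = a * ?L * x n"
   by (simp add: gni sum_distrib_left sum_distrib_right mult_ac)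
  finally show ?thesis unfolding a_def[symmetric] by (simp add: power2_eq_square algebra_simps)
 qed
 have sym': "g' i j = g' j i" if "i < n" "j < n" for i j
  using Suc.prems(1)[of i j] that by (simp add: g'_def mult.commute)
 have pos': "quad n g' x > 0" if "\<exists>i<n. x i \<noteq> 0" for x
 proof -
  \<comment> \<open>The last coordinate is chosen so that the completed square vanishes; only the
    form of \<open>g'\<close> is left.\<close>
  let ?x = "x(n := - (\<Sum>i<n. l i * x i))"
  have "quad (Suc n) g ?x > 0" using that by (intro Suc.prems(2)) (metis fun_upd_other less_SucI less_irrefl)
  moreover have "quad n g' ?x = quad n g' x" by (simp add: quad_def)
  ultimately show ?thesis by (simp add: quad_Suc)
 qed
 let ?D = "det (mat (Suc n) (Suc n) (\<lambda>(i, j). g i j))"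
 define D' where "D' = det (mat n n (\<lambda>(i, j). g' i j))"
 have D: "?D = a * D'" unfolding D'_def g'_def a_def
 proof (rule schur_det)
  show "g n i = g i n" if "i < n" for i using that Suc.prems(1)[of n i] by simp
  show "g n n \<noteq> 0" using a by (simp add: a_def)
 qed
 define e' where "e' m = exp (- pi * quad n g' (\<lambda>i. of_int (m i)))" for m :: "nat \<Rightarrow> int"
 define L where "L m = (\<Sum>i<n. l i * of_int (m i))" for m :: "nat \<Rightarrow> int"
 from Suc.IH[of g', OF sym' pos'] obtain Q' where
  D'pos: "D' > 0" and sum': "e' summable_on int_vecs n"
  and Q'_cong: "\<And>x y. (\<And>i. i < n \<Longrightarrow> x i = y i) \<Longrightarrow> Q' x = Q' y"
  and Q'_g: "\<And>x. Q' (apply_mat n g' x) = quad n g' x"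
  and Q'_sum: "\<And>z. (\<lambda>k. exp (- pi * Q' (\<lambda>i. of_int (k i) + z i))) summable_on int_vecs n"
  and IH: "\<And>z. (\<Sum>\<^sub>\<infinity>m\<in>int_vecs n. complex_of_real (e' m) * cis (2 * pi * (\<Sum>i<n. z i * of_int (m i))))
     = complex_of_real ((\<Sum>\<^sub>\<infinity>k\<in>int_vecs n. exp (- pi * Q' (\<lambda>i. of_int (k i) + z i))) / sqrt D')"
  unfolding D'_def[symmetric] e'_def by blast
 \<comment> \<open>The inverse form splits as the primal one does, but with the transposed inverse
   shear: the last coordinate stays and the others are corrected by
   \<open>y n * l i\<close>.\<close>
 define Q where "Q y = (y n)\<^sup>2 / a + Q' (\<lambda>i. y i - y n * l i)" for y
 have e: "exp (- pi * quad (Suc n) g (\<lambda>i. of_int ((m(n := t)) i))) = e' m * exp (- pi * a * (of_int t + L m)\<^sup>2)"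
  if "m \<in> int_vecs n" for m t
 proof -
  have "quad n g' (\<lambda>i. of_int ((m(n := t)) i)) = quad n g' (\<lambda>i. of_int (m i))"
   by (simp add: quad_def)
  moreover have "(\<Sum>i<n. l i * of_int ((m(n := t)) i)) = L m" by (simp add: L_def)
  ultimately show ?thesis by (simp add: quad_Suc e'_def algebra_simps flip: exp_add)
 qed
 obtain C where C: "\<And>x. (\<Sum>\<^sub>\<infinity>t::int. exp (- pi * a * (of_int t + x)\<^sup>2)) \<le> C"
  using gaussian_sum_bounded[OF a] by blast
 have sumg: "(\<lambda>m. exp (- pi * quad (Suc n) g (\<lambda>i. of_int (m i)))) summable_on int_vecs (Suc n)"
 proof -
  have "(\<lambda>(m, t). e' m * exp (- pi * a * (of_int t + L m)\<^sup>2)) summable_on (int_vecs n \<times> (UNIV :: int set))"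
  proof (rule summable_on_SigmaI)
   fix m assume "m \<in> int_vecs n"
   show "((\<lambda>t::int. case (m, t) of (m, t) \<Rightarrow> e' m * exp (- pi * a * (of_int t + L m)\<^sup>2)) has_sum
     e' m * (\<Sum>\<^sub>\<infinity>t::int. exp (- pi * a * (of_int t + L m)\<^sup>2))) UNIV"
    using gaussian_summable_int[OF a, of "L m"] by (simp add: has_sum_cmult_right)
  next
   show "(\<lambda>m. e' m * (\<Sum>\<^sub>\<infinity>t::int. exp (- pi * a * (of_int t + L m)\<^sup>2))) summable_on int_vecs n"
    by (rule summable_on_comparison_test[OF summable_on_cmult_left[OF sum', of C]])
      (use C in \<open>auto simp: e'_def intro!: mult_left_mono mult_nonneg_nonneg infsum_nonneg\<close>)
  qed (auto simp: e'_def)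
  also have "?this \<longleftrightarrow> (\<lambda>p. exp (- pi * quad (Suc n) g (\<lambda>i. of_int ((case p of (m, t) \<Rightarrow> m(n := t)) i)))) summable_on (int_vecs n \<times> UNIV)"
   by (intro summable_on_cong) (auto simp only: prod.case e mem_Sigma_iff)
  finally show ?thesis
   by (subst summable_on_reindex_bij_betw[OF bij_betw_int_vecs_Suc, symmetric])
 qed
 have norm_e': "norm (complex_of_real (e' m) * cis x) = e' m" for m x by (simp add: norm_mult e'_def)
 \<comment> \<open>Up to \<open>sqrt D'\<close> the dual sum is a Fourier series in \<open>z\<close>
   with coefficients \<open>e' m\<close>. The bound, uniform in \<open>z\<close>, gives the majorant
   for the summation over the last dual coordinate.\<close>
 have Q_sum_bound: "(\<Sum>\<^sub>\<infinity>k\<in>int_vecs n. exp (- pi * Q' (\<lambda>i. of_int (k i) + z i))) \<le> sqrt D' * (\<Sum>\<^sub>\<infinity>m\<in>int_vecs n. e' m)" for z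
 proof -
  have "norm (\<Sum>\<^sub>\<infinity>m\<in>int_vecs n. complex_of_real (e' m) * cis (2 * pi * (\<Sum>i<n. z i * of_int (m i)))) \<le>
    (\<Sum>\<^sub>\<infinity>m\<in>int_vecs n. norm (complex_of_real (e' m) * cis (2 * pi * (\<Sum>i<n. z i * of_int (m i)))))"
   by (rule norm_infsum_bound) (use sum' in \<open>simp add: norm_e'\<close>)
  moreover have "norm (complex_of_real (e' m) * cis x) = e' m" for m x by (rule norm_e')
  moreover have "(\<Sum>\<^sub>\<infinity>k\<in>int_vecs n. exp (- pi * Q' (\<lambda>i. of_int (k i) + z i))) \<ge> 0" by (intro infsum_nonneg) auto
  ultimately show ?thesis using D'pos unfolding IH by (simp add: norm_divide field_simps)
 qed
 define T where "T = sqrt D' * (\<Sum>\<^sub>\<infinity>m\<in>int_vecs n. e' m)"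
 define eQ where "eQ z k s = exp (- pi * (of_int s + z n)\<^sup>2 / a) * exp (- pi * Q' (\<lambda>i. of_int (k i) + (z i - (of_int s + z n) * l i)))"
  for z :: "nat \<Rightarrow> real" and k :: "nat \<Rightarrow> int" and s :: int
 have eQ: "exp (- pi * Q (\<lambda>i. of_int ((k(n := s)) i) + z i)) = eQ z k s" if "k \<in> int_vecs n" for z k s
 proof -
  have "Q' (\<lambda>i. of_int ((k(n := s)) i) + z i - (of_int s + z n) * l i) = Q' (\<lambda>i. of_int (k i) + (z i - (of_int s + z n) * l i))"
   by (rule Q'_cong) auto
  thus ?thesis by (simp add: Q_def eQ_def algebra_simps flip: exp_add)
 qed
 have sumk: "(\<lambda>s::int. exp (- pi * (of_int s + w)\<^sup>2 / a)) summable_on UNIV" for w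
  using gaussian_summable_int[of "1 / a" w] a by simp
 have swap_bij: "bij_betw (\<lambda>(s, k). k(n := s)) ((UNIV :: int set) \<times> int_vecs n) (int_vecs (Suc n))"
  by (rule bij_betw_byWitness[where f' = "\<lambda>m. (m n, m(n := 0))"])
   (auto simp: int_vecs_def fun_eq_iff)
 have sumQ2: "(\<lambda>(s, k). eQ z k s) summable_on ((UNIV :: int set) \<times> int_vecs n)" for z
 proof (rule summable_on_SigmaI)
  fix s :: int
  show "((\<lambda>k. case (s, k) of (s, k) \<Rightarrow> eQ z k s) has_sum
    exp (- pi * (of_int s + z n)\<^sup>2 / a) * (\<Sum>\<^sub>\<infinity>k\<in>int_vecs n. exp (- pi * Q' (\<lambda>i. of_int (k i) + (z i - (of_int s + z n) * l i))))) (int_vecs n)"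
   unfolding eQ_def prod.case by (intro has_sum_cmult_right has_sum_infsum Q'_sum)
 next
  show "(\<lambda>s::int. exp (- pi * (of_int s + z n)\<^sup>2 / a) * (\<Sum>\<^sub>\<infinity>k\<in>int_vecs n. exp (- pi * Q' (\<lambda>i. of_int (k i) + (z i - (of_int s + z n) * l i))))) summable_on UNIV"
   by (rule summable_on_comparison_test[OF summable_on_cmult_left[OF sumk[of "z n"], of T]])
     (use Q_sum_bound in \<open>auto simp: T_def intro!: mult_left_mono mult_nonneg_nonneg infsum_nonneg\<close>)
 qed (auto simp: eQ_def)
 have sumQ: "(\<lambda>k. exp (- pi * Q (\<lambda>i. of_int (k i) + z i))) summable_on int_vecs (Suc n)" for z
 proof -
  have "(\<lambda>(s, k). eQ z k s) summable_on ((UNIV :: int set) \<times> int_vecs n) \<longleftrightarrow>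
    (\<lambda>p. exp (- pi * Q (\<lambda>i. of_int ((case p of (s, k) \<Rightarrow> k(n := s)) i) + z i))) summable_on (UNIV \<times> int_vecs n)"
   by (intro summable_on_cong) (auto simp only: prod.case eQ mem_Sigma_iff)
  thus ?thesis using sumQ2[of z]
   by (subst summable_on_reindex_bij_betw[OF swap_bij, symmetric]) blast
 qed
 have main: "(\<Sum>\<^sub>\<infinity>m\<in>int_vecs (Suc n). complex_of_real (exp (- pi * quad (Suc n) g (\<lambda>i. of_int (m i)))) * cis (2 * pi * (\<Sum>i<Suc n. z i * of_int (m i))))
     = complex_of_real ((\<Sum>\<^sub>\<infinity>k\<in>int_vecs (Suc n). exp (- pi * Q (\<lambda>i. of_int (k i) + z i))) / sqrt ?D)" for z
 proof -
  let ?f = "\<lambda>m. complex_of_real (exp (- pi * quad (Suc n) g (\<lambda>i. of_int (m i)))) * cis (2 * pi * (\<Sum>i<Suc n. z i * of_int (m i)))"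
  define ch where "ch m = cis (2 * pi * (\<Sum>i<n. z i * of_int (m i)))" for m :: "nat \<Rightarrow> int"
  have f: "?f (m(n := t)) = complex_of_real (e' m) * ch m * (complex_of_real (exp (- pi * a * (of_int t + L m)\<^sup>2)) * cis (2 * pi * z n * of_int t))"
   if "m \<in> int_vecs n" for m t
  proof -
   have "(\<Sum>i<Suc n. z i * of_int ((m(n := t)) i)) = (\<Sum>i<n. z i * of_int (m i)) + z n * of_int t" by simp
   thus ?thesis unfolding e[OF that] by (simp only: ch_def distrib_left cis_mult[symmetric] of_real_mult) (simp add: mult_ac)
  qed
  have fs: "?f summable_on int_vecs (Suc n)"
   by (rule abs_summable_summable) (use sumg in \<open>simp add: norm_mult\<close>)
  have fs2: "(\<lambda>(m, t). ?f (m(n := t))) summable_on (int_vecs n \<times> (UNIV :: int set))"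
   using fs by (subst (asm) summable_on_reindex_bij_betw[OF bij_betw_int_vecs_Suc, symmetric]) (simp add: case_prod_unfold)
  define G where "G m s = complex_of_real (e' m) * ch m * (complex_of_real (exp (- pi * (of_int s + z n)\<^sup>2 / a)) * cis (- 2 * pi * (of_int s + z n) * L m))"
   for m s
  have "(\<Sum>\<^sub>\<infinity>m\<in>int_vecs (Suc n). ?f m) = (\<Sum>\<^sub>\<infinity>(m, t)\<in>int_vecs n \<times> (UNIV :: int set). ?f (m(n := t)))"
   by (subst infsum_reindex_bij_betw[OF bij_betw_int_vecs_Suc, symmetric]) (simp add: case_prod_unfold)
  also have "\<dots> = (\<Sum>\<^sub>\<infinity>m\<in>int_vecs n. \<Sum>\<^sub>\<infinity>t. ?f (m(n := t)))"
   using infsum_Sigma_banach[OF fs2] by simp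
  also have "\<dots> = (\<Sum>\<^sub>\<infinity>m\<in>int_vecs n. complex_of_real (1 / sqrt a) * (\<Sum>\<^sub>\<infinity>s. G m s))"
  proof (rule infsum_cong)
   fix m assume m: "m \<in> int_vecs n"
   have "(\<Sum>\<^sub>\<infinity>t. ?f (m(n := t))) = complex_of_real (e' m) * ch m * (\<Sum>\<^sub>\<infinity>t::int. complex_of_real (exp (- pi * a * (of_int t + L m)\<^sup>2)) * cis (2 * pi * z n * of_int t))"
    unfolding f[OF m] by (rule infsum_cmult_right')
   also have "(\<Sum>\<^sub>\<infinity>t::int. complex_of_real (exp (- pi * a * (of_int t + L m)\<^sup>2)) * cis (2 * pi * z n * of_int t))
    = complex_of_real (1 / sqrt a) * (\<Sum>\<^sub>\<infinity>s::int. complex_of_real (exp (- pi * (of_int s + z n)\<^sup>2 / a)) * cis (- 2 * pi * (of_int s + z n) * L m))"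
    using infsumI[OF poisson_gaussian_1[OF a, of "z n" "L m"]] a by (simp add: field_simps)
   finally show "(\<Sum>\<^sub>\<infinity>t. ?f (m(n := t))) = complex_of_real (1 / sqrt a) * (\<Sum>\<^sub>\<infinity>s. G m s)"
    unfolding G_def by (simp only: infsum_cmult_right' mult_ac)
  qed
  also have "\<dots> = complex_of_real (1 / sqrt a) * (\<Sum>\<^sub>\<infinity>m\<in>int_vecs n. \<Sum>\<^sub>\<infinity>s. G m s)"
   by (rule infsum_cmult_right')
  also have "(\<Sum>\<^sub>\<infinity>m\<in>int_vecs n. \<Sum>\<^sub>\<infinity>s. G m s) = (\<Sum>\<^sub>\<infinity>s. \<Sum>\<^sub>\<infinity>m\<in>int_vecs n. G m s)"
  proof (rule infsum_swap_banach, rule abs_summable_summable)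
   have "(\<lambda>(m, s). e' m * exp (- pi * (of_int s + z n)\<^sup>2 / a)) summable_on (int_vecs n \<times> (UNIV :: int set))"
   proof (rule summable_on_SigmaI)
    show "((\<lambda>s. case (m, s) of (m, s) \<Rightarrow> e' m * exp (- pi * (of_int s + z n)\<^sup>2 / a)) has_sum
      e' m * (\<Sum>\<^sub>\<infinity>s::int. exp (- pi * (of_int s + z n)\<^sup>2 / a))) (UNIV :: int set)" for m
     unfolding prod.case by (intro has_sum_cmult_right has_sum_infsum sumk)
   next
    show "(\<lambda>m. e' m * (\<Sum>\<^sub>\<infinity>s::int. exp (- pi * (of_int s + z n)\<^sup>2 / a))) summable_on int_vecs n"
     by (rule summable_on_cmult_left[OF sum'])
   qed (auto simp: e'_def)
   thus "(\<lambda>p. norm (case p of (m, s) \<Rightarrow> G m s)) summable_on (int_vecs n \<times> (UNIV :: int set))"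
    by (simp add: G_def ch_def case_prod_unfold norm_mult e'_def)
  qed
  also have "\<dots> = (\<Sum>\<^sub>\<infinity>s. complex_of_real (\<Sum>\<^sub>\<infinity>k\<in>int_vecs n. eQ z k s) / complex_of_real (sqrt D'))"
  proof (rule infsum_cong)
   fix s :: int
   \<comment> \<open>The character in \<open>L m\<close> left over by the one-dimensional formula is
     linear in \<open>m\<close>; it shifts the frequency at which the induction hypothesis is
     used.\<close>
   define z' where "z' i = z i - (of_int s + z n) * l i" for i
   have chL: "ch m * cis (- 2 * pi * (of_int s + z n) * L m) = cis (2 * pi * (\<Sum>i<n. z' i * of_int (m i)))" for m
   proof -
    have "(\<Sum>i<n. z' i * of_int (m i)) = (\<Sum>i<n. z i * of_int (m i)) - (of_int s + z n) * L m"
     by (simp only: z'_def L_def left_diff_distrib sum_subtractf sum_distrib_left mult.assoc)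
    hence "2 * pi * (\<Sum>i<n. z' i * of_int (m i)) = 2 * pi * (\<Sum>i<n. z i * of_int (m i)) + - 2 * pi * (of_int s + z n) * L m"
     by (simp only:) (simp add: right_diff_distrib)
    thus ?thesis by (simp only: ch_def cis_mult)
   qed
   hence "G m s = complex_of_real (exp (- pi * (of_int s + z n)\<^sup>2 / a)) * (complex_of_real (e' m) * cis (2 * pi * (\<Sum>i<n. z' i * of_int (m i))))" for m
    unfolding G_def chL[symmetric] by (simp only: mult_ac)
   hence "(\<Sum>\<^sub>\<infinity>m\<in>int_vecs n. G m s) = complex_of_real (exp (- pi * (of_int s + z n)\<^sup>2 / a)) * (\<Sum>\<^sub>\<infinity>m\<in>int_vecs n. complex_of_real (e' m) * cis (2 * pi * (\<Sum>i<n. z' i * of_int (m i))))"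
    by (simp only: infsum_cmult_right')
   also have "\<dots> = complex_of_real (exp (- pi * (of_int s + z n)\<^sup>2 / a) * (\<Sum>\<^sub>\<infinity>k\<in>int_vecs n. exp (- pi * Q' (\<lambda>i. of_int (k i) + z' i)))) / complex_of_real (sqrt D')"
    unfolding IH by simp
   also have "exp (- pi * (of_int s + z n)\<^sup>2 / a) * (\<Sum>\<^sub>\<infinity>k\<in>int_vecs n. exp (- pi * Q' (\<lambda>i. of_int (k i) + z' i))) = (\<Sum>\<^sub>\<infinity>k\<in>int_vecs n. eQ z k s)"
    unfolding eQ_def z'_def by (rule infsum_cmult_right'[symmetric])
   finally show "(\<Sum>\<^sub>\<infinity>m\<in>int_vecs n. G m s) = complex_of_real (\<Sum>\<^sub>\<infinity>k\<in>int_vecs n. eQ z k s) / complex_of_real (sqrt D')" .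
  qed
  also have "\<dots> = complex_of_real (\<Sum>\<^sub>\<infinity>s. \<Sum>\<^sub>\<infinity>k\<in>int_vecs n. eQ z k s) / complex_of_real (sqrt D')"
   by (simp only: divide_inverse infsum_cmult_left' infsum_complex_of_real)
  also have "(\<Sum>\<^sub>\<infinity>s. \<Sum>\<^sub>\<infinity>k\<in>int_vecs n. eQ z k s) = (\<Sum>\<^sub>\<infinity>(s, k)\<in>(UNIV :: int set) \<times> int_vecs n. eQ z k s)"
   using infsum_Sigma_banach[OF sumQ2[of z]] by simp
  also have "\<dots> = (\<Sum>\<^sub>\<infinity>k\<in>int_vecs (Suc n). exp (- pi * Q (\<lambda>i. of_int (k i) + z i)))"
   by (subst infsum_reindex_bij_betw[OF swap_bij, symmetric], intro infsum_cong) (auto simp only: prod.case eQ mem_Sigma_iff)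
  finally show ?thesis unfolding D using a by (simp add: real_sqrt_mult)
 qed
 have Qg: "Q (apply_mat (Suc n) g x) = quad (Suc n) g x" for x
 proof -
  let ?y = "apply_mat (Suc n) g x"
  have yn: "?y n = a * (x n + (\<Sum>i<n. l i * x i))"
   by (simp add: apply_mat_def gni a_def[symmetric] distrib_left sum_distrib_left mult_ac)
  have "?y i - ?y n * l i = apply_mat n g' x i" for i
  proof -
   have "(\<Sum>j<n. g i j * x j) = apply_mat n g' x i + a * l i * (\<Sum>j<n. l j * x j)"
    by (simp add: apply_mat_def gij distrib_right distrib_left sum.distrib sum_distrib_left mult_ac)
   hence "?y i = apply_mat n g' x i + a * l i * (\<Sum>j<n. l j * x j) + a * l i * x n"
    by (simp add: apply_mat_def[of "Suc n"] gin)
   thus ?thesis unfolding yn by (simp add: algebra_simps)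
  qed
  hence "Q' (\<lambda>i. ?y i - ?y n * l i) = quad n g' x" by (simp only: Q'_g)
  thus ?thesis unfolding Q_def yn quad_Suc using a by (simp add: power2_eq_square)
 qed
 have Q_cong: "Q x = Q y" if "\<forall>i<Suc n. x i = y i" for x y
  unfolding Q_def using that Q'_cong[of "\<lambda>i. x i - x n * l i" "\<lambda>i. y i - y n * l i"] by simp
 show ?case using sumg sumQ main Qg Q_cong D D'pos a by (intro conjI exI[of _ Q]) auto
qed

section \<open>Theta functions and the Mellin transform\<close>

text \<open>Abstract form of the quotient of metrized ideals. \<open>P\<close> sums the weight
  \<open>\<phi>\<close> over an orbit, so \<open>1 + P\<close> is the theta function;
  \<open>\<iota>\<close> is duality, which inverts the group action, \<open>l\<close> is the
  logarithm of the covolume, and \<open>\<delta> t\<close> is the dilation that raises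
  \<open>l\<close> by \<open>t\<close>. The axiom \<open>poisson\<close> is the functional equation
  of theta.\<close>

locale theta_quotient = sigma_finite_measure M for M :: "'z measure" +
 fixes G :: "'g set" and act :: "'g \<Rightarrow> 'z \<Rightarrow> 'z" and ginv :: "'g \<Rightarrow> 'g"
  and \<phi> :: "'z \<Rightarrow> ennreal" and \<iota> :: "'z \<Rightarrow> 'z" and \<delta> :: "real \<Rightarrow> 'z \<Rightarrow> 'z" and l :: "'z \<Rightarrow> real"
  and P :: "'z \<Rightarrow> ennreal"
 assumes P_def: "\<And>z. z \<in> space M \<Longrightarrow> P z = (\<integral>\<^sup>+g. \<phi> (act g z) \<partial>count_space G)"
  and G: "countable G"
  and act_measurable [measurable]: "\<And>g. g \<in> G \<Longrightarrow> act g \<in> measurable M M"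
  and act_integral: "\<And>g f. g \<in> G \<Longrightarrow> f \<in> borel_measurable M \<Longrightarrow> (\<integral>\<^sup>+z. f (act g z) \<partial>M) = (\<integral>\<^sup>+z. f z \<partial>M)"
  and ginv: "bij_betw ginv G G"
  and act_ginv: "\<And>g z. g \<in> G \<Longrightarrow> z \<in> space M \<Longrightarrow> act g (act (ginv g) z) = z"
  and phi_measurable [measurable]: "\<phi> \<in> borel_measurable M"
  and P_pos: "\<And>z. z \<in> space M \<Longrightarrow> P z > 0"
  and P_fin: "\<And>z. z \<in> space M \<Longrightarrow> P z < \<infinity>"
  and P_act: "\<And>g z. g \<in> G \<Longrightarrow> z \<in> space M \<Longrightarrow> P (act g z) = P z"
  and iota_measurable [measurable]: "\<iota> \<in> measurable M M"
  and iota_integral: "\<And>f. f \<in> borel_measurable M \<Longrightarrow> (\<integral>\<^sup>+z. f (\<iota> z) \<partial>M) = (\<integral>\<^sup>+z. f z \<partial>M)"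
  and iota_act: "\<And>g z. g \<in> G \<Longrightarrow> z \<in> space M \<Longrightarrow> \<iota> (act g z) = act (ginv g) (\<iota> z)"
  and l_measurable [measurable]: "l \<in> borel_measurable M"
  and l_act: "\<And>g z. g \<in> G \<Longrightarrow> z \<in> space M \<Longrightarrow> l (act g z) = l z"
  and l_iota: "\<And>z. z \<in> space M \<Longrightarrow> l (\<iota> z) = - l z"
  and poisson: "\<And>z. z \<in> space M \<Longrightarrow> 1 + P z = ennreal (exp (- l z)) * (1 + P (\<iota> z))"
  and delta_measurable [measurable]: "\<And>t. \<delta> t \<in> measurable M M"
  and delta_integral: "\<And>t f. f \<in> borel_measurable M \<Longrightarrow> (\<integral>\<^sup>+z. f (\<delta> t z) \<partial>M) = (\<integral>\<^sup>+z. f z \<partial>M)"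
  and delta_act: "\<And>g t z. g \<in> G \<Longrightarrow> z \<in> space M \<Longrightarrow> \<delta> t (act g z) = act g (\<delta> t z)"
  and l_delta: "\<And>t z. z \<in> space M \<Longrightarrow> l (\<delta> t z) = l z + t"
begin

lemma P_measurable [measurable]: "P \<in> borel_measurable M"
proof -
 have "(\<lambda>(g, z). \<phi> (act g z)) \<in> borel_measurable (count_space G \<Otimes>\<^sub>M M)"
  by (rule measurable_pair_measure_countable1[OF G]) simp
 hence "(\<lambda>(z, g). \<phi> (act g z)) \<in> borel_measurable (M \<Otimes>\<^sub>M count_space G)"
  by (subst measurable_pair_swap_iff) (simp add: case_prod_unfold)
 interpret C: sigma_finite_measure "count_space G"
  by (rule sigma_finite_measure_count_space_countable[OF G])
 have "(\<lambda>z. \<integral>\<^sup>+g. \<phi> (act g z) \<partial>count_space G) \<in> borel_measurable M"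
  by (rule C.borel_measurable_nn_integral) fact
 thus ?thesis by (rule measurable_cong[THEN iffD1, rotated]) (simp add: P_def)
qed

text \<open>The integral over the quotient of \<open>M\<close> by \<open>G\<close> does not depend on the weight used to
 unfold it, so no fundamental domain is needed.\<close>

lemma quotient_integral_indep:
 assumes [measurable]: "F \<in> borel_measurable M" "\<psi> \<in> borel_measurable M" "Q \<in> borel_measurable M"
  and F: "\<And>g z. g \<in> G \<Longrightarrow> z \<in> space M \<Longrightarrow> F (act g z) = F z"
  and Q: "\<And>z. z \<in> space M \<Longrightarrow> Q z = (\<integral>\<^sup>+g. \<psi> (act g z) \<partial>count_space G)"
  and Q_act: "\<And>g z. g \<in> G \<Longrightarrow> z \<in> space M \<Longrightarrow> Q (act g z) = Q z"
  and Q_pos: "\<And>z. z \<in> space M \<Longrightarrow> Q z > 0" and Q_fin: "\<And>z. z \<in> space M \<Longrightarrow> Q z < \<infinity>"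
 shows "(\<integral>\<^sup>+z. F z * (\<phi> z / P z) \<partial>M) = (\<integral>\<^sup>+z. F z * (\<psi> z / Q z) \<partial>M)"
proof -
 have ginvG: "ginv g \<in> G" if "g \<in> G" for g using ginv that by (auto simp: bij_betw_def)
 \<comment> \<open>The factor 1 is inserted as the orbit sum of \<open>\<psi>\<close> divided by
   \<open>Q\<close>. Each term is moved by \<open>ginv g\<close>, which transfers the group element
   from \<open>\<psi>\<close> to \<open>\<phi>\<close>, and the sum over the group then rebuilds
   \<open>P\<close> and cancels it.\<close>
 have "(\<integral>\<^sup>+z. F z * (\<phi> z / P z) \<partial>M) = (\<integral>\<^sup>+z. F z * (\<phi> z / P z) * ((\<integral>\<^sup>+g. \<psi> (act g z) \<partial>count_space G) / Q z) \<partial>M)"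
  using Q_pos Q_fin by (intro nn_integral_cong) (auto simp: Q[symmetric] ennreal_divide_self less_top[symmetric] zero_less_iff_neq_zero)
 also have "\<dots> = (\<integral>\<^sup>+z. \<integral>\<^sup>+g. F z * (\<phi> z / P z) / Q z * \<psi> (act g z) \<partial>count_space G \<partial>M)"
  by (intro nn_integral_cong, subst nn_integral_cmult) (auto simp: divide_ennreal_def mult_ac)
 also have "\<dots> = (\<integral>\<^sup>+g. \<integral>\<^sup>+z. F z * (\<phi> z / P z) / Q z * \<psi> (act g z) \<partial>M \<partial>count_space G)"
  by (rule nn_integral_count_space_nn_integral[OF G]) measurable
 also have "\<dots> = (\<integral>\<^sup>+g. \<integral>\<^sup>+z. F z * (\<phi> (act (ginv g) z) / P z) / Q z * \<psi> z \<partial>M \<partial>count_space G)"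
 proof (rule nn_integral_cong, clarsimp)
  fix g assume g: "g \<in> G"
  note [measurable] = act_measurable[OF g] act_measurable[OF ginvG[OF g]]
  have "(\<integral>\<^sup>+z. F z * (\<phi> z / P z) / Q z * \<psi> (act g z) \<partial>M)
    = (\<integral>\<^sup>+z. F (act (ginv g) z) * (\<phi> (act (ginv g) z) / P (act (ginv g) z)) / Q (act (ginv g) z) * \<psi> (act g (act (ginv g) z)) \<partial>M)"
   by (rule act_integral[OF ginvG[OF g], symmetric]) measurable
  also have "\<dots> = (\<integral>\<^sup>+z. F z * (\<phi> (act (ginv g) z) / P z) / Q z * \<psi> z \<partial>M)"
   using ginvG[OF g] g by (intro nn_integral_cong) (simp add: F P_act Q_act act_ginv)
  finally show "(\<integral>\<^sup>+z. F z * (\<phi> z / P z) / Q z * \<psi> (act g z) \<partial>M) = (\<integral>\<^sup>+z. F z * (\<phi> (act (ginv g) z) / P z) / Q z * \<psi> z \<partial>M)" .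
 qed
 also have "\<dots> = (\<integral>\<^sup>+g. \<integral>\<^sup>+z. F z * (\<phi> (act g z) / P z) / Q z * \<psi> z \<partial>M \<partial>count_space G)"
  by (rule nn_integral_bij_count_space[OF ginv])
 also have "\<dots> = (\<integral>\<^sup>+z. \<integral>\<^sup>+g. F z * (\<phi> (act g z) / P z) / Q z * \<psi> z \<partial>count_space G \<partial>M)"
  by (rule nn_integral_count_space_nn_integral[OF G, symmetric]) measurable
 also have "\<dots> = (\<integral>\<^sup>+z. \<integral>\<^sup>+g. (F z / P z / Q z * \<psi> z) * \<phi> (act g z) \<partial>count_space G \<partial>M)"
  by (intro nn_integral_cong) (simp add: divide_ennreal_def mult_ac)
 also have "\<dots> = (\<integral>\<^sup>+z. F z / P z / Q z * \<psi> z * P z \<partial>M)"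
  by (intro nn_integral_cong, subst nn_integral_cmult) (auto simp: P_def)
 also have "\<dots> = (\<integral>\<^sup>+z. F z * (\<psi> z / Q z) * (P z / P z) \<partial>M)"
  by (intro nn_integral_cong) (simp add: divide_ennreal_def mult_ac)
 also have "\<dots> = (\<integral>\<^sup>+z. F z * (\<psi> z / Q z) \<partial>M)"
  using P_pos P_fin by (intro nn_integral_cong) (auto simp: ennreal_divide_self less_top[symmetric] zero_less_iff_neq_zero)
 finally show ?thesis .
qed

text \<open>A density whose sum over every orbit is 1: integrating an invariant function against
  \<open>q\<close> is integrating it over the quotient.\<close>

definition q :: "'z \<Rightarrow> ennreal" where "q z = \<phi> z / P z"

lemma q_measurable [measurable]: "q \<in> borel_measurable M" unfolding q_def[abs_def] by measurable

lemma q_P: "z \<in> space M \<Longrightarrow> q z * P z = \<phi> z"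
proof -
 assume z: "z \<in> space M"
 have "q z * P z = \<phi> z * (P z / P z)" by (simp add: q_def divide_ennreal_def mult_ac)
 also have "P z / P z = 1" using P_pos[OF z] P_fin[OF z] by (intro ennreal_divide_self) auto
 finally show ?thesis by simp
qed

lemma iota_space: "z \<in> space M \<Longrightarrow> \<iota> z \<in> space M"
 and delta_space: "z \<in> space M \<Longrightarrow> \<delta> t z \<in> space M"
 using measurable_space[OF iota_measurable] measurable_space[OF delta_measurable] by auto

lemma ginv_G: "g \<in> G \<Longrightarrow> ginv g \<in> G" using ginv by (auto simp: bij_betw_def)

lemma P_iota_act: "g \<in> G \<Longrightarrow> z \<in> space M \<Longrightarrow> P (\<iota> (act g z)) = P (\<iota> z)"
 by (simp add: iota_act P_act ginv_G iota_space)

lemma quotient_iota: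
 assumes [measurable]: "F \<in> borel_measurable M" and F: "\<And>g z. g \<in> G \<Longrightarrow> z \<in> space M \<Longrightarrow> F (act g z) = F z"
 shows "(\<integral>\<^sup>+z. F z * q z \<partial>M) = (\<integral>\<^sup>+z. F z * q (\<iota> z) \<partial>M)"
proof -
 have "P (\<iota> z) = (\<integral>\<^sup>+g. \<phi> (\<iota> (act g z)) \<partial>count_space G)" if "z \<in> space M" for z
 proof -
  have "P (\<iota> z) = (\<integral>\<^sup>+g. \<phi> (act (ginv g) (\<iota> z)) \<partial>count_space G)"
   using that nn_integral_bij_count_space[OF ginv, of "\<lambda>g. \<phi> (act g (\<iota> z))"] by (simp add: P_def iota_space)
  also have "\<dots> = (\<integral>\<^sup>+g. \<phi> (\<iota> (act g z)) \<partial>count_space G)"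
   using that by (intro nn_integral_cong) (simp add: iota_act)
  finally show ?thesis .
 qed
 note Pi = this
 show ?thesis unfolding q_def
  by (rule quotient_integral_indep[where \<psi> = "\<lambda>z. \<phi> (\<iota> z)" and Q = "\<lambda>z. P (\<iota> z)", OF _ _ _ F Pi])
    (simp_all add: P_pos P_fin[simplified] iota_space P_iota_act)
qed

lemma quotient_delta:
 assumes [measurable]: "F \<in> borel_measurable M" and F: "\<And>g z. g \<in> G \<Longrightarrow> z \<in> space M \<Longrightarrow> F (act g z) = F z"
 shows "(\<integral>\<^sup>+z. F z * q z \<partial>M) = (\<integral>\<^sup>+z. F z * q (\<delta> t z) \<partial>M)"
proof -
 have "P (\<delta> t z) = (\<integral>\<^sup>+g. \<phi> (\<delta> t (act g z)) \<partial>count_space G)" if "z \<in> space M" for z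
  using that by (simp add: P_def delta_space) (intro nn_integral_cong, simp add: delta_act)
 note Pd = this
 show ?thesis unfolding q_def
  by (rule quotient_integral_indep[where \<psi> = "\<lambda>z. \<phi> (\<delta> t z)" and Q = "\<lambda>z. P (\<delta> t z)", OF _ _ _ F Pd])
    (simp_all add: P_pos P_fin[simplified] delta_space delta_act P_act)
qed

text \<open>A window of length 1, so that \<open>vol\<close> is the volume of the quotient per unit
  of \<open>l\<close>. It lies to the left of 0 and away from it because Poisson summation forces
  \<open>P \<ge> 1\<close> there.\<close>

definition volw :: "real \<Rightarrow> ennreal" where "volw = indicator {-2..-1}"

definition vol :: ennreal where "vol = (\<integral>\<^sup>+z. volw (l z) * q z \<partial>M)"

text \<open>\<open>\<delta>\<close> preserves the quotient integral and translates \<open>l\<close>,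
  so the image of the quotient measure under \<open>l\<close> is translation invariant. Averaging
  over all translates of the window identifies it as \<open>vol\<close> times Lebesgue
  measure.\<close>

lemma quotient_norm_integral:
 assumes [measurable]: "h \<in> borel_measurable borel"
 shows "(\<integral>\<^sup>+z. h (l z) * q z \<partial>M) = vol * (\<integral>\<^sup>+u. h u \<partial>lborel)"
proof -
 interpret pair_sigma_finite M "lborel :: real measure" ..
 have [measurable]: "volw \<in> borel_measurable borel" by (simp add: volw_def)
 have int: "(\<integral>\<^sup>+t. volw (u + t) \<partial>lborel) = 1" for u
 proof -
  have "(\<integral>\<^sup>+t. volw (u + t) \<partial>lborel) = (\<integral>\<^sup>+t. volw t \<partial>lborel)"
   using nn_integral_real_affine[of volw 1 u] by simp
  thus ?thesis by (simp add: volw_def)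
 qed
 have refl: "(\<integral>\<^sup>+t. h (u - t) \<partial>lborel) = (\<integral>\<^sup>+t. h t \<partial>lborel)" for u
  using nn_integral_real_affine[of h "-1" u] by simp
 have "(\<integral>\<^sup>+z. h (l z) * q z \<partial>M) = (\<integral>\<^sup>+z. \<integral>\<^sup>+t. h (l z) * q z * volw (l z + t) \<partial>lborel \<partial>M)"
  by (subst nn_integral_cmult) (simp_all add: int)
 also have "\<dots> = (\<integral>\<^sup>+t. \<integral>\<^sup>+z. h (l z) * q z * volw (l z + t) \<partial>M \<partial>lborel)"
  by (subst Fubini') auto
 also have "\<dots> = (\<integral>\<^sup>+t. \<integral>\<^sup>+z. h (l z - t) * volw (l z) * q z \<partial>M \<partial>lborel)"
 proof (rule nn_integral_cong)
  fix t
  have "(\<integral>\<^sup>+z. h (l z) * q z * volw (l z + t) \<partial>M) = (\<integral>\<^sup>+z. (h (l z) * volw (l z + t)) * q z \<partial>M)"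
   by (simp add: mult_ac)
  also have "\<dots> = (\<integral>\<^sup>+z. (h (l z) * volw (l z + t)) * q (\<delta> t z) \<partial>M)"
   by (rule quotient_delta) (auto simp: l_act)
  also have "\<dots> = (\<integral>\<^sup>+z. (h (l (\<delta> t z) - t) * volw (l (\<delta> t z))) * q (\<delta> t z) \<partial>M)"
   by (intro nn_integral_cong) (simp add: l_delta)
  also have "\<dots> = (\<integral>\<^sup>+z. (h (l z - t) * volw (l z)) * q z \<partial>M)"
   by (rule delta_integral) simp
  finally show "(\<integral>\<^sup>+z. h (l z) * q z * volw (l z + t) \<partial>M) = (\<integral>\<^sup>+z. h (l z - t) * volw (l z) * q z \<partial>M)" .
 qed
 also have "\<dots> = (\<integral>\<^sup>+z. \<integral>\<^sup>+t. h (l z - t) * volw (l z) * q z \<partial>lborel \<partial>M)"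
  by (subst Fubini') auto
 also have "\<dots> = (\<integral>\<^sup>+z. \<integral>\<^sup>+t. (volw (l z) * q z) * h (l z - t) \<partial>lborel \<partial>M)"
  by (simp add: mult_ac)
 also have "\<dots> = (\<integral>\<^sup>+z. (volw (l z) * q z) * (\<integral>\<^sup>+u. h u \<partial>lborel) \<partial>M)"
  by (subst nn_integral_cmult) (simp_all add: refl)
 also have "\<dots> = vol * (\<integral>\<^sup>+u. h u \<partial>lborel)"
  by (simp add: nn_integral_multc vol_def)
 finally show ?thesis .
qed

text \<open>Image under \<open>l\<close> of the measure with density \<open>\<phi>\<close>. Since
  \<open>q * P = \<phi>\<close>, this is the theta function without its constant term, integrated
  over the quotient and sorted by covolume.\<close>

definition mu :: "real measure" where "mu = distr (density M \<phi>) borel l"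

lemma sets_mu [measurable_cong, simp]: "sets mu = sets borel" by (simp add: mu_def)

lemma nn_integral_mu: "h \<in> borel_measurable borel \<Longrightarrow> (\<integral>\<^sup>+u. h u \<partial>mu) = (\<integral>\<^sup>+z. h (l z) * \<phi> z \<partial>M)"
 by (simp add: mu_def nn_integral_distr nn_integral_density mult_ac)

text \<open>The theta equation is multiplied by \<open>h (l z) * q z\<close> on \<open>l < 0\<close>
  and integrated. The terms with \<open>P\<close> become integrals against \<open>mu\<close>, on the
  dual side after applying \<open>\<iota>\<close>; the two constants 1 give the multiples of
  \<open>vol\<close>. Everything is kept as a sum on either side because the values are in
  \<open>ennreal\<close>.\<close>

theorem mu_reflection:
 assumes [measurable]: "h \<in> borel_measurable borel"
 shows "(\<integral>\<^sup>+u. h u * indicator {..<0} u \<partial>mu) + vol * (\<integral>\<^sup>+u. h u * indicator {..<0} u \<partial>lborel)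
  = (\<integral>\<^sup>+u. h (- u) * ennreal (exp u) * indicator {0<..} u \<partial>mu)
   + vol * (\<integral>\<^sup>+u. h u * ennreal (exp (- u)) * indicator {..<0} u \<partial>lborel)"
proof -
 let ?h = "\<lambda>z. h (l z) * indicator {..<0} (l z) :: ennreal"
 let ?i = "\<lambda>z. h (l z) * ennreal (exp (- l z)) * indicator {..<0} (l z) :: ennreal"
 have "(\<integral>\<^sup>+u. h u * indicator {..<0} u \<partial>mu) + vol * (\<integral>\<^sup>+u. h u * indicator {..<0} u \<partial>lborel)
   = (\<integral>\<^sup>+z. ?h z * \<phi> z \<partial>M) + (\<integral>\<^sup>+z. ?h z * q z \<partial>M)"
  by (subst nn_integral_mu) (auto simp: quotient_norm_integral[where h = "\<lambda>u. h u * indicator {..<0} u", symmetric])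
 also have "\<dots> = (\<integral>\<^sup>+z. ?h z * \<phi> z + ?h z * q z \<partial>M)"
  by (rule nn_integral_add[symmetric]) auto
 also have "\<dots> = (\<integral>\<^sup>+z. ?i z * P (\<iota> z) * q z + ?i z * q z \<partial>M)"
 proof (rule nn_integral_cong)
  fix z assume z: "z \<in> space M"
  have "?h z * \<phi> z + ?h z * q z = ?h z * q z * (1 + P z)"
   by (simp add: q_P[OF z, symmetric] distrib_left distrib_right mult_ac add_ac)
  also have "\<dots> = ?i z * P (\<iota> z) * q z + ?i z * q z"
   by (simp add: poisson[OF z] distrib_left distrib_right mult_ac add_ac)
  finally show "?h z * \<phi> z + ?h z * q z = ?i z * P (\<iota> z) * q z + ?i z * q z" .
 qed
 also have "\<dots> = (\<integral>\<^sup>+z. ?i z * P (\<iota> z) * q z \<partial>M) + (\<integral>\<^sup>+z. ?i z * q z \<partial>M)"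
  by (rule nn_integral_add) auto
 also have "(\<integral>\<^sup>+z. ?i z * q z \<partial>M) = vol * (\<integral>\<^sup>+u. h u * ennreal (exp (- u)) * indicator {..<0} u \<partial>lborel)"
  by (rule quotient_norm_integral) auto
 also have "(\<integral>\<^sup>+z. ?i z * P (\<iota> z) * q z \<partial>M) = (\<integral>\<^sup>+z. ?i z * P (\<iota> z) * q (\<iota> z) \<partial>M)"
  by (rule quotient_iota) (auto simp: l_act P_iota_act)
 also have "\<dots> = (\<integral>\<^sup>+z. h (- l (\<iota> z)) * ennreal (exp (l (\<iota> z))) * indicator {0<..} (l (\<iota> z)) * \<phi> (\<iota> z) \<partial>M)"
  by (intro nn_integral_cong) (auto simp: l_iota q_P[OF iota_space, symmetric] mult_ac split: split_indicator)
 also have "\<dots> = (\<integral>\<^sup>+z. h (- l z) * ennreal (exp (l z)) * indicator {0<..} (l z) * \<phi> z \<partial>M)"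
  by (rule iota_integral) auto
 also have "\<dots> = (\<integral>\<^sup>+u. h (- u) * ennreal (exp u) * indicator {0<..} u \<partial>mu)"
  by (subst nn_integral_mu) auto
 finally show ?thesis .
qed

text \<open>On the window, \<open>1 + P \<ge> exp (- l) \<ge> 2\<close>, hence
  \<open>P \<ge> 1\<close> and \<open>q \<le> \<phi>\<close>. The volume is thus dominated by an
  integral against \<open>mu\<close>.\<close>

lemma vol_finite:
 assumes "(\<integral>\<^sup>+u. ennreal (exp (2 * u)) \<partial>mu) < \<infinity>"
 shows "vol < \<infinity>"
proof -
 have [measurable]: "volw \<in> borel_measurable borel" by (simp add: volw_def)
 have "vol \<le> (\<integral>\<^sup>+z. ennreal (exp 4) * (ennreal (exp (2 * l z)) * \<phi> z) \<partial>M)"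
  unfolding vol_def
 proof (rule nn_integral_mono)
  fix z assume z: "z \<in> space M"
  show "volw (l z) * q z \<le> ennreal (exp 4) * (ennreal (exp (2 * l z)) * \<phi> z)"
  proof (cases "l z \<in> {-2..-1}")
   case True
   have "1 + P z \<ge> ennreal (exp (- l z)) * 1"
    unfolding poisson[OF z] by (intro mult_left_mono) auto
   moreover have "exp (- l z) \<ge> 2" using True exp_ge_add_one_self[of "- l z"] by auto
   ultimately have "1 + P z \<ge> 1 + 1"
    by (metis dual_order.trans ennreal_leI ennreal_numeral mult.right_neutral one_add_one)
   hence P1: "P z \<ge> 1" by (subst (asm) ennreal_add_left_cancel_le) auto
   have "q z = q z * 1" by simp
   also have "\<dots> \<le> q z * P z" by (intro mult_left_mono P1) auto
   also have "\<dots> = \<phi> z" using q_P[OF z] .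
   finally have "q z \<le> \<phi> z" .
   \<comment> \<open>The constant \<open>exp 4\<close> compensates \<open>exp (2 * l)\<close>, which
     is at least \<open>exp (- 4)\<close> on the window.\<close>
   moreover have "1 \<le> ennreal (exp 4) * ennreal (exp (2 * l z))"
    using True by (auto simp: ennreal_mult[symmetric] exp_add[symmetric] ennreal_1[symmetric] simp del: ennreal_1)
   ultimately have "1 * q z \<le> (ennreal (exp 4) * ennreal (exp (2 * l z))) * \<phi> z"
    by (intro mult_mono) auto
   with True show ?thesis by (simp add: volw_def mult_ac)
  qed (auto simp: volw_def)
 qed
 also have "\<dots> = ennreal (exp 4) * (\<integral>\<^sup>+u. ennreal (exp (2 * u)) \<partial>mu)"
  by (subst nn_integral_cmult) (auto simp: nn_integral_mu)
 also have "\<dots> < \<infinity>" using assms by (auto simp: ennreal_mult_less_top)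
 finally show ?thesis .
qed

lemma vol_pos:
 assumes "(\<integral>\<^sup>+u. ennreal (exp (2 * u)) \<partial>mu) > 0"
 shows "vol > 0"
proof (rule ccontr)
 assume "\<not> vol > 0"
 hence 0: "vol = 0" by simp
 have "(\<integral>\<^sup>+z. q z \<partial>M) = 0"
  using quotient_norm_integral[of "\<lambda>_. 1"] 0 by simp
 hence "AE z in M. q z = 0" by (subst (asm) nn_integral_0_iff_AE) auto
 hence "AE z in M. \<phi> z = 0" by (rule AE_mp) (auto intro!: AE_I2 simp: q_P[symmetric])
 hence "(\<integral>\<^sup>+z. ennreal (exp (2 * l z)) * \<phi> z \<partial>M) = 0"
  by (subst nn_integral_0_iff_AE) auto
 thus False using assms by (simp add: nn_integral_mu)
qed

end

section \<open>Laplace transforms and analytic continuation\<close>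

lemma laplace_transform_entire:
 fixes \<mu> :: "real measure"
 assumes [measurable_cong, simp]: "sets \<mu> = sets borel"
  and fin: "\<And>x. (\<integral>\<^sup>+u. ennreal (exp (x * u)) * indicator {0<..} u \<partial>\<mu>) < \<infinity>"
 defines "E \<equiv> (\<lambda>s. \<integral>u. indicator {0<..} u *\<^sub>R exp (s * complex_of_real u) \<partial>\<mu>)"
 shows "E holomorphic_on UNIV"
  and "\<And>s. norm (E s) \<le> enn2real (\<integral>\<^sup>+u. ennreal (exp (Re s * u)) * indicator {0<..} u \<partial>\<mu>)"
  and "\<And>x. E (of_real x) = of_real (enn2real (\<integral>\<^sup>+u. ennreal (exp (x * u)) * indicator {0<..} u \<partial>\<mu>))"
proof -
 have intexp: "integrable \<mu> (\<lambda>u. indicator {0<..} u * exp (x * u))" for x :: real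
  using fin[of x] by (subst integrable_iff_bounded) (auto simp: ennreal_mult' abs_mult ennreal_indicator mult_ac)
 \<comment> \<open>Moments over the positive half-line divided by factorials: the Taylor
   coefficients of \<open>E\<close>. Dominated convergence with majorant
   \<open>exp (norm s * u)\<close> shows that the power series converges everywhere.\<close>
 define a where "a n = (\<integral>u. indicator {0<..} u * (u ^ n / fact n) \<partial>\<mu>)" for n :: nat
 have le: "indicator {0<..} u * (x ^ n * (u ^ n / fact n)) \<le> indicator {0<..} u * exp (x * u)" if "x \<ge> 0" for x u :: real and n
 proof (cases "u > 0")
  case True
  have "(x * u) ^ n / fact n \<le> exp (x * u)"
  proof -
   have "(\<Sum>k\<in>{n}. (x * u) ^ k /\<^sub>R fact k) \<le> exp (x * u)"
    unfolding exp_def using True that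
    by (intro sum_le_suminf summable_exp_generic) (auto simp: zero_le_mult_iff)
   thus ?thesis by (simp add: field_simps)
  qed
  with True show ?thesis by (simp add: power_mult_distrib)
 qed auto
 have inta: "integrable \<mu> (\<lambda>u. indicator {0<..} u * (u ^ n / fact n))" for n
  by (rule Bochner_Integration.integrable_bound[OF intexp[of 1]])
    (use le[of 1] in \<open>auto intro!: AE_I2 simp: indicator_def\<close>)
 have sums: "(\<lambda>n. complex_of_real (a n) * s ^ n) sums E s" for s
 proof -
  define f where "f n u = (indicator {0<..} u * (u ^ n / fact n)) *\<^sub>R s ^ n" for n and u :: real
  have intf: "integrable \<mu> (f n)" for n
   unfolding f_def using inta[of n] by (rule integrable_scaleR_left)
  have normf: "norm (f n u) = indicator {0<..} u * (u ^ n / fact n) * norm s ^ n" for n u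
   by (auto simp: f_def norm_power indicator_def)
  have sumf: "(\<lambda>n. norm (f n u)) sums (indicator {0<..} u * exp (norm s * u))" for u
  proof -
   have "(\<lambda>n. indicator {0<..} u * ((norm s * u) ^ n /\<^sub>R fact n)) sums (indicator {0<..} u * exp (norm s * u))"
    by (intro sums_mult exp_converges)
   thus ?thesis by (simp add: normf power_mult_distrib field_simps)
  qed
  have "(\<lambda>N. \<integral>u. (\<Sum>n<N. f n u) \<partial>\<mu>) \<longlonglongrightarrow> E s"
   unfolding E_def
  proof (rule integral_dominated_convergence[where w = "\<lambda>u. indicator {0<..} u * exp (norm s * u)"])
   have f: "f n u = indicator {0<..} u *\<^sub>R ((s * complex_of_real u) ^ n /\<^sub>R fact n)" for n u
    by (auto simp: f_def power_mult_distrib scaleR_conv_of_real field_simps)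
   show "AE u in \<mu>. (\<lambda>N. \<Sum>n<N. f n u) \<longlonglongrightarrow> indicator {0<..} u *\<^sub>R exp (s * complex_of_real u)"
    using exp_converges unfolding f sums_def[symmetric] by (intro AE_I2 sums_scaleR_right) auto
   show "AE u in \<mu>. norm (\<Sum>n<N. f n u) \<le> indicator {0<..} u * exp (norm s * u)" for N
   proof (intro AE_I2 order_trans[OF norm_sum])
    fix u
    have "(\<Sum>n<N. norm (f n u)) \<le> (\<Sum>n. norm (f n u))"
     using sumf[of u] by (intro sum_le_suminf) (auto simp: sums_iff)
    thus "(\<Sum>n<N. norm (f n u)) \<le> indicator {0<..} u * exp (norm s * u)"
     using sumf[of u] by (simp add: sums_iff)
   qed
  qed (use intf intexp in auto)
  moreover have "(\<integral>u. (\<Sum>n<N. f n u) \<partial>\<mu>) = (\<Sum>n<N. complex_of_real (a n) * s ^ n)" for N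
   unfolding Bochner_Integration.integral_sum[OF intf] unfolding f_def a_def integral_scaleR_left[OF inta]
   by (simp only: scaleR_conv_of_real)
  ultimately show ?thesis by (simp add: sums_def)
 qed
 show "E holomorphic_on UNIV"
 proof -
  have "E holomorphic_on ball 0 r" for r
   by (rule power_series_holomorphic[where a = "\<lambda>n. complex_of_real (a n)"]) (use sums in auto)
  hence "E holomorphic_on (\<Union>r. ball 0 r)" by (intro holomorphic_on_UN_open) auto
  also have "(\<Union>r. ball 0 r) = (UNIV :: complex set)"
  proof (intro equalityI subsetI)
   show "z \<in> (\<Union>r. ball 0 r)" for z :: complex by (intro UN_I[of "norm z + 1"]) auto
  qed auto
  finally show ?thesis .
 qed
 show "norm (E s) \<le> enn2real (\<integral>\<^sup>+u. ennreal (exp (Re s * u)) * indicator {0<..} u \<partial>\<mu>)" for s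
 proof -
  have "norm (E s) \<le> (\<integral>u. norm (indicator {0<..} u *\<^sub>R exp (s * complex_of_real u)) \<partial>\<mu>)"
   unfolding E_def by (rule integral_norm_bound)
  also have "\<dots> = (\<integral>u. indicator {0<..} u * exp (Re s * u) \<partial>\<mu>)"
   by (intro Bochner_Integration.integral_cong) auto
  also have "\<dots> = enn2real (\<integral>\<^sup>+u. ennreal (indicator {0<..} u * exp (Re s * u)) \<partial>\<mu>)"
   by (rule integral_eq_nn_integral) auto
  finally show ?thesis by (simp add: ennreal_mult' ennreal_indicator mult_ac)
 qed
 show "E (of_real x) = of_real (enn2real (\<integral>\<^sup>+u. ennreal (exp (x * u)) * indicator {0<..} u \<partial>\<mu>))" for x
 proof -
  have "E (of_real x) = (\<integral>u. complex_of_real (indicator {0<..} u * exp (x * u)) \<partial>\<mu>)"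
   unfolding E_def by (intro Bochner_Integration.integral_cong) (auto simp: scaleR_conv_of_real exp_of_real[symmetric])
  also have "\<dots> = of_real (\<integral>u. indicator {0<..} u * exp (x * u) \<partial>\<mu>)"
   by (rule integral_complex_of_real)
  also have "(\<integral>u. indicator {0<..} u * exp (x * u) \<partial>\<mu>) = enn2real (\<integral>\<^sup>+u. ennreal (indicator {0<..} u * exp (x * u)) \<partial>\<mu>)"
   by (rule integral_eq_nn_integral) auto
  finally show ?thesis by (simp add: ennreal_mult' ennreal_indicator mult_ac)
 qed
qed

lemma nn_integral_exp_negative_axis:
 assumes "c > 0"
 shows "(\<integral>\<^sup>+u. ennreal (exp (c * u)) * indicator {..<0} u \<partial>lborel) = ennreal (1 / c)"
proof -
 have "(\<integral>\<^sup>+u. ennreal (exp (c * u)) * indicator {..<0} u \<partial>lborel) = (\<integral>\<^sup>+u. ennreal (exp (- c * u)) * indicator {0<..} u \<partial>lborel)"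
  by (subst nn_integral_real_affine[where c = "-1" and t = 0]) (auto intro!: nn_integral_cong split: split_indicator)
 also have "\<dots> = (\<integral>\<^sup>+u. ennreal (exp (- c * u)) * indicator {0..} u \<partial>lborel)"
  by (intro nn_integral_cong_AE, rule AE_mp[OF AE_lborel_singleton[of 0]]) (auto simp: indicator_def)
 also have "\<dots> = ennreal (0 - (- exp (- c * 0) / c))"
 proof (rule nn_integral_FTC_atLeast)
  show "((\<lambda>x. - exp (- c * x) / c) has_real_derivative exp (- c * x)) (at x)" for x
   using assms by (auto intro!: derivative_eq_intros)
  have "((\<lambda>x. - exp (- c * x) / c) \<longlongrightarrow> - 0 / c) at_top"
   using assms by (intro tendsto_intros filterlim_compose[OF exp_at_bot] filterlim_tendsto_neg_mult_at_bot[OF tendsto_const] filterlim_ident) auto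
  thus "((\<lambda>x. - exp (- c * x) / c) \<longlongrightarrow> 0) at_top" by simp
 qed auto
 finally show ?thesis using assms by simp
qed

text \<open>Riemann's splitting at \<open>u = 0\<close>: the reflection turns the negative half of
  the transform at \<open>x\<close> into the positive half at \<open>1 - x\<close> and leaves
  \<open>v / (x - 1) - v / x\<close>. Multiplied by \<open>x * (x - 1)\<close> this is the constant
  \<open>v\<close>; the halves over \<open>u > 0\<close> are entire, and the resulting formula is
  visibly symmetric.\<close>

theorem mellin_continuation:
 fixes \<mu> :: "real measure" and v :: real
 assumes sets_mu [measurable_cong, simp]: "sets \<mu> = sets borel" and v: "v \<ge> 0"
  and fin: "\<And>x. x > 1 \<Longrightarrow> (\<integral>\<^sup>+u. ennreal (exp (x * u)) \<partial>\<mu>) < \<infinity>"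
  and refl: "\<And>h. h \<in> borel_measurable borel \<Longrightarrow>
    (\<integral>\<^sup>+u. h u * indicator {..<0} u \<partial>\<mu>) + ennreal v * (\<integral>\<^sup>+u. h u * indicator {..<0} u \<partial>lborel)
   = (\<integral>\<^sup>+u. h (- u) * ennreal (exp u) * indicator {0<..} u \<partial>\<mu>)
   + ennreal v * (\<integral>\<^sup>+u. h u * ennreal (exp (- u)) * indicator {..<0} u \<partial>lborel)"
 obtains \<Psi> :: "complex \<Rightarrow> complex" where
  "\<Psi> holomorphic_on UNIV" "\<And>s. \<Psi> (1 - s) = \<Psi> s" "\<Psi> 0 = of_real v"
  "\<And>x. x > 1 \<Longrightarrow> \<Psi> (of_real x) = complex_of_real (x * (x - 1) * enn2real (\<integral>\<^sup>+u. ennreal (exp (x * u)) \<partial>\<mu>))"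
  "\<And>s. norm (\<Psi> s) \<le> v + 3 * norm s * (norm s + 1) * enn2real (\<integral>\<^sup>+u. ennreal (exp ((2 + norm s) * u)) \<partial>\<mu>)"
proof -
 define B where "B x = (\<integral>\<^sup>+u. ennreal (exp (x * u)) * indicator {0<..} u \<partial>\<mu>)" for x :: real
 define L where "L x = (\<integral>\<^sup>+u. ennreal (exp (x * u)) \<partial>\<mu>)" for x :: real
 have BL: "B x \<le> L y" if "x \<le> y" for x y unfolding B_def L_def using that
  by (intro nn_integral_mono) (auto simp: indicator_def intro!: mult_right_mono)
 have L0: "emeasure \<mu> {0} \<le> L y" for y
 proof -
  have "emeasure \<mu> {0} = (\<integral>\<^sup>+u. indicator {0} u \<partial>\<mu>)" by simp
  also have "\<dots> \<le> L y"
   unfolding L_def by (intro nn_integral_mono) (auto simp: indicator_def)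
  finally show ?thesis .
 qed
 have Bfin: "B x < \<infinity>" for x
  using BL[of x "max x 2"] fin[of "max x 2"] unfolding L_def[symmetric] by (auto intro: le_less_trans)
 have finm: "emeasure \<mu> {0} < \<infinity>" using L0[of 2] fin[of 2] by (auto simp: L_def)
 \<comment> \<open>The point 0 is fixed by the reflection, so a possible atom there enters as a
   separate constant.\<close>
 define m where "m = enn2real (emeasure \<mu> {0})"
 define E where "E s = (\<integral>u. indicator {0<..} u *\<^sub>R exp (s * complex_of_real u) \<partial>\<mu>)" for s
 note lap = laplace_transform_entire[OF sets_mu, folded B_def, OF Bfin, folded E_def]
 have holE: "E holomorphic_on UNIV" using lap(1) by (simp add: E_def[abs_def])
 define \<Psi> where "\<Psi> s = of_real v + s * (s - 1) * (of_real m + E s + E (1 - s))" for s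
 have real_id: "enn2real (L x) + v / x = m + enn2real (B x) + enn2real (B (1 - x)) + v / (x - 1)" if x: "x > 1" for x
 proof -
  define A where "A = (\<integral>\<^sup>+u. ennreal (exp (x * u)) * indicator {..<0} u \<partial>\<mu>)"
  have "L x = (\<integral>\<^sup>+u. ennreal (exp (x * u)) * indicator {..<0} u + indicator {0} u + ennreal (exp (x * u)) * indicator {0<..} u \<partial>\<mu>)"
   unfolding L_def by (intro nn_integral_cong) (auto simp: indicator_def)
  also have "\<dots> = A + emeasure \<mu> {0} + B x" by (simp add: nn_integral_add A_def B_def)
  finally have L: "L x = A + emeasure \<mu> {0} + B x" .
  have "A + ennreal v * ennreal (1 / x) = B (1 - x) + ennreal v * ennreal (1 / (x - 1))"
  proof -
   have e1: "ennreal (exp (x * - u)) * ennreal (exp u) * indicator {0<..} u = ennreal (exp ((1 - x) * u)) * indicator {0<..} u" for u :: real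
    by (simp add: ennreal_mult[symmetric] exp_add[symmetric] algebra_simps)
   have e2: "ennreal (exp (x * u)) * ennreal (exp (- u)) * indicator {..<0::real} u = ennreal (exp ((x - 1) * u)) * indicator {..<0} u" for u :: real
    by (simp add: ennreal_mult[symmetric] exp_add[symmetric] algebra_simps)
   show ?thesis using refl[of "\<lambda>u. ennreal (exp (x * u))"] x unfolding e1 e2
    by (simp add: nn_integral_exp_negative_axis A_def B_def)
  qed
  moreover have "A < \<infinity>" using fin[OF x] unfolding L_def[symmetric] L by (auto simp: less_top)
  ultimately have "enn2real A + v / x = enn2real (B (1 - x)) + v / (x - 1)"
   using x v Bfin[of "1 - x"]
   by (cases A; cases "B (1 - x)") (auto simp: ennreal_mult[symmetric] ennreal_plus[symmetric] simp del: ennreal_plus)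
  moreover have "enn2real (L x) = enn2real A + m + enn2real (B x)"
   unfolding L m_def using \<open>A < \<infinity>\<close> finm Bfin[of x] by (simp add: enn2real_plus)
  ultimately show ?thesis by simp
 qed
 show ?thesis
 proof (rule that[of \<Psi>])
  show "\<Psi> holomorphic_on UNIV" unfolding \<Psi>_def
   by (intro holomorphic_intros holE holomorphic_on_compose_gen[of "\<lambda>s. 1 - s" UNIV E UNIV, unfolded o_def]) auto
  show "\<Psi> (1 - s) = \<Psi> s" for s by (simp add: \<Psi>_def algebra_simps)
  show "\<Psi> 0 = of_real v" by (simp add: \<Psi>_def)
  show "\<Psi> (of_real x) = complex_of_real (x * (x - 1) * enn2real (\<integral>\<^sup>+u. ennreal (exp (x * u)) \<partial>\<mu>))" if "x > 1" for x
  proof -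
   have "\<Psi> (of_real x) = of_real (v + x * (x - 1) * (m + enn2real (B x) + enn2real (B (1 - x))))"
    using lap(3)[of x] lap(3)[of "1 - x"] by (simp add: \<Psi>_def E_def)
   also have "v + x * (x - 1) * (m + enn2real (B x) + enn2real (B (1 - x))) = x * (x - 1) * enn2real (L x)"
   proof -
    have "m + enn2real (B x) + enn2real (B (1 - x)) = enn2real (L x) + v / x - v / (x - 1)"
     using real_id[OF that] by simp
    hence "x * (x - 1) * (m + enn2real (B x) + enn2real (B (1 - x))) = x * (x - 1) * enn2real (L x) + x * (x - 1) * (v / x - v / (x - 1))"
     by (simp only: add_diff_eq[symmetric] distrib_left)
    also have "x * (x - 1) * (v / x - v / (x - 1)) = - v" using that by (simp add: field_simps)
    finally show ?thesis by simp
   qed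
   finally show ?thesis by (simp add: L_def)
  qed
  show "norm (\<Psi> s) \<le> v + 3 * norm s * (norm s + 1) * enn2real (\<integral>\<^sup>+u. ennreal (exp ((2 + norm s) * u)) \<partial>\<mu>)" for s
  proof -
   \<comment> \<open>\<open>2 + norm s\<close> exceeds 1 and bounds the real parts of both
     \<open>s\<close> and \<open>1 - s\<close>, so one value dominates the atom and the two half
     transforms; hence the factor 3.\<close>
   let ?L = "enn2real (L (2 + norm s))"
   have Lfin: "L (2 + norm s) < \<infinity>" using fin[of "2 + norm s"] norm_ge_zero[of s] unfolding L_def by (simp add: add_pos_nonneg)
   have E: "norm (E z) \<le> ?L" if "Re z \<le> 2 + norm s" for z
   proof -
    have "norm (E z) \<le> enn2real (B (Re z))" using lap(2)[of z] by (simp add: E_def)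
    also have "\<dots> \<le> ?L" using BL[OF that] Lfin by (intro enn2real_mono) auto
    finally show ?thesis .
   qed
   have "norm (of_real m + E s + E (1 - s)) \<le> norm (complex_of_real m) + norm (E s) + norm (E (1 - s))"
    by (meson norm_triangle_ineq order_trans add_right_mono)
   also have "\<dots> \<le> ?L + ?L + ?L"
   proof (intro add_mono)
    show "norm (complex_of_real m) \<le> ?L"
     using L0[of "2 + norm s"] Lfin by (simp add: m_def enn2real_mono)
    show "norm (E s) \<le> ?L" using complex_Re_le_cmod[of s] by (intro E) auto
    show "norm (E (1 - s)) \<le> ?L" using abs_Re_le_cmod[of s] by (intro E) auto
   qed
   finally have 1: "norm (of_real m + E s + E (1 - s)) \<le> 3 * ?L" by simp
   have 2: "norm (s * (s - 1)) \<le> norm s * (norm s + 1)"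
    unfolding norm_mult using norm_triangle_ineq4[of s 1] by (intro mult_left_mono) auto
   have "norm (\<Psi> s) \<le> v + norm (s * (s - 1) * (of_real m + E s + E (1 - s)))"
    unfolding \<Psi>_def using norm_triangle_ineq[of "complex_of_real v"] v by (smt (verit) norm_of_real)
   also have "\<dots> \<le> v + (norm s * (norm s + 1)) * (3 * ?L)"
    unfolding norm_mult[of "s * (s - 1)"] by (intro add_left_mono mult_mono 1 2) auto
   finally show ?thesis by (simp add: L_def algebra_simps)
  qed
 qed
qed

section \<open>Number fields\<close>

subsection \<open>Algebraic integers\<close>

interpretation Zmod: Modules.module "\<lambda>(k::int) (x::complex). of_int k * x"
 by standard (auto simp: algebra_simps)

interpretation Qvs: Vector_Spaces.vector_space "\<lambda>(q::rat) (x::complex). of_rat q * x"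
 by standard (auto simp: algebra_simps of_rat_add of_rat_mult)

lemma algebraic_integer_iff: "algebraic_integer x \<longleftrightarrow> algebraic_int x"
 unfolding algebraic_integer_def algebraic_int_altdef_ipoly by auto

text \<open>The determinant trick: the elements of \<open>S\<close> form an eigenvector, for the
  eigenvalue \<open>x\<close>, of an integral matrix, whose characteristic polynomial is monic and
  integral.\<close>

lemma algebraic_integer_if_stable:
 assumes S: "finite S" "s0 \<in> S" "s0 \<noteq> 0" and stable: "\<And>s. s \<in> S \<Longrightarrow> x * s \<in> Zmod.span S"
 shows "algebraic_integer x"
proof -
 obtain ss where ss: "set ss = S" "distinct ss" using finite_distinct_list[OF S(1)] by auto
 define n where "n = length ss"
 have "\<exists>c :: complex \<Rightarrow> int. x * s = (\<Sum>t\<in>S. of_int (c t) * t)" if "s \<in> S" for s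
  using stable[OF that] unfolding Zmod.span_finite[OF S(1)] by auto
 then obtain c :: "complex \<Rightarrow> complex \<Rightarrow> int" where c: "\<And>s. s \<in> S \<Longrightarrow> x * s = (\<Sum>t\<in>S. of_int (c s t) * t)"
  by metis
 define A where "A = mat n n (\<lambda>(i, j). c (ss ! i) (ss ! j))"
 have A: "A \<in> carrier_mat n n" by (simp add: A_def)
 let ?A = "map_mat complex_of_int A"
 have A': "?A \<in> carrier_mat n n" using A by simp
 define v where "v = vec n (\<lambda>i. ss ! i)"
 obtain i0 where i0: "i0 < n" "ss ! i0 = s0" using S(2) ss(1) unfolding n_def by (metis in_set_conv_nth)
 have "eigenvector ?A v x" unfolding eigenvector_def
 proof (intro conjI)
  show "v \<in> carrier_vec (dim_row ?A)" using A by (simp add: v_def)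
  show "v \<noteq> 0\<^sub>v (dim_row ?A)"
  proof
   assume "v = 0\<^sub>v (dim_row ?A)"
   hence "vec_index v i0 = 0" using i0 A by simp
   thus False using i0 S(3) by (simp add: v_def)
  qed
  show "?A *\<^sub>v v = x \<cdot>\<^sub>v v"
  proof (rule eq_vecI)
   show "dim_vec (?A *\<^sub>v v) = dim_vec (x \<cdot>\<^sub>v v)" using A by (simp add: v_def)
   fix i assume "i < dim_vec (x \<cdot>\<^sub>v v)"
   hence i: "i < n" by (simp add: v_def)
   have "vec_index (?A *\<^sub>v v) i = (\<Sum>j<n. of_int (c (ss ! i) (ss ! j)) * ss ! j)"
    using i by (simp add: A_def v_def scalar_prod_def lessThan_atLeast0)
   also have "\<dots> = (\<Sum>t\<in>S. of_int (c (ss ! i) t) * t)"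
    by (rule sum.reindex_bij_betw) (use ss in \<open>auto simp: n_def intro: bij_betw_nth\<close>)
   also have "\<dots> = x * ss ! i" using i ss by (subst c) (auto simp: n_def)
   finally show "vec_index (?A *\<^sub>v v) i = vec_index (x \<cdot>\<^sub>v v) i" using i by (simp add: v_def)
  qed
 qed
 hence "poly (char_poly ?A) x = 0"
  using eigenvalue_root_char_poly[OF A'] by (auto simp: eigenvalue_def)
 moreover have "char_poly ?A = map_poly of_int (char_poly A)"
  by (rule of_int_hom.char_poly_hom[OF A])
 moreover have "lead_coeff (char_poly A) = 1" using degree_monic_char_poly[OF A] by simp
 ultimately show ?thesis unfolding algebraic_integer_def by metis
qed

lemma Zspan_mult_closed:
 assumes "\<And>s. s \<in> S \<Longrightarrow> x * s \<in> Zmod.span S" and "y \<in> Zmod.span S"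
 shows "x * y \<in> Zmod.span S" using assms(2)
proof (induction rule: Zmod.span_induct_alt)
 case base
 thus ?case by (simp add: Zmod.span_zero)
next
 case (step c z y)
 have "x * (of_int c * z + y) = of_int c * (x * z) + x * y" by (simp add: algebra_simps)
 thus ?case using step assms(1) by (simp add: Zmod.span_add Zmod.span_scale)
qed

lemma algebraic_integer_power_span:
 assumes "algebraic_integer x"
 obtains a where "a > 0" "x ^ a \<in> Zmod.span ((\<lambda>i. x ^ i) ` {..<a})"
proof -
 obtain p :: "int poly" where p: "lead_coeff p = 1" "poly (map_poly of_int p) x = 0"
  using assms by (auto simp: algebraic_integer_def)
 define a where "a = degree p"
 have "a > 0"
 proof (rule ccontr)
  assume "\<not> a > 0"
  then obtain c where "p = [:c:]" by (metis a_def degree_eq_zeroE gr0I)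
  thus False using p by simp
 qed
 have "0 = (\<Sum>i\<le>a. of_int (coeff p i) * x ^ i)"
  using p(2) unfolding poly_altdef a_def by simp
 also have "\<dots> = (\<Sum>i<a. of_int (coeff p i) * x ^ i) + x ^ a"
  using p(1) by (simp add: a_def lessThan_Suc_atMost[symmetric])
 finally have "x ^ a = (\<Sum>i<a. of_int (- coeff p i) * x ^ i)"
  by (simp add: sum_negf eq_neg_iff_add_eq_0 add.commute)
 also have "\<dots> \<in> Zmod.span ((\<lambda>i. x ^ i) ` {..<a})"
  by (intro Zmod.span_sum Zmod.span_scale Zmod.span_base) auto
 finally show ?thesis using that \<open>a > 0\<close> by blast
qed

text \<open>The monomials \<open>x ^ i * y ^ j\<close> below the two degrees span a finitely
  generated module stable under \<open>x\<close> and under \<open>y\<close>, hence under sum and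
  product.\<close>

lemma algebraic_integer_add_mult:
 assumes "algebraic_integer x" "algebraic_integer y"
 shows "algebraic_integer (x + y)" "algebraic_integer (x * y)"
proof -
 obtain a where a: "a > 0" "x ^ a \<in> Zmod.span ((\<lambda>i. x ^ i) ` {..<a})"
  using algebraic_integer_power_span[OF assms(1)] .
 obtain b where b: "b > 0" "y ^ b \<in> Zmod.span ((\<lambda>i. y ^ i) ` {..<b})"
  using algebraic_integer_power_span[OF assms(2)] .
 define S where "S = (\<lambda>(i, j). x ^ i * y ^ j) ` ({..<a} \<times> {..<b})"
 have "1 \<in> S" unfolding S_def by (rule image_eqI[of _ _ "(0, 0)"]) (use a b in auto)
 hence S: "finite S" "1 \<in> S" by (auto simp: S_def)
 have memS: "x ^ i * y ^ j \<in> Zmod.span S" if "i < a" "j < b" for i j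
  using that by (intro Zmod.span_base) (auto simp: S_def)
 have mono: "z * w \<in> Zmod.span S" if w: "w \<in> Zmod.span B" and B: "\<And>v. v \<in> B \<Longrightarrow> z * v \<in> Zmod.span S" for z w B
  using w
 proof (induction rule: Zmod.span_induct_alt)
  case base
  thus ?case by (simp add: Zmod.span_zero)
 next
  case (step c v w)
  have "z * (of_int c * v + w) = of_int c * (z * v) + z * w" by (simp add: algebra_simps)
  thus ?case using step B by (simp add: Zmod.span_add Zmod.span_scale)
 qed
 have xS: "x * s \<in> Zmod.span S" if "s \<in> S" for s
 proof -
  from that obtain i j where ij: "s = x ^ i * y ^ j" "i < a" "j < b" by (auto simp: S_def)
  show ?thesis
  proof (cases "Suc i < a")
   case True
   thus ?thesis using memS[of "Suc i" j] ij by (simp add: mult_ac)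
  next
   case False
   hence "x * s = y ^ j * x ^ a" using ij by (simp add: mult_ac flip: power_Suc) (metis Suc_lessI mult.commute)
   also have "\<dots> \<in> Zmod.span S"
    by (rule mono[OF a(2)]) (use memS ij in \<open>auto simp: mult.commute\<close>)
   finally show ?thesis .
  qed
 qed
 have yS: "y * s \<in> Zmod.span S" if "s \<in> S" for s
 proof -
  from that obtain i j where ij: "s = x ^ i * y ^ j" "i < a" "j < b" by (auto simp: S_def)
  show ?thesis
  proof (cases "Suc j < b")
   case True
   thus ?thesis using memS[of i "Suc j"] ij by (simp add: mult_ac)
  next
   case False
   hence "Suc j = b" using ij by simp
   hence "y * s = x ^ i * y ^ b" using ij by (auto simp: mult_ac)
   also have "\<dots> \<in> Zmod.span S" by (rule mono[OF b(2)]) (use memS ij in auto)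
   finally show ?thesis .
  qed
 qed
 show "algebraic_integer (x + y)"
 proof (rule algebraic_integer_if_stable[OF S])
  show "(x + y) * s \<in> Zmod.span S" if "s \<in> S" for s
   using xS[OF that] yS[OF that] by (simp add: distrib_right Zmod.span_add)
 qed auto
 show "algebraic_integer (x * y)"
 proof (rule algebraic_integer_if_stable[OF S])
  show "(x * y) * s \<in> Zmod.span S" if "s \<in> S" for s
   using Zspan_mult_closed[OF xS yS[OF that]] by (simp add: mult.assoc)
 qed auto
qed

lemma algebraic_integer_uminus: "algebraic_integer x \<Longrightarrow> algebraic_integer (- x)"
 by (simp add: algebraic_integer_iff)

lemma algebraic_integer_of_int [simp]: "algebraic_integer (of_int k)"
 by (simp add: algebraic_integer_iff int_imp_algebraic_int)

lemma algebraic_integer_sum: "(\<And>i. i \<in> I \<Longrightarrow> algebraic_integer (f i)) \<Longrightarrow> algebraic_integer (\<Sum>i\<in>I. f i)"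
 by (induction I rule: infinite_finite_induct)
   (auto intro: algebraic_integer_add_mult simp: algebraic_integer_of_int[of 0, simplified])

lemma algebraic_integer_of_rat: "algebraic_integer (of_rat q) \<Longrightarrow> q \<in> \<int>"
proof -
 assume "algebraic_integer (of_rat q)"
 hence "(of_rat q :: complex) \<in> \<int>"
  using rational_algebraic_int_is_int[of "of_rat q :: complex"] by (simp add: algebraic_integer_iff)
 thus "q \<in> \<int>" by (metis Ints_cases Ints_of_int of_rat_eq_iff of_rat_of_int_eq)
qed

subsection \<open>Primitive elements\<close>

abbreviation qpoly :: "rat poly \<Rightarrow> complex poly" where
 "qpoly p \<equiv> map_poly of_rat p"

abbreviation qeval :: "rat poly \<Rightarrow> complex \<Rightarrow> complex" where
 "qeval p x \<equiv> poly (qpoly p) x"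

interpretation qpoly_hom: map_poly_comm_ring_hom "of_rat :: rat \<Rightarrow> complex" ..

lemma qeval_simps [simp]:
 "qeval (p + q) x = qeval p x + qeval q x" "qeval (p * q) x = qeval p x * qeval q x"
 "qeval (p - q) x = qeval p x - qeval q x" "qeval (- p) x = - qeval p x"
 "qeval (Polynomial.smult c p) x = of_rat c * qeval p x"
 by (simp_all add: hom_distribs qpoly_hom.hom_mult qpoly_hom.hom_minus qpoly_hom.hom_uminus)

definition adjoin :: "complex \<Rightarrow> complex set" where
 "adjoin x = range (\<lambda>p. qeval p x)"

definition algebraic_over_Q :: "complex \<Rightarrow> bool" where
 "algebraic_over_Q x \<longleftrightarrow> (\<exists>p. p \<noteq> 0 \<and> qeval p x = 0)"

definition is_min_poly :: "rat poly \<Rightarrow> complex \<Rightarrow> bool" where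
 "is_min_poly p x \<longleftrightarrow> lead_coeff p = 1 \<and> qeval p x = 0 \<and> (\<forall>q. qeval q x = 0 \<longrightarrow> p dvd q)"

lemma ex_min_poly:
 assumes "algebraic_over_Q x"
 obtains p where "is_min_poly p x"
proof -
 define d where "d = (LEAST d. \<exists>p. p \<noteq> 0 \<and> qeval p x = 0 \<and> degree p = d)"
 have "\<exists>p. p \<noteq> 0 \<and> qeval p x = 0 \<and> degree p = d"
  unfolding d_def by (rule LeastI_ex) (use assms in \<open>auto simp: algebraic_over_Q_def\<close>)
 then obtain p where p: "p \<noteq> 0" "qeval p x = 0" "degree p = d" by blast
 have least: "d \<le> degree q" if "q \<noteq> 0" "qeval q x = 0" for q
  unfolding d_def using that by (intro Least_le) auto
 define P where "P = Polynomial.smult (1 / lead_coeff p) p"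
 have P: "lead_coeff P = 1" "qeval P x = 0" "degree P = d" using p by (auto simp: P_def)
 have "P dvd q" if "qeval q x = 0" for q
 proof -
  have "qeval (q mod P) x = qeval (q - (q div P) * P) x" by (simp add: minus_div_mult_eq_mod)
  also have "\<dots> = 0" using that P by simp
  finally have "q mod P = 0"
   using least[of "q mod P"] degree_mod_less[of P q] P by (metis leD leading_coeff_0_iff zero_neq_one)
  thus ?thesis by auto
 qed
 thus ?thesis using that P unfolding is_min_poly_def by blast
qed

text \<open>A common root of \<open>p\<close> and its derivative is a root of their gcd, which has
  smaller degree than \<open>p\<close>. As \<open>x\<close> is a root of this gcd or of its
  cofactor, minimality of \<open>p\<close> is violated in either case. The claim covers all roots
  because the conjugates are counted with it.\<close>

lemma min_poly_separable:
 assumes p: "is_min_poly p x" and r: "qeval p r = 0"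
 shows "qeval (pderiv p) r \<noteq> 0"
proof
 assume r': "qeval (pderiv p) r = 0"
 have p0: "p \<noteq> 0" using p by (auto simp: is_min_poly_def)
 have deg: "degree p > 0"
 proof (rule ccontr)
  assume "\<not> degree p > 0"
  then obtain c where "p = [:c:]" by (metis degree_eq_zeroE gr0I)
  with p show False by (auto simp: is_min_poly_def)
 qed
 define d where "d = gcd p (pderiv p)"
 have pd0: "pderiv p \<noteq> 0" using deg by (simp add: pderiv_eq_0_iff)
 obtain u v where "u * p + v * pderiv p = d"
  unfolding d_def using bezout_coefficients_fst_snd by blast
 hence dr: "qeval d r = 0" using r r' by (metis add.right_neutral mult_zero_right qeval_simps(1,2))
 obtain e where e: "p = d * e" unfolding d_def by (metis dvdE gcd_dvd1)
 have d0: "d \<noteq> 0" using p0 e by auto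
 have "degree d \<le> degree (pderiv p)" unfolding d_def using pd0 by (intro dvd_imp_degree_le) auto
 also have "\<dots> < degree p" using deg by (simp add: degree_pderiv)
 finally have dd: "degree d < degree p" .
 have "qeval d x * qeval e x = 0" using p unfolding is_min_poly_def e by simp
 then consider "qeval d x = 0" | "qeval e x = 0" by auto
 thus False
 proof cases
  case 1
  hence "p dvd d" using p by (auto simp: is_min_poly_def)
  thus False using dd d0 by (meson dvd_imp_degree_le leD)
 next
  case 2
  hence "p dvd e" using p by (auto simp: is_min_poly_def)
  moreover have "e \<noteq> 0" using p0 e by auto
  ultimately have "degree p \<le> degree e" by (rule dvd_imp_degree_le)
  moreover have "degree p = degree d + degree e" using e d0 \<open>e \<noteq> 0\<close> by (simp add: degree_mult_eq)
  ultimately have "degree d = 0" by simp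
  then obtain c where "d = [:c:]" by (metis degree_eq_zeroE)
  thus False using dr d0 by simp
 qed
qed

text \<open>Inverses come from Bezout: if \<open>h\<close> does not vanish at \<open>x\<close>,
  neither does \<open>d = gcd p h\<close>, so the cofactor of \<open>d\<close> in \<open>p\<close>
  vanishes at \<open>x\<close>, is divisible by \<open>p\<close>, and \<open>d\<close> is
  constant.\<close>

lemma adjoin_subfield:
 assumes x: "algebraic_over_Q x"
 shows "is_complex_subfield (adjoin x)"
proof -
 obtain p where p: "is_min_poly p x" using ex_min_poly[OF x] .
 have "\<exists>q. inverse (qeval h x) = qeval q x" if h: "qeval h x \<noteq> 0" for h
 proof -
  define d where "d = gcd p h"
  obtain u v where uv: "u * p + v * h = d"
   unfolding d_def using bezout_coefficients_fst_snd by blast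
  obtain e where e: "p = d * e" unfolding d_def by (metis dvdE gcd_dvd1)
  obtain f where f: "h = d * f" unfolding d_def by (metis dvdE gcd_dvd2)
  have dx: "qeval d x \<noteq> 0" using h f by auto
  hence "qeval e x = 0" using p e by (auto simp: is_min_poly_def)
  hence "p dvd e" using p by (auto simp: is_min_poly_def)
  moreover have "e dvd p" using e by simp
  moreover have p0: "p \<noteq> 0" using p by (auto simp: is_min_poly_def)
  ultimately have "degree e = degree p" by (metis dvd_0_left_iff dvd_imp_degree_le order_antisym)
  hence "degree d = 0" using e p0 by (metis add_cancel_left_left degree_mult_eq mult_eq_0_iff)
  then obtain c where c: "d = [:c:]" by (metis degree_eq_zeroE)
  have c0: "c \<noteq> 0" using dx c by auto
  have "qeval v x * qeval h x = qeval d x" using uv p by (auto simp: is_min_poly_def simp flip: uv)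
  hence "inverse (qeval h x) = qeval (Polynomial.smult (1 / c) v) x"
   using c c0 h by (simp add: field_simps of_rat_divide)
  thus ?thesis by blast
 qed
 note inv = this
 show ?thesis unfolding is_complex_subfield_def
 proof (intro conjI ballI impI)
  show "0 \<in> adjoin x" unfolding adjoin_def by (rule range_eqI[of _ _ 0]) simp
  show "1 \<in> adjoin x" unfolding adjoin_def by (rule range_eqI[of _ _ 1]) simp
  fix a assume "a \<in> adjoin x"
  then obtain p where p: "a = qeval p x" by (auto simp: adjoin_def)
  show "- a \<in> adjoin x" unfolding adjoin_def by (rule range_eqI[of _ _ "- p"]) (simp add: p)
  show "inverse a \<in> adjoin x" if "a \<noteq> 0" using inv[of p] that by (auto simp: adjoin_def p)
  fix b assume "b \<in> adjoin x"
  then obtain q where q: "b = qeval q x" by (auto simp: adjoin_def)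
  show "a + b \<in> adjoin x" unfolding adjoin_def by (rule range_eqI[of _ _ "p + q"]) (simp add: p q)
  show "a * b \<in> adjoin x" unfolding adjoin_def by (rule range_eqI[of _ _ "p * q"]) (simp add: p q)
 qed
qed

definition poly_over :: "complex set \<Rightarrow> complex poly set" where
 "poly_over F = {p. \<forall>i. coeff p i \<in> F}"

context
 fixes F :: "complex set"
 assumes F: "is_complex_subfield F"
begin

lemma subfield_closed:
 "0 \<in> F" "1 \<in> F" "x \<in> F \<Longrightarrow> y \<in> F \<Longrightarrow> x + y \<in> F" "x \<in> F \<Longrightarrow> y \<in> F \<Longrightarrow> x * y \<in> F"
 "x \<in> F \<Longrightarrow> - x \<in> F" "x \<in> F \<Longrightarrow> y \<in> F \<Longrightarrow> x - y \<in> F" "x \<in> F \<Longrightarrow> inverse x \<in> F"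
 "x \<in> F \<Longrightarrow> y \<in> F \<Longrightarrow> x / y \<in> F"
proof -
 show *: "0 \<in> F" "1 \<in> F" "x \<in> F \<Longrightarrow> y \<in> F \<Longrightarrow> x + y \<in> F" "x \<in> F \<Longrightarrow> y \<in> F \<Longrightarrow> x * y \<in> F"
 "x \<in> F \<Longrightarrow> - x \<in> F" for x y using F by (auto simp: is_complex_subfield_def)
 show "x \<in> F \<Longrightarrow> y \<in> F \<Longrightarrow> x - y \<in> F" for x y using *(3)[of x "- y"] *(5)[of y] by simp
 show i: "x \<in> F \<Longrightarrow> inverse x \<in> F" for x using F by (cases "x = 0") (auto simp: is_complex_subfield_def)
 show "x \<in> F \<Longrightarrow> y \<in> F \<Longrightarrow> x / y \<in> F" for x y using *(4)[of x "inverse y"] i[of y] by (simp add: field_simps)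
qed

lemma subfield_sum: "(\<And>i. i \<in> I \<Longrightarrow> f i \<in> F) \<Longrightarrow> (\<Sum>i\<in>I. f i) \<in> F"
 by (induction I rule: infinite_finite_induct) (auto intro: subfield_closed)

lemma subfield_power: "x \<in> F \<Longrightarrow> x ^ k \<in> F"
 by (induction k) (auto intro: subfield_closed)

lemma subfield_of_nat: "of_nat k \<in> F" by (induction k) (auto intro: subfield_closed)

lemma subfield_of_int: "of_int k \<in> F"
 by (cases k) (auto intro!: subfield_closed(5) subfield_of_nat simp: simp del: of_nat_Suc)

lemma subfield_of_rat: "of_rat q \<in> F"
 by (cases q) (auto simp: of_rat_rat intro!: subfield_closed(8) subfield_of_int)

lemma subfield_qeval: "x \<in> F \<Longrightarrow> qeval p x \<in> F"
 unfolding poly_altdef by (auto intro!: subfield_sum subfield_closed(4) subfield_power subfield_of_rat)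

lemma poly_over_closed:
 "p \<in> poly_over F \<Longrightarrow> q \<in> poly_over F \<Longrightarrow> p - q \<in> poly_over F"
 "p \<in> poly_over F \<Longrightarrow> q \<in> poly_over F \<Longrightarrow> p + q \<in> poly_over F"
 "p \<in> poly_over F \<Longrightarrow> q \<in> poly_over F \<Longrightarrow> p * q \<in> poly_over F"
 "c \<in> F \<Longrightarrow> monom c k \<in> poly_over F" "c \<in> F \<Longrightarrow> p \<in> poly_over F \<Longrightarrow> pCons c p \<in> poly_over F"
 "0 \<in> poly_over F" "qpoly g \<in> poly_over F" "c \<in> F \<Longrightarrow> p \<in> poly_over F \<Longrightarrow> Polynomial.smult c p \<in> poly_over F"
 by (auto simp: poly_over_def coeff_mult coeff_pCons split: nat.splits intro!: subfield_closed subfield_sum subfield_of_rat)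

text \<open>The subfield is a set, not a type, so the usual division is repeated to see that the
  remainder keeps its coefficients in \<open>F\<close>; with a monic divisor each step only uses
  ring operations on coefficients.\<close>

lemma poly_over_division:
 assumes m: "m \<in> poly_over F" "lead_coeff m = 1"
 shows "h \<in> poly_over F \<Longrightarrow> \<exists>q r. h = q * m + r \<and> r \<in> poly_over F \<and> (r = 0 \<or> degree r < degree m)"
proof (induction "degree h" arbitrary: h rule: less_induct)
 case less
 show ?case
 proof (cases "h = 0 \<or> degree h < degree m")
  case True
  thus ?thesis using less.prems by - (rule exI[of _ "0 :: complex poly"], rule exI[of _ h], auto simp: poly_over_def subfield_closed)
 next
  case False
  define t where "t = monom (lead_coeff h) (degree h - degree m)"
  define h' where "h' = h - t * m"
  have h0: "h \<noteq> 0" "degree m \<le> degree h" using False by auto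
  have m0: "m \<noteq> 0" using m by auto
  have t0: "t \<noteq> 0" using h0 by (simp add: t_def)
  have tF: "t \<in> poly_over F" unfolding t_def using less.prems by (intro poly_over_closed) (auto simp: poly_over_def)
  have h'F: "h' \<in> poly_over F" unfolding h'_def by (intro poly_over_closed less.prems tF m)
  have dt: "degree (t * m) = degree h" using t0 m0 h0 by (simp add: degree_mult_eq t_def degree_monom_eq)
  have lt: "lead_coeff (t * m) = lead_coeff h" using m by (simp only: lead_coeff_mult t_def lead_coeff_monom) simp
  show ?thesis
  proof (cases "h' = 0")
   case True
   thus ?thesis by - (rule exI[of _ t], rule exI[of _ "0 :: complex poly"], auto simp: h'_def poly_over_closed(6))
  next
   case False
   have "degree h' < degree h"
   proof -
    have "degree h' \<le> degree h" unfolding h'_def using dt by (intro degree_diff_le) auto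
    moreover have "coeff h' (degree h) = 0" unfolding h'_def using lt dt by simp
    ultimately show ?thesis using False by (metis le_neq_implies_less leading_coeff_0_iff)
   qed
   from less.hyps[OF this h'F] obtain q r where "h' = q * m + r" "r \<in> poly_over F" "r = 0 \<or> degree r < degree m" by blast
   thus ?thesis by - (rule exI[of _ "q + t"], rule exI[of _ r], auto simp: h'_def algebra_simps)
  qed
 qed
qed

end

text \<open>For all but finitely many \<open>c\<close>, the polynomials \<open>g z\<close> and
  \<open>f (t - c * z)\<close>, where \<open>t = x + c * y\<close>, have only the root
  \<open>y\<close> in common. The conclusion is conditional on \<open>t\<close> being algebraic,
  which is automatic inside a number field.\<close>

lemma primitive_element_pair:
 assumes x: "algebraic_over_Q x" and y: "algebraic_over_Q y"
 obtains c :: nat where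
  "algebraic_over_Q (x + of_nat c * y) \<Longrightarrow> x \<in> adjoin (x + of_nat c * y) \<and> y \<in> adjoin (x + of_nat c * y)"
proof -
 obtain f where f: "is_min_poly f x" using ex_min_poly[OF x] .
 obtain g where g: "is_min_poly g y" using ex_min_poly[OF y] .
 have f0: "qpoly f \<noteq> 0" and g0: "qpoly g \<noteq> 0" using f g by (auto simp: is_min_poly_def)
 \<comment> \<open>The values of \<open>c\<close> for which a second common root could occur. Pairs
   with \<open>y' = y\<close> contribute only 0, by the convention for division by zero, so
   \<open>c = 0\<close> is excluded too.\<close>
 define bad where "bad = (\<lambda>(x', y'). (x' - x) / (y - y')) ` ({z. qeval f z = 0} \<times> {z. qeval g z = 0})"
 have "finite bad" unfolding bad_def using poly_roots_finite[OF f0] poly_roots_finite[OF g0] by auto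
 hence "finite ((of_nat :: nat \<Rightarrow> complex) -` bad)" by (rule finite_vimageI) (simp add: inj_on_def)
 then obtain c :: nat where c: "of_nat c \<notin> bad" using ex_new_if_finite[OF infinite_UNIV_nat] by (metis vimageI)
 show ?thesis
 proof (rule that[of c])
  define t where "t = x + of_nat c * y"
  assume "algebraic_over_Q (x + of_nat c * y)"
  hence F: "is_complex_subfield (adjoin t)" unfolding t_def by (rule adjoin_subfield)
  let ?F = "adjoin t"
  have tF: "t \<in> ?F" unfolding adjoin_def by (rule range_eqI[of _ _ "[:0, 1:]"]) simp
  \<comment> \<open>The polynomial \<open>f (t - c * z)\<close> in \<open>z\<close>: its
    coefficients lie in the field generated by \<open>t\<close>, and \<open>y\<close> is a
    root.\<close>
  define h where "h = pcompose (qpoly f) [:t, - of_nat c:]"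
  have hF: "h \<in> poly_over ?F"
  proof -
   have tmF: "[:t, - of_nat c:] \<in> poly_over ?F"
    by (intro poly_over_closed[OF F] tF subfield_closed[OF F] subfield_of_nat[OF F])
   have "pcompose p [:t, - of_nat c:] \<in> poly_over ?F" if "p \<in> poly_over ?F" for p
    using that
   proof (induction p)
    case 0
    thus ?case by (simp add: poly_over_closed[OF F])
   next
    case (pCons a p)
    have "a \<in> ?F" "p \<in> poly_over ?F"
     using pCons.prems unfolding poly_over_def by (auto, metis coeff_pCons_0, metis coeff_pCons_Suc)
    thus ?case using pCons.IH tmF unfolding pcompose_pCons
     by (intro poly_over_closed(2)[OF F] poly_over_closed(5)[OF F _ poly_over_closed(6)[OF F]] poly_over_closed(3)[OF F]) auto
   qed
   thus ?thesis unfolding h_def using poly_over_closed(7)[OF F] by blast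
  qed
  have hy: "poly h y = 0" using f by (simp add: h_def poly_pcompose t_def is_min_poly_def algebra_simps)
  \<comment> \<open>The minimal polynomial \<open>m\<close> of \<open>y\<close> over the field of
    \<open>t\<close> divides both \<open>g\<close> and \<open>h\<close>, so \<open>y\<close> is its
    only root; separability of \<open>g\<close> makes the root simple, so \<open>m\<close> is linear
    and \<open>y\<close> lies in that field.\<close>
  define d where "d = (LEAST d. \<exists>p \<in> poly_over ?F. p \<noteq> 0 \<and> poly p y = 0 \<and> degree p = d)"
  have "\<exists>p \<in> poly_over ?F. p \<noteq> 0 \<and> poly p y = 0 \<and> degree p = d"
   unfolding d_def by (rule LeastI_ex) (intro exI[of _ "degree (qpoly g)"] bexI[of _ "qpoly g"], use g g0 poly_over_closed(7)[OF F] in \<open>auto simp: is_min_poly_def\<close>)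
  then obtain m0 where m0: "m0 \<in> poly_over ?F" "m0 \<noteq> 0" "poly m0 y = 0" "degree m0 = d" by blast
  have least: "d \<le> degree q" if "q \<in> poly_over ?F" "q \<noteq> 0" "poly q y = 0" for q
   unfolding d_def using that by (intro Least_le) auto
  define m where "m = Polynomial.smult (inverse (lead_coeff m0)) m0"
  have m: "m \<in> poly_over ?F" "m \<noteq> 0" "poly m y = 0" "degree m = d" "lead_coeff m = 1"
   unfolding m_def using m0
   by (auto intro!: poly_over_closed[OF F] subfield_closed[OF F], simp add: poly_over_def)
  have dvd: "m dvd q" if q: "q \<in> poly_over ?F" "poly q y = 0" for q
  proof -
   obtain u r where r: "q = u * m + r" "r \<in> poly_over ?F" "r = 0 \<or> degree r < degree m"
    using poly_over_division[OF F m(1,5) q(1)] by blast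
   have "poly r y = 0" using q(2) m(3) r(1) by simp
   hence "r = 0" using least[OF r(2)] r(3) m(4) by fastforce
   thus ?thesis using r(1) by simp
  qed
  have mg: "m dvd qpoly g" using g poly_over_closed(7)[OF F] by (intro dvd) (auto simp: is_min_poly_def)
  have mh: "m dvd h" by (intro dvd hF hy)
  have root: "z = y" if z: "poly m z = 0" for z
  proof (rule ccontr)
   assume "z \<noteq> y"
   have "qeval g z = 0" using mg z by auto
   moreover have "qeval f (t - of_nat c * z) = 0"
   proof -
    have "poly h z = 0" using mh z by auto
    thus ?thesis by (simp add: h_def poly_pcompose mult.commute)
   qed
   ultimately have "((t - of_nat c * z) - x) / (y - z) \<in> bad" unfolding bad_def by force
   moreover have "((t - of_nat c * z) - x) / (y - z) = of_nat c" using \<open>z \<noteq> y\<close> by (simp add: t_def field_simps)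
   ultimately show False using c by simp
  qed
  obtain m1 where m1: "m = [:- y, 1:] * m1" using m(3) by (metis dvdE poly_eq_0_iff_dvd)
  have "degree m1 = 0"
  proof (rule ccontr)
   assume "degree m1 \<noteq> 0"
   then obtain z where z: "poly m1 z = 0" using fundamental_theorem_of_algebra_alt[of m1] by (metis degree_pCons_0)
   hence "z = y" by (intro root) (simp add: m1)
   then obtain m2 where "m1 = [:- y, 1:] * m2" using z by (metis dvdE poly_eq_0_iff_dvd)
   then obtain k where k: "qpoly g = [:- y, 1:] * ([:- y, 1:] * k)" using mg m1 by (metis dvdE mult.assoc)
   have "qpoly (pderiv g) = pderiv (qpoly g)" by (rule of_rat_hom.map_poly_pderiv)
   hence "qeval (pderiv g) y = 0" unfolding k pderiv_mult by simp
   thus False using min_poly_separable[OF g] g by (auto simp: is_min_poly_def)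
  qed
  then obtain e where "m1 = [:e:]" by (metis degree_eq_zeroE)
  hence "lead_coeff m = e" using m(2) by (cases "e = 0") (simp_all add: m1)
  hence "m = [:- y, 1:]" using m(5) m1 \<open>m1 = [:e:]\<close> by simp
  hence "- y \<in> ?F" using m(1) unfolding poly_over_def by (auto dest: spec[of _ 0])
  hence yF: "y \<in> ?F" using subfield_closed(5)[OF F, of "- y"] by simp
  moreover have "x \<in> ?F" using subfield_closed(6)[OF F tF subfield_closed(4)[OF F subfield_of_nat[OF F] yF], of c] by (simp add: t_def)
  ultimately show "x \<in> adjoin (x + of_nat c * y) \<and> y \<in> adjoin (x + of_nat c * y)" by (simp add: t_def)
 qed
qed

subsection \<open>Determinants of matrices given by functions\<close>

text \<open>Matrices given by index functions keep the dimension side conditions of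
  \<open>mat\<close> inside a few lemmas.\<close>

definition fdet :: "nat \<Rightarrow> (nat \<Rightarrow> nat \<Rightarrow> 'a) \<Rightarrow> 'a :: comm_ring_1" where
 "fdet n f = det (mat n n (\<lambda>(i, j). f i j))"

lemma fdet_cong: "(\<And>i j. i < n \<Longrightarrow> j < n \<Longrightarrow> f i j = g i j) \<Longrightarrow> fdet n f = fdet n g"
 unfolding fdet_def by (rule arg_cong[where f = det]) (auto intro!: eq_matI)

lemma fdet_mult: "fdet n (\<lambda>i j. \<Sum>k<n. f i k * g k j) = fdet n f * fdet n g"
proof -
 have "mat n n (\<lambda>(i, j). \<Sum>k<n. f i k * g k j) = mat n n (\<lambda>(i, j). f i j) * mat n n (\<lambda>(i, j). g i j)"
  by (rule eq_matI) (auto simp: scalar_prod_def lessThan_atLeast0)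
 thus ?thesis unfolding fdet_def by (simp add: det_mult[of _ n])
qed

lemma fdet_id: "fdet n (\<lambda>i j. if i = j then 1 else 0) = 1"
proof -
 have "mat n n (\<lambda>(i, j). if i = j then 1 else (0 :: 'a)) = 1\<^sub>m n" by (rule eq_matI) auto
 thus ?thesis by (simp add: fdet_def)
qed

lemma fdet_diag: "fdet n (\<lambda>i j. if i = j then d i else 0) = (\<Prod>i<n. d i)"
proof -
 let ?D = "mat n n (\<lambda>(i, j). if i = j then d i else 0)"
 have "det ?D = prod_list (diag_mat ?D)"
  by (rule det_upper_triangular[of _ n]) (auto simp: upper_triangular_def)
 also have "\<dots> = (\<Prod>i<n. d i)" by (simp add: prod_list_diag_prod lessThan_atLeast0)
 finally show ?thesis by (simp add: fdet_def)
qed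

lemma fdet_scale_rows: "fdet n (\<lambda>i j. d i * f i j) = (\<Prod>i<n. d i) * fdet n f"
proof -
 have "fdet n (\<lambda>i j. d i * f i j) = fdet n (\<lambda>i j. \<Sum>k<n. (if i = k then d i else 0) * f k j)"
  by (rule fdet_cong) (simp add: if_distrib[of "\<lambda>x. x * _"] cong: if_cong)
 thus ?thesis by (simp add: fdet_mult fdet_diag)
qed

lemma fdet_transpose: "fdet n (\<lambda>i j. f j i) = fdet n f"
proof -
 have "mat n n (\<lambda>(i, j). f j i) = transpose_mat (mat n n (\<lambda>(i, j). f i j))"
  by (rule eq_matI) auto
 thus ?thesis unfolding fdet_def by (simp add: det_transpose[of _ n])
qed

lemma fdet_permute_rows:
 assumes "p permutes {0..<n}"
 shows "fdet n (\<lambda>i j. f (p i) j) = of_int (sign p) * fdet n (f :: _ \<Rightarrow> _ \<Rightarrow> 'a :: idom)"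
proof -
 have "det (mat n n (\<lambda>(i, j). (mat n n (\<lambda>(i, j). f i j)) $$ (p i, j))) = of_int (sign p) * det (mat n n (\<lambda>(i, j). f i j))"
  by (rule det_permute_rows[OF _ assms]) auto
 also have "mat n n (\<lambda>(i, j). (mat n n (\<lambda>(i, j). f i j)) $$ (p i, j)) = mat n n (\<lambda>(i, j). f (p i) j)"
  using permutes_in_image[OF assms] by (intro eq_matI) auto
 finally show ?thesis by (simp add: fdet_def)
qed

lemma (in comm_ring_hom) fdet_hom: "fdet n (\<lambda>i j. hom (f i j)) = hom (fdet n f)"
proof -
 have "mat n n (\<lambda>(i, j). hom (f i j)) = map_mat hom (mat n n (\<lambda>(i, j). f i j))"
  by (rule eq_matI) auto
 thus ?thesis by (simp add: fdet_def)
qed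

lemma fdet_zero_iff:
 fixes f :: "nat \<Rightarrow> nat \<Rightarrow> 'a :: idom"
 shows "fdet n f = 0 \<longleftrightarrow> (\<exists>v. (\<exists>i<n. v i \<noteq> 0) \<and> (\<forall>i<n. (\<Sum>j<n. f i j * v j) = 0))"
proof
 assume "fdet n f = 0"
 then obtain v where v: "v \<in> carrier_vec n" "v \<noteq> 0\<^sub>v n" "mat n n (\<lambda>(i, j). f i j) *\<^sub>v v = 0\<^sub>v n"
  unfolding fdet_def by (subst (asm) det_0_iff_vec_prod_zero[of _ n]) auto
 show "\<exists>v. (\<exists>i<n. v i \<noteq> 0) \<and> (\<forall>i<n. (\<Sum>j<n. f i j * v j) = 0)"
 proof (intro exI[of _ "vec_index v"] conjI allI impI)
  show "\<exists>i<n. vec_index v i \<noteq> 0" using v(1,2) by (metis carrier_vecD eq_vecI index_zero_vec(1) index_zero_vec(2))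
  fix i assume i: "i < n"
  have "(\<Sum>j<n. f i j * vec_index v j) = vec_index (mat n n (\<lambda>(i, j). f i j) *\<^sub>v v) i"
   using i v(1) by (auto simp: scalar_prod_def lessThan_atLeast0)
  thus "(\<Sum>j<n. f i j * vec_index v j) = 0" using i v(3) by simp
 qed
next
 assume "\<exists>v. (\<exists>i<n. v i \<noteq> 0) \<and> (\<forall>i<n. (\<Sum>j<n. f i j * v j) = 0)"
 then obtain v where v: "\<exists>i<n. v i \<noteq> 0" "\<And>i. i < n \<Longrightarrow> (\<Sum>j<n. f i j * v j) = 0" by blast
 have "vec n v \<noteq> 0\<^sub>v n" using v(1) by (metis index_vec index_zero_vec(1))
 moreover have "mat n n (\<lambda>(i, j). f i j) *\<^sub>v vec n v = 0\<^sub>v n"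
  using v(2) by (intro eq_vecI) (auto simp: scalar_prod_def lessThan_atLeast0)
 ultimately show "fdet n f = 0" unfolding fdet_def
  by (subst det_0_iff_vec_prod_zero[of _ n]) (auto intro!: exI[of _ "vec n v"])
qed

lemma fdet_inverse_commute:
 fixes f g :: "nat \<Rightarrow> nat \<Rightarrow> 'a :: field"
 assumes "\<And>i j. i < n \<Longrightarrow> j < n \<Longrightarrow> (\<Sum>k<n. f i k * g k j) = (if i = j then 1 else 0)" and "i < n" "j < n"
 shows "(\<Sum>k<n. g i k * f k j) = (if i = j then 1 else 0)"
proof -
 let ?A = "mat n n (\<lambda>(i, j). f i j)" and ?B = "mat n n (\<lambda>(i, j). g i j)"
 have "?A * ?B = 1\<^sub>m n"
  using assms(1) by (intro eq_matI) (auto simp: scalar_prod_def lessThan_atLeast0)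
 hence "?B * ?A = 1\<^sub>m n" by (rule mat_mult_left_right_inverse[rotated 2]) auto
 hence "(?B * ?A) $$ (i, j) = (1\<^sub>m n :: 'a mat) $$ (i, j)" by simp
 thus ?thesis using assms(2,3) by (auto simp: scalar_prod_def lessThan_atLeast0)
qed

lemma fdet_nonzero_inverse:
 fixes f :: "nat \<Rightarrow> nat \<Rightarrow> 'a :: field"
 assumes "fdet n f \<noteq> 0"
 obtains g where "\<And>i j. i < n \<Longrightarrow> j < n \<Longrightarrow> (\<Sum>k<n. f i k * g k j) = (if i = j then 1 else 0)"
  "\<And>i j. i < n \<Longrightarrow> j < n \<Longrightarrow> (\<Sum>k<n. g i k * f k j) = (if i = j then 1 else 0)"
proof -
 let ?A = "mat n n (\<lambda>(i, j). f i j)"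
 have "?A \<in> Units (ring_mat TYPE('a) n ())"
  using assms by (intro det_non_zero_imp_unit) (auto simp: fdet_def)
 then obtain B where B: "B \<in> carrier_mat n n" "?A * B = 1\<^sub>m n"
  unfolding Units_def ring_mat_def by auto
 have 1: "(\<Sum>k<n. f i k * B $$ (k, j)) = (if i = j then 1 else 0)" if ij: "i < n" "j < n" for i j
 proof -
  have "(?A * B) $$ (i, j) = (1\<^sub>m n :: 'a mat) $$ (i, j)" using B by simp
  thus ?thesis using ij B(1) by (auto simp: scalar_prod_def lessThan_atLeast0)
 qed
 show ?thesis
 proof (rule that[of "\<lambda>i j. B $$ (i, j)"])
  show "(\<Sum>k<n. f i k * B $$ (k, j)) = (if i = j then 1 else 0)" if "i < n" "j < n" for i j
   using 1 that by blast
  show "(\<Sum>k<n. B $$ (i, k) * f k j) = (if i = j then 1 else 0)" if "i < n" "j < n" for i j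
   using fdet_inverse_commute[of n f "\<lambda>i j. B $$ (i, j)"] 1 that by blast
 qed
qed

lemma det_fun_eq_fdet: "det_fun n f = fdet n f" unfolding det_fun_def fdet_def det_def
 by (auto simp: lessThan_atLeast0 intro!: sum.cong prod.cong dest: permutes_in_image)

section \<open>Rational spans, powers of an algebraic number and dimension\<close>

lemma Q_span_eq: "finite B \<Longrightarrow> Q_span B = Qvs.span B"
 by (auto simp: Q_span_def Qvs.span_finite)

lemma qeval_monom: "qeval (monom c k) x = of_rat c * x ^ k" by (simp add: map_poly_monom poly_monom)

lemma qeval_sum: "qeval (\<Sum>i\<in>A. f i) x = (\<Sum>i\<in>A. qeval (f i) x)"
 by (induction A rule: infinite_finite_induct) auto

lemma qeval_pCons: "qeval (pCons a q) z = of_rat a + z * qeval q z"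
 by (simp add: of_rat_hom.map_poly_pCons_hom)

lemma cnj_of_rat: "cnj (of_rat q) = of_rat q" by (cases q) (simp add: of_rat_rat)

lemma qeval_altdef: "degree p < n \<Longrightarrow> qeval p x = (\<Sum>i<n. of_rat (coeff p i) * x ^ i)"
proof -
 assume "degree p < n"
 hence "(\<Sum>i<n. of_rat (coeff p i) * x ^ i) = (\<Sum>i\<le>degree p. of_rat (coeff p i) * x ^ i)"
  by (intro sum.mono_neutral_right) (auto simp: coeff_eq_0)
 thus ?thesis by (simp add: poly_altdef)
qed

lemma adjoin_span:
 assumes p: "is_min_poly p x"
 shows "adjoin x = Qvs.span ((\<lambda>i. x ^ i) ` {..<degree p})" (is "_ = Qvs.span ?B")
proof (intro equalityI subsetI)
 fix y assume "y \<in> adjoin x"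
 then obtain q where q: "y = qeval q x" by (auto simp: adjoin_def)
 have "qeval q x = qeval (q div p * p + q mod p) x" by simp
 also have "\<dots> = qeval (q mod p) x" using p unfolding qeval_simps by (simp add: is_min_poly_def)
 finally have y: "y = qeval (q mod p) x" using q by simp
 have "p \<noteq> 0" using p by (auto simp: is_min_poly_def)
 have d: "degree p > 0"
 proof (rule ccontr)
  assume "\<not> degree p > 0"
  then obtain c where "p = [:c:]" by (metis degree_eq_zeroE gr0I)
  with p show False by (auto simp: is_min_poly_def)
 qed
 have "degree (q mod p) < degree p"
  using degree_mod_less[OF \<open>p \<noteq> 0\<close>, of q] d by auto
 hence "y = (\<Sum>i<degree p. of_rat (coeff (q mod p) i) * x ^ i)"
  unfolding y by (rule qeval_altdef)
 also have "\<dots> \<in> Qvs.span ?B" by (intro Qvs.span_sum Qvs.span_scale Qvs.span_base) auto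
 finally show "y \<in> Qvs.span ?B" .
next
 fix y assume "y \<in> Qvs.span ?B"
 thus "y \<in> adjoin x"
 proof (induction rule: Qvs.span_induct_alt)
  case base
  show ?case unfolding adjoin_def by (rule range_eqI[of _ _ 0]) simp
 next
  case (step c z y)
  then obtain i q where "z = x ^ i" "y = qeval q x" by (auto simp: adjoin_def)
  thus ?case unfolding adjoin_def
   by (intro range_eqI[of _ _ "monom c i + q"]) (simp only: qeval_simps qeval_monom)
 qed
qed

lemma min_poly_powers:
 assumes p: "is_min_poly p x"
 shows "inj_on (\<lambda>i. x ^ i) {..<degree p}" "\<not> Qvs.dependent ((\<lambda>i. x ^ i) ` {..<degree p})"
proof -
 have zero: "c i = 0" if c: "(\<Sum>i<degree p. of_rat (c i) * x ^ i) = 0" and i: "i < degree p" for c i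
 proof -
  define q where "q = (\<Sum>i<degree p. monom (c i) i)"
  have co: "coeff q j = (if j < degree p then c j else 0)" for j by (auto simp: q_def coeff_sum)
  have dq: "degree q < degree p" if "q \<noteq> 0" using that co by (metis leading_coeff_0_iff)
  have "qeval q x = (\<Sum>i<degree p. qeval (monom (c i) i) x)"
   unfolding q_def by (rule qeval_sum)
  also have "\<dots> = 0" using c by (simp only: qeval_monom)
  finally have "p dvd q" using p by (auto simp: is_min_poly_def)
  hence "q = 0" using dq by (meson dvd_imp_degree_le leD)
  thus ?thesis using co[of i] i by simp
 qed
 show inj: "inj_on (\<lambda>i. x ^ i) {..<degree p}"
 proof (rule inj_onI, rule ccontr)
  fix i j assume ij: "i \<in> {..<degree p}" "j \<in> {..<degree p}" "x ^ i = x ^ j" "i \<noteq> j"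
  have "(\<Sum>k<degree p. of_rat ((if k = i then 1 else 0) - (if k = j then 1 else 0)) * x ^ k) = x ^ i - x ^ j"
   using ij by (simp add: of_rat_diff left_diff_distrib sum_subtractf if_distrib[of of_rat] if_distrib[of "\<lambda>y. y * _"] cong: if_cong)
  hence "(if i = i then 1 else 0) - (if i = j then 1 else 0) = (0 :: rat)"
   using ij by (intro zero[of "\<lambda>k. (if k = i then 1 else 0) - (if k = j then 1 else 0)"]) auto
  thus False using ij by simp
 qed
 show "\<not> Qvs.dependent ((\<lambda>i. x ^ i) ` {..<degree p})"
 proof
  assume "Qvs.dependent ((\<lambda>i. x ^ i) ` {..<degree p})"
  then obtain u v where u: "(\<Sum>v\<in>(\<lambda>i. x ^ i) ` {..<degree p}. of_rat (u v) * v) = 0" "v \<in> (\<lambda>i. x ^ i) ` {..<degree p}" "u v \<noteq> 0"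
   by (subst (asm) Qvs.dependent_finite) auto
  from u(1) have "(\<Sum>i<degree p. of_rat (u (x ^ i)) * x ^ i) = 0"
   by (subst (asm) sum.reindex[OF inj]) simp
  thus False using u(2,3) zero[of "\<lambda>i. u (x ^ i)"] by auto
 qed
qed

context
 fixes K :: "complex set"
 assumes K: "number_field K"
begin

lemma number_field_subfield: "is_complex_subfield K" using K by (simp add: number_field_def)

text \<open>The bound \<open>d\<close>, uniform over the field, is what allows a generator to be
  chosen as an element of maximal degree.\<close>

lemma number_field_algebraic:
 obtains d where "\<And>x. x \<in> K \<Longrightarrow> algebraic_over_Q x" "\<And>x p. x \<in> K \<Longrightarrow> is_min_poly p x \<Longrightarrow> degree p \<le> d"
proof -
 obtain B where B: "finite B" "Q_span B = K" using K by (auto simp: number_field_def Q_basis_def)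
 hence KB: "K = Qvs.span B" by (simp add: Q_span_eq)
 note pw = subfield_power[OF number_field_subfield]
 have alg: "algebraic_over_Q x" if x: "x \<in> K" for x
 proof (cases "inj_on (\<lambda>i. x ^ i) {..card B}")
  case True
  let ?P = "(\<lambda>i. x ^ i) ` {..card B}"
  have "Qvs.dependent ?P"
  proof (rule ccontr)
   assume "\<not> Qvs.dependent ?P"
   moreover have "?P \<subseteq> Qvs.span B" using pw[OF x] KB by auto
   ultimately have "card ?P \<le> card B" using Qvs.independent_span_bound[OF B(1)] by blast
   thus False by (simp add: card_image[OF True])
  qed
  then obtain u v where u: "(\<Sum>v\<in>?P. of_rat (u v) * v) = 0" "v \<in> ?P" "u v \<noteq> 0"
   by (subst (asm) Qvs.dependent_finite) auto
  define q where "q = (\<Sum>i\<le>card B. monom (u (x ^ i)) i)"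
  have co: "coeff q j = (if j \<le> card B then u (x ^ j) else 0)" for j
   by (auto simp: q_def coeff_sum)
  have "qeval q x = (\<Sum>i\<le>card B. qeval (monom (u (x ^ i)) i) x)"
   unfolding q_def by (rule qeval_sum)
  also have "\<dots> = 0" using u(1) unfolding qeval_monom by (subst (asm) sum.reindex[OF True]) simp
  finally have "qeval q x = 0" .
  moreover have "q \<noteq> 0" using u(2,3) co by (metis (no_types, lifting) atMost_iff coeff_0 image_iff)
  ultimately show ?thesis unfolding algebraic_over_Q_def by blast
 next
  case False
  then obtain i j where ij: "i \<noteq> j" "x ^ i = x ^ j" by (auto simp: inj_on_def)
  have "qeval (monom 1 i - monom 1 j) x = 0" using ij unfolding qeval_simps qeval_monom by simp
  moreover have "monom 1 i - monom 1 j \<noteq> (0 :: rat poly)" using ij by (auto simp: poly_eq_iff)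
  ultimately show ?thesis unfolding algebraic_over_Q_def by blast
 qed
 have "degree p \<le> card B" if x: "x \<in> K" and p: "is_min_poly p x" for x p
 proof -
  have "(\<lambda>i. x ^ i) ` {..<degree p} \<subseteq> Qvs.span B" using pw[OF x] KB by auto
  hence "card ((\<lambda>i. x ^ i) ` {..<degree p}) \<le> card B"
   using Qvs.independent_span_bound[OF B(1) min_poly_powers(2)[OF p]] by blast
  thus ?thesis by (simp add: card_image[OF min_poly_powers(1)[OF p]])
 qed
 with alg that show ?thesis by blast
qed

text \<open>Take \<open>t\<close> of maximal degree. For \<open>y\<close> outside its field, an
  element generating both \<open>t\<close> and \<open>y\<close> would have a strictly larger degree,
  since the powers of \<open>t\<close> together with \<open>y\<close> are independent.\<close>

lemma primitive_element:
 obtains t p where "t \<in> K" "is_min_poly p t" "K = adjoin t"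
proof -
 obtain d where d: "\<And>x. x \<in> K \<Longrightarrow> algebraic_over_Q x" "\<And>x p. x \<in> K \<Longrightarrow> is_min_poly p x \<Longrightarrow> degree p \<le> d"
  using number_field_algebraic by blast
 note F = number_field_subfield
 define D where "D = {degree p |p x. x \<in> K \<and> is_min_poly p x}"
 have "finite D" by (rule finite_subset[of _ "{..d}"]) (use d(2) in \<open>auto simp: D_def\<close>)
 moreover have "D \<noteq> {}"
 proof -
  obtain p where "is_min_poly p 0" using ex_min_poly[OF d(1)[OF subfield_closed(1)[OF F]]] .
  thus ?thesis using subfield_closed(1)[OF F] by (auto simp: D_def)
 qed
 ultimately have "Max D \<in> D" and max: "\<And>e. e \<in> D \<Longrightarrow> e \<le> Max D" by auto
 then obtain t p where t: "t \<in> K" "is_min_poly p t" "degree p = Max D" by (auto simp: D_def)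
 have "K \<subseteq> adjoin t"
 proof
  fix y assume y: "y \<in> K"
  obtain c :: nat where c: "algebraic_over_Q (t + of_nat c * y) \<Longrightarrow> t \<in> adjoin (t + of_nat c * y) \<and> y \<in> adjoin (t + of_nat c * y)"
   using primitive_element_pair[OF d(1)[OF t(1)] d(1)[OF y]] by metis
  define u where "u = t + of_nat c * y"
  have uK: "u \<in> K" unfolding u_def by (intro subfield_closed[OF F] t(1) y subfield_of_nat[OF F])
  have tu: "t \<in> adjoin u" "y \<in> adjoin u" using c d(1)[OF uK] by (auto simp: u_def)
  obtain q where q: "is_min_poly q u" using ex_min_poly[OF d(1)[OF uK]] .
  have dq: "degree q \<le> degree p" unfolding t(3) using uK q by (intro max) (auto simp: D_def)
  let ?T = "(\<lambda>i. t ^ i) ` {..<degree p}" and ?U = "(\<lambda>i. u ^ i) ` {..<degree q}"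
  have Fu: "is_complex_subfield (adjoin u)" by (rule adjoin_subfield[OF d(1)[OF uK]])
  show "y \<in> adjoin t"
  proof (rule ccontr)
   assume "y \<notin> adjoin t"
   hence y: "y \<notin> Qvs.span ?T" by (simp add: adjoin_span[OF t(2)])
   hence "\<not> Qvs.dependent (insert y ?T)"
    using Qvs.independent_insertI min_poly_powers(2)[OF t(2)] by blast
   moreover have "insert y ?T \<subseteq> Qvs.span ?U"
    using tu subfield_power[OF Fu tu(1)] by (auto simp: adjoin_span[OF q])
   ultimately have "card (insert y ?T) \<le> card ?U"
    using Qvs.independent_span_bound[of ?U "insert y ?T"] by blast
   moreover have "y \<notin> ?T" by (rule contra_subsetD[OF Qvs.span_superset y])
   ultimately show False
    using dq by (simp add: card_image min_poly_powers(1)[OF t(2)] min_poly_powers(1)[OF q])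
  qed
 qed
 moreover have "adjoin t \<subseteq> K" using subfield_qeval[OF F t(1)] by (auto simp: adjoin_def)
 ultimately show ?thesis using that t by blast
qed

end

text \<open>The list \<open>rs\<close> fixes an order on the conjugates of the generator
  \<open>t\<close>, so that embeddings become indices below \<open>n\<close> and matrices of
  conjugates can be written down.\<close>

locale nfield =
 fixes K :: "complex set" and t :: complex and p :: "rat poly" and rs :: "complex list" and n :: nat
 assumes K: "number_field K" and tK: "t \<in> K" and p: "is_min_poly p t" and K_eq: "K = adjoin t"
  and rs: "set rs = {r. qeval p r = 0}" "distinct rs" and n: "n = degree p"

lemma nfield_exists:
 assumes "number_field K"
 obtains t p rs n where "nfield K t p rs n"
proof -
 obtain t p where tp: "t \<in> K" "is_min_poly p t" "K = adjoin t" using primitive_element[OF assms] .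
 have "finite {r. qeval p r = 0}" using tp(2) by (intro poly_roots_finite) (auto simp: is_min_poly_def)
 then obtain rs where "set rs = {r. qeval p r = 0}" "distinct rs" using finite_distinct_list by blast
 thus ?thesis using tp assms by (intro that[of t p rs "degree p"]) (auto simp: nfield_def)
qed

context nfield
begin

lemmas F = number_field_subfield[OF K]
lemmas K_closed = subfield_closed[OF F]
lemmas K_sum = subfield_sum[OF F]
lemmas K_power = subfield_power[OF F]
lemmas K_of_rat = subfield_of_rat[OF F]
lemmas K_of_int = subfield_of_int[OF F]

lemma length_rs: "length rs = n"
proof -
 let ?p = "qpoly p"
 have "pderiv ?p = qpoly (pderiv p)" by (rule of_rat_hom.map_poly_pderiv[symmetric])
 hence "rsquarefree ?p" using min_poly_separable[OF p] by (auto simp: rsquarefree_roots)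
 from complex_poly_decompose_rsquarefree[OF this]
 have "degree ?p = degree (\<Prod>z|poly ?p z = 0. [:- z, 1:])" using p by (metis (no_types, lifting) degree_smult_eq is_min_poly_def leading_coeff_0_iff of_rat_hom.hom_0_iff of_rat_hom.degree_map_poly_hom of_rat_hom.coeff_map_poly_hom zero_neq_one)
 also have "\<dots> = card {z. poly ?p z = 0}" by (simp add: degree_prod_eq_sum_degree)
 also have "\<dots> = length rs" using rs by (simp add: distinct_card flip: rs(1))
 finally show ?thesis by (simp add: n)
qed

lemma n_pos: "n > 0"
proof -
 have "t \<in> set rs" using p by (simp add: rs is_min_poly_def)
 thus ?thesis using length_rs by (metis length_pos_if_in_set)
qed

lemma root: "i < n \<Longrightarrow> qeval p (rs ! i) = 0" using rs(1) length_rs nth_mem by auto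

text \<open>The choice of the polynomial does not affect the value: two candidates agree at
  \<open>t\<close>, so they differ by a multiple of \<open>p\<close>, which vanishes at every
  conjugate. The value 0 outside \<open>K\<close> matches the convention in
  \<open>embeddings\<close>.\<close>

definition emb :: "nat \<Rightarrow> complex \<Rightarrow> complex" where
 "emb i x = (if x \<in> K then qeval (SOME q. qeval q t = x) (rs ! i) else 0)"

lemma qeval_in_K: "qeval q t \<in> K" by (simp add: K_eq adjoin_def)

lemma K_qeval: "x \<in> K \<Longrightarrow> \<exists>q. x = qeval q t"
 by (auto simp: K_eq adjoin_def)

lemma emb_qeval: "i < n \<Longrightarrow> emb i (qeval q t) = qeval q (rs ! i)"
proof -
 assume i: "i < n"
 define q' where "q' = (SOME q'. qeval q' t = qeval q t)"
 have "qeval q' t = qeval q t" unfolding q'_def by (rule someI) simp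
 hence "qeval (q' - q) t = 0" by simp
 hence "p dvd q' - q" using p unfolding is_min_poly_def by blast
 then obtain h where "q' - q = p * h" unfolding dvd_def by blast
 hence "qeval (q' - q) (rs ! i) = 0" using root[OF i] by simp
 thus ?thesis by (simp add: emb_def qeval_in_K q'_def)
qed

lemma emb_add: "i < n \<Longrightarrow> x \<in> K \<Longrightarrow> y \<in> K \<Longrightarrow> emb i (x + y) = emb i x + emb i y"
 and emb_mult: "i < n \<Longrightarrow> x \<in> K \<Longrightarrow> y \<in> K \<Longrightarrow> emb i (x * y) = emb i x * emb i y"
proof -
 assume *: "i < n" "x \<in> K" "y \<in> K"
 then obtain q r where qr: "x = qeval q t" "y = qeval r t" using K_qeval by meson
 show "emb i (x + y) = emb i x + emb i y" "emb i (x * y) = emb i x * emb i y"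
  using emb_qeval[OF *(1), of "q + r"] emb_qeval[OF *(1), of "q * r"] emb_qeval[OF *(1), of q] emb_qeval[OF *(1), of r]
  by (simp_all add: qr)
qed

lemma emb_of_rat: "i < n \<Longrightarrow> emb i (of_rat q) = of_rat q"
 using emb_qeval[of i "[:q:]"] unfolding qeval_pCons by simp

lemma emb_of_int [simp]: "i < n \<Longrightarrow> emb i (of_int k) = of_int k"
 using emb_of_rat[of i "of_int k"] by simp

lemma emb_0 [simp]: "i < n \<Longrightarrow> emb i 0 = 0" and emb_1 [simp]: "i < n \<Longrightarrow> emb i 1 = 1"
 using emb_of_int[of i 0] emb_of_int[of i 1] by simp_all

lemma emb_sum: "i < n \<Longrightarrow> (\<And>a. a \<in> A \<Longrightarrow> f a \<in> K) \<Longrightarrow> emb i (\<Sum>a\<in>A. f a) = (\<Sum>a\<in>A. emb i (f a))"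
 by (induction A rule: infinite_finite_induct) (auto simp: emb_add K_sum)

lemma emb_uminus: "i < n \<Longrightarrow> x \<in> K \<Longrightarrow> emb i (- x) = - emb i x"
 using emb_add[of i x "- x"] by (simp add: K_closed eq_neg_iff_add_eq_0 add.commute)

lemma emb_nonzero: "i < n \<Longrightarrow> x \<in> K \<Longrightarrow> x \<noteq> 0 \<Longrightarrow> emb i x \<noteq> 0"
 using emb_mult[of i x "inverse x"] K_closed(7)[of x] by auto

lemma emb_inverse: "i < n \<Longrightarrow> x \<in> K \<Longrightarrow> emb i (inverse x) = inverse (emb i x)"
 using emb_mult[of i x "inverse x"] K_closed(7)[of x] by (cases "x = 0") (auto simp: field_simps emb_nonzero)

lemma emb_t: "i < n \<Longrightarrow> emb i t = rs ! i" using emb_qeval[of i "[:0, 1:]"] by simp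

lemma emb_power: "i < n \<Longrightarrow> x \<in> K \<Longrightarrow> emb i (x ^ k) = emb i x ^ k"
 by (induction k) (auto simp: emb_mult K_power)

lemma hom_qeval:
 assumes "\<sigma> \<in> embeddings K" "x \<in> K"
 shows "\<sigma> (qeval q x) = qeval q (\<sigma> x)"
proof -
 have add: "\<sigma> (a + b) = \<sigma> a + \<sigma> b" and mult: "\<sigma> (a * b) = \<sigma> a * \<sigma> b" if "a \<in> K" "b \<in> K" for a b
  using assms that by (auto simp: embeddings_def)
 have one: "\<sigma> 1 = 1" using assms by (auto simp: embeddings_def)
 have zero: "\<sigma> 0 = 0" using add[of 0 0] K_closed by simp
 have neg: "\<sigma> (- a) = - \<sigma> a" if "a \<in> K" for a
  using add[of a "- a"] that K_closed(5)[of a] zero by (simp add: eq_neg_iff_add_eq_0 add.commute)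
 have nat: "\<sigma> (of_nat k) = of_nat k" for k
  by (induction k) (auto simp: zero one add K_closed subfield_of_nat[OF F])
 have int: "\<sigma> (of_int k) = of_int k" for k
  by (cases k) (auto simp: nat neg subfield_of_nat[OF F] simp del: of_nat_Suc)
 have rat: "\<sigma> (of_rat c) = of_rat c" for c
 proof (cases c)
  case (Fract a b)
  hence "b \<noteq> 0" by auto
  have "\<sigma> (of_rat c) * of_int b = \<sigma> (of_rat c * of_int b)"
   using mult[of "of_rat c" "of_int b"] by (simp add: K_of_rat K_of_int int)
  also have "of_rat c * of_int b = (of_int a :: complex)" using Fract \<open>b \<noteq> 0\<close> by (simp add: of_rat_rat)
  finally show ?thesis using Fract \<open>b \<noteq> 0\<close> by (simp add: int of_rat_rat field_simps)
 qed
 show ?thesis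
 proof (induction q)
  case 0
  thus ?case by (simp add: zero)
 next
  case (pCons a q)
  show ?case unfolding qeval_pCons using pCons.IH assms(2) add[of "of_rat a" "x * qeval q x"] mult[of x "qeval q x"]
   by (simp add: K_of_rat K_closed subfield_qeval[OF F] rat)
 qed
qed

lemma emb_in_embeddings: "i < n \<Longrightarrow> emb i \<in> embeddings K"
 unfolding embeddings_def by (auto simp: emb_add emb_mult) (simp add: emb_def)

text \<open>An embedding is determined by its value at \<open>t\<close>, and this value has to be a
  root of \<open>p\<close>.\<close>

lemma bij_emb: "bij_betw emb {..<n} (embeddings K)"
proof (rule bij_betw_imageI)
 show "inj_on emb {..<n}"
 proof (rule inj_onI)
  fix i j assume "i \<in> {..<n}" "j \<in> {..<n}" "emb i = emb j"
  hence "rs ! i = rs ! j" using emb_t by (metis lessThan_iff)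
  thus "i = j" using rs(2) length_rs \<open>i \<in> _\<close> \<open>j \<in> _\<close> by (simp add: nth_eq_iff_index_eq)
 qed
 show "emb ` {..<n} = embeddings K"
 proof (intro equalityI subsetI)
  fix \<sigma> assume s: "\<sigma> \<in> embeddings K"
  have "\<sigma> 0 = 0" using hom_qeval[OF s tK, of 0] by simp
  hence "qeval p (\<sigma> t) = 0" using hom_qeval[OF s tK, of p] p by (simp add: is_min_poly_def)
  hence "\<sigma> t \<in> set rs" using rs by simp
  then obtain i where i: "i < n" "\<sigma> t = rs ! i" using length_rs by (metis in_set_conv_nth)
  have "\<sigma> x = emb i x" for x
  proof (cases "x \<in> K")
   case True
   then obtain q where "x = qeval q t" using K_qeval by blast
   thus ?thesis using hom_qeval[OF s tK, of q] emb_qeval[OF i(1), of q] i by simp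
  next
   case False
   thus ?thesis using s by (auto simp: embeddings_def emb_def)
  qed
  hence "\<sigma> = emb i" by (rule ext)
  thus "\<sigma> \<in> emb ` {..<n}" using i by auto
 qed (use emb_in_embeddings in auto)
qed

lemma expand_powers:
 assumes "x \<in> K"
 obtains c :: "nat \<Rightarrow> rat" where "x = (\<Sum>j<n. of_rat (c j) * t ^ j)"
proof -
 obtain q where q: "x = qeval q t" using K_qeval[OF assms] by blast
 have "qeval q t = qeval (q div p * p + q mod p) t" by simp
 also have "\<dots> = qeval (q mod p) t" using p unfolding qeval_simps by (simp add: is_min_poly_def)
 finally have x: "x = qeval (q mod p) t" using q by simp
 have "p \<noteq> 0" using p by (auto simp: is_min_poly_def)
 hence "degree (q mod p) < n" using degree_mod_less[OF \<open>p \<noteq> 0\<close>, of q] n_pos n by auto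
 thus ?thesis using that qeval_altdef[of "q mod p" n t] x by auto
qed

text \<open>Its square is the discriminant of the tuple. Its modulus serves as covolume in the
  coordinates given by all \<open>n\<close> embeddings, with no factor for complex places.\<close>

definition disc_mat :: "(nat \<Rightarrow> complex) \<Rightarrow> complex" where
 "disc_mat b = fdet n (\<lambda>i j. emb i (b j))"

text \<open>Vandermonde: a kernel vector would be a nonzero polynomial of degree below
  \<open>n\<close> with the \<open>n\<close> distinct conjugates as roots.\<close>

lemma disc_powers: "disc_mat (\<lambda>j. t ^ j) \<noteq> 0"
proof
 assume "disc_mat (\<lambda>j. t ^ j) = 0"
 then obtain v where v: "\<exists>i<n. v i \<noteq> 0" "\<And>i. i < n \<Longrightarrow> (\<Sum>j<n. emb i (t ^ j) * v j) = 0"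
  unfolding disc_mat_def fdet_zero_iff by blast
 define q where "q = (\<Sum>j<n. monom (v j) j)"
 have co: "coeff q j = (if j < n then v j else 0)" for j by (auto simp: q_def coeff_sum)
 have q0: "q \<noteq> 0" using v(1) co by (metis coeff_0)
 have dq: "degree q < n" using co q0 by (metis leading_coeff_0_iff)
 have "poly q (rs ! i) = 0" if "i < n" for i
  using v(2)[OF that] that by (simp add: q_def poly_sum poly_monom emb_power tK emb_t mult.commute)
 hence "set rs \<subseteq> {z. poly q z = 0}" using length_rs by (auto simp: in_set_conv_nth)
 hence "card (set rs) \<le> card {z. poly q z = 0}" by (intro card_mono poly_roots_finite q0)
 also have "\<dots> \<le> degree q" by (rule card_poly_roots_bound[OF q0])
 finally show False using dq rs(2) length_rs by (simp add: distinct_card)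
qed

lemma disc_change:
 assumes "\<And>j. j < n \<Longrightarrow> b j \<in> K" and "\<And>j. j < n \<Longrightarrow> b' j = (\<Sum>k<n. of_rat (c k j) * b k)"
 shows "disc_mat b' = disc_mat b * of_rat (fdet n c)"
proof -
 have "disc_mat b' = fdet n (\<lambda>i j. \<Sum>k<n. emb i (b k) * of_rat (c k j))"
  unfolding disc_mat_def using assms by (intro fdet_cong) (subst assms(2), simp, subst emb_sum,
    auto simp: emb_mult emb_of_rat K_of_rat mult.commute intro!: K_closed)
 thus ?thesis by (simp add: fdet_mult disc_mat_def of_rat_hom.fdet_hom)
qed

lemma disc_change_int:
 assumes "\<And>j. j < n \<Longrightarrow> b j \<in> K" and "\<And>j. j < n \<Longrightarrow> b' j = (\<Sum>k<n. of_int (c k j) * b k)"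
 shows "disc_mat b' = disc_mat b * of_int (fdet n c)"
 using disc_change[of b b' "\<lambda>k j. of_int (c k j)"] assms by (simp add: of_int_hom.fdet_hom)

lemma expand_basis:
 assumes b: "\<And>j. j < n \<Longrightarrow> b j \<in> K" and disc: "disc_mat b \<noteq> 0" and x: "x \<in> K"
 obtains c :: "nat \<Rightarrow> rat" where "x = (\<Sum>j<n. of_rat (c j) * b j)"
proof -
 have "\<exists>c :: nat \<Rightarrow> rat. b j = (\<Sum>k<n. of_rat (c k) * t ^ k)" if "j < n" for j
  using expand_powers[OF b[OF that]] by metis
 then obtain c where c: "\<And>j. j < n \<Longrightarrow> b j = (\<Sum>k<n. of_rat (c j k) * t ^ k)" by metis
 have "disc_mat b = disc_mat (\<lambda>j. t ^ j) * of_rat (fdet n (\<lambda>k j. c j k))"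
  by (rule disc_change) (auto simp: K_power tK c)
 hence "fdet n (\<lambda>k j. c j k) \<noteq> 0" using disc by auto
 then obtain d where d: "\<And>i j. i < n \<Longrightarrow> j < n \<Longrightarrow> (\<Sum>k<n. c k i * d k j) = (if i = j then 1 else 0)"
  using fdet_nonzero_inverse[of n "\<lambda>k j. c j k"] by metis
 have tb: "t ^ i = (\<Sum>j<n. of_rat (d j i) * b j)" if "i < n" for i
 proof -
  have "(\<Sum>j<n. of_rat (d j i) * b j) = (\<Sum>j<n. \<Sum>k<n. of_rat (c j k * d j i) * t ^ k)"
   by (simp add: c sum_distrib_left of_rat_mult mult_ac)
  also have "\<dots> = (\<Sum>k<n. of_rat (\<Sum>j<n. c j k * d j i) * t ^ k)"
   by (subst sum.swap) (simp add: of_rat_sum sum_distrib_right)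
  also have "\<dots> = (\<Sum>k<n. if k = i then t ^ k else 0)"
   using d[OF _ that] by (intro sum.cong) auto
  also have "\<dots> = t ^ i" using that by simp
  finally show ?thesis by simp
 qed
 obtain e :: "nat \<Rightarrow> rat" where "x = (\<Sum>i<n. of_rat (e i) * t ^ i)" using expand_powers[OF x] by metis
 also have "\<dots> = (\<Sum>i<n. \<Sum>j<n. of_rat (e i * d j i) * b j)"
  by (simp add: tb sum_distrib_left of_rat_mult mult_ac)
 also have "\<dots> = (\<Sum>j<n. of_rat (\<Sum>i<n. e i * d j i) * b j)"
  by (subst sum.swap) (simp add: of_rat_sum sum_distrib_right)
 finally show ?thesis by (rule that)
qed

lemma disc_indep:
 assumes b: "\<And>j. j < n \<Longrightarrow> b j \<in> K" and disc: "disc_mat b \<noteq> 0"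
  and zero: "(\<Sum>j<n. of_rat (c j) * b j) = 0" and j: "j < n"
 shows "c j = 0"
proof (rule ccontr)
 assume "c j \<noteq> 0"
 have "(\<Sum>j<n. emb i (b j) * of_rat (c j)) = 0" if "i < n" for i
 proof -
  have "emb i (\<Sum>j<n. of_rat (c j) * b j) = (\<Sum>j<n. emb i (b j) * of_rat (c j))"
   using that b by (subst emb_sum) (auto simp: emb_mult emb_of_rat K_of_rat mult.commute intro!: K_closed)
  thus ?thesis using zero that by simp
 qed
 hence "disc_mat b = 0" unfolding disc_mat_def fdet_zero_iff
  using \<open>c j \<noteq> 0\<close> j by (intro exI[of _ "\<lambda>j. of_rat (c j)"]) auto
 thus False using disc by simp
qed

section \<open>Traces and dual bases\<close>

definition tr :: "complex \<Rightarrow> complex" where "tr x = (\<Sum>i<n. emb i x)"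

lemma tr_sum: "(\<And>a. a \<in> A \<Longrightarrow> f a \<in> K) \<Longrightarrow> tr (\<Sum>a\<in>A. f a) = (\<Sum>a\<in>A. tr (f a))"
 unfolding tr_def by (simp add: emb_sum) (rule sum.swap)

lemma tr_of_rat_mult: "x \<in> K \<Longrightarrow> tr (of_rat c * x) = of_rat c * tr x"
 by (simp add: tr_def emb_mult emb_of_rat K_of_rat sum_distrib_left)

text \<open>The matrix \<open>M\<close> of conjugates of the powers of \<open>t\<close> diagonalizes
  multiplication by \<open>x\<close>, so the sum of conjugates is the trace of the rational matrix
  of this multiplication in the basis of powers.\<close>

lemma tr_rational:
 assumes x: "x \<in> K"
 shows "tr x \<in> range of_rat"
proof -
 have "\<exists>c :: nat \<Rightarrow> rat. x * t ^ j = (\<Sum>k<n. of_rat (c k) * t ^ k)" for j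
  using expand_powers[of "x * t ^ j"] x K_closed K_power tK by metis
 then obtain a where a: "\<And>j. x * t ^ j = (\<Sum>k<n. of_rat (a j k) * t ^ k)" by metis
 define M where "M i j = emb i (t ^ j)" for i j
 have "fdet n M \<noteq> 0" using disc_powers by (simp add: disc_mat_def M_def[abs_def])
 then obtain N where N: "\<And>i j. i < n \<Longrightarrow> j < n \<Longrightarrow> (\<Sum>k<n. M i k * N k j) = (if i = j then 1 else 0)"
  "\<And>i j. i < n \<Longrightarrow> j < n \<Longrightarrow> (\<Sum>k<n. N i k * M k j) = (if i = j then 1 else 0)"
  using fdet_nonzero_inverse[of n M] by blast
 have xM: "emb i x * M i j = (\<Sum>k<n. of_rat (a j k) * M i k)" if "i < n" for i j
 proof -
  have "emb i x * M i j = emb i (x * t ^ j)" using that by (simp add: M_def emb_mult x K_power tK)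
  also have "\<dots> = (\<Sum>k<n. of_rat (a j k) * M i k)"
   unfolding a M_def using that by (simp add: emb_sum emb_mult emb_of_rat K_of_rat K_closed K_power tK)
  finally show ?thesis .
 qed
 have "tr x = (\<Sum>i<n. emb i x * (\<Sum>j<n. M i j * N j i))"
  unfolding tr_def by (intro sum.cong) (auto simp: N(1))
 also have "\<dots> = (\<Sum>i<n. \<Sum>j<n. (emb i x * M i j) * N j i)"
  by (simp add: sum_distrib_left mult_ac)
 also have "\<dots> = (\<Sum>i<n. \<Sum>j<n. \<Sum>k<n. of_rat (a j k) * M i k * N j i)"
  by (intro sum.cong refl) (simp add: xM sum_distrib_right)
 also have "\<dots> = (\<Sum>j<n. \<Sum>i<n. \<Sum>k<n. of_rat (a j k) * M i k * N j i)"
  by (rule sum.swap)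
 also have "\<dots> = (\<Sum>j<n. \<Sum>i<n. \<Sum>k<n. of_rat (a j k) * (N j i * M i k))"
  by (simp add: mult_ac)
 also have "\<dots> = (\<Sum>j<n. \<Sum>k<n. \<Sum>i<n. of_rat (a j k) * (N j i * M i k))"
  by (intro sum.cong refl sum.swap)
 also have "\<dots> = (\<Sum>j<n. \<Sum>k<n. of_rat (a j k) * (if j = k then 1 else 0))"
  by (intro sum.cong refl) (simp add: N(2) sum_distrib_left[symmetric])
 also have "\<dots> = (\<Sum>j<n. of_rat (a j j))" by (intro sum.cong refl) (simp add: if_distrib cong: if_cong)
 also have "\<dots> = of_rat (\<Sum>j<n. a j j)" by (simp add: of_rat_sum)
 finally show ?thesis by auto
qed

definition dual_pair :: "(nat \<Rightarrow> complex) \<Rightarrow> (nat \<Rightarrow> complex) \<Rightarrow> bool" where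
 "dual_pair b b' \<longleftrightarrow> (\<forall>j<n. b j \<in> K \<and> b' j \<in> K) \<and> (\<forall>i<n. \<forall>j<n. tr (b i * b' j) = (if i = j then 1 else 0))"

lemma dual_pair_sym: "dual_pair b b' \<Longrightarrow> dual_pair b' b"
 by (auto simp: dual_pair_def mult.commute)

lemma dual_pair_disc: "dual_pair b b' \<Longrightarrow> disc_mat b * disc_mat b' = 1"
proof -
 assume d: "dual_pair b b'"
 have "disc_mat b * disc_mat b' = fdet n (\<lambda>i j. emb j (b i)) * disc_mat b'"
  unfolding disc_mat_def by (subst fdet_transpose[of n "\<lambda>i j. emb j (b i)", symmetric]) simp
 also have "\<dots> = fdet n (\<lambda>i j. \<Sum>k<n. emb k (b i) * emb k (b' j))"
  unfolding disc_mat_def by (rule fdet_mult[symmetric])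
 also have "\<dots> = fdet n (\<lambda>i j. if i = j then 1 else 0)"
  using d by (intro fdet_cong) (auto simp: dual_pair_def tr_def emb_mult[symmetric])
 finally show ?thesis by (simp add: fdet_id)
qed

text \<open>The trace relations say that the two matrices of conjugates are inverse to each other in
  one order; this is the other order.\<close>

lemma dual_pair_orth:
 assumes d: "dual_pair b b'" and "i < n" "j < n"
 shows "(\<Sum>k<n. emb i (b k) * emb j (b' k)) = (if i = j then 1 else 0)"
proof -
 have "(\<Sum>k<n. emb k (b i) * emb k (b' j)) = (if i = j then 1 else 0)" if "i < n" "j < n" for i j
  using d that by (auto simp: dual_pair_def tr_def emb_mult[symmetric])
 from fdet_inverse_commute[of n "\<lambda>i k. emb k (b i)" "\<lambda>k j. emb k (b' j)", OF this assms(3,2)]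
 show ?thesis by (simp add: mult.commute eq_commute)
qed

text \<open>The Gram matrix of the trace form is rational with determinant the square of
  \<open>disc_mat b\<close>, hence invertible, and its inverse supplies the coefficients.\<close>

lemma dual_basis_exists:
 assumes b: "\<And>j. j < n \<Longrightarrow> b j \<in> K" and disc: "disc_mat b \<noteq> 0"
 obtains b' where "dual_pair b b'"
proof -
 have "\<exists>q. tr (b i * b j) = of_rat q" if "i < n" "j < n" for i j
  using tr_rational[of "b i * b j"] b that K_closed by auto
 then obtain T where T: "\<And>i j. i < n \<Longrightarrow> j < n \<Longrightarrow> tr (b i * b j) = of_rat (T i j)" by metis
 have "complex_of_rat (fdet n T) = fdet n (\<lambda>i j. \<Sum>k<n. emb k (b i) * emb k (b j))"
  unfolding of_rat_hom.fdet_hom[symmetric]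
  by (rule fdet_cong) (simp add: T[symmetric] tr_def emb_mult b)
 also have "\<dots> = disc_mat b * disc_mat b"
  unfolding fdet_mult disc_mat_def by (subst fdet_transpose[of n "\<lambda>i j. emb j (b i)", symmetric]) simp
 finally have "fdet n T \<noteq> 0" using disc by auto
 then obtain S where S: "\<And>i j. i < n \<Longrightarrow> j < n \<Longrightarrow> (\<Sum>k<n. T i k * S k j) = (if i = j then 1 else 0)"
  using fdet_nonzero_inverse by metis
 define b' where "b' j = (\<Sum>k<n. of_rat (S k j) * b k)" for j
 have b'K: "b' j \<in> K" for j unfolding b'_def by (intro K_sum K_closed K_of_rat b) auto
 have "tr (b i * b' j) = (if i = j then 1 else 0)" if ij: "i < n" "j < n" for i j
 proof -
  have "b i * b' j = (\<Sum>k<n. of_rat (S k j) * (b i * b k))" by (simp add: b'_def sum_distrib_left mult_ac)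
  hence "tr (b i * b' j) = (\<Sum>k<n. of_rat (S k j) * tr (b i * b k))"
   using ij b by (simp only:) (subst tr_sum, auto intro!: K_of_rat K_closed sum.cong tr_of_rat_mult)
  also have "\<dots> = of_rat (\<Sum>k<n. S k j * T i k)" using ij by (simp add: T of_rat_sum of_rat_mult)
  also have "(\<Sum>k<n. S k j * T i k) = (\<Sum>k<n. T i k * S k j)" by (simp add: mult.commute)
  finally show ?thesis using S[OF ij] by simp
 qed
 thus ?thesis using that[of b'] b b'K by (auto simp: dual_pair_def)
qed

lemma disc_scale:
 assumes "x \<in> K" "\<And>j. j < n \<Longrightarrow> b j \<in> K"
 shows "disc_mat (\<lambda>j. x * b j) = (\<Prod>i<n. emb i x) * disc_mat b"
 unfolding disc_mat_def fdet_scale_rows[symmetric] using assms by (intro fdet_cong) (simp add: emb_mult)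

lemma conj_index:
 assumes "i < n"
 obtains j where "j < n" "\<And>x. x \<in> K \<Longrightarrow> emb j x = cnj (emb i x)"
proof -
 have cnj_q: "cnj (qeval q z) = qeval q (cnj z)" for q z by (simp add: poly_altdef cnj_of_rat)
 have "qeval p (cnj (rs ! i)) = 0" using root[OF assms] cnj_q[of p "rs ! i"] by simp
 hence "cnj (rs ! i) \<in> set rs" by (simp add: rs(1))
 then obtain j where j: "j < n" "rs ! j = cnj (rs ! i)" unfolding in_set_conv_nth length_rs by auto
 have "emb j x = cnj (emb i x)" if x: "x \<in> K" for x
 proof -
  obtain q where "x = qeval q t" using K_qeval[OF x] by blast
  thus ?thesis using emb_qeval[OF j(1), of q] emb_qeval[OF assms, of q] j cnj_q by simp
 qed
 thus ?thesis using that j by blast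
qed

end

subsection \<open>Lattices\<close>

lemma fdet_upper_triangular:
 assumes "\<And>i j. i < n \<Longrightarrow> j < i \<Longrightarrow> f i j = 0"
 shows "fdet n f = (\<Prod>i<n. f i i)"
proof -
 let ?D = "mat n n (\<lambda>(i, j). f i j)"
 have "det ?D = prod_list (diag_mat ?D)"
  by (rule det_upper_triangular[of _ n]) (use assms in \<open>auto simp: upper_triangular_def\<close>)
 also have "\<dots> = (\<Prod>i<n. f i i)" by (simp add: prod_list_diag_prod lessThan_atLeast0)
 finally show ?thesis by (simp add: fdet_def)
qed

lemma bij_betw_quotient:
 assumes R: "equiv A R" and S: "S \<subseteq> A" and ex: "\<And>x. x \<in> A \<Longrightarrow> \<exists>s\<in>S. (x, s) \<in> R"
  and uniq: "\<And>s s'. s \<in> S \<Longrightarrow> s' \<in> S \<Longrightarrow> (s, s') \<in> R \<Longrightarrow> s = s'"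
 shows "bij_betw (\<lambda>s. R `` {s}) S (A // R)"
proof (rule bij_betw_imageI)
 show "inj_on (\<lambda>s. R `` {s}) S"
  using eq_equiv_class[OF _ R] S uniq by (intro inj_onI) blast
 show "(\<lambda>s. R `` {s}) ` S = A // R"
 proof (intro equalityI subsetI)
  fix X assume "X \<in> A // R"
  then obtain x where x: "x \<in> A" "X = R `` {x}" unfolding quotient_def by blast
  obtain s where "s \<in> S" "(x, s) \<in> R" using ex[OF x(1)] by blast
  thus "X \<in> (\<lambda>s. R `` {s}) ` S" using x equiv_class_eq[OF R] by blast
 next
  fix X assume "X \<in> (\<lambda>s. R `` {s}) ` S"
  thus "X \<in> A // R" using S by (auto intro: quotientI)
 qed
qed

context nfield
begin

definition basis :: "(nat \<Rightarrow> complex) \<Rightarrow> bool" where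
 "basis b \<longleftrightarrow> (\<forall>j<n. b j \<in> K) \<and> disc_mat b \<noteq> 0"

definition lat :: "(nat \<Rightarrow> complex) \<Rightarrow> complex set" where
 "lat b = {x. \<exists>c :: nat \<Rightarrow> int. x = (\<Sum>j<n. of_int (c j) * b j)}"

definition is_lattice :: "complex set \<Rightarrow> bool" where
 "is_lattice L \<longleftrightarrow> (\<exists>b. basis b \<and> L = lat b)"

text \<open>The basis chosen is immaterial: two bases of the same lattice are related by mutually
  inverse integral matrices, whose determinants have modulus 1.\<close>

definition covol :: "complex set \<Rightarrow> real" where
 "covol L = cmod (disc_mat (SOME b. basis b \<and> L = lat b))"

definition subgroup :: "complex set \<Rightarrow> bool" where
 "subgroup H \<longleftrightarrow> 0 \<in> H \<and> (\<forall>x\<in>H. \<forall>y\<in>H. x - y \<in> H)"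

lemma subgroup_closed:
 assumes "subgroup H"
 shows "0 \<in> H" "x \<in> H \<Longrightarrow> - x \<in> H" "x \<in> H \<Longrightarrow> y \<in> H \<Longrightarrow> x - y \<in> H" "x \<in> H \<Longrightarrow> y \<in> H \<Longrightarrow> x + y \<in> H"
  "x \<in> H \<Longrightarrow> of_nat m * x \<in> H" "x \<in> H \<Longrightarrow> of_int k * x \<in> H"
proof -
 show *: "0 \<in> H" "x \<in> H \<Longrightarrow> y \<in> H \<Longrightarrow> x - y \<in> H" for x y using assms by (auto simp: subgroup_def)
 show u: "x \<in> H \<Longrightarrow> - x \<in> H" for x using *(2)[OF *(1), of x] by simp
 show a: "x \<in> H \<Longrightarrow> y \<in> H \<Longrightarrow> x + y \<in> H" for x y using *(2)[OF _ u, of x y] by simp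
 have m: "of_nat m * x \<in> H" if "x \<in> H" for m x
  using that by (induction m) (auto simp: * a distrib_right)
 thus "x \<in> H \<Longrightarrow> of_nat m * x \<in> H" by blast
 show "x \<in> H \<Longrightarrow> of_int k * x \<in> H"
  using m[of x "nat k"] u[OF m[of x "nat (- k)"]] by (cases "k \<ge> 0") auto
qed

lemma subgroup_sum: "subgroup H \<Longrightarrow> (\<And>i. i \<in> I \<Longrightarrow> f i \<in> H) \<Longrightarrow> (\<Sum>i\<in>I. f i) \<in> H"
 by (induction I rule: infinite_finite_induct) (auto intro: subgroup_closed)

lemma basis_K: "basis b \<Longrightarrow> j < n \<Longrightarrow> b j \<in> K"
 by (simp add: basis_def)

lemma latE:
 assumes "x \<in> lat b"
 obtains c :: "nat \<Rightarrow> int" where "x = (\<Sum>j<n. of_int (c j) * b j)"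
 using assms unfolding lat_def by blast

lemma lat_subset_K: "basis b \<Longrightarrow> lat b \<subseteq> K"
 using K_of_int basis_K unfolding lat_def by (auto intro!: K_sum K_closed(4))

lemma subgroup_lat: "subgroup (lat b)" unfolding subgroup_def
proof (intro conjI ballI)
 show "0 \<in> lat b" unfolding lat_def by (rule CollectI, rule exI[of _ "\<lambda>_. 0"]) simp
 fix x y assume "x \<in> lat b" "y \<in> lat b"
 then obtain c d :: "nat \<Rightarrow> int" where "x = (\<Sum>j<n. of_int (c j) * b j)" "y = (\<Sum>j<n. of_int (d j) * b j)"
  by (auto simp: lat_def)
 thus "x - y \<in> lat b" unfolding lat_def
  by (intro CollectI exI[of _ "\<lambda>j. c j - d j"]) (simp add: left_diff_distrib sum_subtractf)
qed

lemma basis_in_lat: "j < n \<Longrightarrow> b j \<in> lat b"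
 unfolding lat_def by (rule CollectI, rule exI[of _ "\<lambda>i. if i = j then 1 else 0"]) (simp add: if_distrib[of of_int] if_distrib[of "\<lambda>y. y * _"] cong: if_cong)

lemma lat_subset: "subgroup H \<Longrightarrow> (\<And>j. j < n \<Longrightarrow> b j \<in> H) \<Longrightarrow> lat b \<subseteq> H"
 by (auto simp: lat_def intro!: subgroup_sum subgroup_closed(6))

lemma lat_coeffs:
 assumes "\<And>j. j < n \<Longrightarrow> b' j \<in> lat b"
 obtains c :: "nat \<Rightarrow> nat \<Rightarrow> int" where "\<And>j. j < n \<Longrightarrow> b' j = (\<Sum>k<n. of_int (c k j) * b k)"
proof -
 have "\<exists>c :: nat \<Rightarrow> int. b' j = (\<Sum>k<n. of_int (c k) * b k)" if "j < n" for j
  using assms[OF that] by (auto simp: lat_def)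
 then obtain c :: "nat \<Rightarrow> nat \<Rightarrow> int" where "\<And>j. j < n \<Longrightarrow> b' j = (\<Sum>k<n. of_int (c j k) * b k)" by metis
 thus ?thesis by (intro that[of "\<lambda>k j. c j k"]) auto
qed

lemma lat_coeffs_unique:
 assumes b: "basis b" and eq: "(\<Sum>j<n. of_int (c j) * b j) = (\<Sum>j<n. of_int (d j) * b j)" and j: "j < n"
 shows "c j = (d j :: int)"
proof -
 have "(\<Sum>j<n. of_rat (of_int (c j - d j)) * b j) = 0"
  using eq by (simp add: left_diff_distrib sum_subtractf of_rat_diff)
 hence "(of_int (c j - d j) :: rat) = 0"
  using b j by (intro disc_indep[of b "\<lambda>j. of_int (c j - d j)"]) (auto simp: basis_def)
 thus ?thesis by simp
qed

lemma disc_mat_lat_eq: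
 assumes b: "basis b" "basis b'" and eq: "lat b = lat b'"
 shows "cmod (disc_mat b) = cmod (disc_mat b')"
proof -
 obtain c :: "nat \<Rightarrow> nat \<Rightarrow> int" where c: "\<And>j. j < n \<Longrightarrow> b' j = (\<Sum>k<n. of_int (c k j) * b k)"
  using lat_coeffs[of b' b] basis_in_lat[of _ b'] eq by metis
 obtain d :: "nat \<Rightarrow> nat \<Rightarrow> int" where d: "\<And>j. j < n \<Longrightarrow> b j = (\<Sum>k<n. of_int (d k j) * b' k)"
  using lat_coeffs[of b b'] basis_in_lat[of _ b] eq by metis
 have 1: "disc_mat b' = disc_mat b * of_int (fdet n c)"
  by (rule disc_change_int) (use b c basis_K in auto)
 have 2: "disc_mat b = disc_mat b' * of_int (fdet n d)"
  by (rule disc_change_int) (use b d basis_K in auto)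
 have "disc_mat b = disc_mat b * of_int (fdet n c) * of_int (fdet n d)" using 1 2 by metis
 hence "of_int (fdet n c * fdet n d) = (1 :: complex)" using b by (simp add: basis_def mult.assoc)
 hence "fdet n c * fdet n d = 1" by (metis of_int_eq_1_iff)
 hence "\<bar>fdet n c\<bar> = 1" by (metis abs_zmult_eq_1 abs_one)
 hence "cmod (of_int (fdet n c)) = 1" by (metis norm_of_int of_int_abs of_int_1)
 thus ?thesis using 1 by (simp add: norm_mult)
qed

lemma covol_lat: "basis b \<Longrightarrow> covol (lat b) = cmod (disc_mat b)"
proof -
 assume b: "basis b"
 have "basis (SOME b'. basis b' \<and> lat b = lat b') \<and> lat b = lat (SOME b'. basis b' \<and> lat b = lat b')"
  by (rule someI[of _ b]) (use b in auto)
 thus ?thesis unfolding covol_def using disc_mat_lat_eq[OF b] by metis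
qed

lemma lattice_covol_pos: "is_lattice L \<Longrightarrow> covol L > 0"
 by (auto simp: is_lattice_def covol_lat basis_def)

lemma lattice_subset_K: "is_lattice L \<Longrightarrow> L \<subseteq> K"
 by (auto simp: is_lattice_def dest: lat_subset_K)

lemma lattice_subgroup: "is_lattice L \<Longrightarrow> subgroup L"
 by (auto simp: is_lattice_def subgroup_lat)

lemma basis_nonzero: "basis b \<Longrightarrow> j < n \<Longrightarrow> b j \<noteq> 0"
proof
 assume b: "basis b" "j < n" "b j = 0"
 have "(1 :: rat) = 0" using b disc_indep[of b "\<lambda>i. if i = j then 1 else 0" j]
  by (auto simp: basis_def if_distrib[of of_rat] if_distrib[of "\<lambda>y. y * _"] cong: if_cong)
 thus False by simp
qed

lemma lattice_nonzero: "is_lattice L \<Longrightarrow> \<exists>x\<in>L. x \<noteq> 0"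
 using basis_nonzero[OF _ n_pos] basis_in_lat[OF n_pos] by (auto simp: is_lattice_def)

lemma lattice_multiple:
 assumes L: "is_lattice L" and x: "x \<in> K"
 obtains m :: nat where "m > 0" "of_nat m * x \<in> L"
proof -
 obtain b where b: "basis b" "L = lat b" using L by (auto simp: is_lattice_def)
 obtain c :: "nat \<Rightarrow> rat" where c: "x = (\<Sum>j<n. of_rat (c j) * b j)"
  using expand_basis[of b x] b x by (auto simp: basis_def)
 define m where "m = (\<Prod>j<n. snd (quotient_of (c j)))"
 have mpos: "m > 0" unfolding m_def by (intro prod_pos) (auto intro: quotient_of_denom_pos')
 have "\<exists>k :: int. of_int m * c j = of_int k" if "j < n" for j
 proof -
  have "snd (quotient_of (c j)) dvd m" unfolding m_def using that by (intro dvd_prodI) auto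
  then obtain e where e: "m = snd (quotient_of (c j)) * e" unfolding dvd_def by blast
  have "c j = of_int (fst (quotient_of (c j))) / of_int (snd (quotient_of (c j)))"
   by (rule quotient_of_div) simp
  moreover have "snd (quotient_of (c j)) > 0" by (rule quotient_of_denom_pos')
  ultimately have "of_int m * c j = of_int (e * fst (quotient_of (c j)))" unfolding e by (simp add: field_simps)
  thus ?thesis by blast
 qed
 then obtain k where k: "\<And>j. j < n \<Longrightarrow> of_int m * c j = of_int (k j)" by metis
 have "of_int m * x = (\<Sum>j<n. of_rat (of_int m * c j) * b j)"
  by (simp add: c sum_distrib_left of_rat_mult mult_ac)
 also have "\<dots> = (\<Sum>j<n. of_int (k j) * b j)" by (intro sum.cong) (auto simp: k)
 finally have "of_int m * x \<in> L" unfolding b(2) lat_def by blast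
 thus ?thesis using mpos by (intro that[of "nat m"]) auto
qed

lemma lattice_multiple_sub:
 assumes L: "is_lattice L" and L': "is_lattice L'"
 obtains m :: nat where "m > 0" "\<And>x. x \<in> L \<Longrightarrow> of_nat m * x \<in> L'"
proof -
 obtain b where b: "basis b" "L = lat b" using L by (auto simp: is_lattice_def)
 have "\<exists>m::nat. m > 0 \<and> of_nat m * b j \<in> L'" if "j < n" for j
  using lattice_multiple[OF L' basis_K[OF b(1) that]] by metis
 then obtain m :: "nat \<Rightarrow> nat" where m: "\<And>j. j < n \<Longrightarrow> m j > 0 \<and> of_nat (m j) * b j \<in> L'" by metis
 define M where "M = (\<Prod>j<n. m j)"
 note sL' = lattice_subgroup[OF L']
 have "of_nat M * x \<in> L'" if xL: "x \<in> L" for x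
 proof -
  obtain c :: "nat \<Rightarrow> int" where c: "x = (\<Sum>j<n. of_int (c j) * b j)" using xL b(2) latE by metis
  have "of_nat M * (of_int (c j) * b j) \<in> L'" if "j < n" for j
  proof -
   have "m j dvd M" unfolding M_def using that by (intro dvd_prodI) auto
   then obtain e where e: "M = m j * e" unfolding dvd_def by blast
   have "of_nat M * (of_int (c j) * b j) = of_int (c j) * (of_nat e * (of_nat (m j) * b j))"
    by (simp add: e mult_ac)
   thus ?thesis using m[OF that] by (simp only: subgroup_closed(5,6)[OF sL'])
  qed
  thus ?thesis unfolding c sum_distrib_left by (intro subgroup_sum[OF sL']) auto
 qed
 moreover have "M > 0" unfolding M_def using m by (intro prod_pos) auto
 ultimately show ?thesis using that by blast
qed

text \<open>The relation is the one used in \<open>ideal_norm\<close>, so that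
  \<open>card (cosets OK I)\<close> is the norm of \<open>I\<close> by definition.\<close>

definition cosets :: "complex set \<Rightarrow> complex set \<Rightarrow> complex set set" where
 "cosets L H = L // {(x, y). x \<in> L \<and> y \<in> L \<and> x - y \<in> H}"

lemma equiv_cosets: "subgroup H \<Longrightarrow> equiv L {(x, y). x \<in> L \<and> y \<in> L \<and> x - y \<in> H}"
proof (rule equivI)
 assume H: "subgroup H"
 show "refl_on L {(x, y). x \<in> L \<and> y \<in> L \<and> x - y \<in> H}"
  using subgroup_closed(1)[OF H] by (auto simp: refl_on_def)
 show "sym {(x, y). x \<in> L \<and> y \<in> L \<and> x - y \<in> H}"
  using subgroup_closed(2)[OF H] by (auto simp: sym_def) (metis minus_diff_eq)
 show "trans {(x, y). x \<in> L \<and> y \<in> L \<and> x - y \<in> H}"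
  using subgroup_closed(4)[OF H] by (auto simp: trans_def) (metis diff_add_cancel add_diff_eq)
qed auto

definition vlat :: "(nat \<Rightarrow> complex) \<Rightarrow> nat \<Rightarrow> complex set" where
 "vlat b k = {x. \<exists>c :: nat \<Rightarrow> int. x = (\<Sum>j<k. of_int (c j) * b j)}"

text \<open>Hermite normal form for a subgroup \<open>H\<close> relative to the first
  \<open>k\<close> basis vectors. The columns of \<open>c\<close> give generators of the part of
  \<open>H\<close> in \<open>vlat b k\<close>, and the box below the diagonal entries is a system of
  representatives of \<open>vlat b k\<close> modulo \<open>H\<close>.\<close>

definition triangular :: "(nat \<Rightarrow> complex) \<Rightarrow> complex set \<Rightarrow> nat \<Rightarrow> (nat \<Rightarrow> nat \<Rightarrow> int) \<Rightarrow> bool" where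
 "triangular b H k c \<longleftrightarrow> (\<forall>j<k. c j j > 0) \<and> (\<forall>i j. j < i \<longrightarrow> c i j = 0) \<and>
   (\<forall>j<k. (\<Sum>i<n. of_int (c i j) * b i) \<in> H) \<and>
   (\<forall>x \<in> vlat b k. x \<in> H \<longrightarrow> (\<exists>e :: nat \<Rightarrow> int. x = (\<Sum>j<k. of_int (e j) * (\<Sum>i<n. of_int (c i j) * b i)))) \<and>
   (\<forall>x \<in> vlat b k. \<exists>r :: nat \<Rightarrow> int. (\<forall>j<k. 0 \<le> r j \<and> r j < c j j) \<and> x - (\<Sum>j<k. of_int (r j) * b j) \<in> H) \<and>
   (\<forall>r r' :: nat \<Rightarrow> int. (\<forall>j<k. 0 \<le> r j \<and> r j < c j j) \<longrightarrow> (\<forall>j<k. 0 \<le> r' j \<and> r' j < c j j) \<longrightarrow>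
    (\<Sum>j<k. of_int (r j) * b j) - (\<Sum>j<k. of_int (r' j) * b j) \<in> H \<longrightarrow> (\<forall>j<k. r j = r' j))"

lemma triangularD:
 assumes "triangular b H k c"
 shows "j < k \<Longrightarrow> c j j > 0" "j < i \<Longrightarrow> c i j = 0" "j < k \<Longrightarrow> (\<Sum>i<n. of_int (c i j) * b i) \<in> H"
  "x \<in> vlat b k \<Longrightarrow> x \<in> H \<Longrightarrow> \<exists>e :: nat \<Rightarrow> int. x = (\<Sum>j<k. of_int (e j) * (\<Sum>i<n. of_int (c i j) * b i))"
  "x \<in> vlat b k \<Longrightarrow> \<exists>r :: nat \<Rightarrow> int. (\<forall>j<k. 0 \<le> r j \<and> r j < c j j) \<and> x - (\<Sum>j<k. of_int (r j) * b j) \<in> H"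
  "(\<forall>j<k. 0 \<le> r j \<and> r j < c j j) \<Longrightarrow> (\<forall>j<k. 0 \<le> r' j \<and> r' j < c j j) \<Longrightarrow>
    (\<Sum>j<k. of_int (r j) * b j) - (\<Sum>j<k. of_int (r' j) * b j) \<in> H \<Longrightarrow> j < k \<Longrightarrow> r j = r' j"
 using assms unfolding triangular_def by simp_all

text \<open>One vector is added at a time. The multiple \<open>m\<close>, which carries the whole
  lattice into \<open>H\<close>, guarantees a nonzero pivot at every stage.\<close>

lemma triangular_basis:
 assumes b: "basis b" and H: "subgroup H" and m: "m > 0" and mH: "\<And>x. x \<in> lat b \<Longrightarrow> of_nat m * x \<in> H"
  and k: "k \<le> n"
 shows "\<exists>c. triangular b H k c" using k
proof (induction k)
 case 0
 show ?case by (intro exI[of _ "\<lambda>_ _. 0"]) (auto simp: triangular_def vlat_def subgroup_closed(1)[OF H])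
next
 case (Suc k)
 hence kn: "k < n" by simp
 from Suc.IH kn obtain c where c: "triangular b H k c" by auto
 let ?V = "vlat b k"
 have V_diff: "x - y \<in> vlat b k" if "x \<in> vlat b k" "y \<in> vlat b k" for x y
 proof -
  from that obtain c d :: "nat \<Rightarrow> int" where "x = (\<Sum>j<k. of_int (c j) * b j)" "y = (\<Sum>j<k. of_int (d j) * b j)"
   unfolding vlat_def by blast
  thus ?thesis unfolding vlat_def
   by (intro CollectI exI[of _ "\<lambda>j. c j - d j"]) (simp add: left_diff_distrib sum_subtractf)
 qed
 have V_mult: "of_int a * x \<in> vlat b k" if "x \<in> vlat b k" for x a
 proof -
  from that obtain c :: "nat \<Rightarrow> int" where "x = (\<Sum>j<k. of_int (c j) * b j)" unfolding vlat_def by blast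
  thus ?thesis unfolding vlat_def
   by (intro CollectI exI[of _ "\<lambda>j. a * c j"]) (simp add: sum_distrib_left mult_ac)
 qed
 have V_0: "0 \<in> vlat b k" unfolding vlat_def by (rule CollectI, rule exI[of _ "\<lambda>_. 0"]) simp
 have V_Suc: "x \<in> vlat b (Suc k) \<longleftrightarrow> (\<exists>y z. y \<in> vlat b k \<and> x = y + of_int z * b k)" for x
 proof
  assume "x \<in> vlat b (Suc k)"
  thus "\<exists>y z. y \<in> vlat b k \<and> x = y + of_int z * b k" unfolding vlat_def by auto
 next
  assume "\<exists>y z. y \<in> vlat b k \<and> x = y + of_int z * b k"
  then obtain c z where x: "x = (\<Sum>j<k. of_int (c j :: int) * b j) + of_int z * b k" unfolding vlat_def by blast
  show "x \<in> vlat b (Suc k)" unfolding vlat_def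
   by (rule CollectI, rule exI[of _ "c(k := z)"]) (simp add: x)
 qed
 \<comment> \<open>The possible coordinates at \<open>b k\<close> of elements of \<open>H\<close> in
   the span of the first \<open>k + 1\<close> vectors. They are closed under integral combinations,
   so the least positive one divides all others and becomes the pivot.\<close>
 define D where "D z \<longleftrightarrow> (\<exists>y\<in>vlat b k. y + of_int z * b k \<in> H)" for z :: int
 have Dm: "D (int m)"
  unfolding D_def using V_0 mH[OF basis_in_lat[OF kn, of b]] by (intro bexI[of _ 0]) auto
 have D_comb: "D (z - a * w)" if Dz: "D z" "D w" for z a w
 proof -
  obtain y y' where y: "y \<in> vlat b k" "y + of_int z * b k \<in> H" "y' \<in> vlat b k" "y' + of_int w * b k \<in> H"
   using Dz by (auto simp: D_def)
  have "(y - of_int a * y') + of_int (z - a * w) * b k = (y + of_int z * b k) - of_int a * (y' + of_int w * b k)"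
   unfolding of_int_diff of_int_mult left_diff_distrib right_diff_distrib distrib_left by simp
  also have "\<dots> \<in> H" by (intro subgroup_closed(3,6)[OF H] y)
  finally show ?thesis unfolding D_def using V_diff[OF y(1) V_mult[OF y(3)]] by blast
 qed
 define d where "d = (LEAST d::nat. d > 0 \<and> D (int d))"
 have d: "d > 0" "D (int d)" using LeastI[of "\<lambda>d. d > 0 \<and> D (int d)" m] m Dm by (auto simp: d_def)
 have dvd: "int d dvd z" if "D z" for z
 proof -
  have "D (z - (z div int d) * int d)" by (rule D_comb[OF that d(2)])
  hence "D (z mod int d)" by (simp add: minus_div_mult_eq_mod)
  hence "D (int (nat (z mod int d)))" using d by simp
  hence "\<not> nat (z mod int d) > 0"
   using not_less_Least[of "nat (z mod int d)" "\<lambda>d. d > 0 \<and> D (int d)"] d(1) unfolding d_def[symmetric]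
   by (metis nat_less_iff pos_mod_bound pos_mod_sign of_nat_0_less_iff)
  hence "z mod int d = 0" using d(1) by (metis nat_eq_iff2 gr0I pos_mod_sign of_nat_0_less_iff of_nat_0)
  thus ?thesis by auto
 qed
 obtain y0 where y0: "y0 \<in> vlat b k" "y0 + of_int (int d) * b k \<in> H" using d(2) by (auto simp: D_def)
 obtain g :: "nat \<Rightarrow> int" where g: "y0 = (\<Sum>j<k. of_int (g j) * b j)" using y0(1) unfolding vlat_def by blast
 \<comment> \<open>The new column is an element of \<open>H\<close> realizing the pivot:
   coefficients \<open>g\<close> above the diagonal, \<open>d\<close> on it, zeros below.\<close>
 define c' where "c' i j = (if j < k then c i j else if j = k then (if i < k then g i else if i = k then int d else 0) else 0)" for i j
 have h_old: "(\<Sum>i<n. of_int (c' i j) * b i) = (\<Sum>i<n. of_int (c i j) * b i)" if "j < k" for j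
  using that by (simp add: c'_def)
 have h_new: "(\<Sum>i<n. of_int (c' i k) * b i) = y0 + of_int (int d) * b k"
 proof -
  have "(\<Sum>i<n. of_int (c' i k) * b i) = (\<Sum>i<Suc k. of_int (c' i k) * b i)"
   using kn by (intro sum.mono_neutral_right) (auto simp: c'_def)
  also have "\<dots> = y0 + of_int (int d) * b k" by (simp add: c'_def g)
  finally show ?thesis .
 qed
 let ?h = "\<lambda>j. \<Sum>i<n. of_int (c' i j) * b i"
 show ?case unfolding triangular_def
 proof (rule exI[of _ c'], intro conjI allI impI ballI)
  show "c' j j > 0" if "j < Suc k" for j using that triangularD(1)[OF c] d(1) by (auto simp: c'_def less_Suc_eq)
  show "c' i j = 0" if "j < i" for i j using that triangularD(2)[OF c] by (auto simp: c'_def)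
  show "?h j \<in> H" if "j < Suc k" for j
   using that y0(2) triangularD(3)[OF c] by (auto simp: less_Suc_eq h_new h_old)
 next
  fix x assume "x \<in> vlat b (Suc k)" "x \<in> H"
  then obtain y z where x: "x \<in> H" "y \<in> vlat b k" "x = y + of_int z * b k" using V_Suc by auto
  hence "D z" by (auto simp: D_def)
  then obtain a where a: "z = int d * a" using dvd by (auto elim: dvdE)
  have "x - of_int a * ?h k = y - of_int a * y0" unfolding h_new x(3) a by (simp add: algebra_simps)
  moreover have "x - of_int a * ?h k \<in> H" unfolding h_new by (intro subgroup_closed[OF H] x y0)
  ultimately have "y - of_int a * y0 \<in> H" "y - of_int a * y0 \<in> vlat b k" using V_diff[OF x(2) V_mult[OF y0(1)]] by auto
  then obtain e :: "nat \<Rightarrow> int" where e: "y - of_int a * y0 = (\<Sum>j<k. of_int (e j) * (\<Sum>i<n. of_int (c i j) * b i))" using triangularD(4)[OF c] by blast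
  have "x = (y - of_int a * y0) + of_int a * ?h k" unfolding h_new x(3) a by (simp add: algebra_simps)
  also have "\<dots> = (\<Sum>j<Suc k. of_int ((e(k := a)) j) * ?h j)" by (simp add: e h_old)
  finally show "\<exists>e :: nat \<Rightarrow> int. x = (\<Sum>j<Suc k. of_int (e j) * ?h j)" by blast
 next
  fix x assume "x \<in> vlat b (Suc k)"
  then obtain y z where x: "y \<in> vlat b k" "x = y + of_int z * b k" using V_Suc by auto
  define a where "a = z div int d"
  define r where "r = z mod int d"
  have z: "z = a * int d + r" by (simp add: a_def r_def)
  have r: "0 \<le> r" "r < int d" using d(1) by (auto simp: r_def)
  obtain s :: "nat \<Rightarrow> int" where s: "\<And>j. j < k \<Longrightarrow> 0 \<le> s j \<and> s j < c j j" "y - of_int a * y0 - (\<Sum>j<k. of_int (s j) * b j) \<in> H"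
   using triangularD(5)[OF c V_diff[OF x(1) V_mult[OF y0(1)]]] by blast
  have "x - (\<Sum>j<Suc k. of_int ((s(k := r)) j) * b j) = (y - of_int a * y0 - (\<Sum>j<k. of_int (s j) * b j)) + of_int a * (y0 + of_int (int d) * b k)"
   by (simp add: x z algebra_simps)
  also have "\<dots> \<in> H" by (intro subgroup_closed[OF H] s y0)
  finally show "\<exists>r :: nat \<Rightarrow> int. (\<forall>j<Suc k. 0 \<le> r j \<and> r j < c' j j) \<and> x - (\<Sum>j<Suc k. of_int (r j) * b j) \<in> H"
   using s(1) r by (intro exI[of _ "s(k := r)"] conjI) (auto simp: less_Suc_eq c'_def)
 next
  fix r r' :: "nat \<Rightarrow> int" and j
  assume A: "\<forall>j<Suc k. 0 \<le> r j \<and> r j < c' j j" "\<forall>j<Suc k. 0 \<le> r' j \<and> r' j < c' j j"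
    "(\<Sum>j<Suc k. of_int (r j) * b j) - (\<Sum>j<Suc k. of_int (r' j) * b j) \<in> H" and j: "j < Suc k"
  have V1: "(\<Sum>j<k. of_int (r j) * b j) - (\<Sum>j<k. of_int (r' j) * b j) \<in> vlat b k"
   by (intro V_diff) (auto simp: vlat_def)
  have eq: "(\<Sum>j<Suc k. of_int (r j) * b j) - (\<Sum>j<Suc k. of_int (r' j) * b j)
   = ((\<Sum>j<k. of_int (r j) * b j) - (\<Sum>j<k. of_int (r' j) * b j)) + of_int (r k - r' k) * b k"
   by (simp add: algebra_simps)
  hence "D (r k - r' k)" unfolding D_def using V1 A(3) by (intro bexI[OF _ V1]) (simp only:)
  hence "int d dvd r k - r' k" by (rule dvd)
  moreover have "\<bar>r k - r' k\<bar> < int d" using A(1)[rule_format, of k] A(2)[rule_format, of k] unfolding c'_def by (simp add: abs_less_iff)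
  ultimately have rk: "r k = r' k"
   using dvd_imp_le_int[of "r k - r' k" "int d"] by (cases "r k = r' k") auto
  show "r j = r' j"
  proof (cases "j = k")
   case False
   hence "j < k" using j by simp
   show ?thesis
   proof (rule triangularD(6)[OF c])
    show "\<forall>j<k. 0 \<le> r j \<and> r j < c j j" using A(1) by (auto simp: c'_def less_Suc_eq)
    show "\<forall>j<k. 0 \<le> r' j \<and> r' j < c j j" using A(2) by (auto simp: c'_def less_Suc_eq)
    show "(\<Sum>j<k. of_int (r j) * b j) - (\<Sum>j<k. of_int (r' j) * b j) \<in> H" using A(3) eq rk by simp
   qed fact
  qed (use rk in auto)
 qed
qed

text \<open>The product of the diagonal entries of the normal form is at once the determinant of the
  change of basis and the number of points in the box of representatives. The lattice
  \<open>L'\<close> inside \<open>H\<close> ensures full rank.\<close>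

theorem sublattice:
 assumes L: "is_lattice L" and H: "subgroup H" "H \<subseteq> L" and L': "is_lattice L'" "L' \<subseteq> H"
 shows "is_lattice H" and "card (cosets L H) > 0" and "covol H = real (card (cosets L H)) * covol L"
proof -
 obtain b where b: "basis b" "L = lat b" using L by (auto simp: is_lattice_def)
 obtain m :: nat where m: "m > 0" "\<And>x. x \<in> lat b \<Longrightarrow> of_nat m * x \<in> H"
  using lattice_multiple_sub[OF L L'(1)] L'(2) unfolding b(2) by (metis subsetD)
 from triangular_basis[OF b(1) H(1) m, of n] obtain c where tri: "triangular b H n c" by auto
 have Lv: "L = vlat b n" by (simp add: b(2) lat_def vlat_def)
 note c = triangularD[OF tri, folded Lv]
 define h where "h j = (\<Sum>i<n. of_int (c i j) * b i)" for j
 have disc: "disc_mat h = disc_mat b * of_int (\<Prod>j<n. c j j)"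
 proof -
  have "disc_mat h = disc_mat b * of_int (fdet n c)"
   by (rule disc_change_int) (auto simp: h_def basis_K[OF b(1)])
  also have "fdet n c = (\<Prod>j<n. c j j)" by (rule fdet_upper_triangular) (use c(2) in auto)
  finally show ?thesis .
 qed
 have ppos: "(\<Prod>j<n. c j j) > 0" by (intro prod_pos c(1)) simp
 have hb: "basis h" unfolding basis_def
 proof (intro conjI allI impI)
  show "h j \<in> K" for j unfolding h_def by (intro K_sum K_closed(4) K_of_int basis_K[OF b(1)]) simp
  show "disc_mat h \<noteq> 0" unfolding disc using ppos b(1)
   by (metis basis_def less_irrefl mult_eq_0_iff of_int_0_eq_iff)
 qed
 have Hh: "H = lat h"
 proof
  show "H \<subseteq> lat h" using c(4) H(2) unfolding lat_def h_def by blast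
  show "lat h \<subseteq> H" by (rule lat_subset[OF H(1)]) (use c(3) in \<open>auto simp: h_def\<close>)
 qed
 thus "is_lattice H" using hb by (auto simp: is_lattice_def)
 define R where "R = PiE {..<n} (\<lambda>j. {0..<c j j})"
 define S where "S = (\<lambda>r. \<Sum>j<n. of_int (r j) * b j) ` R"
 have cardS: "int (card S) = (\<Prod>j<n. c j j)"
 proof -
  have "inj_on (\<lambda>r. \<Sum>j<n. of_int (r j) * b j) R"
  proof (rule inj_onI)
   fix r r' assume r: "r \<in> R" "r' \<in> R" "(\<Sum>j<n. of_int (r j) * b j) = (\<Sum>j<n. of_int (r' j) * b j)"
   have "r j = r' j" if "j < n" for j by (rule lat_coeffs_unique[OF b(1) r(3) that])
   thus "r = r'" using r(1,2) unfolding R_def by (intro PiE_ext) auto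
  qed
  hence "card S = (\<Prod>j<n. card {0..<c j j})" unfolding S_def R_def by (simp add: card_image card_PiE)
  thus ?thesis using c(1) by (simp add: less_imp_le)
 qed
 have "bij_betw (\<lambda>s. {(x, y). x \<in> L \<and> y \<in> L \<and> x - y \<in> H} `` {s}) S (cosets L H)"
  unfolding cosets_def
 proof (rule bij_betw_quotient[OF equiv_cosets[OF H(1)]])
  show SL: "S \<subseteq> L" by (auto simp: S_def b(2) lat_def)
  fix x assume x: "x \<in> L"
  obtain r :: "nat \<Rightarrow> int" where r: "\<And>j. j < n \<Longrightarrow> 0 \<le> r j \<and> r j < c j j" "x - (\<Sum>j<n. of_int (r j) * b j) \<in> H"
   using c(5)[OF x] by metis
  have "(\<Sum>j<n. of_int (r j) * b j) \<in> S" unfolding S_def R_def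
   by (rule image_eqI[of _ _ "restrict r {..<n}"]) (use r(1) in auto)
  thus "\<exists>s\<in>S. (x, s) \<in> {(x, y). x \<in> L \<and> y \<in> L \<and> x - y \<in> H}" using r(2) x SL by blast
 next
  fix s s' assume "s \<in> S" "s' \<in> S" "(s, s') \<in> {(x, y). x \<in> L \<and> y \<in> L \<and> x - y \<in> H}"
  then obtain r r' where r: "r \<in> R" "r' \<in> R" "s = (\<Sum>j<n. of_int (r j) * b j)" "s' = (\<Sum>j<n. of_int (r' j) * b j)" "s - s' \<in> H"
   by (auto simp: S_def)
  have "r j = r' j" if "j < n" for j
   by (rule c(6)[of r r']) (use r that in \<open>auto simp: R_def PiE_iff\<close>)
  thus "s = s'" using r by simp
 qed
 hence "card (cosets L H) = card S" by (simp add: bij_betw_same_card)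
 hence *: "int (card (cosets L H)) = (\<Prod>j<n. c j j)" using cardS by simp
 thus "card (cosets L H) > 0" using ppos by linarith
 have "real (card (cosets L H)) = of_int (\<Prod>j<n. c j j)" using * by (metis of_int_of_nat_eq)
 thus "covol H = real (card (cosets L H)) * covol L"
  unfolding Hh b(2) covol_lat[OF hb] covol_lat[OF b(1)] disc using ppos
  by (simp add: norm_mult mult.commute del: of_int_prod)
qed

text \<open>The dual for the trace form, without complex conjugation. For \<open>OK\<close> it is
  the inverse different.\<close>

definition Dual :: "complex set \<Rightarrow> complex set" where
 "Dual L = {x \<in> K. \<forall>y\<in>L. tr (x * y) \<in> \<int>}"

lemma dual_pair_basis: "dual_pair b b' \<Longrightarrow> basis b'" "dual_pair b b' \<Longrightarrow> basis b"
 using dual_pair_disc[of b b'] by (auto simp: basis_def dual_pair_def)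

lemma Dual_lat:
 assumes d: "dual_pair b b'"
 shows "Dual (lat b) = lat b'"
proof
 note bb = dual_pair_basis[OF d]
 have K: "b j \<in> K" "b' j \<in> K" if "j < n" for j using that d by (auto simp: dual_pair_def)
 have comb: "tr ((\<Sum>i<n. of_rat (c i) * b' i) * b j) = of_rat (c j)" if "j < n" for c j
 proof -
  have "tr ((\<Sum>i<n. of_rat (c i) * b' i) * b j) = tr (\<Sum>i<n. of_rat (c i) * (b' i * b j))"
   by (simp only: sum_distrib_right mult.assoc)
  also have "\<dots> = (\<Sum>i<n. of_rat (c i) * tr (b' i * b j))"
   using that K by (subst tr_sum) (auto intro!: K_closed K_of_rat sum.cong tr_of_rat_mult)
  also have "\<dots> = (\<Sum>i<n. of_rat (c i) * (if i = j then 1 else 0))"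
   using d that by (intro sum.cong) (auto simp: dual_pair_def mult.commute)
  also have "\<dots> = of_rat (c j)" using that by (simp add: if_distrib cong: if_cong)
  finally show ?thesis .
 qed
 show "Dual (lat b) \<subseteq> lat b'"
 proof
  fix x assume x: "x \<in> Dual (lat b)"
  then obtain c :: "nat \<Rightarrow> rat" where c: "x = (\<Sum>j<n. of_rat (c j) * b' j)"
   using expand_basis[of b' x] bb by (auto simp: basis_def Dual_def)
  have "\<exists>k::int. c j = of_int k" if "j < n" for j
  proof -
   have "complex_of_rat (c j) \<in> \<int>" using x basis_in_lat[OF that, of b] comb[OF that, of c] by (auto simp: Dual_def c)
   thus ?thesis by (metis Ints_cases of_rat_eq_iff of_rat_of_int_eq)
  qed
  then obtain k where k: "\<And>j. j < n \<Longrightarrow> c j = of_int (k j)" by metis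
  hence "x = (\<Sum>j<n. of_int (k j) * b' j)" unfolding c by (intro sum.cong) auto
  thus "x \<in> lat b'" by (auto simp: lat_def)
 qed
 show "lat b' \<subseteq> Dual (lat b)"
 proof
  fix x assume "x \<in> lat b'"
  then obtain k :: "nat \<Rightarrow> int" where k: "x = (\<Sum>j<n. of_int (k j) * b' j)" by (auto simp: lat_def)
  have xK: "x \<in> K" unfolding k using K by (intro K_sum K_closed K_of_int) auto
  have trx: "tr (x * b j) = of_int (k j)" if "j < n" for j
   using comb[OF that, of "\<lambda>j. of_int (k j)"] by (simp add: k)
  have "tr (x * y) \<in> \<int>" if yb: "y \<in> lat b" for y
  proof -
   obtain e :: "nat \<Rightarrow> int" where e: "y = (\<Sum>j<n. of_int (e j) * b j)" using yb latE by metis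
   have "x * y = (\<Sum>j<n. of_rat (of_int (e j)) * (x * b j))" by (simp add: e sum_distrib_left mult_ac)
   also have "tr \<dots> = (\<Sum>j<n. of_rat (of_int (e j)) * tr (x * b j))"
    using K xK by (subst tr_sum) (auto intro!: K_closed K_of_rat K_of_int sum.cong tr_of_rat_mult simp del: of_rat_of_int_eq)
   also have "\<dots> = (\<Sum>j<n. of_int (e j * k j))" by (intro sum.cong) (auto simp: trx)
   finally show ?thesis by (auto simp del: of_int_mult simp flip: of_int_sum)
  qed
  thus "x \<in> Dual (lat b)" using xK by (auto simp: Dual_def)
 qed
qed

lemma Dual_lattice:
 assumes "is_lattice L"
 shows "is_lattice (Dual L)" "Dual (Dual L) = L" "covol (Dual L) = 1 / covol L"
proof -
 obtain b where b: "basis b" "L = lat b" using assms by (auto simp: is_lattice_def)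
 obtain b' where d: "dual_pair b b'" using dual_basis_exists[of b] b by (auto simp: basis_def)
 show "is_lattice (Dual L)" using Dual_lat[OF d] dual_pair_basis[OF d] b by (auto simp: is_lattice_def)
 show "Dual (Dual L) = L" using Dual_lat[OF d] Dual_lat[OF dual_pair_sym[OF d]] b by simp
 show "covol (Dual L) = 1 / covol L"
  using Dual_lat[OF d] dual_pair_disc[OF d] dual_pair_basis[OF d] b
  by (simp add: covol_lat) (metis nonzero_eq_divide_eq norm_mult norm_one mult.commute norm_eq_zero basis_def)
qed

definition scale :: "complex \<Rightarrow> complex set \<Rightarrow> complex set" where
 "scale x L = (\<lambda>y. x * y) ` L"

lemma scale_lattice:
 assumes L: "is_lattice L" and x: "x \<in> K" "x \<noteq> 0"
 shows "is_lattice (scale x L)" "covol (scale x L) = cmod (\<Prod>i<n. emb i x) * covol L"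
  "Dual (scale x L) = scale (inverse x) (Dual L)"
proof -
 obtain b where b: "basis b" "L = lat b" using L by (auto simp: is_lattice_def)
 let ?b = "\<lambda>j. x * b j"
 have disc: "disc_mat ?b = (\<Prod>i<n. emb i x) * disc_mat b" by (rule disc_scale) (use x basis_K[OF b(1)] in auto)
 have bb: "basis ?b"
  using b(1) x unfolding basis_def disc by (auto intro!: K_closed simp: emb_nonzero)
 have sc: "scale x L = lat ?b"
 proof -
  have *: "x * (\<Sum>j<n. of_int (c j) * b j) = (\<Sum>j<n. of_int (c j) * (x * b j))" for c :: "nat \<Rightarrow> int"
   by (simp add: sum_distrib_left mult_ac)
  have "scale x (lat b) = {z. \<exists>c :: nat \<Rightarrow> int. z = x * (\<Sum>j<n. of_int (c j) * b j)}"
   unfolding scale_def lat_def by blast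
  with * show ?thesis unfolding b(2) lat_def by simp
 qed
 show "is_lattice (scale x L)" using bb sc by (auto simp: is_lattice_def)
 show "covol (scale x L) = cmod (\<Prod>i<n. emb i x) * covol L"
  using sc covol_lat[OF bb] covol_lat[OF b(1)] unfolding disc b(2) by (simp add: norm_mult)
 show "Dual (scale x L) = scale (inverse x) (Dual L)"
 proof (intro equalityI subsetI)
  fix z assume "z \<in> Dual (scale x L)"
  hence "z \<in> K" "\<And>y. y \<in> L \<Longrightarrow> tr ((x * z) * y) \<in> \<int>" by (auto simp: Dual_def scale_def mult_ac)
  hence "x * z \<in> Dual L" using x by (auto simp: Dual_def K_closed)
  thus "z \<in> scale (inverse x) (Dual L)" unfolding scale_def
   by (intro image_eqI[of _ _ "x * z"]) (use x in auto)
 next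
  fix z assume "z \<in> scale (inverse x) (Dual L)"
  then obtain w where w: "z = inverse x * w" "w \<in> Dual L" by (auto simp: scale_def)
  hence "z \<in> K" using x by (auto simp: Dual_def K_closed)
  moreover have "tr (z * (x * y)) \<in> \<int>" if "y \<in> L" for y
  proof -
   have 1: "z * (x * y) = w * y" using w x by simp
   have "tr (w * y) \<in> \<int>" using w that by (auto simp: Dual_def)
   thus ?thesis by (simp only: 1)
  qed
  ultimately show "z \<in> Dual (scale x L)" by (auto simp: Dual_def scale_def)
 qed
qed

end

subsection \<open>Fractional ideals\<close>

context nfield
begin

abbreviation OK :: "complex set" where "OK \<equiv> ring_of_integers K"

abbreviation Ids :: "complex set set" where "Ids \<equiv> nonzero_ideals K"

abbreviation Nm :: "complex set \<Rightarrow> nat" where "Nm \<equiv> ideal_norm K"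

lemma OK_subset_K: "OK \<subseteq> K" by (auto simp: ring_of_integers_def)

lemma OK_closed:
 "0 \<in> OK" "1 \<in> OK" "of_int k \<in> OK" "x \<in> OK \<Longrightarrow> y \<in> OK \<Longrightarrow> x + y \<in> OK" "x \<in> OK \<Longrightarrow> y \<in> OK \<Longrightarrow> x * y \<in> OK"
 "x \<in> OK \<Longrightarrow> - x \<in> OK" "x \<in> OK \<Longrightarrow> y \<in> OK \<Longrightarrow> x - y \<in> OK" "x \<in> OK \<Longrightarrow> x ^ m \<in> OK"
proof -
 show i: "of_int k \<in> OK" for k using K_of_int by (simp add: ring_of_integers_def)
 show "0 \<in> OK" and o: "1 \<in> OK" using i[of 0] i[of 1] by simp_all
 show a: "x \<in> OK \<Longrightarrow> y \<in> OK \<Longrightarrow> x + y \<in> OK" and m: "x \<in> OK \<Longrightarrow> y \<in> OK \<Longrightarrow> x * y \<in> OK" for x y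
  by (simp_all add: ring_of_integers_def K_closed algebraic_integer_add_mult)
 show u: "x \<in> OK \<Longrightarrow> - x \<in> OK" for x by (simp add: ring_of_integers_def K_closed algebraic_integer_uminus)
 show "x \<in> OK \<Longrightarrow> y \<in> OK \<Longrightarrow> x - y \<in> OK" for x y using a[OF _ u, of x y] by simp
 show "x \<in> OK \<Longrightarrow> x ^ m \<in> OK" for x m by (induction m) (auto intro: o m)
qed

lemma subgroup_OK: "subgroup OK" by (auto simp: subgroup_def intro: OK_closed)

lemma Zspan_basis: "Zmod.span (b ` {..<n}) = lat b"
proof
 show "Zmod.span (b ` {..<n}) \<subseteq> lat b"
 proof
  fix x assume "x \<in> Zmod.span (b ` {..<n})"
  thus "x \<in> lat b"
  proof (induction rule: Zmod.span_induct_alt)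
   case base
   thus ?case by (rule subgroup_closed(1)[OF subgroup_lat])
  next
   case (step c x y)
   thus ?case by (intro subgroup_closed(4,6)[OF subgroup_lat]) (auto intro: basis_in_lat)
  qed
 qed
 show "lat b \<subseteq> Zmod.span (b ` {..<n})"
 proof
  fix x assume "x \<in> lat b"
  then obtain c :: "nat \<Rightarrow> int" where "x = (\<Sum>j<n. of_int (c j) * b j)" unfolding lat_def by blast
  thus "x \<in> Zmod.span (b ` {..<n})"
   by (simp only:) (intro Zmod.span_sum Zmod.span_scale Zmod.span_base imageI)
 qed
qed

lemma stable_lattice_integral:
 assumes L: "is_lattice L" and st: "\<And>y. y \<in> L \<Longrightarrow> x * y \<in> L"
 shows "algebraic_integer x"
proof -
 obtain b where b: "basis b" "L = lat b" using L by (auto simp: is_lattice_def)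
 show ?thesis
 proof (rule algebraic_integer_if_stable[of "b ` {..<n}" "b 0"])
  show "x * s \<in> Zmod.span (b ` {..<n})" if "s \<in> b ` {..<n}" for s
   unfolding Zspan_basis using that st b(2) basis_in_lat by auto
 qed (use n_pos basis_nonzero[OF b(1) n_pos] in auto)
qed

lemma basis_powers: "basis (\<lambda>j. t ^ j)" by (simp add: basis_def disc_powers K_power tK)

text \<open>If \<open>m\<close> carries \<open>x * L\<close> into \<open>L\<close>, for the lattice
  \<open>L\<close> of the powers of \<open>t\<close>, then multiplication by \<open>m * x\<close>
  stabilizes \<open>L\<close>, and the determinant trick applies.\<close>

lemma integral_multiple:
 assumes x: "x \<in> K"
 obtains m :: nat where "m > 0" "of_nat m * x \<in> OK"
proof -
 define L where "L = lat (\<lambda>j. t ^ j)"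
 have L: "is_lattice L" using basis_powers by (auto simp: is_lattice_def L_def)
 show ?thesis
 proof (cases "x = 0")
  case True
  thus ?thesis using that[of 1] OK_closed(1) by simp
 next
  case False
  obtain m :: nat where m: "m > 0" "\<And>y. y \<in> scale x L \<Longrightarrow> of_nat m * y \<in> L"
   using lattice_multiple_sub[OF scale_lattice(1)[OF L x False] L] by blast
  have "algebraic_integer (of_nat m * x)"
  proof (rule stable_lattice_integral[OF L])
   show "of_nat m * x * y \<in> L" if y: "y \<in> L" for y
   proof -
    have "x * y \<in> scale x L" unfolding scale_def using y by (rule imageI)
    thus ?thesis using m(2) by (simp add: mult.assoc)
   qed
  qed
  thus ?thesis using that[of m] m(1) x by (simp add: ring_of_integers_def K_closed subfield_of_nat[OF F])
 qed
qed

lemma tr_integral: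
 assumes "x \<in> OK"
 shows "tr x \<in> \<int>"
proof -
 have x: "x \<in> K" "algebraic_integer x" using assms by (auto simp: ring_of_integers_def)
 obtain p :: "int poly" where p: "lead_coeff p = 1" "poly (map_poly of_int p) x = 0"
  using x(2) by (auto simp: algebraic_integer_def)
 have "algebraic_integer (emb i x)" if i: "i < n" for i
 proof -
  have "emb i (poly (map_poly of_int p) x) = poly (map_poly of_int p) (emb i x)"
   unfolding poly_altdef using i x(1)
   by (subst emb_sum) (auto simp: emb_mult emb_power K_of_int K_power intro!: K_closed)
  thus ?thesis using p i unfolding algebraic_integer_def by (intro exI[of _ p]) auto
 qed
 hence a: "algebraic_integer (tr x)" unfolding tr_def by (intro algebraic_integer_sum) auto
 obtain q where q: "tr x = of_rat q" using tr_rational[OF x(1)] by auto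
 hence "q \<in> \<int>" using algebraic_integer_of_rat a by simp
 thus ?thesis unfolding q by (auto elim!: Ints_cases)
qed

text \<open>The integers are caught between two lattices: they contain one spanned by integral
  multiples of the powers of \<open>t\<close>, and they lie in its trace dual because traces of
  integers are integers.\<close>

lemma OK_lattice: "is_lattice OK"
proof -
 have "\<exists>m::nat. m > 0 \<and> of_nat m * t ^ j \<in> OK" for j
  using integral_multiple[OF K_power[OF tK]] by metis
 then obtain m :: "nat \<Rightarrow> nat" where m: "\<And>j. m j > 0 \<and> of_nat (m j) * t ^ j \<in> OK" by metis
 define w where "w j = of_nat (m j) * t ^ j" for j
 have wK: "w j \<in> K" for j using m OK_subset_K by (auto simp: w_def)
 have "disc_mat w = disc_mat (\<lambda>j. t ^ j) * of_int (fdet n (\<lambda>k j. if k = j then int (m k) else 0))"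
  by (rule disc_change_int) (auto simp: K_power tK w_def if_distrib[of of_int] if_distrib[of "\<lambda>y. y * _"] cong: if_cong)
 hence "disc_mat w \<noteq> 0" using disc_powers m by (auto simp: fdet_diag simp del: of_int_prod)
 hence w: "basis w" using wK by (simp add: basis_def)
 have lw: "is_lattice (lat w)" using w by (auto simp: is_lattice_def)
 have sub: "lat w \<subseteq> OK" by (rule lat_subset[OF subgroup_OK]) (use m in \<open>auto simp: w_def\<close>)
 have "OK \<subseteq> Dual (lat w)"
  using OK_subset_K sub tr_integral OK_closed(5) by (auto simp: Dual_def)
 thus ?thesis by (rule sublattice(1)[OF Dual_lattice(1)[OF lw] subgroup_OK _ lw sub])
qed

definition frac :: "complex set \<Rightarrow> bool" where
 "frac a \<longleftrightarrow> is_lattice a \<and> (\<forall>r\<in>OK. \<forall>x\<in>a. r * x \<in> a)"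

lemma frac_OK: "frac OK" by (simp add: frac_def OK_lattice OK_closed)

lemma frac_lattice: "frac a \<Longrightarrow> is_lattice a" by (simp add: frac_def)

lemma frac_mult: "frac a \<Longrightarrow> r \<in> OK \<Longrightarrow> x \<in> a \<Longrightarrow> r * x \<in> a" by (simp add: frac_def)

lemma frac_K: "frac a \<Longrightarrow> x \<in> a \<Longrightarrow> x \<in> K" using lattice_subset_K by (auto simp: frac_def)

lemmas frac_closed = subgroup_closed[OF lattice_subgroup[OF frac_lattice]]

lemma fracI:
 assumes H: "subgroup H" "H \<subseteq> L" and L: "is_lattice L" and st: "\<And>r x. r \<in> OK \<Longrightarrow> x \<in> H \<Longrightarrow> r * x \<in> H"
  and x: "x \<in> H" "x \<noteq> 0"
 shows "frac H"
proof -
 have "x \<in> K" using x H L lattice_subset_K by blast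
 hence "is_lattice (scale x OK)" using x by (intro scale_lattice OK_lattice)
 moreover have "scale x OK \<subseteq> H" using st x by (auto simp: scale_def mult.commute)
 ultimately have "is_lattice H" by (intro sublattice(1)[OF L H])
 thus ?thesis using st by (simp add: frac_def)
qed

lemma frac_scale: "frac a \<Longrightarrow> x \<in> K \<Longrightarrow> x \<noteq> 0 \<Longrightarrow> frac (scale x a)"
 unfolding frac_def using scale_lattice(1) by (auto simp: scale_def mult.left_commute)

lemma frac_Dual: "frac a \<Longrightarrow> frac (Dual a)"
proof -
 assume a: "frac a"
 have "r * x \<in> Dual a" if "r \<in> OK" "x \<in> Dual a" for r x
 proof -
  have "tr (r * x * y) \<in> \<int>" if "y \<in> a" for y
  proof -
   have "tr (x * (r * y)) \<in> \<int>" using frac_mult[OF a \<open>r \<in> OK\<close> that] \<open>x \<in> Dual a\<close> by (auto simp: Dual_def)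
   thus ?thesis by (simp add: mult_ac)
  qed
  thus ?thesis using that OK_subset_K by (auto simp: Dual_def K_closed)
 qed
 thus ?thesis using a Dual_lattice(1) by (simp add: frac_def)
qed

lemma frac_multiple: "frac a \<Longrightarrow> \<exists>m::nat. m > 0 \<and> (\<forall>x\<in>a. of_nat m * x \<in> OK)"
 using lattice_multiple_sub[OF frac_lattice OK_lattice] by metis

lemma nonzero_ideals_iff: "I \<in> Ids \<longleftrightarrow> frac I \<and> I \<subseteq> OK"
proof
 assume I: "I \<in> Ids"
 hence *: "I \<subseteq> OK" "0 \<in> I" "\<And>x y. x \<in> I \<Longrightarrow> y \<in> I \<Longrightarrow> x + y \<in> I" "\<And>x. x \<in> I \<Longrightarrow> - x \<in> I"
   "\<And>r x. r \<in> OK \<Longrightarrow> x \<in> I \<Longrightarrow> r * x \<in> I" "I \<noteq> {0}"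
  by (auto simp: nonzero_ideals_def)
 obtain x where "x \<in> I" "x \<noteq> 0" using *(2,6) by blast
 moreover have "subgroup I" unfolding subgroup_def using *(2) *(3)[OF _ *(4)] by auto
 ultimately show "frac I \<and> I \<subseteq> OK" using *(1,5) by (auto intro!: fracI[OF _ _ OK_lattice])
next
 assume "frac I \<and> I \<subseteq> OK"
 thus "I \<in> Ids"
  using frac_closed[of I] frac_mult[of I] lattice_nonzero[OF frac_lattice, of I] by (auto simp: nonzero_ideals_def)
qed

section \<open>Products and sums of fractional ideals\<close>

definition idl :: "complex set \<Rightarrow> complex set \<Rightarrow> complex set" where
 "idl a b = Zmod.span {x * y |x y. x \<in> a \<and> y \<in> b}"

lemma idl_mem: "x \<in> a \<Longrightarrow> y \<in> b \<Longrightarrow> x * y \<in> idl a b"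
 unfolding idl_def by (rule Zmod.span_base) auto

lemma subgroup_idl: "subgroup (idl a b)"
 by (auto simp: subgroup_def idl_def Zmod.span_zero Zmod.span_diff)

lemma idl_subset: "subgroup c \<Longrightarrow> (\<And>x y. x \<in> a \<Longrightarrow> y \<in> b \<Longrightarrow> x * y \<in> c) \<Longrightarrow> idl a b \<subseteq> c"
proof
 fix z assume c: "subgroup c" "\<And>x y. x \<in> a \<Longrightarrow> y \<in> b \<Longrightarrow> x * y \<in> c" and "z \<in> idl a b"
 from this(3) show "z \<in> c" unfolding idl_def
 proof (induction rule: Zmod.span_induct_alt)
  case base
  thus ?case by (rule subgroup_closed(1)[OF c(1)])
 next
  case (step k x y)
  thus ?case using c(2) by (auto intro!: subgroup_closed(4,6)[OF c(1)])
 qed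
qed

lemma idl_commute: "idl a b = idl b a"
proof -
 have "{x * y |x y. x \<in> a \<and> y \<in> b} \<subseteq> {x * y |x y. x \<in> b \<and> y \<in> a}" for a b :: "complex set"
  by (clarify, metis mult.commute)
 from this[of a b] this[of b a] show ?thesis unfolding idl_def by (intro arg_cong[where f = Zmod.span] subset_antisym)
qed

lemma idl_mono: "a \<subseteq> a' \<Longrightarrow> b \<subseteq> b' \<Longrightarrow> idl a b \<subseteq> idl a' b'"
 unfolding idl_def by (rule Zmod.span_mono) auto

lemma idl_mult_mem:
 assumes "z \<in> idl a b" "subgroup c" "\<And>x y. x \<in> a \<Longrightarrow> y \<in> b \<Longrightarrow> w * (x * y) \<in> c"
 shows "w * z \<in> c" using assms(1) unfolding idl_def
proof (induction rule: Zmod.span_induct_alt)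
 case base
 thus ?case using subgroup_closed(1)[OF assms(2)] by simp
next
 case (step k x y)
 have "w * (of_int k * x + y) = of_int k * (w * x) + w * y" by (simp add: algebra_simps)
 thus ?case using step assms(3) by (auto intro!: subgroup_closed(4,6)[OF assms(2)])
qed

lemma idl_assoc: "idl (idl a b) c = idl a (idl b c)"
proof
 have le: "idl (idl a b) c \<subseteq> idl a (idl b c)" for a b c
 proof (rule idl_subset[OF subgroup_idl])
  fix x y assume x: "x \<in> idl a b" and y: "y \<in> c"
  have "y * x \<in> idl a (idl b c)"
  proof (rule idl_mult_mem[OF x subgroup_idl])
   fix u v assume "u \<in> a" "v \<in> b"
   thus "y * (u * v) \<in> idl a (idl b c)" using idl_mem[of u a "v * y" "idl b c"] idl_mem[of v b y c] y by (simp add: mult_ac)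
  qed
  thus "x * y \<in> idl a (idl b c)" by (simp add: mult.commute)
 qed
 show "idl (idl a b) c \<subseteq> idl a (idl b c)" by (rule le)
 show "idl a (idl b c) \<subseteq> idl (idl a b) c" using le[of c b a] by (simp add: idl_commute)
qed

lemma idl_OK: "frac a \<Longrightarrow> idl OK a = a" "frac a \<Longrightarrow> idl a OK = a"
proof -
 assume a: "frac a"
 show *: "idl OK a = a"
 proof
  show "idl OK a \<subseteq> a" by (rule idl_subset[OF lattice_subgroup[OF frac_lattice[OF a]]]) (use frac_mult[OF a] in auto)
  show "a \<subseteq> idl OK a" using idl_mem[OF OK_closed(2), of _ a] by auto
 qed
 thus "idl a OK = a" by (simp add: idl_commute)
qed

lemma frac_nonzero: "frac a \<Longrightarrow> \<exists>x\<in>a. x \<noteq> 0"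
 using lattice_nonzero frac_lattice by blast

lemma frac_idl:
 assumes a: "frac a" and b: "frac b"
 shows "frac (idl a b)"
proof -
 obtain m :: nat where m: "m > 0" "\<And>x. x \<in> a \<Longrightarrow> of_nat m * x \<in> OK" using frac_multiple[OF a] by blast
 have mK: "inverse (of_nat m) \<in> K" by (intro K_closed subfield_of_nat[OF F])
 have L: "frac (scale (inverse (of_nat m)) b)" using m(1) by (intro frac_scale b mK) auto
 obtain x where x: "x \<in> a" "x \<noteq> 0" using frac_nonzero[OF a] by blast
 obtain y where y: "y \<in> b" "y \<noteq> 0" using frac_nonzero[OF b] by blast
 show ?thesis
 proof (rule fracI[OF subgroup_idl _ frac_lattice[OF L]])
  show "idl a b \<subseteq> scale (inverse (of_nat m)) b"
  proof (rule idl_subset[OF lattice_subgroup[OF frac_lattice[OF L]]])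
   fix x y assume "x \<in> a" "y \<in> b"
   hence "(of_nat m * x) * y \<in> b" using m(2) frac_mult[OF b] by blast
   thus "x * y \<in> scale (inverse (of_nat m)) b" unfolding scale_def
    by (intro image_eqI[of _ _ "(of_nat m * x) * y"]) (use m(1) in auto)
  qed
  show "r * z \<in> idl a b" if "r \<in> OK" "z \<in> idl a b" for r z
  proof (rule idl_mult_mem[OF that(2) subgroup_idl])
   fix x y assume "x \<in> a" "y \<in> b"
   thus "r * (x * y) \<in> idl a b" using idl_mem[OF frac_mult[OF a that(1)], of x y b] by (simp add: mult.assoc)
  qed
  show "x * y \<in> idl a b" by (rule idl_mem[OF x(1) y(1)])
  show "x * y \<noteq> 0" using x y by simp
 qed
qed

lemma covol_index:
 assumes a: "frac a" and b: "frac b" and sub: "a \<subseteq> b"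
 shows "covol a = real (card (cosets b a)) * covol b" "card (cosets b a) > 0"
 using sublattice(2,3)[OF frac_lattice[OF b] lattice_subgroup[OF frac_lattice[OF a]] sub frac_lattice[OF a]] by auto

lemma ideal_norm_covol:
 assumes "I \<in> Ids"
 shows "covol I = real (Nm I) * covol OK" "Nm I > 0"
 using covol_index[of I OK] assms frac_OK unfolding nonzero_ideals_iff cosets_def ideal_norm_def by auto

lemma covol_strict:
 assumes a: "frac a" and b: "frac b" and sub: "a \<subseteq> b" "a \<noteq> b"
 shows "covol a > covol b"
proof -
 have "card (cosets b a) \<noteq> 1"
 proof
  assume "card (cosets b a) = 1"
  then obtain X where X: "cosets b a = {X}" by (auto simp: card_1_singleton_iff)
  obtain x where x: "x \<in> b" "x \<notin> a" using sub by blast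
  let ?R = "{(x, y). x \<in> b \<and> y \<in> b \<and> x - y \<in> a}"
  have 0: "0 \<in> b" using frac_closed(1)[OF b] .
  have "?R `` {x} \<in> cosets b a" "?R `` {0} \<in> cosets b a" unfolding cosets_def using x 0 by (simp_all only: quotientI)
  hence "?R `` {x} = ?R `` {0}" using X by auto
  hence "(x, 0) \<in> ?R" using eq_equiv_class[OF _ equiv_cosets[OF lattice_subgroup[OF frac_lattice[OF a]]] 0] by blast
  thus False using x by auto
 qed
 hence "card (cosets b a) \<ge> 2" using covol_index(2)[OF a b sub(1)] by linarith
 hence "2 * covol b \<le> covol a"
  using covol_index(1)[OF a b sub(1)] lattice_covol_pos[OF frac_lattice[OF b]] by (simp add: mult_right_mono)
 thus ?thesis using lattice_covol_pos[OF frac_lattice[OF b]] by linarith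
qed

lemma ideal_norm_strict:
 assumes "a \<in> Ids" "b \<in> Ids" "a \<subseteq> b" "a \<noteq> b"
 shows "Nm a > Nm b"
 using covol_strict[of a b] assms ideal_norm_covol[OF assms(1)] ideal_norm_covol[OF assms(2)]
  lattice_covol_pos[OF OK_lattice] by (simp add: nonzero_ideals_iff)

definition idlsum :: "complex set \<Rightarrow> complex set \<Rightarrow> complex set" where
 "idlsum a b = {x + y |x y. x \<in> a \<and> y \<in> b}"

lemma idlsumI: "x \<in> a \<Longrightarrow> y \<in> b \<Longrightarrow> x + y \<in> idlsum a b"
 unfolding idlsum_def by blast

lemma frac_idlsum:
 assumes a: "frac a" and b: "frac b" and c: "frac c" "a \<subseteq> c" "b \<subseteq> c"
 shows "frac (idlsum a b)" "a \<subseteq> idlsum a b" "b \<subseteq> idlsum a b" "idlsum a b \<subseteq> c"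
proof -
 have a0: "0 \<in> a" "0 \<in> b" using frac_closed(1) a b by auto
 show sub: "a \<subseteq> idlsum a b" "b \<subseteq> idlsum a b"
 proof -
  have "x + 0 \<in> idlsum a b" if "x \<in> a" for x using that a0 unfolding idlsum_def by blast
  thus "a \<subseteq> idlsum a b" by auto
  have "0 + x \<in> idlsum a b" if "x \<in> b" for x using that a0 unfolding idlsum_def by blast
  thus "b \<subseteq> idlsum a b" by auto
 qed
 show sc: "idlsum a b \<subseteq> c" using c frac_closed(4)[OF c(1)] by (auto simp: idlsum_def)
 obtain x where x: "x \<in> a" "x \<noteq> 0" using frac_nonzero[OF a] by blast
 show "frac (idlsum a b)"
 proof (rule fracI[OF _ sc frac_lattice[OF c(1)]])
  show "subgroup (idlsum a b)" unfolding subgroup_def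
  proof (intro conjI ballI)
   show "0 \<in> idlsum a b" using a0 sub by blast
   fix u v assume "u \<in> idlsum a b" "v \<in> idlsum a b"
   then obtain p q r s where "u = p + q" "v = r + s" "p \<in> a" "q \<in> b" "r \<in> a" "s \<in> b" by (auto simp: idlsum_def)
   thus "u - v \<in> idlsum a b"
    using idlsumI[OF frac_closed(3)[OF a, of p r] frac_closed(3)[OF b, of q s]] by (simp add: algebra_simps)
  qed
  show "r * u \<in> idlsum a b" if "r \<in> OK" "u \<in> idlsum a b" for r u
  proof -
   obtain x y where "u = x + y" "x \<in> a" "y \<in> b" using \<open>u \<in> _\<close> unfolding idlsum_def by blast
   thus ?thesis using idlsumI[OF frac_mult[OF a that(1)] frac_mult[OF b that(1)], of x y] by (simp add: distrib_left)
  qed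
  show "x \<in> idlsum a b" using x sub by blast
 qed (use x in auto)
qed

section \<open>Prime ideals, invertibility and multiplicativity of the norm\<close>

definition prm :: "complex set \<Rightarrow> bool" where
 "prm P \<longleftrightarrow> P \<in> Ids \<and> 1 \<notin> P \<and> (\<forall>x\<in>OK. \<forall>y\<in>OK. x * y \<in> P \<longrightarrow> x \<in> P \<or> y \<in> P)"

lemma prm_frac: "prm P \<Longrightarrow> frac P" "prm P \<Longrightarrow> P \<subseteq> OK"
 by (auto simp: prm_def nonzero_ideals_iff)

lemma ideal_eq_OK: "frac I \<Longrightarrow> 1 \<in> I \<Longrightarrow> I \<subseteq> OK \<Longrightarrow> I = OK"
 using frac_mult[of I _ 1] by auto

lemma frac_principal: "x \<in> OK \<Longrightarrow> x \<noteq> 0 \<Longrightarrow> frac (scale x OK)" "x \<in> OK \<Longrightarrow> scale x OK \<subseteq> OK" "x \<in> scale x OK"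
 using frac_scale[OF frac_OK] OK_subset_K OK_closed by (auto simp: scale_def)

text \<open>A finite integral domain is a field: the powers of \<open>x\<close> repeat modulo
  \<open>P\<close>, so some positive power of \<open>x\<close> is congruent to 1, and any ideal
  containing \<open>P\<close> and \<open>x\<close> contains 1.\<close>

lemma prm_maximal:
 assumes P: "prm P" and J: "frac J" "P \<subseteq> J" "J \<subseteq> OK" "J \<noteq> P"
 shows "J = OK"
proof -
 obtain x where x: "x \<in> J" "x \<notin> P" using J by blast
 have xO: "x \<in> OK" using x J by blast
 let ?R = "{(x, y). x \<in> OK \<and> y \<in> OK \<and> x - y \<in> P}"
 note Pg = lattice_subgroup[OF frac_lattice[OF prm_frac(1)[OF P]]]
 have "finite (cosets OK P)"
  using covol_index(2)[OF prm_frac(1)[OF P] frac_OK prm_frac(2)[OF P]] by (rule card_ge_0_finite)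
 moreover have "range (\<lambda>i. ?R `` {x ^ i}) \<subseteq> cosets OK P" unfolding cosets_def by (intro image_subsetI quotientI OK_closed(8) xO)
 ultimately have "finite (range (\<lambda>i::nat. ?R `` {x ^ i}))" by (rule rev_finite_subset)
 hence "\<not> inj (\<lambda>i::nat. ?R `` {x ^ i})" using finite_imageD infinite_UNIV_nat by blast
 then obtain i' j' :: nat where "i' \<noteq> j'" "?R `` {x ^ i'} = ?R `` {x ^ j'}" unfolding inj_on_def by blast
 hence "min i' j' < max i' j'" "?R `` {x ^ min i' j'} = ?R `` {x ^ max i' j'}" by (simp_all add: min_def max_def)
 then obtain i j :: nat where ij: "i < j" "?R `` {x ^ i} = ?R `` {x ^ j}" by blast
 hence "(x ^ i, x ^ j) \<in> ?R" using eq_equiv_class[OF _ equiv_cosets[OF Pg] OK_closed(8)[OF xO]] by blast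
 hence "x ^ i * (1 - x ^ (j - i)) \<in> P" using ij(1) by (simp add: algebra_simps flip: power_add)
 moreover have "x ^ k \<notin> P" for k
 proof (induction k)
  case 0
  thus ?case using P by (simp add: prm_def)
 next
  case (Suc k)
  thus ?case using P x OK_closed(8)[OF xO] xO by (auto simp: prm_def)
 qed
 moreover have "x ^ i \<in> OK" "1 - x ^ (j - i) \<in> OK" using OK_closed(2,7,8) xO by auto
 ultimately have "1 - x ^ (j - i) \<in> P" using P unfolding prm_def by blast
 hence "1 - x ^ (j - i) \<in> J" using J by blast
 moreover have "x ^ (j - i) \<in> J"
 proof -
  have "x ^ (j - i) = x ^ (j - i - 1) * x" using ij(1) by (metis Suc_diff_1 power_Suc2 zero_less_diff)
  thus ?thesis using frac_mult[OF J(1) OK_closed(8)[OF xO] x(1)] by simp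
 qed
 ultimately have "1 \<in> J" using frac_closed(4)[OF J(1)] by fastforce
 thus ?thesis using J by (intro ideal_eq_OK) auto
qed

text \<open>Among the proper ideals containing \<open>I\<close>, one of least norm is prime, since a
  larger ideal has smaller norm.\<close>

lemma ex_prm:
 assumes I: "I \<in> Ids" "I \<noteq> OK"
 obtains P where "prm P" "I \<subseteq> P"
proof -
 define A where "A J \<longleftrightarrow> J \<in> Ids \<and> J \<noteq> OK \<and> I \<subseteq> J" for J
 obtain J where J: "A J" "\<And>J'. A J' \<Longrightarrow> Nm J \<le> Nm J'"
  using ex_has_least_nat[of A I "Nm"] I by (auto simp: A_def)
 hence J': "frac J" "J \<subseteq> OK" "J \<noteq> OK" by (auto simp: A_def nonzero_ideals_iff)
 have "x \<in> J \<or> y \<in> J" if xy: "x \<in> OK" "y \<in> OK" "x * y \<in> J" for x y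
 proof (rule ccontr)
  assume *: "\<not> (x \<in> J \<or> y \<in> J)"
  hence x0: "x \<noteq> 0" using frac_closed(1)[OF J'(1)] by auto
  note s = frac_idlsum[OF J'(1) frac_principal(1)[OF xy(1) x0] frac_OK J'(2) frac_principal(2)[OF xy(1)]]
  have "idlsum J (scale x OK) = OK"
  proof (rule ccontr)
   assume ne: "idlsum J (scale x OK) \<noteq> OK"
   have A1: "A (idlsum J (scale x OK))" using ne s J by (auto simp: A_def nonzero_ideals_iff)
   have "J \<noteq> idlsum J (scale x OK)" using s(3) frac_principal(3)[of x] * by blast
   hence "Nm (idlsum J (scale x OK)) < Nm J"
    using A1 J s by (intro ideal_norm_strict) (auto simp: A_def)
   thus False using J(2)[OF A1] by simp
  qed
  hence "1 \<in> idlsum J (scale x OK)" using OK_closed by simp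
  then obtain j r where jr: "1 = j + x * r" "j \<in> J" "r \<in> OK" by (auto simp: idlsum_def scale_def)
  have "y = y * j + r * (x * y)"
  proof -
   have "y = y * (j + x * r)" using jr(1) by simp
   thus ?thesis by (simp add: algebra_simps)
  qed
  moreover have "y * j + r * (x * y) \<in> J" by (intro frac_closed(4)[OF J'(1)] frac_mult[OF J'(1)] xy jr)
  ultimately show False using * by simp
 qed
 moreover have "1 \<notin> J" using ideal_eq_OK[OF J'(1)] J' by blast
 ultimately have "prm J" using J by (auto simp: prm_def A_def)
 thus ?thesis using that J by (auto simp: A_def)
qed

text \<open>The product of the ideals in \<open>Ps\<close> lies in \<open>I\<close>, expressed by
  elements, one factor from each ideal. The empty list stands for the unit ideal.\<close>

definition prods :: "complex set list \<Rightarrow> complex set \<Rightarrow> bool" where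
 "prods Ps I \<longleftrightarrow> (\<forall>xs. list_all2 (\<in>) xs Ps \<longrightarrow> prod_list xs \<in> I)"

text \<open>Induction on the norm. If \<open>x * y\<close> is in \<open>I\<close> but neither factor
  is, the lists found for \<open>I + (x)\<close> and \<open>I + (y)\<close> are concatenated,
  because the product of these two ideals lies in \<open>I\<close>.\<close>

lemma contains_prods:
 "I \<in> Ids \<Longrightarrow> \<exists>Ps. (\<forall>P\<in>set Ps. prm P) \<and> prods Ps I"
proof (induction "Nm I" arbitrary: I rule: less_induct)
 case less
 have I: "frac I" "I \<subseteq> OK" using less.prems by (auto simp: nonzero_ideals_iff)
 consider "1 \<in> I" | "prm I" | "1 \<notin> I" "\<not> prm I" by blast
 thus ?case
 proof cases
  case 1
  thus ?thesis by (intro exI[of _ "[]"]) (auto simp: prods_def)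
 next
  case 2
  thus ?thesis by (intro exI[of _ "[I]"]) (auto simp: prods_def list_all2_Cons2)
 next
  case 3
  then obtain x y where xy: "x \<in> OK" "y \<in> OK" "x * y \<in> I" "x \<notin> I" "y \<notin> I"
   using less.prems by (auto simp: prm_def)
  have ex: "\<exists>Ps. (\<forall>P\<in>set Ps. prm P) \<and> prods Ps (idlsum I (scale z OK))" if z: "z \<in> OK" "z \<notin> I" for z
  proof -
   have z0: "z \<noteq> 0" using z frac_closed(1)[OF I(1)] by auto
   note s = frac_idlsum[OF I(1) frac_principal(1)[OF z(1) z0] frac_OK I(2) frac_principal(2)[OF z(1)]]
   have ni: "idlsum I (scale z OK) \<in> Ids" using s by (simp add: nonzero_ideals_iff)
   have "I \<noteq> idlsum I (scale z OK)" using s(3) frac_principal(3)[of z] z by blast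
   hence "Nm (idlsum I (scale z OK)) < Nm I"
    using s by (intro ideal_norm_strict less.prems ni) auto
   thus ?thesis using less.hyps ni by blast
  qed
  obtain Ps Qs where PQ: "\<forall>P\<in>set Ps. prm P" "prods Ps (idlsum I (scale x OK))" "\<forall>P\<in>set Qs. prm P" "prods Qs (idlsum I (scale y OK))"
   using ex[OF xy(1,4)] ex[OF xy(2,5)] by blast
  have "prods (Ps @ Qs) I" unfolding prods_def
  proof (intro allI impI)
   fix zs assume "list_all2 (\<in>) zs (Ps @ Qs)"
   then obtain xs ys where zs: "zs = xs @ ys" "list_all2 (\<in>) xs Ps" "list_all2 (\<in>) ys Qs" by (auto simp: list_all2_append2)
   hence "prod_list xs \<in> idlsum I (scale x OK)" "prod_list ys \<in> idlsum I (scale y OK)" using PQ by (auto simp: prods_def)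
   then obtain i r j s where ij: "prod_list xs = i + x * r" "i \<in> I" "r \<in> OK" "prod_list ys = j + y * s" "j \<in> I" "s \<in> OK"
    by (auto simp: idlsum_def scale_def)
   have "prod_list zs = (j + y * s) * i + ((x * r) * j + (r * s) * (x * y))" using ij by (simp add: zs algebra_simps)
   also have "\<dots> \<in> I"
   proof -
    have "j + y * s \<in> OK" "x * r \<in> OK" "r * s \<in> OK" using ij I(2) xy OK_closed(4,5) by auto
    thus ?thesis using ij xy frac_mult[OF I(1)] frac_closed(4)[OF I(1)] by simp
   qed
   finally show "prod_list zs \<in> I" .
  qed
  thus ?thesis using PQ by (intro exI[of _ "Ps @ Qs"]) auto
 qed
qed

text \<open>Take a shortest list of primes whose product lies in a principal ideal generated by some
  \<alpha> in \<open>P\<close>. One of them is \<open>P\<close> itself; dropping it leaves a product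
  \<open>b\<close> outside the principal ideal with \<open>b * P\<close> inside it, and
  \<open>b / \<alpha>\<close> is the element sought.\<close>

lemma prm_inverse_element:
 assumes P: "prm P"
 obtains \<beta> where "\<beta> \<in> K" "\<beta> \<notin> OK" "\<And>y. y \<in> P \<Longrightarrow> \<beta> * y \<in> OK"
proof -
 note Pf = prm_frac[OF P]
 obtain \<alpha> where \<alpha>: "\<alpha> \<in> P" "\<alpha> \<noteq> 0" using frac_nonzero[OF Pf(1)] by blast
 hence \<alpha>O: "\<alpha> \<in> OK" using Pf by blast
 define I where "I = scale \<alpha> OK"
 have I: "I \<in> Ids" using frac_principal(1,2)[OF \<alpha>O] \<alpha> by (auto simp: I_def nonzero_ideals_iff)
 have IP: "I \<subseteq> P" using frac_mult[OF Pf(1) _ \<alpha>(1)] by (auto simp: I_def scale_def mult.commute)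
 define A where "A Ps \<longleftrightarrow> (\<forall>P\<in>set Ps. prm P) \<and> prods Ps I" for Ps
 obtain Ps0 where "A Ps0" using contains_prods[OF I] by (auto simp: A_def)
 then obtain Ps where Ps: "A Ps" "\<And>Qs. A Qs \<Longrightarrow> length Ps \<le> length Qs"
  using ex_has_least_nat[of A Ps0 length] by blast
 have "\<exists>Q\<in>set Ps. Q \<subseteq> P"
 proof (rule ccontr)
  assume no: "\<not> (\<exists>Q\<in>set Ps. Q \<subseteq> P)"
  \<comment> \<open>If no prime of the list lay in \<open>P\<close>, choosing from each an element
    outside \<open>P\<close> would give a product outside \<open>P\<close>, although it lies in
    \<open>I\<close>, which \<open>P\<close> contains.\<close>
  have key: "(\<forall>Q\<in>set Qs. prm Q \<and> \<not> Q \<subseteq> P) \<Longrightarrow> \<exists>xs. list_all2 (\<in>) xs Qs \<and> prod_list xs \<in> OK \<and> prod_list xs \<notin> P" for Qs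
  proof (induction Qs)
   case Nil
   thus ?case using P OK_closed by (auto simp: prm_def)
  next
   case (Cons Q Qs)
   then obtain xs where xs: "list_all2 (\<in>) xs Qs" "prod_list xs \<in> OK" "prod_list xs \<notin> P" by auto
   obtain x where x: "x \<in> Q" "x \<notin> P" using Cons.prems by auto
   have xO: "x \<in> OK" using x prm_frac(2)[of Q] Cons.prems by auto
   hence "x * prod_list xs \<notin> P" using P x xs by (auto simp: prm_def)
   thus ?case using xs x xO by (intro exI[of _ "x # xs"]) (auto simp: OK_closed)
  qed
  obtain xs where "list_all2 (\<in>) xs Ps" "prod_list xs \<notin> P" using key[of Ps] no Ps(1) by (auto simp: A_def)
  thus False using Ps(1) IP by (auto simp: A_def prods_def)
 qed
 then obtain Q where Q: "Q \<in> set Ps" "Q \<subseteq> P" by blast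
 have "prm Q" using Q Ps(1) by (auto simp: A_def)
 have QP: "Q = P"
 proof (rule ccontr)
  assume "Q \<noteq> P"
  hence "P = OK" using prm_maximal[OF \<open>prm Q\<close> Pf(1) Q(2) Pf(2)] by blast
  thus False using P OK_closed(2) by (auto simp: prm_def)
 qed
 obtain Bs Cs where BC: "Ps = Bs @ P # Cs" using Q(1) QP by (metis split_list)
 have "\<not> A (Bs @ Cs)" using Ps(2)[of "Bs @ Cs"] BC by auto
 hence "\<not> prods (Bs @ Cs) I" using Ps(1) BC by (auto simp: A_def)
 then obtain zs where zs: "list_all2 (\<in>) zs (Bs @ Cs)" "prod_list zs \<notin> I" by (auto simp: prods_def)
 then obtain xs ys where xy: "zs = xs @ ys" "list_all2 (\<in>) xs Bs" "list_all2 (\<in>) ys Cs" by (auto simp: list_all2_append2)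
 define b where "b = prod_list zs"
 have bP: "b * y \<in> I" if "y \<in> P" for y
 proof -
  have "list_all2 (\<in>) (xs @ y # ys) Ps" unfolding BC using xy that by (auto intro!: list_all2_appendI)
  hence "prod_list (xs @ y # ys) \<in> I" using Ps(1) by (auto simp: A_def prods_def)
  thus ?thesis by (simp add: b_def xy(1) mult_ac)
 qed
 have bK: "b \<in> K"
 proof -
  have "b * \<alpha> \<in> K" using bP[OF \<alpha>(1)] I OK_subset_K by (auto simp: nonzero_ideals_iff)
  hence "(b * \<alpha>) / \<alpha> \<in> K" using \<alpha>O OK_subset_K by (intro K_closed(8)) auto
  thus ?thesis using \<alpha>(2) by simp
 qed
 show ?thesis
 proof (rule that[of "b / \<alpha>"])
  show "b / \<alpha> \<in> K" using bK \<alpha>O OK_subset_K by (intro K_closed(8)) auto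
  show "b / \<alpha> \<notin> OK"
  proof
   assume "b / \<alpha> \<in> OK"
   hence "b \<in> I" unfolding I_def scale_def by (intro image_eqI[of _ _ "b / \<alpha>"]) (use \<alpha> in auto)
   thus False using zs(2) by (simp add: b_def)
  qed
  show "b / \<alpha> * y \<in> OK" if y: "y \<in> P" for y
  proof -
   obtain r where "b * y = \<alpha> * r" "r \<in> OK" using bP[OF y] by (auto simp: I_def scale_def)
   thus ?thesis using \<alpha>(2) by (simp add: field_simps)
  qed
 qed
qed

definition iinv :: "complex set \<Rightarrow> complex set" where
 "iinv a = {x \<in> K. \<forall>y\<in>a. x * y \<in> OK}"

lemma frac_iinv: "frac a \<Longrightarrow> frac (iinv a)"
proof -
 assume a: "frac a"
 obtain y where y: "y \<in> a" "y \<noteq> 0" using frac_nonzero[OF a] by blast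
 obtain m :: nat where m: "m > 0" "\<And>x. x \<in> a \<Longrightarrow> of_nat m * x \<in> OK" using frac_multiple[OF a] by blast
 have yK: "y \<in> K" using frac_K[OF a y(1)] .
 show ?thesis
 proof (rule fracI)
  show "is_lattice (scale (inverse y) OK)" using y yK by (intro scale_lattice OK_lattice K_closed) auto
  show "iinv a \<subseteq> scale (inverse y) OK"
  proof
   fix x assume "x \<in> iinv a"
   thus "x \<in> scale (inverse y) OK" unfolding scale_def
    by (intro image_eqI[of _ _ "x * y"]) (use y in \<open>auto simp: iinv_def\<close>)
  qed
  show "subgroup (iinv a)" using OK_closed by (auto simp: subgroup_def iinv_def K_closed left_diff_distrib)
  show "r * x \<in> iinv a" if "r \<in> OK" "x \<in> iinv a" for r x
   using that OK_subset_K OK_closed(5) by (auto simp: iinv_def K_closed mult.assoc)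
  show "of_nat m \<in> iinv a" using m(2) subfield_of_nat[OF F] by (auto simp: iinv_def)
 qed (use m in auto)
qed

definition invertible :: "complex set \<Rightarrow> bool" where
 "invertible a \<longleftrightarrow> frac a \<and> idl a (iinv a) = OK"

lemma iinv_unique:
 assumes a: "frac a" and b: "frac b" and ab: "idl a b = OK"
 shows "b = iinv a" "invertible a"
proof -
 have sub: "b \<subseteq> iinv a"
 proof
  fix x assume x: "x \<in> b"
  have "x * y \<in> OK" if "y \<in> a" for y using idl_mem[OF that x] ab by (simp add: mult.commute)
  thus "x \<in> iinv a" using frac_K[OF b x] by (simp add: iinv_def)
 qed
 have "idl a (iinv a) \<subseteq> OK" by (rule idl_subset[OF subgroup_OK]) (auto simp: iinv_def mult.commute)
 moreover have "OK \<subseteq> idl a (iinv a)" using idl_mono[OF order_refl sub, of a] ab by auto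
 ultimately have eq: "idl a (iinv a) = OK" by blast
 show "invertible a" using eq a by (simp add: invertible_def)
 have "iinv a = idl (idl a b) (iinv a)" using ab idl_OK(1)[OF frac_iinv[OF a]] by simp
 also have "\<dots> = idl b (idl a (iinv a))" by (metis idl_assoc idl_commute)
 also have "\<dots> = b" using eq idl_OK(2)[OF b] by simp
 finally show "b = iinv a" by simp
qed

text \<open>By maximality the product of \<open>P\<close> and \<open>iinv P\<close> is
  \<open>P\<close> or \<open>OK\<close>. In the first case the nonintegral element found above would
  stabilize the lattice \<open>P\<close> and so be integral.\<close>

lemma prm_invertible:
 assumes P: "prm P"
 shows "invertible P" "iinv P \<noteq> OK" "OK \<subseteq> iinv P"
proof -
 note Pf = prm_frac[OF P]
 obtain \<beta> where \<beta>: "\<beta> \<in> K" "\<beta> \<notin> OK" "\<And>y. y \<in> P \<Longrightarrow> \<beta> * y \<in> OK" using prm_inverse_element[OF P] by blast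
 have bi: "\<beta> \<in> iinv P" using \<beta> by (auto simp: iinv_def)
 thus "iinv P \<noteq> OK" using \<beta> by blast
 show Oi: "OK \<subseteq> iinv P" using OK_subset_K OK_closed(5) Pf by (auto simp: iinv_def)
 have fi: "frac (idl P (iinv P))" by (intro frac_idl frac_iinv Pf)
 have 1: "idl P (iinv P) \<subseteq> OK" by (rule idl_subset[OF subgroup_OK]) (auto simp: iinv_def mult.commute)
 have 2: "P \<subseteq> idl P (iinv P)" using idl_mono[OF order_refl Oi, of P] idl_OK(2)[OF Pf(1)] by auto
 have "idl P (iinv P) \<noteq> P"
 proof
  assume "idl P (iinv P) = P"
  hence "\<beta> * y \<in> P" if "y \<in> P" for y using idl_mem[OF that bi] by (simp add: mult.commute)
  hence "algebraic_integer \<beta>" by (rule stable_lattice_integral[OF frac_lattice[OF Pf(1)]])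
  thus False using \<beta> by (auto simp: ring_of_integers_def)
 qed
 hence "idl P (iinv P) = OK" by (rule prm_maximal[OF P fi 2 1])
 thus "invertible P" using Pf by (simp add: invertible_def)
qed

lemma prm_cancel: "prm P \<Longrightarrow> frac a \<Longrightarrow> idl P (idl (iinv P) a) = a" "prm P \<Longrightarrow> frac a \<Longrightarrow> idl (iinv P) (idl P a) = a"
proof -
 assume P: "prm P" and a: "frac a"
 have *: "idl P (iinv P) = OK" using prm_invertible(1)[OF P] by (simp add: invertible_def)
 show "idl P (idl (iinv P) a) = a" using idl_assoc[of P "iinv P" a] * idl_OK(1)[OF a] by simp
 show "idl (iinv P) (idl P a) = a" using idl_assoc[of "iinv P" P a] * idl_OK(1)[OF a] by (simp add: idl_commute)
qed

text \<open>Containment in \<open>P\<close> is divisibility by \<open>P\<close>. The quotient is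
  strictly larger, since otherwise every element of \<open>iinv P\<close> would stabilize
  \<open>I\<close> and be integral.\<close>

lemma prm_divide:
 assumes P: "prm P" and I: "I \<in> Ids" and sub: "I \<subseteq> P"
 shows "idl (iinv P) I \<in> Ids" "I \<subseteq> idl (iinv P) I" "I \<noteq> idl (iinv P) I"
proof -
 have If: "frac I" using I by (simp add: nonzero_ideals_iff)
 note Pf = prm_frac[OF P]
 have *: "idl (iinv P) P = OK" using prm_invertible(1)[OF P] by (simp add: invertible_def idl_commute)
 have "idl (iinv P) I \<subseteq> OK" using idl_mono[OF order_refl sub, of "iinv P"] * by simp
 thus "idl (iinv P) I \<in> Ids" using frac_idl[OF frac_iinv[OF Pf(1)] If] by (simp add: nonzero_ideals_iff)
 show "I \<subseteq> idl (iinv P) I" using idl_mono[OF prm_invertible(3)[OF P] order_refl, of I] idl_OK(1)[OF If] by simp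
 show "I \<noteq> idl (iinv P) I"
 proof
  assume eq: "I = idl (iinv P) I"
  have "x \<in> OK" if x: "x \<in> iinv P" for x
  proof -
   have "algebraic_integer x"
    by (rule stable_lattice_integral[OF frac_lattice[OF If]]) (use eq idl_mem[OF x, of _ I] in auto)
   thus ?thesis using x by (auto simp: iinv_def ring_of_integers_def)
  qed
  thus False using prm_invertible(2,3)[OF P] by blast
 qed
qed

text \<open>Existence of the factorization into primes in the form of an induction rule; the norm
  drops whenever a prime is divided out.\<close>

lemma ideal_induct [consumes 1, case_names one mult]:
 assumes "I \<in> Ids" and one: "Q OK"
  and mult: "\<And>P a. prm P \<Longrightarrow> a \<in> Ids \<Longrightarrow> Q a \<Longrightarrow> Q (idl P a)"
 shows "Q I" using assms(1)
proof (induction "Nm I" arbitrary: I rule: less_induct)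
 case less
 show ?case
 proof (cases "I = OK")
  case True
  thus ?thesis using one by simp
 next
  case False
  obtain P where P: "prm P" "I \<subseteq> P" using ex_prm[OF less.prems False] .
  note d = prm_divide[OF P(1) less.prems P(2)]
  have "Q (idl (iinv P) I)" using less.hyps[OF _ d(1)] ideal_norm_strict[OF less.prems d] by blast
  hence "Q (idl P (idl (iinv P) I))" by (rule mult[OF P(1) d(1)])
  thus ?thesis using prm_cancel(1)[OF P(1)] less.prems by (simp add: nonzero_ideals_iff)
 qed
qed

lemma card_cosets_eq:
 assumes H: "subgroup H" and H': "subgroup H'" "subgroup L'" "H' \<subseteq> L'"
  and f: "\<And>x. x \<in> L \<Longrightarrow> f x \<in> L'" and iff: "\<And>x y. x \<in> L \<Longrightarrow> y \<in> L \<Longrightarrow> x - y \<in> H \<longleftrightarrow> f x - f y \<in> H'"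
  and surj: "\<And>y. y \<in> L' \<Longrightarrow> \<exists>x\<in>L. y - f x \<in> H'"
 shows "card (cosets L H) = card (cosets L' H')"
proof -
 let ?R = "{(x, y). x \<in> L \<and> y \<in> L \<and> x - y \<in> H}" and ?R' = "{(x, y). x \<in> L' \<and> y \<in> L' \<and> x - y \<in> H'}"
 note e = equiv_cosets[OF H, of L] and e' = equiv_cosets[OF H'(1), of L']
 define S where "S = (\<lambda>X. SOME x. x \<in> X) ` (cosets L H)"
 have SX: "(SOME x. x \<in> X) \<in> X \<and> (SOME x. x \<in> X) \<in> L" if X: "X \<in> cosets L H" for X
 proof -
  have "X \<noteq> {}" using X e unfolding cosets_def by (rule in_quotient_imp_non_empty[rotated])
  hence "(SOME x. x \<in> X) \<in> X" by (simp add: some_in_eq)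
  thus ?thesis using X in_quotient_imp_subset[OF e] unfolding cosets_def by blast
 qed
 have ex: "\<exists>s\<in>S. (x, s) \<in> ?R" if x: "x \<in> L" for x
 proof -
  have X: "?R `` {x} \<in> cosets L H" unfolding cosets_def using x by (rule quotientI)
  have "(SOME y. y \<in> ?R `` {x}) \<in> S" unfolding S_def using X by (rule imageI)
  thus ?thesis using SX[OF X] by blast
 qed
 have uniq: "s = s'" if "s \<in> S" "s' \<in> S" "(s, s') \<in> ?R" for s s'
 proof -
  obtain X X' where X: "X \<in> cosets L H" "X' \<in> cosets L H" "s = (SOME x. x \<in> X)" "s' = (SOME x. x \<in> X')"
   using \<open>s \<in> S\<close> \<open>s' \<in> S\<close> by (auto simp: S_def)
  have "X = X'"
   using quotient_eqI[OF e, of X X' s s'] X SX[OF X(1)] SX[OF X(2)] \<open>(s, s') \<in> ?R\<close> unfolding cosets_def by blast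
  thus ?thesis using X by simp
 qed
 have SL: "S \<subseteq> L" using SX by (auto simp: S_def)
 have "card (cosets L H) = card S"
  using bij_betw_same_card[OF bij_betw_quotient[OF e SL ex uniq]] by (simp add: cosets_def)
 moreover have "inj_on f S"
 proof (rule inj_onI)
  fix s s' assume s: "s \<in> S" "s' \<in> S" "f s = f s'"
  hence "s - s' \<in> H" using iff[of s s'] SL subgroup_closed(1)[OF H'(1)] by auto
  thus "s = s'" using uniq s SL by blast
 qed
 hence "card S = card (f ` S)" by (simp add: card_image)
 moreover have "card (cosets L' H') = card (f ` S)"
 proof -
  have "bij_betw (\<lambda>s. ?R' `` {s}) (f ` S) (L' // ?R')"
  proof (rule bij_betw_quotient[OF e'])
   show "f ` S \<subseteq> L'" using f SL by auto
   show "\<exists>s\<in>f ` S. (y, s) \<in> ?R'" if y: "y \<in> L'" for y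
   proof -
    obtain x where x: "x \<in> L" "y - f x \<in> H'" using surj[OF y] by blast
    obtain s where s: "s \<in> S" "(x, s) \<in> ?R" using ex[OF x(1)] by blast
    have "f x - f s \<in> H'" using iff[of x s] s by auto
    hence "y - f s \<in> H'" using subgroup_closed(4)[OF H'(1) x(2), of "f x - f s"] by simp
    thus ?thesis using s y f SL by auto
   qed
   show "u = v" if "u \<in> f ` S" "v \<in> f ` S" "(u, v) \<in> ?R'" for u v
    using that uniq iff SL by auto blast
  qed
  thus ?thesis by (simp add: bij_betw_same_card cosets_def)
 qed
 ultimately show ?thesis by simp
qed

text \<open>\<open>OK\<close> modulo \<open>P\<close> is isomorphic to \<open>a\<close> modulo
  \<open>P a\<close> by multiplication with any \<open>x\<close> in \<open>a\<close> outside
  \<open>P a\<close>. Maximality of \<open>P\<close> is used twice: for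
  \<open>P a + (x) = a\<close>, after multiplication by \<open>iinv a\<close>, and for the kernel
  being exactly \<open>P\<close>.\<close>

lemma covol_prm_mult:
 assumes P: "prm P" and a: "invertible a"
 shows "covol (idl P a) = real (Nm P) * covol a"
proof -
 have af: "frac a" using a by (simp add: invertible_def)
 have ai: "idl a (iinv a) = OK" using a by (simp add: invertible_def)
 note Pf = prm_frac[OF P]
 note fPa = frac_idl[OF Pf(1) af]
 have sub: "idl P a \<subseteq> a" using idl_mono[OF Pf(2) order_refl, of a] idl_OK(1)[OF af] by simp
 have bk: "idl (idl c a) (iinv a) = c" if "frac c" for c
  using that ai idl_OK(2)[OF that] by (simp add: idl_assoc)
 have "idl P a \<noteq> a"
 proof
  assume "idl P a = a"
  hence "P = OK" using bk[OF Pf(1)] ai by simp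
  thus False using P OK_closed by (auto simp: prm_def)
 qed
 then obtain x where x: "x \<in> a" "x \<notin> idl P a" using sub by blast
 have x0: "x \<noteq> 0" using x frac_closed(1)[OF fPa] by auto
 have xK: "x \<in> K" using frac_K[OF af x(1)] .
 have fx: "frac (scale x OK)" by (rule frac_scale[OF frac_OK xK x0])
 have xa: "scale x OK \<subseteq> a" using frac_mult[OF af _ x(1)] by (auto simp: scale_def mult.commute)
 define c where "c = idlsum (idl P a) (scale x OK)"
 have c: "frac c" "idl P a \<subseteq> c" "scale x OK \<subseteq> c" "c \<subseteq> a"
  unfolding c_def using frac_idlsum[OF fPa fx af sub xa] by auto
 have "c = a"
 proof -
  let ?J = "idl c (iinv a)"
  have "P \<subseteq> ?J" using idl_mono[OF c(2) order_refl, of "iinv a"] bk[OF Pf(1)] by simp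
  moreover have "?J \<subseteq> OK" using idl_mono[OF c(4) order_refl, of "iinv a"] ai by simp
  moreover have J: "frac ?J" by (intro frac_idl c frac_iinv af)
  moreover have cJ: "c = idl ?J a" using ai idl_OK(2)[OF c(1)] by (simp add: idl_assoc idl_commute[of "iinv a"])
  moreover have "?J \<noteq> P"
  proof
   assume "?J = P"
   hence "c = idl P a" using cJ by simp
   thus False using c(3) x(2) OK_closed(2) by (auto simp: scale_def)
  qed
  ultimately have "?J = OK" using prm_maximal[OF P] by blast
  thus ?thesis using cJ idl_OK(1)[OF af] by simp
 qed
 obtain z where z: "z \<in> P" "z \<noteq> 0" using frac_nonzero[OF Pf(1)] by blast
 define J where "J = {r \<in> OK. r * x \<in> idl P a}"
 have "J = P"
 proof -
  have PJ: "P \<subseteq> J" using Pf idl_mem[OF _ x(1), of _ P] by (auto simp: J_def)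
  have "frac J"
  proof (rule fracI[OF _ _ OK_lattice])
   show "subgroup J" using OK_closed frac_closed(1,3)[OF fPa] by (auto simp: subgroup_def J_def left_diff_distrib)
   show "r * y \<in> J" if "r \<in> OK" "y \<in> J" for r y
    using that OK_closed(5) frac_mult[OF fPa] by (auto simp: J_def mult.assoc)
   show "z \<in> J" "z \<noteq> 0" using z PJ by auto
  qed (auto simp: J_def)
  moreover have "J \<noteq> OK"
  proof
   assume "J = OK"
   hence "1 \<in> J" using OK_closed(2) by simp
   thus False using x(2) by (simp add: J_def)
  qed
  ultimately show ?thesis using prm_maximal[OF P _ PJ] by (auto simp: J_def)
 qed
 have "card (cosets OK P) = card (cosets a (idl P a))"
 proof (rule card_cosets_eq[where f = "\<lambda>r. r * x"])
  show "subgroup P" "subgroup (idl P a)" "subgroup a" "idl P a \<subseteq> a"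
   using lattice_subgroup frac_lattice Pf fPa af sub by auto
  show "r * x \<in> a" if "r \<in> OK" for r using frac_mult[OF af that x(1)] .
  show "r - s \<in> P \<longleftrightarrow> r * x - s * x \<in> idl P a" if "r \<in> OK" "s \<in> OK" for r s
  proof -
   have "r - s \<in> P \<longleftrightarrow> r - s \<in> J" by (simp add: \<open>J = P\<close>)
   thus ?thesis using OK_closed(7)[OF that] by (simp add: J_def left_diff_distrib)
  qed
  show "\<exists>r\<in>OK. y - r * x \<in> idl P a" if "y \<in> a" for y
  proof -
   have "y \<in> c" using that \<open>c = a\<close> by simp
   then obtain u r where "y = u + x * r" "u \<in> idl P a" "r \<in> OK" unfolding c_def idlsum_def scale_def by blast
   thus ?thesis by (intro bexI[of _ r]) (auto simp: mult.commute)
  qed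
 qed
 moreover have "Nm P = card (cosets OK P)" by (simp add: ideal_norm_def cosets_def)
 ultimately show ?thesis using covol_index(1)[OF fPa af sub] by simp
qed

text \<open>The relation between the covolumes is what converts \<open>covol (iinv I)\<close> into
  \<open>covol OK / Nm I\<close> in the Mellin transform. Each prime factor multiplies the covolume
  of the ideal and divides that of the inverse by the same norm.\<close>

theorem ideal_invertible:
 assumes "I \<in> Ids"
 shows "invertible I \<and> covol I * covol (iinv I) = covol OK * covol OK" using assms
proof (induction rule: ideal_induct)
 case one
 have "idl OK OK = OK" by (rule idl_OK[OF frac_OK])
 thus ?case using iinv_unique[OF frac_OK frac_OK] by simp
next
 case (mult P a)
 note Pf = prm_frac[OF mult(1)]
 have af: "frac a" and ai: "idl a (iinv a) = OK" using mult by (auto simp: invertible_def)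
 have Pi: "idl P (iinv P) = OK" using prm_invertible(1)[OF mult(1)] by (simp add: invertible_def)
 let ?b = "idl (iinv P) (iinv a)"
 have fb: "frac ?b" and fPa: "frac (idl P a)" by (simp_all add: frac_idl frac_iinv Pf af)
 have "idl (idl P a) ?b = idl (idl P (iinv P)) (idl a (iinv a))" by (metis idl_assoc idl_commute)
 also have "\<dots> = OK" using Pi ai idl_OK(1)[OF frac_OK] by simp
 finally have e: "idl (idl P a) ?b = OK" .
 hence inv: "?b = iinv (idl P a)" "invertible (idl P a)" using iinv_unique[OF fPa fb] by auto
 have "invertible ?b" using iinv_unique(2)[OF fb fPa] e by (simp add: idl_commute)
 from covol_prm_mult[OF mult(1) this] have "covol (iinv a) = real (Nm P) * covol ?b"
  using prm_cancel(1)[OF mult(1) frac_iinv[OF af]] by simp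
 moreover have "covol (idl P a) = real (Nm P) * covol a"
  using covol_prm_mult[OF mult(1)] mult(3) by blast
 ultimately have "covol (idl P a) * covol ?b = covol a * covol (iinv a)" by simp
 thus ?case using mult(3) inv by simp
qed

text \<open>The unfolded theta integral runs over the fractional ideals that contain 1; this
  bijection turns it into a sum over integral ideals.\<close>

lemma iinv_bij: "bij_betw iinv Ids {c. frac c \<and> OK \<subseteq> c}"
proof (rule bij_betw_byWitness[where f' = iinv])
 have inv_inv: "iinv (iinv a) = a" if "invertible a" for a
  using iinv_unique(1)[of "iinv a" a] that frac_iinv by (auto simp: invertible_def idl_commute)
 show "\<forall>a\<in>Ids. iinv (iinv a) = a" using inv_inv ideal_invertible by blast
 have ic: "invertible c" if c: "frac c" for c
 proof -
  obtain m :: nat where m: "m > 0" "\<And>x. x \<in> c \<Longrightarrow> of_nat m * x \<in> OK" using frac_multiple[OF c] by blast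
  have mK: "of_nat m \<in> K" by (rule subfield_of_nat[OF F])
  have fs: "frac (scale (of_nat m) c)" using m by (intro frac_scale[OF c mK]) auto
  have "scale (of_nat m) c \<in> Ids" using fs m by (auto simp: nonzero_ideals_iff scale_def)
  hence i: "idl (scale (of_nat m) c) (iinv (scale (of_nat m) c)) = OK" using ideal_invertible by (auto simp: invertible_def)
  let ?d = "scale (of_nat m) (iinv (scale (of_nat m) c))"
  have fd: "frac ?d" using m by (intro frac_scale[OF frac_iinv[OF fs] mK]) auto
  have "idl c ?d = idl (scale (of_nat m) c) (iinv (scale (of_nat m) c))" unfolding idl_def
  proof (rule arg_cong[where f = Zmod.span], intro equalityI subsetI)
   fix z assume "z \<in> {x * y |x y. x \<in> c \<and> y \<in> ?d}"
   then obtain x w where "z = x * (of_nat m * w)" "x \<in> c" "w \<in> iinv (scale (of_nat m) c)" by (auto simp: scale_def)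
   thus "z \<in> {x * y |x y. x \<in> scale (of_nat m) c \<and> y \<in> iinv (scale (of_nat m) c)}"
    by - (rule CollectI, rule exI[of _ "of_nat m * x"], rule exI[of _ w], auto simp: scale_def)
  next
   fix z assume "z \<in> {x * y |x y. x \<in> scale (of_nat m) c \<and> y \<in> iinv (scale (of_nat m) c)}"
   then obtain x w where "z = (of_nat m * x) * w" "x \<in> c" "w \<in> iinv (scale (of_nat m) c)" by (auto simp: scale_def)
   thus "z \<in> {x * y |x y. x \<in> c \<and> y \<in> ?d}"
    by - (rule CollectI, rule exI[of _ x], rule exI[of _ "of_nat m * w"], auto simp: scale_def)
  qed
  thus ?thesis using iinv_unique(2)[OF c fd] i by simp
 qed
 show "\<forall>c\<in>{c. frac c \<and> OK \<subseteq> c}. iinv (iinv c) = c" using inv_inv ic by blast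
 show "iinv ` Ids \<subseteq> {c. frac c \<and> OK \<subseteq> c}"
  using frac_iinv OK_subset_K frac_mult by (auto simp: nonzero_ideals_iff iinv_def) (meson OK_closed(5) subsetD)
 show "iinv ` {c. frac c \<and> OK \<subseteq> c} \<subseteq> Ids"
 proof clarify
  fix c assume c: "frac c" "OK \<subseteq> c"
  have "iinv c \<subseteq> OK" using c(2) OK_closed(2) unfolding iinv_def by force
  thus "iinv c \<in> Ids" using frac_iinv[OF c(1)] by (simp add: nonzero_ideals_iff)
 qed
qed

lemma ideal_norm_mult:
 assumes P: "prm P" and a: "a \<in> Ids"
 shows "Nm (idl P a) = Nm P * Nm a" "idl P a \<in> Ids"
proof -
 have af: "frac a" "a \<subseteq> OK" using a by (auto simp: nonzero_ideals_iff)
 have "idl P a \<subseteq> OK" using idl_mono[OF prm_frac(2)[OF P] af(2)] idl_OK(1)[OF frac_OK] by simp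
 thus n: "idl P a \<in> Ids" using frac_idl[OF prm_frac(1)[OF P] af(1)] by (simp add: nonzero_ideals_iff)
 have "covol (idl P a) = real (Nm P) * covol a" using covol_prm_mult[OF P] ideal_invertible[OF a] by blast
 hence "real (Nm (idl P a)) = real (Nm P * Nm a)"
  using ideal_norm_covol[OF n] ideal_norm_covol[OF a] lattice_covol_pos[OF OK_lattice] by simp
 thus "Nm (idl P a) = Nm P * Nm a" by (rule of_nat_eq_iff[THEN iffD1])
qed

end

subsection \<open>The Euler product\<close>

lemma norm_of_nat_powr: "norm (of_nat m powr (- s) :: complex) = real m powr (- Re s)"
 using norm_powr_real_powr[of "of_nat m" "- s"] by simp

text \<open>After taking logarithms the claim is, term by term in the logarithm series,
  \<open>3 + 4 cos + cos of the double angle = 2 (1 + cos)^2 \<ge> 0\<close>. The hypothesis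
  \<open>z^2 = r * w\<close> says that \<open>w\<close> has twice the argument of
  \<open>z\<close>.\<close>

lemma cos_3_4_1:
 fixes r :: real and z w :: complex
 assumes r: "0 < r" "r < 1" and z: "cmod z = r" and w: "z\<^sup>2 = r * w"
 shows "cmod (1 - complex_of_real r) ^ 3 * cmod (1 - z) ^ 4 * cmod (1 - w) \<le> 1"
proof -
 define u where "u = z / r"
 have u: "cmod u = 1" "z = r * u" "w = r * u\<^sup>2"
  using r z w by (auto simp: u_def norm_divide power2_eq_square field_simps)
 have cw: "cmod w = r" using u r by (simp add: norm_mult norm_power)
 have L: "(\<lambda>k. Re (x ^ k / of_nat k)) sums (- ln (cmod (1 - x)))" if "cmod x < 1" for x :: complex
 proof -
  have "1 - x \<noteq> 0" using that by auto
  have "(\<lambda>k. Re (- (x ^ k) / of_nat k)) sums Re (ln (1 + - x))"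
   using sums_Re[OF Ln_series'[of "- x"]] that by simp
  hence "(\<lambda>k. - Re (- (x ^ k) / of_nat k)) sums - Re (ln (1 - x))" by (intro sums_minus) simp
  thus ?thesis using \<open>1 - x \<noteq> 0\<close> by (simp add: Re_Ln)
 qed
 have "(\<lambda>k. 3 * Re (complex_of_real r ^ k / of_nat k) + 4 * Re (z ^ k / of_nat k) + Re (w ^ k / of_nat k)) sums
   (3 * - ln (cmod (1 - complex_of_real r)) + 4 * - ln (cmod (1 - z)) + - ln (cmod (1 - w)))" (is "?f sums ?S")
  by (intro sums_add sums_mult L) (use r z cw in auto)
 moreover have "?f k \<ge> 0" for k
 proof -
  define v where "v = u ^ k"
  have "cmod v = 1" using u by (simp add: v_def norm_power)
  hence "(Re v)\<^sup>2 + (Im v)\<^sup>2 = 1" using cmod_power2[of v] by simp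
  hence "3 + 4 * Re v + Re (v\<^sup>2) = 2 * (1 + Re v)\<^sup>2" by (simp add: power2_eq_square algebra_simps)
  moreover have "?f k = r ^ k / real k * (3 + 4 * Re v + Re (v\<^sup>2))"
  proof -
   have "complex_of_real r ^ k / of_nat k = of_real (r ^ k / k)" "z ^ k / of_nat k = of_real (r ^ k / k) * v"
    "w ^ k / of_nat k = of_real (r ^ k / k) * v\<^sup>2"
    by (simp_all add: u(2,3) v_def power_mult_distrib flip: power_mult) (simp_all add: mult.commute)
   thus ?thesis by (simp only: Re_complex_of_real times_complex.sel Im_complex_of_real) (simp add: algebra_simps add_divide_distrib)
  qed
  ultimately show ?thesis using r by simp
 qed
 ultimately have S: "?S \<ge> 0" by (rule sums_le[OF _ sums_zero, rotated])
 have p: "cmod (1 - complex_of_real r) > 0" "cmod (1 - z) > 0" "cmod (1 - w) > 0" using r z cw by auto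
 hence "ln (cmod (1 - complex_of_real r) ^ 3 * cmod (1 - z) ^ 4 * cmod (1 - w)) \<le> ln 1"
  using S by (simp add: ln_mult ln_realpow)
 thus ?thesis using p by (subst (asm) ln_le_cancel_iff) auto
qed

context nfield
begin

lemma prm_contains:
 assumes Q: "prm Q" and P: "prm P" and a: "a \<in> Ids" and sub: "idl P a \<subseteq> Q"
 shows "Q = P \<or> a \<subseteq> Q"
proof (rule disjCI)
 assume "\<not> a \<subseteq> Q"
 then obtain y where y: "y \<in> a" "y \<notin> Q" by blast
 have aO: "a \<subseteq> OK" using a by (simp add: nonzero_ideals_iff)
 have "x \<in> Q" if "x \<in> P" for x
  using Q y aO prm_frac(2)[OF P] that idl_mem[OF that y(1)] sub unfolding prm_def by blast
 hence "P \<subseteq> Q" by blast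
 thus "Q = P" using prm_maximal[OF P prm_frac(1)[OF Q] _ prm_frac(2)[OF Q]] Q OK_closed(2) by (auto simp: prm_def)
qed

lemma prm_norm_ge2: "prm P \<Longrightarrow> Nm P \<ge> 2"
proof -
 assume P: "prm P"
 have O: "OK \<in> Ids" using frac_OK by (simp add: nonzero_ideals_iff)
 have "Nm P > Nm OK"
  using P O OK_closed(2) by (intro ideal_norm_strict) (auto simp: prm_def nonzero_ideals_iff)
 thus ?thesis using ideal_norm_covol(2)[OF O] by simp
qed

lemma prm_q_less_1: "prm P \<Longrightarrow> s > 0 \<Longrightarrow> real (Nm P) powr (- s) < 1"
 using prm_norm_ge2[of P] powr_less_mono[of "- s" 0 "real (Nm P)"] by auto

text \<open>Distinct primes containing \<open>I\<close> can be divided out one after the other,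
  since a quotient by one of them is still contained in the rest.\<close>

lemma prod_norm_le:
 assumes "finite F" "\<And>P. P \<in> F \<Longrightarrow> prm P \<and> I \<subseteq> P" "I \<in> Ids"
 shows "(\<Prod>P\<in>F. Nm P) \<le> Nm I" using assms
proof (induction F arbitrary: I rule: finite_induct)
 case empty
 thus ?case using ideal_norm_covol(2)[of I] by simp
next
 case (insert P F)
 have P: "prm P" "I \<subseteq> P" using insert.prems(1) by auto
 define J where "J = idl (iinv P) I"
 have J: "J \<in> Ids" unfolding J_def by (rule prm_divide(1)[OF P(1) insert.prems(2) P(2)])
 have I: "idl P J = I" using prm_cancel(1)[OF P(1)] insert.prems(2) by (simp add: J_def nonzero_ideals_iff)
 have "J \<subseteq> Q" if "Q \<in> F" for Q
  using prm_contains[OF _ P(1) J, of Q] I insert.prems(1)[of Q] that insert.hyps by auto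
 moreover have "prm Q" if "Q \<in> F" for Q using insert.prems(1)[of Q] that by simp
 ultimately have "(\<Prod>P\<in>F. Nm P) \<le> Nm J" using insert.IH[of J] J by blast
 thus ?case using insert.hyps ideal_norm_mult(1)[OF P(1) J] I by simp
qed

lemma finite_prm_above:
 assumes I: "I \<in> Ids"
 shows "finite {P. prm P \<and> I \<subseteq> P}"
proof (rule ccontr)
 assume "infinite {P. prm P \<and> I \<subseteq> P}"
 then obtain F where F: "F \<subseteq> {P. prm P \<and> I \<subseteq> P}" "finite F" "card F = Nm I"
  by (meson infinite_arbitrarily_large)
 have "(\<Prod>P\<in>F. 2) \<le> (\<Prod>P\<in>F. Nm P)" using prm_norm_ge2 F by (intro prod_mono) auto
 also have "\<dots> \<le> Nm I" using F I by (intro prod_norm_le) auto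
 finally have "2 ^ card F \<le> Nm I" by simp
 thus False using F(3) less_exp[of "card F"] by linarith
qed

section \<open>Primes above rational primes and convergence of the Dirichlet series\<close>

lemma prm_rational:
 assumes P: "prm P"
 obtains q where "prime q" "of_nat q \<in> P"
proof -
 obtain m :: nat where m: "m > 0" "of_nat m * 1 \<in> P" using lattice_multiple[OF frac_lattice[OF prm_frac(1)[OF P]] K_closed(2)] by blast
 have "m > 0 \<Longrightarrow> of_nat m \<in> P \<Longrightarrow> \<exists>q. prime q \<and> of_nat q \<in> P"
 proof (induction m rule: less_induct)
  case (less m)
  have "m \<noteq> 1" using P less.prems by (auto simp: prm_def)
  then obtain q where q: "prime q" "q dvd m" using prime_factor_nat by blast
  then obtain k where k: "m = q * k" by blast
  have "of_nat q * of_nat k \<in> P" using less.prems k by simp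
  moreover have "(of_nat i :: complex) \<in> OK" for i using OK_closed(3)[of "int i"] by simp
  ultimately have "of_nat q \<in> P \<or> of_nat k \<in> P" using P unfolding prm_def by blast
  thus ?case using less.IH[of k] less.prems k q prime_gt_1_nat[OF q(1)] by auto
 qed
 thus ?thesis using m that by auto
qed

lemma principal_rational:
 assumes q: "q > (0::nat)"
 shows "scale (of_nat q) OK \<in> Ids" "Nm (scale (of_nat q) OK) = q ^ n"
proof -
 have pO: "(of_nat q :: complex) \<in> OK" using OK_closed(3)[of "int q"] by simp
 show I: "scale (of_nat q) OK \<in> Ids"
  using frac_principal(1,2)[OF pO] q by (simp add: nonzero_ideals_iff)
 have "emb i (of_nat q) = of_nat q" if "i < n" for i using emb_of_int[OF that, of "int q"] by simp
 hence "covol (scale (of_nat q) OK) = real q ^ n * covol OK"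
  using scale_lattice(2)[OF OK_lattice, of "of_nat q"] pO OK_subset_K q by (auto simp: prod_norm norm_power)
 hence "real (Nm (scale (of_nat q) OK)) = real (q ^ n)"
  using ideal_norm_covol(1)[OF I] lattice_covol_pos[OF OK_lattice] by simp
 thus "Nm (scale (of_nat q) OK) = q ^ n" by (rule of_nat_eq_iff[THEN iffD1])
qed

text \<open>The norm divides the norm \<open>q ^ n\<close> of the ideal generated by
  \<open>q\<close>, so it is a power of \<open>q\<close>, and it is not 1.\<close>

lemma prm_norm_ge:
 assumes P: "prm P" and q: "prime q" "of_nat q \<in> P"
 shows "scale (of_nat q) OK \<subseteq> P" "Nm P \<ge> q"
proof -
 note I = principal_rational[OF prime_gt_0_nat[OF q(1)]]
 show sub: "scale (of_nat q) OK \<subseteq> P" using frac_mult[OF prm_frac(1)[OF P] _ q(2)] by (auto simp: scale_def mult.commute)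
 let ?c = "card (cosets P (scale (of_nat q) OK))"
 have "covol (scale (of_nat q) OK) = real ?c * covol P"
  using I sub by (intro covol_index(1) prm_frac(1)[OF P]) (auto simp: nonzero_ideals_iff)
 moreover have "covol P = real (Nm P) * covol OK" by (rule ideal_norm_covol) (use P in \<open>simp add: prm_def\<close>)
 ultimately have "real (q ^ n) = real (?c * Nm P)"
  using ideal_norm_covol(1)[OF I(1)] I(2) lattice_covol_pos[OF OK_lattice] by simp
 hence eq: "q ^ n = ?c * Nm P" by (rule of_nat_eq_iff[THEN iffD1])
 hence "Nm P dvd q ^ n" by simp
 then obtain i where "Nm P = q ^ i" using divides_primepow_nat[OF q(1)] by blast
 moreover hence "i \<noteq> 0" using prm_norm_ge2[OF P] by (cases i) auto
 ultimately show "Nm P \<ge> q" using self_le_power[of q i] prime_ge_1_nat[OF q(1)] by auto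
qed

text \<open>At most \<open>n\<close> primes lie over a rational prime: their norms are at least
  \<open>q\<close> each, and the product of the norms is at most \<open>q ^ n\<close>.\<close>

lemma sum_prm_bound:
 assumes s: "s > (1::real)" and F: "finite F" "\<And>P. P \<in> F \<Longrightarrow> prm P"
 shows "(\<Sum>P\<in>F. real (Nm P) powr (- s)) \<le> n * (\<Sum>m. real m powr (- s))"
proof -
 have "\<forall>P. \<exists>q::nat. prm P \<longrightarrow> prime q \<and> of_nat q \<in> P" by (meson prm_rational)
 from choice[OF this] obtain g :: "complex set \<Rightarrow> nat" where g: "\<And>P. prm P \<Longrightarrow> prime (g P) \<and> of_nat (g P) \<in> P" by blast
 have card: "card {P \<in> F. g P = m} \<le> n" if m: "m \<in> g ` F" for m
 proof -
  let ?G = "{P \<in> F. g P = m}"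
  have mp: "prime m" using m g F by auto
  note I = principal_rational[OF prime_gt_0_nat[OF mp]]
  have "(\<Prod>P\<in>?G. m) \<le> (\<Prod>P\<in>?G. Nm P)" using prm_norm_ge(2) g F by (intro prod_mono) auto
  also have "\<dots> \<le> Nm (scale (of_nat m) OK)"
  proof (rule prod_norm_le[OF _ _ I(1)])
   show "prm P \<and> scale (of_nat m) OK \<subseteq> P" if "P \<in> ?G" for P using that g F prm_norm_ge(1)[of P m] by auto
  qed (use F in auto)
  finally have "m ^ card ?G \<le> m ^ n" using I(2) by simp
  thus ?thesis using prime_gt_1_nat[OF mp] by (subst (asm) power_increasing_iff) auto
 qed
 have "(\<Sum>P\<in>F. real (Nm P) powr (- s)) \<le> (\<Sum>P\<in>F. real (g P) powr (- s))"
  using s g F prm_norm_ge(2) by (intro sum_mono powr_mono2') (auto intro!: prime_gt_0_nat)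
 also have "\<dots> = (\<Sum>m\<in>g ` F. \<Sum>P | P \<in> F \<and> g P = m. real (g P) powr (- s))"
  using sum.image_gen[OF F(1), of "\<lambda>P. real (g P) powr (- s)" g] .
 also have "\<dots> = (\<Sum>m\<in>g ` F. card {P \<in> F. g P = m} * real m powr (- s))" by (intro sum.cong) auto
 also have "\<dots> \<le> (\<Sum>m\<in>g ` F. n * real m powr (- s))" using card by (intro sum_mono mult_right_mono) auto
 also have "\<dots> = n * (\<Sum>m\<in>g ` F. real m powr (- s))" by (simp add: sum_distrib_left)
 also have "\<dots> \<le> n * (\<Sum>m. real m powr (- s))"
  using F s by (intro mult_left_mono sum_le_suminf) (auto simp: summable_real_powr_iff)
 finally show ?thesis .
qed

text \<open>The ideals all of whose prime divisors belong to \<open>F\<close>; containment in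
  \<open>P\<close> expresses divisibility by \<open>P\<close>.\<close>

definition smth :: "complex set set \<Rightarrow> complex set set" where
 "smth F = {a \<in> Ids. \<forall>P. prm P \<longrightarrow> a \<subseteq> P \<longrightarrow> P \<in> F}"

lemma smth_empty: "smth {} = {OK}"
proof -
 have O: "OK \<in> Ids" using frac_OK by (simp add: nonzero_ideals_iff)
 have "\<not> OK \<subseteq> P" if "prm P" for P using that OK_closed(2) by (auto simp: prm_def)
 hence "OK \<in> smth {}" using O by (auto simp: smth_def)
 moreover have "a = OK" if aS: "a \<in> smth {}" for a
 proof (rule ccontr)
  assume "a \<noteq> OK"
  then obtain P where "prm P" "a \<subseteq> P" using ex_prm[of a] aS unfolding smth_def by blast
  thus False using aS by (auto simp: smth_def)
 qed
 ultimately show ?thesis by blast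
qed

lemma ideal_norm_OK: "Nm OK = 1"
 using ideal_norm_covol(1)[of OK] lattice_covol_pos[OF OK_lattice] frac_OK by (simp add: nonzero_ideals_iff)

text \<open>An ideal of the larger class is either free of \<open>P\<close> or \<open>P\<close>
  times an ideal of the same class. The generating sum therefore satisfies
  \<open>S' = S + q * S'\<close>, which replaces a sum over exponents of \<open>P\<close>.\<close>

lemma smth_insert:
 assumes P: "prm P" "P \<notin> F"
 shows "smth (insert P F) = smth F \<union> idl P ` smth (insert P F)" "smth F \<inter> idl P ` smth (insert P F) = {}"
  "inj_on (idl P) (smth (insert P F))" "a \<in> smth (insert P F) - smth F \<Longrightarrow> a \<subseteq> P"
proof -
 have sub: "idl P a \<subseteq> P" if "a \<in> Ids" for a
  using that idl_mono[of P P a OK] idl_OK(2)[OF prm_frac(1)[OF P(1)]] by (simp add: nonzero_ideals_iff)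
 show aP: "a \<subseteq> P" if "a \<in> smth (insert P F) - smth F" for a using that by (auto simp: smth_def)
 show "smth F \<inter> idl P ` smth (insert P F) = {}" using sub P by (fastforce simp: smth_def)
 show "inj_on (idl P) (smth (insert P F))"
  using prm_cancel(2)[OF P(1)] by (intro inj_on_inverseI[of _ "idl (iinv P)"]) (auto simp: smth_def nonzero_ideals_iff)
 show "smth (insert P F) = smth F \<union> idl P ` smth (insert P F)"
 proof
  show "smth (insert P F) \<subseteq> smth F \<union> idl P ` smth (insert P F)"
  proof
   fix a assume a: "a \<in> smth (insert P F)"
   show "a \<in> smth F \<union> idl P ` smth (insert P F)"
   proof (cases "a \<in> smth F")
    case False
    have aI: "a \<in> Ids" using a by (simp add: smth_def)
    have "a \<subseteq> P" using aP a False by blast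
    note d = prm_divide[OF P(1) aI this]
    have "idl (iinv P) a \<in> smth (insert P F)" using a d unfolding smth_def by blast
    moreover have "a = idl P (idl (iinv P) a)" using prm_cancel(1)[OF P(1)] aI by (simp add: nonzero_ideals_iff)
    ultimately show ?thesis by blast
   qed simp
  qed
  have "idl P a \<in> smth (insert P F)" if "a \<in> smth (insert P F)" for a
   using that prm_contains[OF _ P(1), of _ a] ideal_norm_mult(2)[OF P(1), of a] unfolding smth_def by blast
  thus "smth F \<union> idl P ` smth (insert P F) \<subseteq> smth (insert P F)" by (auto simp: smth_def)
 qed
qed

text \<open>Convergence is not yet available, so the equation \<open>S' = S + q * S'\<close> is used
  for finite partial sums: an inner induction on a bound \<open>x\<close> for the norms, which is at
  least halved when \<open>P\<close> is divided out.\<close>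

lemma smth_bound:
 fixes s :: real
 assumes s: "s > 0" and F: "finite F" "\<And>P. P \<in> F \<Longrightarrow> prm P"
  and A: "finite A" "A \<subseteq> smth F"
 shows "(\<Sum>a\<in>A. real (Nm a) powr (- s)) \<le> (\<Prod>P\<in>F. 1 / (1 - real (Nm P) powr (- s)))"
 using F A
proof (induction F arbitrary: A rule: finite_induct)
 case empty
 hence "A = {} \<or> A = {OK}" by (auto simp: smth_empty)
 thus ?case by (auto simp: ideal_norm_OK)
next
 case (insert P F)
 let ?g = "\<lambda>a. real (Nm a) powr (- s)" and ?T = "\<Prod>P\<in>F. 1 / (1 - real (Nm P) powr (- s))"
 have P: "prm P" using insert by auto
 note si = smth_insert[OF P insert.hyps(2)]
 have q: "?g P < 1" by (rule prm_q_less_1[OF P s])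
 have main: "(\<Sum>a\<in>A. ?g a) \<le> 1 / (1 - ?g P) * ?T"
  if "finite A" "A \<subseteq> smth (insert P F)" "\<forall>a\<in>A. Nm a \<le> x" for A x
  using that
 proof (induction x arbitrary: A rule: less_induct)
  case (less x)
  let ?B = "A - smth F" and ?C = "idl (iinv P) ` (A - smth F)"
  have fr: "frac a" "a \<in> Ids" if "a \<in> ?B" for a using that less.prems by (auto simp: smth_def nonzero_ideals_iff)
  have inB: "idl P (idl (iinv P) a) = a" "idl (iinv P) a \<in> smth (insert P F)" if "a \<in> ?B" for a
  proof -
   show "idl P (idl (iinv P) a) = a" by (rule prm_cancel(1)[OF P fr(1)[OF that]])
   have "a \<subseteq> P" using si(4) that less.prems(2) by blast
   thus "idl (iinv P) a \<in> smth (insert P F)"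
    using prm_divide[OF P fr(2)[OF that]] that less.prems(2) unfolding smth_def by blast
  qed
  have inj: "inj_on (idl (iinv P)) ?B" using inB(1) by (intro inj_on_inverseI[of _ "idl P"]) auto
  have nrm: "Nm a = Nm P * Nm (idl (iinv P) a)" if "a \<in> ?B" for a
   using ideal_norm_mult(1)[OF P, of "idl (iinv P) a"] inB[OF that] by (simp add: smth_def)
  have "(\<Sum>a\<in>?B. ?g a) \<le> ?g P * (1 / (1 - ?g P) * ?T)"
  proof (cases "?B = {}")
   case True
   have "0 \<le> (1 / (1 - ?g P) * ?T)" using q order.trans[OF sum_nonneg insert.IH[of "{}"]] insert by auto
   thus ?thesis unfolding True sum.empty by (rule mult_nonneg_nonneg[OF powr_ge_zero])
  next
   case False
   hence x: "x > 0" using fr(2) ideal_norm_covol(2) less.prems(3) by fastforce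
   have le: "Nm c \<le> x div 2" if cC: "c \<in> ?C" for c
   proof -
    obtain a where a: "c = idl (iinv P) a" "a \<in> ?B" using cC by blast
    have "2 * Nm c \<le> Nm a" using nrm[OF a(2)] a prm_norm_ge2[OF P] by simp
    thus ?thesis using less.prems(3) a by fastforce
   qed
   have "(\<Sum>a\<in>?B. ?g a) = (\<Sum>a\<in>?B. ?g P * ?g (idl (iinv P) a))" using nrm by (intro sum.cong) (auto simp: powr_mult)
   also have "\<dots> = ?g P * (\<Sum>c\<in>?C. ?g c)" by (simp add: sum.reindex[OF inj] sum_distrib_left)
   also have "\<dots> \<le> ?g P * (1 / (1 - ?g P) * ?T)"
    using less.IH[of "x div 2" ?C] less.prems(1) inB le x by (intro mult_left_mono) auto
   finally show ?thesis .
  qed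
  moreover have "(\<Sum>a\<in>A \<inter> smth F. ?g a) \<le> ?T" using insert less.prems(1) by (intro insert.IH) auto
  moreover have "(\<Sum>a\<in>A. ?g a) = (\<Sum>a\<in>A \<inter> smth F. ?g a) + (\<Sum>a\<in>?B. ?g a)"
   using less.prems(1) by (simp add: sum.Int_Diff)
  moreover have "?T + ?g P * (1 / (1 - ?g P) * ?T) = 1 / (1 - ?g P) * ?T" using q by (simp add: field_simps)
  ultimately show ?case by linarith
 qed
 show ?case
  using main[OF insert.prems(2,3), of "Max (Nm ` A)"] insert.prems(2) insert.hyps(1,2) by simp
qed

lemma zeta_summable:
 assumes s: "s > (1::real)"
 shows "(\<lambda>a. real (Nm a) powr (- s)) summable_on Ids"
proof (rule nonneg_bounded_partial_sums_imp_summable_on)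
 let ?g = "\<lambda>a. real (Nm a) powr (- s)" and ?B = "exp (2 * (n * (\<Sum>m. real m powr (- s))))"
 show "\<forall>\<^sub>F X in finite_subsets_at_top Ids. sum ?g X \<le> ?B"
 proof (rule eventually_finite_subsets_at_top_weakI)
  fix A assume A: "finite A" "A \<subseteq> Ids"
  define F where "F = (\<Union>a\<in>A. {P. prm P \<and> a \<subseteq> P})"
  have F: "finite F" "\<And>P. P \<in> F \<Longrightarrow> prm P" "A \<subseteq> smth F" using A finite_prm_above by (auto simp: F_def smth_def)
  have "sum ?g A \<le> (\<Prod>P\<in>F. 1 / (1 - ?g P))" using F A s by (intro smth_bound) auto
  also have "\<dots> \<le> (\<Prod>P\<in>F. exp (2 * ?g P))"
  proof (intro prod_mono conjI)
   fix P assume P: "P \<in> F"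
   \<comment> \<open>Norms are at least 2 and \<open>s > 1\<close>, so each Euler term
     \<open>q\<close> is at most 1/2; then
     \<open>1 / (1 - q) \<le> 1 + 2 * q \<le> exp (2 * q)\<close>, and the product is controlled by
     the sum over primes.\<close>
   have "?g P \<le> 2 powr (- s)" using prm_norm_ge2[OF F(2)[OF P]] s by (intro powr_mono2') auto
   also have "\<dots> \<le> 2 powr (- 1)" using s by (intro powr_mono) auto
   finally have q: "?g P \<le> 1/2" by (simp add: powr_minus)
   thus "0 \<le> 1 / (1 - ?g P)" by simp
   have "1 / (1 - ?g P) \<le> 1 + 2 * ?g P" using q mult_left_mono[OF q, of "?g P"] by (simp add: field_simps)
   also have "\<dots> \<le> exp (2 * ?g P)" by (rule exp_ge_add_one_self)
   finally show "1 / (1 - ?g P) \<le> exp (2 * ?g P)" .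
  qed
  also have "\<dots> = exp (2 * sum ?g F)" using F by (simp add: exp_sum sum_distrib_left)
  also have "\<dots> \<le> ?B" using sum_prm_bound[OF s F(1,2)] by simp
  finally show "sum ?g A \<le> ?B" .
 qed
qed simp

lemma zeta_abs_summable: "Re s > 1 \<Longrightarrow> (\<lambda>a. norm (of_nat (Nm a) powr (- s) :: complex)) summable_on Ids"
 using zeta_summable[of "Re s"] by (simp add: norm_of_nat_powr)

text \<open>With summability established, the relation \<open>S' = S + q * S'\<close> can be solved
  for \<open>S'\<close>, which yields one Euler factor per prime.\<close>

lemma smth_euler:
 assumes s: "Re s > 1" and F: "finite F" "\<And>P. P \<in> F \<Longrightarrow> prm P"
 shows "(\<Sum>\<^sub>\<infinity>a\<in>smth F. of_nat (Nm a) powr (- s)) = (\<Prod>P\<in>F. 1 / (1 - (of_nat (Nm P) powr (- s) :: complex)))"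
 using F
proof (induction F rule: finite_induct)
 case empty
 thus ?case by (simp add: smth_empty ideal_norm_OK)
next
 case (insert P F)
 let ?g = "\<lambda>a. of_nat (Nm a) powr (- s) :: complex"
 have P: "prm P" using insert by auto
 note si = smth_insert[OF P insert.hyps(2)]
 have sm: "?g summable_on smth G" for G
  using abs_summable_summable[OF zeta_abs_summable[OF s]] by (rule summable_on_subset) (auto simp: smth_def)
 have sm': "?g summable_on idl P ` smth (insert P F)"
  by (rule summable_on_subset[OF sm[of "insert P F"]]) (use si(1) in blast)
 have "infsum ?g (idl P ` smth (insert P F)) = (\<Sum>\<^sub>\<infinity>a\<in>smth (insert P F). ?g P * ?g a)"
  using ideal_norm_mult(1)[OF P] unfolding infsum_reindex[OF si(3)] o_def
  by (intro infsum_cong) (auto simp: smth_def powr_times_real)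
 also have "\<dots> = ?g P * infsum ?g (smth (insert P F))" by (rule infsum_cmult_right) (use sm in auto)
 finally have "infsum ?g (smth (insert P F)) = infsum ?g (smth F) + ?g P * infsum ?g (smth (insert P F))"
  using infsum_Un_disjoint[OF sm[of F] sm' si(2)] si(1) by simp
 hence "infsum ?g (smth (insert P F)) * (1 - ?g P) = infsum ?g (smth F)" by (simp add: algebra_simps)
 moreover have "cmod (?g P) < 1"
  using prm_q_less_1[OF P, of "Re s"] s unfolding norm_of_nat_powr by simp
 hence "1 - ?g P \<noteq> 0" by auto
 ultimately show ?case using insert by (simp add: field_simps)
qed

lemma dedekind_series_euler:
 assumes s: "Re s > 1"
 shows "((\<lambda>F. \<Prod>P\<in>F. 1 / (1 - (of_nat (Nm P) powr (- s) :: complex))) \<longlongrightarrow> dedekind_series K s)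
  (finite_subsets_at_top {P. prm P})"
proof (rule tendstoI)
 fix e :: real assume e: "e > 0"
 let ?g = "\<lambda>a. of_nat (Nm a) powr (- s) :: complex" and ?I = "Ids"
 have sm: "?g summable_on ?I" by (rule abs_summable_summable[OF zeta_abs_summable[OF s]])
 hence "(sum ?g \<longlongrightarrow> dedekind_series K s) (finite_subsets_at_top ?I)"
  using has_sum_infsum by (auto simp: dedekind_series_def has_sum_def)
 hence "\<forall>\<^sub>F A in finite_subsets_at_top ?I. dist (sum ?g A) (dedekind_series K s) < e / 2"
  using e by (auto dest!: tendstoD[of _ _ _ "e / 2"])
 then obtain A0 where A0: "finite A0" "A0 \<subseteq> ?I"
  "\<And>A. finite A \<Longrightarrow> A0 \<subseteq> A \<Longrightarrow> A \<subseteq> ?I \<Longrightarrow> dist (sum ?g A) (dedekind_series K s) < e / 2"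
  unfolding eventually_finite_subsets_at_top by metis
 \<comment> \<open>As soon as \<open>F\<close> contains every prime dividing some ideal of
   \<open>A0\<close>, the ideals composed of primes of \<open>F\<close> include \<open>A0\<close>,
   and the corresponding sum is close to the full series.\<close>
 define F0 where "F0 = (\<Union>a\<in>A0. {P. prm P \<and> a \<subseteq> P})"
 have "dist (\<Prod>P\<in>F. 1 / (1 - ?g P)) (dedekind_series K s) < e"
  if F: "finite F" "F0 \<subseteq> F" "F \<subseteq> {P. prm P}" for F
 proof -
  have sub: "A0 \<subseteq> smth F" "smth F \<subseteq> ?I" using A0 F by (auto simp: F0_def smth_def)
  have "(sum ?g \<longlongrightarrow> infsum ?g (smth F)) (finite_subsets_at_top (smth F))"
   using has_sum_infsum[OF summable_on_subset[OF sm sub(2)]] by (simp add: has_sum_def)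
  moreover have "\<forall>\<^sub>F A in finite_subsets_at_top (smth F). dist (sum ?g A) (dedekind_series K s) \<le> e / 2"
   unfolding eventually_finite_subsets_at_top
  proof (intro exI[of _ A0] conjI allI impI)
   fix A assume "finite A \<and> A0 \<subseteq> A \<and> A \<subseteq> smth F"
   thus "dist (sum ?g A) (dedekind_series K s) \<le> e / 2" using A0(3)[of A] sub by (meson less_imp_le order_trans)
  qed (use A0(1) sub in auto)
  ultimately have "dist (infsum ?g (smth F)) (dedekind_series K s) \<le> e / 2"
   by (intro tendsto_upperbound[OF tendsto_dist[OF _ tendsto_const]]) auto
  moreover have "infsum ?g (smth F) = (\<Prod>P\<in>F. 1 / (1 - ?g P))" by (rule smth_euler[OF s F(1)]) (use F(3) in auto)
  ultimately show ?thesis using e by simp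
 qed
 moreover have "finite F0" "F0 \<subseteq> {P. prm P}" using A0 finite_prm_above by (auto simp: F0_def)
 ultimately show "\<forall>\<^sub>F F in finite_subsets_at_top {P. prm P}. dist (\<Prod>P\<in>F. 1 / (1 - ?g P)) (dedekind_series K s) < e"
  unfolding eventually_finite_subsets_at_top by blast
qed

lemma dedekind_series_3_4_1:
 assumes s: "\<sigma> > (1::real)"
 shows "cmod (dedekind_series K \<sigma>) ^ 3 * cmod (dedekind_series K (Complex \<sigma> \<tau>)) ^ 4 * cmod (dedekind_series K (Complex \<sigma> (2 * \<tau>))) \<ge> 1"
proof (rule tendsto_lowerbound)
 let ?E = "\<lambda>s F. \<Prod>P\<in>F. 1 / (1 - (of_nat (Nm P) powr (- s) :: complex))"
 show "((\<lambda>F. cmod (?E \<sigma> F) ^ 3 * cmod (?E (Complex \<sigma> \<tau>) F) ^ 4 * cmod (?E (Complex \<sigma> (2 * \<tau>)) F)) \<longlongrightarrow>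
  cmod (dedekind_series K \<sigma>) ^ 3 * cmod (dedekind_series K (Complex \<sigma> \<tau>)) ^ 4 * cmod (dedekind_series K (Complex \<sigma> (2 * \<tau>))))
  (finite_subsets_at_top {P. prm P})"
  by (intro tendsto_intros dedekind_series_euler) (use s in auto)
 have "cmod (?E \<sigma> F) ^ 3 * cmod (?E (Complex \<sigma> \<tau>) F) ^ 4 * cmod (?E (Complex \<sigma> (2 * \<tau>)) F) \<ge> 1"
  if F: "finite F" "F \<subseteq> {P. prm P}" for F
 proof -
  define T where "T P s = cmod (1 / (1 - (of_nat (Nm P) powr (- s) :: complex)))" for P s
  have "1 \<le> T P \<sigma> ^ 3 * T P (Complex \<sigma> \<tau>) ^ 4 * T P (Complex \<sigma> (2 * \<tau>))" if "P \<in> F" for P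
  proof -
   define r z w where "r = real (Nm P) powr (- \<sigma>)"
    and "z = (of_nat (Nm P) powr (- Complex \<sigma> \<tau>) :: complex)"
    and "w = (of_nat (Nm P) powr (- Complex \<sigma> (2 * \<tau>)) :: complex)"
   have N: "Nm P \<ge> 2" using that F prm_norm_ge2 by auto
   have rr: "(of_nat (Nm P) powr (- complex_of_real \<sigma>) :: complex) = of_real r"
    using powr_of_real[of "real (Nm P)" "- \<sigma>"] by (simp add: r_def)
   have r: "0 < r" "r < 1" using N s prm_q_less_1[of P \<sigma>] that F by (auto simp: r_def)
   have cz: "cmod z = r" "cmod w = r" by (simp_all add: z_def w_def r_def norm_of_nat_powr)
   let ?L = "complex_of_real (ln (real (Nm P)))"
   have pw: "of_nat (Nm P) powr u = exp (u * ?L)" for u :: complex using N by (simp add: powr_def)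
   have "- Complex \<sigma> \<tau> * ?L + - Complex \<sigma> \<tau> * ?L = - complex_of_real \<sigma> * ?L + - Complex \<sigma> (2 * \<tau>) * ?L"
    by (simp add: complex_eq_iff)
   hence "z\<^sup>2 = r * w"
    unfolding z_def w_def rr[symmetric] pw power2_eq_square exp_add[symmetric] by (rule arg_cong)
   note * = cos_3_4_1[OF r cz(1) this]
   have p: "cmod (1 - complex_of_real r) > 0" "cmod (1 - z) > 0" "cmod (1 - w) > 0" using r cz by auto
   have "T P \<sigma> ^ 3 * T P (Complex \<sigma> \<tau>) ^ 4 * T P (Complex \<sigma> (2 * \<tau>)) =
     1 / (cmod (1 - complex_of_real r) ^ 3 * cmod (1 - z) ^ 4 * cmod (1 - w))"
    unfolding T_def rr z_def[symmetric] w_def[symmetric] by (simp add: norm_divide power_divide)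
   moreover have "0 < cmod (1 - complex_of_real r) ^ 3 * cmod (1 - z) ^ 4 * cmod (1 - w)" using p by simp
   ultimately show ?thesis using * by (simp only: le_divide_eq_1_pos)
  qed
  hence "1 \<le> (\<Prod>P\<in>F. T P \<sigma> ^ 3 * T P (Complex \<sigma> \<tau>) ^ 4 * T P (Complex \<sigma> (2 * \<tau>)))" by (rule prod_ge_1)
  thus ?thesis by (simp add: T_def prod.distrib prod_power_distrib flip: prod_norm)
 qed
 thus "\<forall>\<^sub>F F in finite_subsets_at_top {P. prm P}.
   1 \<le> cmod (?E \<sigma> F) ^ 3 * cmod (?E (Complex \<sigma> \<tau>) F) ^ 4 * cmod (?E (Complex \<sigma> (2 * \<tau>)) F)"
  by (intro eventually_finite_subsets_at_top_weakI) auto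
qed (rule finite_subsets_at_top_neq_bot)

lemma dedekind_series_holomorphic: "dedekind_series K holomorphic_on {s. Re s > 1}"
proof (rule holomorphic_onI)
 fix s :: complex assume s: "s \<in> {s. Re s > 1}"
 define r where "r = (Re s - 1) / 2"
 have r: "r > 0" "Re s - r > 1" using s by (auto simp: r_def field_simps)
 have low: "Re z \<ge> Re s - r" if "z \<in> cball s r" for z
  using that abs_Re_le_cmod[of "s - z"] by (auto simp: dist_norm)
 let ?g = "\<lambda>a z. of_nat (Nm a) powr (- z) :: complex"
 have ul: "uniform_limit (cball s r) (\<lambda>A z. \<Sum>a\<in>A. ?g a z) (\<lambda>z. \<Sum>\<^sub>\<infinity>a\<in>Ids. ?g a z) (finite_subsets_at_top Ids)"
 proof (rule Weierstrass_m_test_general)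
  show "(\<lambda>a. real (Nm a) powr (- (Re s - r))) summable_on Ids" by (rule zeta_summable) (use r in auto)
  show "norm (?g a z) \<le> real (Nm a) powr (- (Re s - r))" if "a \<in> Ids" "z \<in> cball s r" for a z
   using low[OF that(2)] ideal_norm_covol(2)[OF that(1)] unfolding norm_of_nat_powr by (intro powr_mono) auto
 qed
 have "(\<lambda>z. \<Sum>a\<in>A. ?g a z) holomorphic_on X" if "A \<subseteq> Ids" for A X
  using that ideal_norm_covol(2) by (intro holomorphic_intros) auto
 hence ev: "\<forall>\<^sub>F A in finite_subsets_at_top Ids. continuous_on (cball s r) (\<lambda>z. \<Sum>a\<in>A. ?g a z) \<and>
   (\<lambda>z. \<Sum>a\<in>A. ?g a z) holomorphic_on ball s r"
  by (intro eventually_finite_subsets_at_top_weakI conjI holomorphic_on_imp_continuous_on) auto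
 have "(\<lambda>z. \<Sum>\<^sub>\<infinity>a\<in>Ids. ?g a z) holomorphic_on ball s r"
  by (rule holomorphic_uniform_limit[OF ev ul finite_subsets_at_top_neq_bot])
 hence "dedekind_series K field_differentiable at s"
  using r unfolding dedekind_series_def[abs_def] by (intro holomorphic_on_imp_differentiable_at[of _ "ball s r"]) auto
 thus "dedekind_series K field_differentiable at s within {s. Re s > 1}" by (rule field_differentiable_at_within)
qed

end

subsection \<open>Theta functions of lattices\<close>

context nfield
begin

definition cbar :: "nat \<Rightarrow> nat" where
 "cbar i = (SOME j. j < n \<and> (\<forall>x\<in>K. emb j x = cnj (emb i x)))"

lemma cbar: "i < n \<Longrightarrow> cbar i < n" "i < n \<Longrightarrow> x \<in> K \<Longrightarrow> emb (cbar i) x = cnj (emb i x)"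
proof -
 assume i: "i < n"
 then obtain j where "j < n \<and> (\<forall>x\<in>K. emb j x = cnj (emb i x))" by (meson conj_index)
 from someI[of "\<lambda>j. j < n \<and> (\<forall>x\<in>K. emb j x = cnj (emb i x))", OF this]
 have *: "cbar i < n \<and> (\<forall>x\<in>K. emb (cbar i) x = cnj (emb i x))" unfolding cbar_def .
 thus "cbar i < n" by blast
 show "x \<in> K \<Longrightarrow> emb (cbar i) x = cnj (emb i x)" using * by blast
qed

lemma cbar_cbar: "i < n \<Longrightarrow> cbar (cbar i) = i"
proof -
 assume i: "i < n"
 have "rs ! cbar (cbar i) = rs ! i" using cbar(1) cbar(2)[OF _ tK] emb_t i by (metis complex_cnj_cnj)
 thus ?thesis using rs(2) length_rs cbar(1) i by (simp add: nth_eq_iff_index_eq)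
qed

lemma cbar_bij: "bij_betw cbar {..<n} {..<n}"
 by (rule bij_betwI[of _ _ _ cbar]) (auto simp: cbar cbar_cbar)

lemma sum_cbar: "(\<Sum>i<n. f (cbar i)) = (\<Sum>i<n. f i)"
 by (rule sum.reindex_bij_betw[OF cbar_bij])

lemma cmod_emb_cbar: "i < n \<Longrightarrow> x \<in> K \<Longrightarrow> cmod (emb (cbar i) x) = cmod (emb i x)"
 by (simp add: cbar)

lemma infsum_lat:
 assumes b: "basis b"
 shows "(\<Sum>\<^sub>\<infinity>x\<in>lat b. f x) = (\<Sum>\<^sub>\<infinity>m\<in>int_vecs n. f (\<Sum>j<n. of_int (m j) * b j))"
  "f summable_on lat b \<longleftrightarrow> (\<lambda>m. f (\<Sum>j<n. of_int (m j) * b j)) summable_on int_vecs n"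
proof -
 have "bij_betw (\<lambda>m. \<Sum>j<n. of_int (m j) * b j) (int_vecs n) (lat b)"
 proof (rule bij_betw_imageI)
  show "inj_on (\<lambda>m. \<Sum>j<n. of_int (m j) * b j) (int_vecs n)"
  proof (rule inj_onI)
   fix m m' assume m: "m \<in> int_vecs n" "m' \<in> int_vecs n" and eq: "(\<Sum>j<n. of_int (m j) * b j) = (\<Sum>j<n. of_int (m' j) * b j)"
   show "m = m'"
   proof
    fix j show "m j = m' j"
     using lat_coeffs_unique[OF b eq, of j] m by (cases "j < n") (auto simp: int_vecs_def)
   qed
  qed
  show "(\<lambda>m. \<Sum>j<n. of_int (m j) * b j) ` int_vecs n = lat b"
  proof
   show "lat b \<subseteq> (\<lambda>m. \<Sum>j<n. of_int (m j) * b j) ` int_vecs n"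
   proof
    fix x assume "x \<in> lat b"
    then obtain c :: "nat \<Rightarrow> int" where c: "x = (\<Sum>j<n. of_int (c j) * b j)" unfolding lat_def by blast
    show "x \<in> (\<lambda>m. \<Sum>j<n. of_int (m j) * b j) ` int_vecs n"
     by (rule image_eqI[of _ _ "\<lambda>j. if j < n then c j else 0"]) (auto simp: c int_vecs_def)
   qed
  qed (auto simp: lat_def)
 qed
 thus "(\<Sum>\<^sub>\<infinity>x\<in>lat b. f x) = (\<Sum>\<^sub>\<infinity>m\<in>int_vecs n. f (\<Sum>j<n. of_int (m j) * b j))"
  "f summable_on lat b \<longleftrightarrow> (\<lambda>m. f (\<Sum>j<n. of_int (m j) * b j)) summable_on int_vecs n"
  by (rule infsum_reindex_bij_betw[symmetric], rule summable_on_reindex_bij_betw[symmetric])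
qed

text \<open>In a lattice basis, \<open>N y\<close> is the quadratic form of a Gram matrix, to which
  Poisson summation applies. The matrix is real because complex conjugation permutes the embeddings
  and fixes the weights; its determinant is the product of the weights times the squared covolume,
  and its inverse form is \<open>N\<close> with inverse weights in the dual basis.\<close>

theorem theta_lattice:
 assumes L: "is_lattice L" and y: "\<And>i. i < n \<Longrightarrow> y i > 0" and yc: "\<And>i. i < n \<Longrightarrow> y (cbar i) = y i"
 defines "N \<equiv> \<lambda>y x. \<Sum>i<n. y i * (cmod (emb i x))\<^sup>2"
 shows "(\<lambda>x. exp (- pi * N y x)) summable_on L"
  "(\<Sum>\<^sub>\<infinity>x\<in>L. exp (- pi * N y x)) = (\<Sum>\<^sub>\<infinity>x\<in>Dual L. exp (- pi * N (\<lambda>i. 1 / y i) x)) / (sqrt (\<Prod>i<n. y i) * covol L)"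
proof -
 obtain b where b: "basis b" "L = lat b" using L by (auto simp: is_lattice_def)
 obtain b' where d: "dual_pair b b'" using dual_basis_exists[of b] b by (auto simp: basis_def)
 have y0: "y i \<noteq> 0" if "i < n" for i using y[OF that] by simp
 have bK: "b j \<in> K" "b' j \<in> K" if "j < n" for j using d that by (auto simp: dual_pair_def)
 have orth: "(\<Sum>i<n. emb i (b j) * emb i (b' k)) = (if j = k then 1 else 0)" if "j < n" "k < n" for j k
  using d that bK by (auto simp: dual_pair_def tr_def emb_mult[symmetric])
 \<comment> \<open>The embeddings extended linearly to real coordinate vectors with respect to the
   tuple \<open>c\<close>.\<close>
 define ll where "ll c x i = (\<Sum>j<n. of_real (x j) * emb i (c j))" for c :: "nat \<Rightarrow> complex" and x :: "nat \<Rightarrow> real" and i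
 have l_cbar: "ll c x (cbar i) = cnj (ll c x i)" if "i < n" "\<And>j. j < n \<Longrightarrow> c j \<in> K" for c x i
  using that by (simp add: ll_def cbar cnj_sum)
 define G where "G j k = (\<Sum>i<n. of_real (y i) * cnj (emb i (b j)) * emb i (b k))" for j k
 have G_cnj: "cnj (G j k) = G j k" if "j < n" "k < n" for j k
 proof -
  have "G j k = (\<Sum>i<n. of_real (y (cbar i)) * cnj (emb (cbar i) (b j)) * emb (cbar i) (b k))"
   unfolding G_def by (rule sum_cbar[symmetric])
  also have "\<dots> = cnj (G j k)" unfolding G_def cnj_sum using that bK by (intro sum.cong) (auto simp: cbar yc)
  finally show ?thesis ..
 qed
 define g where "g j k = Re (G j k)" for j k
 have gG: "of_real (g j k) = G j k" if "j < n" "k < n" for j k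
  using G_cnj[OF that] by (auto simp: g_def complex_eq_iff)
 have g_sym: "g j k = g k j" for j k by (simp add: g_def G_def mult_ac)
 have gx: "(\<Sum>k<n. of_real (x k) * G j k) = (\<Sum>i<n. of_real (y i) * cnj (emb i (b j)) * ll b x i)" for x j
  unfolding G_def ll_def sum_distrib_left by (subst sum.swap) (simp add: mult_ac)
 have quad: "quad n g x = (\<Sum>i<n. y i * (cmod (ll b x i))\<^sup>2)" for x
 proof -
  have "complex_of_real (quad n g x) = (\<Sum>j<n. of_real (x j) * (\<Sum>k<n. of_real (x k) * G j k))"
   unfolding quad_def sum_distrib_left of_real_sum by (intro sum.cong) (simp_all add: gG[symmetric])
  also have "\<dots> = (\<Sum>i<n. of_real (y i) * (\<Sum>j<n. of_real (x j) * cnj (emb i (b j))) * ll b x i)"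
   unfolding gx sum_distrib_left sum_distrib_right by (subst sum.swap) (simp add: mult_ac)
  also have "\<dots> = (\<Sum>i<n. of_real (y i) * (ll b x i * cnj (ll b x i)))"
   by (simp add: ll_def cnj_sum mult_ac)
  also have "\<dots> = complex_of_real (\<Sum>i<n. y i * (cmod (ll b x i))\<^sup>2)"
   by (simp only: complex_norm_square[symmetric]) simp
  finally show ?thesis by (simp only: of_real_eq_iff)
 qed
 have recover: "of_real (x j) = (\<Sum>i<n. ll b x i * emb i (b' j))" if "j < n" for x j
 proof -
  have "(\<Sum>i<n. ll b x i * emb i (b' j)) = (\<Sum>k<n. of_real (x k) * (\<Sum>i<n. emb i (b k) * emb i (b' j)))"
   unfolding ll_def sum_distrib_left sum_distrib_right by (subst sum.swap) (simp add: mult_ac)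
  also have "\<dots> = of_real (x j)" using that by (simp add: orth if_distrib[of "\<lambda>a. _ * a"] cong: if_cong)
  finally show ?thesis ..
 qed
 have pos: "quad n g x > 0" if x: "\<exists>i<n. x i \<noteq> 0" for x
 proof -
  have "\<exists>i<n. ll b x i \<noteq> 0"
  proof (rule ccontr)
   assume "\<not> (\<exists>i<n. ll b x i \<noteq> 0)"
   hence "complex_of_real (x j) = 0" if "j < n" for j using recover[OF that, of x] by simp
   thus False using x by auto
  qed
  then obtain i where "i < n" "ll b x i \<noteq> 0" by blast
  thus ?thesis unfolding quad using y by (intro sum_pos2[of _ i]) (auto simp: less_imp_le)
 qed
 have hom: "comm_ring_hom complex_of_real" "comm_ring_hom cnj" by unfold_locales auto
 have det: "fdet n g = (\<Prod>i<n. y i) * (covol L)\<^sup>2"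
 proof -
  have "complex_of_real (fdet n g) = fdet n (\<lambda>j k. \<Sum>i<n. (of_real (y i) * cnj (emb i (b j))) * emb i (b k))"
   unfolding comm_ring_hom.fdet_hom[OF hom(1), symmetric] by (rule fdet_cong) (simp add: gG, simp add: G_def)
  also have "\<dots> = fdet n (\<lambda>j i. of_real (y i) * cnj (emb i (b j))) * disc_mat b"
   unfolding fdet_mult disc_mat_def ..
  also have "fdet n (\<lambda>j i. of_real (y i) * cnj (emb i (b j))) = fdet n (\<lambda>i j. of_real (y i) * cnj (emb i (b j)))"
   by (rule fdet_transpose[of n "\<lambda>i j. of_real (y i) * cnj (emb i (b j))"])
  also have "\<dots> = (\<Prod>i<n. of_real (y i)) * fdet n (\<lambda>i j. cnj (emb i (b j)))" by (rule fdet_scale_rows)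
  also have "fdet n (\<lambda>i j. cnj (emb i (b j))) = cnj (disc_mat b)"
   unfolding disc_mat_def by (rule comm_ring_hom.fdet_hom[OF hom(2)])
  also have "(\<Prod>i<n. of_real (y i)) * cnj (disc_mat b) * disc_mat b = of_real ((\<Prod>i<n. y i) * (covol L)\<^sup>2)"
   using covol_lat[OF b(1)] b(2) complex_norm_square[of "disc_mat b"] by (simp add: mult_ac)
  finally show ?thesis by (simp only: of_real_eq_iff)
 qed
 from poisson_gaussian[OF g_sym pos] obtain Q where
  sm: "(\<lambda>m. exp (- pi * quad n g (\<lambda>i. of_int (m i)))) summable_on int_vecs n"
  and Qc: "\<And>x x'. (\<forall>i<n. x i = x' i) \<Longrightarrow> Q x = Q x'" and Qg: "\<And>x. Q (apply_mat n g x) = quad n g x"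
  and P: "\<And>z. (\<Sum>\<^sub>\<infinity>m\<in>int_vecs n. complex_of_real (exp (- pi * quad n g (\<lambda>i. of_int (m i)))) * cis (2 * pi * (\<Sum>i<n. z i * of_int (m i))))
     = complex_of_real ((\<Sum>\<^sub>\<infinity>k\<in>int_vecs n. exp (- pi * Q (\<lambda>i. of_int (k i) + z i))) / sqrt (fdet n g))"
  unfolding fdet_def by blast
 have emb_l: "emb i (\<Sum>j<n. of_int (m j) * c j) = ll c (\<lambda>j. of_int (m j)) i"
  if "i < n" "\<And>j. j < n \<Longrightarrow> c j \<in> K" for c m i
 proof -
  have "emb i (\<Sum>j<n. of_int (m j) * c j) = (\<Sum>j<n. emb i (of_int (m j) * c j))"
   using that by (intro emb_sum) (auto intro!: K_closed(4) K_of_int)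
  also have "\<dots> = (\<Sum>j<n. of_int (m j) * emb i (c j))"
   using that by (intro sum.cong) (auto simp: emb_mult K_of_int)
  finally show ?thesis by (simp add: ll_def)
 qed
 have quad_N: "quad n g (\<lambda>i. of_int (m i)) = N y (\<Sum>j<n. of_int (m j) * b j)" for m
  using bK by (simp add: quad N_def emb_l)
 have Q_N: "Q (\<lambda>i. of_int (m i)) = N (\<lambda>i. 1 / y i) (\<Sum>j<n. of_int (m j) * b' j)" for m
 proof -
  let ?k = "\<lambda>i. real_of_int (m i)"
  define v where "v = ll b' ?k"
  \<comment> \<open>The real vector mapped by \<open>g\<close> to the integer vector
    \<open>m\<close>. Its image under the embeddings is \<open>cnj (v i) / y i\<close>, which
    explains the inverse weights; the sum is real by conjugation symmetry, so taking
    \<open>Re\<close> loses nothing.\<close>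
  define x where "x j = Re (\<Sum>i<n. cnj (v i) / y i * emb i (b' j))" for j
  have v_cbar: "v (cbar i) = cnj (v i)" if "i < n" for i unfolding v_def by (rule l_cbar[OF that bK(2)])
  have x: "of_real (x j) = (\<Sum>i<n. cnj (v i) / y i * emb i (b' j))" if "j < n" for j
  proof -
   have "(\<Sum>i<n. cnj (v i) / y i * emb i (b' j)) = (\<Sum>i<n. cnj (v (cbar i)) / y (cbar i) * emb (cbar i) (b' j))"
    by (rule sum_cbar[symmetric])
   also have "\<dots> = cnj (\<Sum>i<n. cnj (v i) / y i * emb i (b' j))"
    unfolding cnj_sum using that bK by (intro sum.cong) (auto simp: cbar yc v_cbar)
   finally have "(\<Sum>i<n. cnj (v i) / y i * emb i (b' j)) \<in> \<real>" by (simp only: Reals_cnj_iff)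
   thus ?thesis unfolding x_def by (rule of_real_Re)
  qed
  have lx: "ll b x i = cnj (v i) / y i" if "i < n" for i
  proof -
   have "ll b x i = (\<Sum>l<n. cnj (v l) / y l * (\<Sum>j<n. emb i (b j) * emb l (b' j)))"
    unfolding ll_def sum_distrib_left by (subst sum.swap) (simp add: x sum_distrib_left sum_distrib_right mult_ac)
   thus ?thesis using that by (simp add: dual_pair_orth[OF d] if_distrib[of "\<lambda>a. _ * a"] cong: if_cong)
  qed
  have "apply_mat n g x j = ?k j" if j: "j < n" for j
  proof -
   have "complex_of_real (apply_mat n g x j) = (\<Sum>k<n. of_real (x k) * G j k)"
    unfolding apply_mat_def using j by (simp add: gG mult.commute)
   also have "\<dots> = (\<Sum>i<n. cnj (emb i (b j) * v i))"
    unfolding gx by (intro sum.cong) (auto simp: lx y0)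
   also have "\<dots> = cnj (\<Sum>k<n. of_real (?k k) * (\<Sum>i<n. emb i (b j) * emb i (b' k)))"
    unfolding v_def ll_def sum_distrib_left cnj_sum by (subst sum.swap) (simp add: mult_ac)
   also have "\<dots> = of_real (?k j)" using j by (simp add: orth if_distrib[of "\<lambda>a. _ * a"] cong: if_cong)
   finally show ?thesis by (simp only: of_real_eq_iff)
  qed
  hence "Q ?k = quad n g x" using Qc[of "apply_mat n g x" ?k] Qg[of x] by simp
  also have "\<dots> = (\<Sum>i<n. 1 / y i * (cmod (v i))\<^sup>2)"
   unfolding quad using y by (intro sum.cong) (auto simp: lx norm_divide power_divide power2_eq_square less_imp_neq[symmetric])
  also have "\<dots> = N (\<lambda>i. 1 / y i) (\<Sum>j<n. of_int (m j) * b' j)" unfolding N_def v_def using bK by (simp add: emb_l)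
  finally show ?thesis .
 qed
 note bb = dual_pair_basis[OF d]
 show "(\<lambda>x. exp (- pi * N y x)) summable_on L"
  using sm unfolding b(2) infsum_lat(2)[OF b(1)] quad_N .
 have sq: "sqrt (fdet n g) = sqrt (\<Prod>i<n. y i) * covol L"
  using lattice_covol_pos[OF L] by (simp add: det real_sqrt_mult)
 have "complex_of_real (\<Sum>\<^sub>\<infinity>m\<in>int_vecs n. exp (- pi * quad n g (\<lambda>i. of_int (m i)))) =
   of_real ((\<Sum>\<^sub>\<infinity>k\<in>int_vecs n. exp (- pi * Q (\<lambda>i. of_int (k i)))) / sqrt (fdet n g))"
  using P[of "\<lambda>_. 0"] by (simp add: infsum_complex_of_real)
 hence "(\<Sum>\<^sub>\<infinity>m\<in>int_vecs n. exp (- pi * quad n g (\<lambda>i. of_int (m i)))) =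
   (\<Sum>\<^sub>\<infinity>k\<in>int_vecs n. exp (- pi * Q (\<lambda>i. of_int (k i)))) / sqrt (fdet n g)" by (simp only: of_real_eq_iff)
 thus "(\<Sum>\<^sub>\<infinity>x\<in>L. exp (- pi * N y x)) = (\<Sum>\<^sub>\<infinity>x\<in>Dual L. exp (- pi * N (\<lambda>i. 1 / y i) x)) / (sqrt (\<Prod>i<n. y i) * covol L)"
  unfolding sq quad_N Q_N by (simp only: b(2) Dual_lat[OF d] infsum_lat(1)[OF b(1)] infsum_lat(1)[OF bb(1)])
qed

end

subsection \<open>Translations and reflections of product Lebesgue measure\<close>

lemma lborel_affine_unit:
 assumes "\<bar>\<epsilon>\<bar> = (1::real)"
 shows "distr lborel borel (\<lambda>x. c + \<epsilon> * x) = lborel"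
proof -
 have "\<epsilon> \<noteq> 0" using assms by auto
 from lborel_real_affine[OF this, of c] assms show ?thesis by (simp add: density_1 flip: one_ennreal_def)
qed

abbreviation log_space :: "nat set \<Rightarrow> (nat \<Rightarrow> real) measure" where
 "log_space V \<equiv> Pi\<^sub>M V (\<lambda>_. lborel)"

lemma log_space_sigma_finite: "finite V \<Longrightarrow> sigma_finite_measure (log_space V)"
proof -
 assume V: "finite V"
 interpret finite_product_sigma_finite "\<lambda>_. lborel :: real measure" V by standard (rule V)
 show ?thesis by (rule sigma_finite_measure_axioms)
qed

lemma log_space_affine:
 assumes V: "finite V" and e: "\<bar>\<epsilon>\<bar> = (1::real)"
 shows "distr (log_space V) (log_space V) (\<lambda>u. \<lambda>v\<in>V. c v + \<epsilon> * u v) = log_space V"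
proof -
 interpret product_sigma_finite "\<lambda>_. lborel :: real measure" by standard
 let ?f = "\<lambda>u. \<lambda>v\<in>V. c v + \<epsilon> * u v"
 have [measurable]: "?f \<in> measurable (log_space V) (log_space V)" by (rule measurable_restrict) measurable
 show ?thesis
 proof (rule PiM_eqI[OF V])
  fix A :: "nat \<Rightarrow> real set" assume A: "\<And>v. v \<in> V \<Longrightarrow> A v \<in> sets lborel"
  have "emeasure (distr (log_space V) (log_space V) ?f) (Pi\<^sub>E V A) = emeasure (log_space V) (?f -` Pi\<^sub>E V A \<inter> space (log_space V))"
   by (rule emeasure_distr) (use A V in \<open>auto intro!: sets_PiM_I_finite\<close>)
  also have "?f -` Pi\<^sub>E V A \<inter> space (log_space V) = Pi\<^sub>E V (\<lambda>v. (\<lambda>x. c v + \<epsilon> * x) -` A v)"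
   by (auto simp: space_PiM PiE_iff)
  also have "emeasure (log_space V) \<dots> = (\<Prod>v\<in>V. emeasure lborel ((\<lambda>x. c v + \<epsilon> * x) -` A v))"
  proof (rule emeasure_PiM[OF V])
   show "(\<lambda>x. c v + \<epsilon> * x) -` A v \<in> sets lborel" if "v \<in> V" for v
    using measurable_sets[of "\<lambda>x. c v + \<epsilon> * x" borel borel "A v"] A[OF that] by simp
  qed
  also have "\<dots> = (\<Prod>v\<in>V. emeasure lborel (A v))"
  proof (rule prod.cong)
   fix v assume "v \<in> V"
   hence "emeasure (distr lborel borel (\<lambda>x. c v + \<epsilon> * x)) (A v) = emeasure lborel ((\<lambda>x. c v + \<epsilon> * x) -` A v)"
    using A by (subst emeasure_distr) auto
   thus "emeasure lborel ((\<lambda>x. c v + \<epsilon> * x) -` A v) = emeasure lborel (A v)" by (simp add: lborel_affine_unit[OF e])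
  qed simp
  finally show "emeasure (distr (log_space V) (log_space V) ?f) (Pi\<^sub>E V A) = (\<Prod>v\<in>V. emeasure lborel (A v))" .
 qed simp
qed

text \<open>One shape for all three symmetries: multiplication by field elements (shift
  \<open>c\<close>, sign 1), duality (no shift, sign -1) and dilation of the metric (constant shift,
  ideal fixed).\<close>

definition twist :: "nat set \<Rightarrow> ('a \<Rightarrow> 'a) \<Rightarrow> (nat \<Rightarrow> real) \<Rightarrow> real \<Rightarrow> 'a \<times> (nat \<Rightarrow> real) \<Rightarrow> 'a \<times> (nat \<Rightarrow> real)" where
 "twist V h c \<epsilon> = (\<lambda>(a, u). (h a, \<lambda>v\<in>V. c v + \<epsilon> * u v))"

lemma twist_measurable:
 assumes F: "countable F" and V: "finite V" and h: "h ` F \<subseteq> F"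
 shows "twist V h c \<epsilon> \<in> measurable (count_space F \<Otimes>\<^sub>M log_space V) (count_space F \<Otimes>\<^sub>M log_space V)"
proof (rule measurable_pair_measure_countable1[OF F])
 fix a assume a: "a \<in> F"
 have "(\<lambda>u. \<lambda>v\<in>V. c v + \<epsilon> * u v) \<in> measurable (log_space V) (log_space V)" by (rule measurable_restrict) measurable
 thus "(\<lambda>u. twist V h c \<epsilon> (a, u)) \<in> measurable (log_space V) (count_space F \<Otimes>\<^sub>M log_space V)"
  using a h unfolding twist_def by (auto intro!: measurable_Pair)
qed

lemma nn_integral_pair_log_space:
 assumes "finite V" "f \<in> borel_measurable (count_space F \<Otimes>\<^sub>M log_space V)"
 shows "(\<integral>\<^sup>+z. f z \<partial>(count_space F \<Otimes>\<^sub>M log_space V)) = (\<integral>\<^sup>+a. \<integral>\<^sup>+u. f (a, u) \<partial>log_space V \<partial>count_space F)"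
 using sigma_finite_measure.nn_integral_fst[OF log_space_sigma_finite] assms by metis

lemma twist_integral:
 assumes F: "countable F" and V: "finite V" and h: "bij_betw h F F" and e: "\<bar>\<epsilon>\<bar> = (1::real)"
  and f: "f \<in> borel_measurable (count_space F \<Otimes>\<^sub>M log_space V)"
 shows "(\<integral>\<^sup>+z. f (twist V h c \<epsilon> z) \<partial>(count_space F \<Otimes>\<^sub>M log_space V)) = (\<integral>\<^sup>+z. f z \<partial>(count_space F \<Otimes>\<^sub>M log_space V))"
proof -
 let ?g = "\<lambda>u. \<lambda>v\<in>V. c v + \<epsilon> * u v"
 have hF: "h ` F \<subseteq> F" using h by (auto simp: bij_betw_def)
 have [measurable]: "?g \<in> measurable (log_space V) (log_space V)" by (rule measurable_restrict) measurable
 have fa: "(\<lambda>u. f (a, u)) \<in> borel_measurable (log_space V)" if "a \<in> F" for a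
  using measurable_compose[OF measurable_Pair1' f, of a] that by simp
 have "(\<integral>\<^sup>+z. f (twist V h c \<epsilon> z) \<partial>(count_space F \<Otimes>\<^sub>M log_space V)) = (\<integral>\<^sup>+a. \<integral>\<^sup>+u. f (h a, ?g u) \<partial>log_space V \<partial>count_space F)"
  using measurable_compose[OF twist_measurable[OF F V hF] f]
  by (subst nn_integral_pair_log_space[OF V]) (auto simp: twist_def)
 also have "\<dots> = (\<integral>\<^sup>+a. \<integral>\<^sup>+u. f (h a, u) \<partial>log_space V \<partial>count_space F)"
 proof (rule nn_integral_cong)
  fix a assume "a \<in> space (count_space F)"
  hence ha: "h a \<in> F" using hF by auto
  have "(\<integral>\<^sup>+u. f (h a, u) \<partial>log_space V) = (\<integral>\<^sup>+u. f (h a, u) \<partial>distr (log_space V) (log_space V) ?g)"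
   by (simp only: log_space_affine[OF V e])
  also have "\<dots> = (\<integral>\<^sup>+u. f (h a, ?g u) \<partial>log_space V)" by (rule nn_integral_distr) (use fa[OF ha] in auto)
  finally show "(\<integral>\<^sup>+u. f (h a, ?g u) \<partial>log_space V) = (\<integral>\<^sup>+u. f (h a, u) \<partial>log_space V)" ..
 qed
 also have "\<dots> = (\<integral>\<^sup>+a. \<integral>\<^sup>+u. f (a, u) \<partial>log_space V \<partial>count_space F)"
  by (rule nn_integral_bij_count_space[OF h])
 finally show ?thesis using nn_integral_pair_log_space[OF V f] by simp
qed

text \<open>Euler's integral after the substitution \<open>t = c * exp u\<close>.\<close>

lemma nn_integral_exp_exp:
 assumes x: "x > (0::real)" and c: "c > 0"
 shows "(\<integral>\<^sup>+u. ennreal (exp (x * u) * exp (- (c * exp u))) \<partial>lborel) = ennreal (Gamma x * c powr (- x))"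
proof -
 let ?f = "\<lambda>t. t powr (x - 1) / exp t" and ?g = "\<lambda>u. c * exp u"
 have "(?f has_integral Gamma x) {0<..}"
  using Gamma_integral_real[OF x] by (rule has_integral_spike_set_eq[THEN iffD1, rotated 2])
   (auto intro: negligible_subset[of "{0}"])
 hence "?f absolutely_integrable_on {0<..}" "integral {0<..} ?f = Gamma x"
  by (auto intro!: nonnegative_absolutely_integrable_1 integral_unique has_integral_integrable)
 moreover have "?g ` UNIV = {0<..}"
 proof
  show "{0<..} \<subseteq> range ?g"
  proof
   fix t :: real assume "t \<in> {0<..}"
   hence "t = ?g (ln (t / c))" using c by simp
   thus "t \<in> range ?g" by (rule range_eqI)
  qed
 qed (use c in auto)
 moreover have "inj ?g" using c by (auto intro!: injI)
 moreover have "(?g has_field_derivative c * exp u) (at u within UNIV)" for u by (auto intro!: derivative_eq_intros)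
 ultimately have "(\<lambda>u. \<bar>c * exp u\<bar> * ?f (?g u)) absolutely_integrable_on UNIV \<and> integral UNIV (\<lambda>u. \<bar>c * exp u\<bar> * ?f (?g u)) = Gamma x"
  using has_absolute_integral_change_of_variables_1'[of UNIV ?g "\<lambda>u. c * exp u" ?f "Gamma x"] by simp
 hence A: "(\<lambda>u. \<bar>c * exp u\<bar> * ?f (?g u)) absolutely_integrable_on UNIV"
  and B: "integral UNIV (\<lambda>u. \<bar>c * exp u\<bar> * ?f (?g u)) = Gamma x" by (rule conjunct1, rule conjunct2)
 have "((\<lambda>u. \<bar>c * exp u\<bar> * ?f (?g u)) has_integral Gamma x) UNIV"
  using integrable_integral[OF set_lebesgue_integral_eq_integral(1)[OF A]] unfolding B .
 hence "((\<lambda>u. c powr (- x) * (\<bar>c * exp u\<bar> * ?f (?g u))) has_integral c powr (- x) * Gamma x) UNIV"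
  by (rule has_integral_mult_right)
 moreover have "c powr (- x) * (\<bar>c * exp u\<bar> * ?f (?g u)) = exp (x * u) * exp (- (c * exp u))" for u
 proof -
  have "\<bar>c * exp u\<bar> * ?f (?g u) = (c * exp u) powr x / exp (c * exp u)"
   using c powr_mult_base[of "c * exp u" "x - 1"] by simp
  thus ?thesis using c by (simp add: powr_mult exp_minus field_simps powr_minus powr_def[of "exp u"])
 qed
 ultimately have "((\<lambda>u. exp (x * u) * exp (- (c * exp u))) has_integral c powr (- x) * Gamma x) UNIV" by simp
 from nn_integral_has_integral_lborel[OF _ _ this] show ?thesis by (simp add: mult.commute)
qed

lemma nn_integral_count_space_infsum:
 assumes "f summable_on A" "\<And>x. x \<in> A \<Longrightarrow> f x \<ge> (0::real)"
 shows "(\<integral>\<^sup>+x. ennreal (f x) \<partial>count_space A) = ennreal (infsum f A)"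
proof -
 have "(\<lambda>x. norm (f x)) summable_on A" using assms by (auto intro: summable_on_cong[THEN iffD1, OF _ assms(1)])
 hence "Infinite_Set_Sum.abs_summable_on f A" by (rule abs_summable_equivalent[THEN iffD1])
 thus ?thesis using nn_integral_conv_infsetsum infsetsum_infsum assms(2) by metis
qed

subsection \<open>The space of metrized fractional ideals\<close>

context nfield
begin

text \<open>The archimedean places, each represented by the smaller index of its conjugate pair; a
  real embedding is its own partner.\<close>

definition places :: "nat set" where "places = {i. i < n \<and> i \<le> cbar i}"

definition place :: "nat \<Rightarrow> nat" where "place i = min i (cbar i)"

lemma place: "i < n \<Longrightarrow> place i \<in> places" "i < n \<Longrightarrow> place (cbar i) = place i"
 "i < n \<Longrightarrow> x \<in> K \<Longrightarrow> cmod (emb (place i) x) = cmod (emb i x)" "finite places"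
 using cbar(1) cbar_cbar by (auto simp: place_def places_def min_def cmod_emb_cbar)

definition local_degree :: "nat \<Rightarrow> nat" where "local_degree v = (if cbar v = v then 1 else 2)"

lemma place_fibre:
 assumes "v \<in> places"
 shows "{i \<in> {..<n}. place i = v} = {v, cbar v}" "card {i \<in> {..<n}. place i = v} = local_degree v"
proof -
 have v: "v < n" "v \<le> cbar v" using assms by (auto simp: places_def)
 show "{i \<in> {..<n}. place i = v} = {v, cbar v}"
  using v cbar(1) cbar_cbar by (auto simp: place_def min_def split: if_splits)
 thus "card {i \<in> {..<n}. place i = v} = local_degree v" by (simp add: local_degree_def card_insert_if)
qed

lemma sum_place: "(\<Sum>i<n. f (place i)) = (\<Sum>v\<in>places. real (local_degree v) * f v)"
proof -
 have "(\<Sum>i<n. f (place i)) = (\<Sum>v\<in>place ` {..<n}. \<Sum>i | i \<in> {..<n} \<and> place i = v. f (place i))"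
  by (rule sum.image_gen) simp
 also have "place ` {..<n} = places"
 proof
  show "places \<subseteq> place ` {..<n}"
  proof
   fix v assume "v \<in> places"
   thus "v \<in> place ` {..<n}" by (intro image_eqI[of _ _ v]) (auto simp: places_def place_def)
  qed
 qed (use place in auto)
 also have "(\<Sum>v\<in>places. \<Sum>i | i \<in> {..<n} \<and> place i = v. f (place i)) = (\<Sum>v\<in>places. \<Sum>i | i \<in> {..<n} \<and> place i = v. f v)"
  by (intro sum.cong) auto
 also have "\<dots> = (\<Sum>v\<in>places. real (local_degree v) * f v)" using place_fibre(2) by (intro sum.cong) auto
 finally show ?thesis .
qed

lemma countable_K: "countable K"
proof -
 have "K \<subseteq> range (\<lambda>qs. qeval (Poly qs) t)"
 proof
  fix x assume "x \<in> K"
  then obtain q where "x = qeval q t" using K_qeval by blast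
  thus "x \<in> range (\<lambda>qs. qeval (Poly qs) t)" by (intro range_eqI[of _ _ "coeffs q"]) simp
 qed
 thus ?thesis by (rule countable_subset) simp
qed

lemma countable_frac: "countable {a. frac a}"
proof -
 have "{a. frac a} \<subseteq> (\<lambda>bs. lat (\<lambda>j. bs ! j)) ` lists K"
 proof
  fix a assume "a \<in> {a. frac a}"
  then obtain b where b: "basis b" "a = lat b" by (auto simp: frac_def is_lattice_def)
  have "lat b = lat (\<lambda>j. map b [0..<n] ! j)" unfolding lat_def by simp
  moreover have "map b [0..<n] \<in> lists K" using basis_K[OF b(1)] by auto
  ultimately show "a \<in> (\<lambda>bs. lat (\<lambda>j. bs ! j)) ` lists K" using b(2) by blast
 qed
 thus ?thesis by (rule countable_subset) (intro countable_image countable_lists countable_K)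
qed

lemma scale_scale: "scale x (scale y a) = scale (x * y) a"
 by (auto simp: scale_def image_image mult.assoc)

lemma bij_scale: "x \<in> K \<Longrightarrow> x \<noteq> 0 \<Longrightarrow> bij_betw (scale x) {a. frac a} {a. frac a}"
proof (rule bij_betwI[of _ _ _ "scale (inverse x)"])
 assume x: "x \<in> K" "x \<noteq> 0"
 show "scale x \<in> {a. frac a} \<rightarrow> {a. frac a}" "scale (inverse x) \<in> {a. frac a} \<rightarrow> {a. frac a}"
  using x K_closed(7) by (auto intro: frac_scale)
qed (simp_all add: scale_scale, simp_all add: scale_def)

lemma bij_Dual: "bij_betw Dual {a. frac a} {a. frac a}"
 by (rule bij_betwI[of _ _ _ Dual]) (auto simp: frac_Dual Dual_lattice(2) frac_lattice)

text \<open>A point consists of a fractional ideal and, at each place, the logarithm of the factor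
  by which the squared absolute value is weighted. There are countably many fractional ideals, so
  the product is sigma-finite.\<close>

definition metr :: "(complex set \<times> (nat \<Rightarrow> real)) measure" where
 "metr = count_space {a. frac a} \<Otimes>\<^sub>M log_space places"

lemma space_metr: "z \<in> space metr \<longleftrightarrow> frac (fst z) \<and> snd z \<in> extensional places"
 by (cases z) (auto simp: metr_def space_pair_measure space_PiM PiE_def)

text \<open>Dividing the ideal by \<open>x\<close> and raising the weight at \<open>v\<close> by
  \<open>2 * ln \<bar>x\<bar>\<close> compensate each other: multiplication by
  \<open>inverse x\<close> is an isometry onto the new lattice, so the quadratic form, and with it
  theta and the covolume, are preserved.\<close>

definition dilate :: "complex \<Rightarrow> complex set \<times> (nat \<Rightarrow> real) \<Rightarrow> complex set \<times> (nat \<Rightarrow> real)" where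
 "dilate x = twist places (scale (inverse x)) (\<lambda>v. 2 * ln (cmod (emb v x))) 1"

text \<open>Logarithm of the covolume in the weighted metric, whose density is the square root of
  the product of the weights over all embeddings.\<close>

definition logvol :: "complex set \<times> (nat \<Rightarrow> real) \<Rightarrow> real" where
 "logvol z = (\<Sum>i<n. snd z (place i)) / 2 + ln (covol (fst z))"

text \<open>The theta term of the vector 1 in the metrized lattice. After dilation by
  \<open>x\<close> it is the term of the vector \<open>x\<close>, so summing over
  \<open>K - {0}\<close> gives every nonzero vector of the lattice exactly once.\<close>

definition weight :: "complex set \<times> (nat \<Rightarrow> real) \<Rightarrow> ennreal" where
 "weight z = indicator {a. 1 \<in> a} (fst z) * ennreal (exp (- pi * (\<Sum>i<n. exp (snd z (place i)))))"

definition qf :: "(nat \<Rightarrow> real) \<Rightarrow> complex \<Rightarrow> real" where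
 "qf u x = (\<Sum>i<n. exp (u (place i)) * (cmod (emb i x))\<^sup>2)"

definition Theta :: "complex set \<times> (nat \<Rightarrow> real) \<Rightarrow> real" where
 "Theta z = (\<Sum>\<^sub>\<infinity>x\<in>fst z. exp (- pi * qf (snd z) x))"

lemma dilate_pair: "dilate x (a, u) = (scale (inverse x) a, \<lambda>v\<in>places. 2 * ln (cmod (emb v x)) + u v)"
 by (simp add: dilate_def twist_def)

lemma theta_summable: "frac a \<Longrightarrow> (\<lambda>x. exp (- pi * qf u x)) summable_on a"
 unfolding qf_def by (rule theta_lattice(1)) (auto simp: frac_lattice place)

lemma theta_functional:
 assumes a: "frac a"
 shows "Theta (a, u) = exp (- logvol (a, u)) * Theta (Dual a, \<lambda>v\<in>places. - u v)"
proof -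
 have "Theta (a, u) = (\<Sum>\<^sub>\<infinity>x\<in>Dual a. exp (- pi * (\<Sum>i<n. 1 / exp (u (place i)) * (cmod (emb i x))\<^sup>2))) / (sqrt (\<Prod>i<n. exp (u (place i))) * covol a)"
  unfolding Theta_def qf_def fst_conv snd_conv by (rule theta_lattice(2)) (auto simp: frac_lattice[OF a] place)
 also have "(\<Sum>\<^sub>\<infinity>x\<in>Dual a. exp (- pi * (\<Sum>i<n. 1 / exp (u (place i)) * (cmod (emb i x))\<^sup>2))) = Theta (Dual a, \<lambda>v\<in>places. - u v)"
  unfolding Theta_def qf_def fst_conv snd_conv
  by (intro infsum_cong arg_cong[where f = exp] arg_cong2[where f = "(*)"] sum.cong) (auto simp: place exp_minus divide_inverse)
 also have "sqrt (\<Prod>i<n. exp (u (place i))) = exp ((\<Sum>i<n. u (place i)) / 2)"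
  by (rule real_sqrt_unique) (simp_all add: exp_sum flip: exp_double)
 also have "exp ((\<Sum>i<n. u (place i)) / 2) * covol a = exp (logvol (a, u))"
  using lattice_covol_pos[OF frac_lattice[OF a]] by (simp add: logvol_def exp_add)
 finally show ?thesis unfolding exp_minus divide_inverse by (simp only: mult.commute)
qed

lemma weight_dilate:
 assumes x: "x \<in> K" "x \<noteq> 0" and a: "frac a"
 shows "weight (dilate x (a, u)) = indicator a x * ennreal (exp (- pi * qf u x))"
proof -
 have "1 \<in> scale (inverse x) a \<longleftrightarrow> x \<in> a" using x by (auto simp: scale_def image_iff field_simps intro: bexI[of _ x])
 moreover have "(\<Sum>i<n. exp (snd (dilate x (a, u)) (place i))) = qf u x" unfolding qf_def
 proof (rule sum.cong)
  fix i assume "i \<in> {..<n}"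
  thus "exp (snd (dilate x (a, u)) (place i)) = exp (u (place i)) * (cmod (emb i x))\<^sup>2"
   using x emb_nonzero[of i x] by (simp add: dilate_pair place exp_add exp_double)
 qed simp
 moreover have "fst (dilate x (a, u)) = scale (inverse x) a" by (simp add: dilate_pair)
 ultimately show ?thesis by (simp add: weight_def indicator_def)
qed

text \<open>The constant 1 is the term of the zero vector. The strict inequality holds because the
  lattice contains a nonzero vector, whose term is positive.\<close>

lemma one_plus_P:
 assumes a: "frac a"
 shows "1 + (\<integral>\<^sup>+x. weight (dilate x (a, u)) \<partial>count_space (K - {0})) = ennreal (Theta (a, u))" "Theta (a, u) > 1"
proof -
 let ?f = "\<lambda>x. exp (- pi * qf u x)"
 have sm: "?f summable_on a" by (rule theta_summable[OF a])
 hence sm': "?f summable_on a - {0}" by (rule summable_on_subset) auto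
 have "qf u 0 = 0" by (simp add: qf_def)
 hence eq: "Theta (a, u) = 1 + infsum ?f (a - {0})"
  using infsum_insert[OF sm', of 0] insert_Diff[OF frac_closed(1)[OF a]] by (simp add: Theta_def)
 have "(\<integral>\<^sup>+x. weight (dilate x (a, u)) \<partial>count_space (K - {0})) = (\<integral>\<^sup>+x. ennreal (?f x) * indicator a x \<partial>count_space (K - {0}))"
  by (intro nn_integral_cong) (simp add: weight_dilate a mult.commute)
 also have "\<dots> = (\<integral>\<^sup>+x. ennreal (?f x) \<partial>count_space (a - {0}))"
  using frac_K[OF a] by (subst nn_integral_restrict_space[symmetric])
   (auto simp: restrict_count_space Int_absorb1 intro!: arg_cong2[where f = nn_integral] arg_cong[where f = count_space])
 also have "\<dots> = ennreal (infsum ?f (a - {0}))" using sm' by (rule nn_integral_count_space_infsum) simp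
 finally show "1 + (\<integral>\<^sup>+x. weight (dilate x (a, u)) \<partial>count_space (K - {0})) = ennreal (Theta (a, u))"
  by (simp add: eq infsum_nonneg flip: ennreal_1 ennreal_plus)
 obtain x where x: "x \<in> a" "x \<noteq> 0" using frac_nonzero[OF a] by blast
 have "0 < sum ?f {x}" by simp
 also have "\<dots> \<le> infsum ?f (a - {0})" by (rule finite_sum_le_infsum[OF sm']) (use x in auto)
 finally show "Theta (a, u) > 1" by (simp add: eq)
qed

lemma dilate_dilate:
 assumes "x \<in> K" "x \<noteq> 0" "y \<in> K" "y \<noteq> 0"
 shows "dilate x (dilate y z) = dilate (x * y) z"
proof -
 have "2 * ln (cmod (emb v x)) + (2 * ln (cmod (emb v y)) + w) = 2 * ln (cmod (emb v (x * y))) + w" if "v \<in> places" for v w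
  using that assms emb_nonzero[of v] by (simp add: places_def emb_mult norm_mult ln_mult)
 thus ?thesis
  by (cases z) (auto simp: dilate_pair scale_scale mult.commute inverse_mult_distrib intro!: restrict_ext)
qed

lemma dilate_1: "z \<in> space metr \<Longrightarrow> dilate 1 z = z"
 by (cases z) (auto simp: dilate_pair space_metr scale_def places_def extensional_restrict intro!: extensionalityI[where A = places])

lemma logvol_dilate:
 assumes x: "x \<in> K" "x \<noteq> 0" and z: "z \<in> space metr"
 shows "logvol (dilate x z) = logvol z"
proof (cases z)
 case (Pair a u)
 have a: "is_lattice a" using z Pair by (simp add: space_metr frac_lattice)
 have nz: "emb i x \<noteq> 0" if "i < n" for i using emb_nonzero that x by blast
 have "covol (scale (inverse x) a) = cmod (\<Prod>i<n. emb i (inverse x)) * covol a"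
  using x K_closed(7) by (intro scale_lattice(2)[OF a]) auto
 also have "cmod (\<Prod>i<n. emb i (inverse x)) = (\<Prod>i<n. inverse (cmod (emb i x)))"
  using x by (simp add: emb_inverse norm_inverse flip: prod_norm)
 also have "\<dots> * covol a = covol a / (\<Prod>i<n. cmod (emb i x))"
  using prod_inversef[of "\<lambda>i. cmod (emb i x)" "{..<n}"] by (simp add: o_def divide_inverse)
 finally have "ln (covol (scale (inverse x) a)) = ln (covol a) - (\<Sum>i<n. ln (cmod (emb i x)))"
  using lattice_covol_pos[OF a] nz ln_prod[of "{..<n}" "\<lambda>i. cmod (emb i x)"] by (simp add: ln_div prod_pos)
 moreover have "(\<Sum>i<n. 2 * ln (cmod (emb (place i) x)) + u (place i)) = 2 * (\<Sum>i<n. ln (cmod (emb i x))) + (\<Sum>i<n. u (place i))"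
  using x by (simp add: place sum.distrib sum_distrib_left)
 ultimately show ?thesis by (simp add: Pair logvol_def dilate_pair place)
qed

lemma sigma_finite_metr: "sigma_finite_measure metr"
 unfolding metr_def by (intro sigma_finite_pair_measure sigma_finite_measure_count_space_countable countable_frac log_space_sigma_finite place)

text \<open>The shift \<open>2 * \<tau> / n\<close> is dictated by \<open>logvol\<close>: applied at
  all \<open>n\<close> embeddings and halved, it adds up to \<tau>. Invariance of the orbit sum
  under dilation is a reindexing of \<open>K - {0}\<close>, and finiteness and positivity come from
  \<open>Theta > 1\<close>.\<close>

sublocale theta_quotient metr "K - {0}" dilate inverse weight "twist places Dual (\<lambda>_. 0) (-1)" "\<lambda>\<tau>. twist places id (\<lambda>_. 2 * \<tau> / n) 1" logvol
 "\<lambda>z. \<integral>\<^sup>+x. weight (dilate x z) \<partial>count_space (K - {0})"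
proof (rule theta_quotient.intro[OF sigma_finite_metr], unfold_locales)
 let ?\<iota> = "twist places Dual (\<lambda>_. 0) (-1)" and ?\<delta> = "\<lambda>\<tau>. twist places id (\<lambda>_. 2 * \<tau> / n) 1"
 note tm = twist_measurable[OF countable_frac place(4), folded metr_def]
 note ti = twist_integral[OF countable_frac place(4), folded metr_def]
 show "countable (K - {0})" using countable_K by blast
 have inv: "inverse x \<in> K" "inverse x \<noteq> 0" if "x \<in> K - {0}" for x using that K_closed(7) by auto
 show dm: "dilate x \<in> measurable metr metr" if "x \<in> K - {0}" for x
  unfolding dilate_def using bij_scale[OF inv[OF that]] by (intro tm) (auto simp: bij_betw_def)
 show "(\<integral>\<^sup>+z. f (dilate x z) \<partial>metr) = (\<integral>\<^sup>+z. f z \<partial>metr)" if "x \<in> K - {0}" "f \<in> borel_measurable metr" for x f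
  unfolding dilate_def using bij_scale[OF inv[OF that(1)]] that(2) by (intro ti) auto
 show "bij_betw inverse (K - {0}) (K - {0})" by (rule bij_betwI[of _ _ _ inverse]) (use inv in auto)
 show "dilate x (dilate (inverse x) z) = z" if "x \<in> K - {0}" "z \<in> space metr" for x z
  using dilate_dilate[of x "inverse x" z] inv[OF that(1)] that dilate_1 by simp
 have comp: "(\<lambda>u. u (place i)) \<in> borel_measurable (log_space places)" if "i < n" for i
  using measurable_component_singleton[OF place(1)[OF that], of "\<lambda>_. lborel"] by simp
 show wm: "weight \<in> borel_measurable metr" unfolding metr_def
 proof (rule measurable_pair_measure_countable1[OF countable_frac])
  fix a
  have [measurable]: "(\<lambda>u. exp (- pi * (\<Sum>i<n. exp (u (place i))))) \<in> borel_measurable (log_space places)"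
  proof -
   have [measurable]: "(\<lambda>u. u (place i)) \<in> borel_measurable (log_space places)" if "i \<in> {..<n}" for i using comp that by simp
   show ?thesis by measurable
  qed
  show "(\<lambda>u. weight (a, u)) \<in> borel_measurable (log_space places)"
   unfolding weight_def fst_conv snd_conv by measurable
 qed
 show "logvol \<in> borel_measurable metr"
  unfolding metr_def by (rule measurable_pair_measure_countable1[OF countable_frac])
   (auto simp: logvol_def intro!: borel_measurable_add borel_measurable_divide borel_measurable_sum comp)
 let ?P = "\<lambda>z. \<integral>\<^sup>+x. weight (dilate x z) \<partial>count_space (K - {0})"
 have P: "1 + ?P z = ennreal (Theta z)" "Theta z > 1" if "z \<in> space metr" for z
  using one_plus_P[of "fst z" "snd z"] that by (simp_all add: space_metr)
 show "?P z > 0" if "z \<in> space metr" for z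
 proof (rule ccontr)
  assume "\<not> ?P z > 0"
  hence "?P z = 0" by simp
  hence "ennreal (Theta z) = ennreal 1" using P(1)[OF that] by simp
  thus False using P(2)[OF that] by (subst (asm) ennreal_inj) auto
 qed
 show "?P z < \<infinity>" if "z \<in> space metr" for z
 proof -
  have "?P z \<le> 1 + ?P z" by simp
  also have "\<dots> < \<infinity>" using P(1)[OF that] by simp
  finally show ?thesis .
 qed
 show "?P (dilate g z) = ?P z" if "g \<in> K - {0}" "z \<in> space metr" for g z
 proof -
  have "bij_betw (\<lambda>x. x * g) (K - {0}) (K - {0})"
  proof (rule bij_betwI[of _ _ _ "\<lambda>x. x * inverse g"])
   show "(\<lambda>x. x * g) \<in> K - {0} \<rightarrow> K - {0}" using K_closed(4)[of _ g] that(1) by simp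
   show "(\<lambda>x. x * inverse g) \<in> K - {0} \<rightarrow> K - {0}" using K_closed(4)[of _ "inverse g"] inv[OF that(1)] by simp
  qed (use that in simp_all)
  from nn_integral_bij_count_space[OF this, of "\<lambda>x. weight (dilate x z)"]
  have "(\<integral>\<^sup>+x. weight (dilate (x * g) z) \<partial>count_space (K - {0})) = ?P z" .
  moreover have "?P (dilate g z) = (\<integral>\<^sup>+x. weight (dilate (x * g) z) \<partial>count_space (K - {0}))"
   using that by (intro nn_integral_cong) (simp add: dilate_dilate)
  ultimately show ?thesis by simp
 qed
 show im: "?\<iota> \<in> measurable metr metr" using bij_Dual by (intro tm) (auto simp: bij_betw_def)
 show "(\<integral>\<^sup>+z. f (?\<iota> z) \<partial>metr) = (\<integral>\<^sup>+z. f z \<partial>metr)" if "f \<in> borel_measurable metr" for f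
  using bij_Dual that by (intro ti) auto
 show "?\<iota> (dilate g z) = dilate (inverse g) (?\<iota> z)" if g: "g \<in> K - {0}" and z: "z \<in> space metr" for g z
 proof (cases z)
  case (Pair a u)
  have "Dual (scale (inverse g) a) = scale g (Dual a)"
   using scale_lattice(3)[OF _ inv[OF g], of a] z Pair by (simp add: space_metr frac_lattice)
  moreover have "ln (cmod (emb v (inverse g))) = - ln (cmod (emb v g))" if "v \<in> places" for v
   using that g emb_nonzero[of v g] by (simp add: places_def emb_inverse norm_inverse ln_inverse)
  ultimately show ?thesis by (auto simp: Pair twist_def dilate_pair intro!: restrict_ext)
 qed
 show "logvol (dilate g z) = logvol z" if "g \<in> K - {0}" "z \<in> space metr" for g z using that logvol_dilate by auto
 show "logvol (?\<iota> z) = - logvol z" if "z \<in> space metr" for z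
 proof (cases z)
  case (Pair a u)
  have a: "is_lattice a" using that Pair by (simp add: space_metr frac_lattice)
  show ?thesis using lattice_covol_pos[OF a]
   by (simp add: Pair logvol_def twist_def place Dual_lattice(3)[OF a] ln_div sum_negf)
 qed
 show "1 + ?P z = ennreal (exp (- logvol z)) * (1 + ?P (?\<iota> z))" if z: "z \<in> space metr" for z
 proof (cases z)
  case (Pair a u)
  have "?\<iota> z \<in> space metr" using measurable_space[OF im z] .
  from P(1)[OF this] P(1)[OF z] show ?thesis
   using theta_functional[of a u] z by (simp add: Pair space_metr twist_def ennreal_mult')
 qed
 show "?\<delta> \<tau> \<in> measurable metr metr" for \<tau> by (intro tm) auto
 show "(\<integral>\<^sup>+z. f (?\<delta> \<tau> z) \<partial>metr) = (\<integral>\<^sup>+z. f z \<partial>metr)" if "f \<in> borel_measurable metr" for f \<tau>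
  using that by (intro ti bij_betw_id) auto
 show "?\<delta> \<tau> (dilate g z) = dilate g (?\<delta> \<tau> z)" if "g \<in> K - {0}" "z \<in> space metr" for g \<tau> z
  by (cases z) (auto simp: twist_def dilate_pair intro!: restrict_ext)
 show "logvol (?\<delta> \<tau> z) = logvol z + \<tau>" if "z \<in> space metr" for \<tau> z
 proof (cases z)
  case (Pair a u)
  have "(\<Sum>i<n. 2 * \<tau> / n + u (place i)) = 2 * \<tau> + (\<Sum>i<n. u (place i))" using n_pos by (simp add: sum.distrib)
  moreover have "snd (?\<delta> \<tau> z) (place i) = 2 * \<tau> / n + u (place i)" if "i < n" for i
   using place(1)[OF that] by (simp add: Pair twist_def)
  moreover have "fst (?\<delta> \<tau> z) = a" by (simp add: Pair twist_def)
  ultimately show ?thesis by (simp add: Pair logvol_def add_divide_distrib)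
 qed
qed simp

end

subsection \<open>The Mellin transform of the theta measure\<close>

context nfield
begin

definition zreal :: "real \<Rightarrow> real" where
 "zreal x = (\<Sum>\<^sub>\<infinity>I\<in>Ids. real (Nm I) powr (- x))"

lemma r1_r2:
 "card {v \<in> places. cbar v = v} = nf_r1 K" "card {v \<in> places. cbar v \<noteq> v} = nf_r2 K"
proof -
 have real: "emb i \<in> real_embeddings K \<longleftrightarrow> cbar i = i" if i: "i < n" for i
 proof -
  have "emb i \<in> embeddings K" using bij_emb i by (auto simp: bij_betw_def)
  moreover have "(\<forall>x\<in>K. emb i x \<in> \<real>) \<longleftrightarrow> cbar i = i"
  proof
   assume "\<forall>x\<in>K. emb i x \<in> \<real>"
   hence "emb (cbar i) t = emb i t" using cbar(2)[OF i tK] tK by (simp add: Reals_cnj_iff)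
   thus "cbar i = i" using emb_t i cbar(1)[OF i] rs(2) length_rs by (simp add: nth_eq_iff_index_eq)
  next
   assume "cbar i = i"
   thus "\<forall>x\<in>K. emb i x \<in> \<real>" using cbar(2)[OF i] by (metis Reals_cnj_iff)
  qed
  ultimately show ?thesis by (simp add: real_embeddings_def)
 qed
 have emb_img: "embeddings K = emb ` {..<n}" and inj: "inj_on emb {..<n}" using bij_emb by (auto simp: bij_betw_def)
 have "real_embeddings K = emb ` {i \<in> {..<n}. cbar i = i}"
  using real emb_img by (auto simp: real_embeddings_def)
 moreover have "{i \<in> {..<n}. cbar i = i} = {v \<in> places. cbar v = v}" by (auto simp: places_def)
 ultimately show "card {v \<in> places. cbar v = v} = nf_r1 K"
  unfolding nf_r1_def using card_image[OF inj_on_subset[OF inj], of "{i \<in> {..<n}. cbar i = i}"] by force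
 have "embeddings K - real_embeddings K = emb ` {i \<in> {..<n}. cbar i \<noteq> i}"
  using real emb_img by auto
 hence "card (embeddings K - real_embeddings K) = card {i \<in> {..<n}. cbar i \<noteq> i}"
  using card_image[OF inj_on_subset[OF inj], of "{i \<in> {..<n}. cbar i \<noteq> i}"] by auto
 also have "{i \<in> {..<n}. cbar i \<noteq> i} = {v \<in> places. cbar v \<noteq> v} \<union> cbar ` {v \<in> places. cbar v \<noteq> v}" (is "?N = ?A \<union> ?B")
 proof
  show "?N \<subseteq> ?A \<union> ?B"
  proof
   fix i assume i: "i \<in> ?N"
   show "i \<in> ?A \<union> ?B"
   proof (cases "i \<le> cbar i")
    case False
    hence "cbar i \<in> ?A" using i cbar(1)[of i] cbar_cbar[of i] by (auto simp: places_def)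
    thus ?thesis using cbar_cbar[of i] i by (metis (no_types, lifting) UnI2 imageI lessThan_iff mem_Collect_eq)
   qed (use i in \<open>auto simp: places_def\<close>)
  qed
 qed (auto simp: places_def cbar cbar_cbar)
 also have "card \<dots> = card ?A + card ?B"
  by (rule card_Un_disjoint) (auto simp: places_def cbar_cbar)
 also have "card ?B = card ?A"
  by (rule card_image) (auto intro!: inj_on_inverseI[of _ cbar] simp: places_def cbar_cbar)
 finally show "card {v \<in> places. cbar v \<noteq> v} = nf_r2 K" unfolding nf_r2_def by simp
qed

lemma prod_places:
 "(\<Prod>v\<in>places. f (local_degree v)) = (f 1 ^ nf_r1 K * f 2 ^ nf_r2 K :: real)"
proof -
 have "(\<Prod>v\<in>places. f (local_degree v)) =
   (\<Prod>v\<in>{v \<in> places. cbar v = v}. f (local_degree v)) * (\<Prod>v\<in>{v \<in> places. cbar v \<noteq> v}. f (local_degree v))"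
  by (subst prod.union_disjoint[symmetric]) (auto simp: place intro!: prod.cong)
 thus ?thesis by (simp add: local_degree_def r1_r2)
qed

lemma r1_r2_pos: "nf_r1 K + nf_r2 K > 0"
proof -
 have "place 0 \<in> places" using place(1) n_pos by simp
 hence "card places > 0" using place(4) by (auto simp: card_gt_0_iff)
 also have "card places = card {v \<in> places. cbar v = v} + card {v \<in> places. cbar v \<noteq> v}"
  by (subst card_Un_disjoint[symmetric]) (auto simp: place intro!: arg_cong[where f = card])
 finally show ?thesis by (simp add: r1_r2)
qed

text \<open>The base of the exponential part of the completed zeta function, with
  \<open>covol OK\<close> in the place of the square root of the absolute discriminant and one power
  of \<open>pi\<close> or \<open>2 * pi\<close> per place.\<close>

definition afactor :: real where
 "afactor = covol OK * (pi powr (- 1 / 2)) ^ nf_r1 K * ((2 * pi) powr (- 1)) ^ nf_r2 K"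

lemma afactor_pos: "afactor > 0" using lattice_covol_pos[OF OK_lattice] by (simp add: afactor_def)

text \<open>For a fixed ideal the integrand factors over the places. A place of local degree
  \<open>e\<close> gives \<open>Gamma (e * x / 2) * (pi * e) powr (- e * x / 2)\<close>, that is,
  the classical factors for \<open>e = 1\<close> and \<open>e = 2\<close>.\<close>

lemma mellin_fibre:
 assumes x: "x > 0" and a: "frac a"
 shows "(\<integral>\<^sup>+u. ennreal (exp (x * logvol (a, u))) * weight (a, u) \<partial>log_space places) =
  indicator {a. 1 \<in> a} a * ennreal (covol a powr x * ((Gamma (x / 2) * pi powr (- x / 2)) ^ nf_r1 K * (Gamma x * (2 * pi) powr (- x)) ^ nf_r2 K))"
proof -
 interpret product_sigma_finite "\<lambda>_. lborel :: real measure" by standard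
 let ?e = "\<lambda>v. real (local_degree v)"
 let ?f = "\<lambda>v w. exp (?e v * x / 2 * w) * exp (- (pi * ?e v * exp w))"
 let ?i = "indicator {a. 1 \<in> a} a :: ennreal"
 have e: "?e v > 0" for v by (simp add: local_degree_def)
 have c: "covol a > 0" using lattice_covol_pos[OF frac_lattice[OF a]] .
 have "ennreal (exp (x * logvol (a, u))) * weight (a, u) = ?i * ennreal (covol a powr x) * (\<Prod>v\<in>places. ennreal (?f v (u v)))" for u
 proof -
  have "exp (x * logvol (a, u)) * exp (- pi * (\<Sum>i<n. exp (u (place i)))) = covol a powr x * (\<Prod>v\<in>places. ?f v (u v))"
  proof -
   have "x * logvol (a, u) + - pi * (\<Sum>i<n. exp (u (place i))) =
     x * ln (covol a) + (\<Sum>v\<in>places. ?e v * x / 2 * u v + - (pi * ?e v * exp (u v)))"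
   proof -
    have "(\<Sum>v\<in>places. ?e v * x / 2 * u v + - (pi * ?e v * exp (u v))) =
      x / 2 * (\<Sum>v\<in>places. ?e v * u v) - pi * (\<Sum>v\<in>places. ?e v * exp (u v))"
     unfolding sum.distrib sum_negf sum_distrib_left by (simp add: mult_ac)
    thus ?thesis by (simp add: logvol_def sum_place sum_place[of "\<lambda>v. exp (u v)"] algebra_simps)
   qed
   moreover have "covol a powr x = exp (x * ln (covol a))" using c by (simp add: powr_def)
   ultimately show ?thesis by (simp only: exp_add[symmetric] exp_sum[OF place(4), symmetric])
  qed
  thus ?thesis by (simp add: weight_def prod_ennreal mult_ac flip: ennreal_mult')
 qed
 hence "(\<integral>\<^sup>+u. ennreal (exp (x * logvol (a, u))) * weight (a, u) \<partial>log_space places) =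
   ?i * ennreal (covol a powr x) * (\<integral>\<^sup>+u. (\<Prod>v\<in>places. ennreal (?f v (u v))) \<partial>log_space places)"
  by (simp only:) (rule nn_integral_cmult, measurable)
 also have "(\<integral>\<^sup>+u. (\<Prod>v\<in>places. ennreal (?f v (u v))) \<partial>log_space places) = (\<Prod>v\<in>places. \<integral>\<^sup>+w. ennreal (?f v w) \<partial>lborel)"
  by (rule product_nn_integral_prod) (auto simp: place)
 also have "\<dots> = (\<Prod>v\<in>places. ennreal (Gamma (?e v * x / 2) * (pi * ?e v) powr (- (?e v * x / 2))))"
  using x e by (intro prod.cong nn_integral_exp_exp) (auto intro!: mult_pos_pos)
 also have "\<dots> = ennreal (\<Prod>v\<in>places. Gamma (?e v * x / 2) * (pi * ?e v) powr (- (?e v * x / 2)))"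
  using x e by (intro prod_ennreal) (auto intro!: mult_nonneg_nonneg Gamma_real_nonneg)
 also have "(\<Prod>v\<in>places. Gamma (?e v * x / 2) * (pi * ?e v) powr (- (?e v * x / 2))) =
   (Gamma (x / 2) * pi powr (- x / 2)) ^ nf_r1 K * (Gamma x * (2 * pi) powr (- x)) ^ nf_r2 K"
  by (subst prod_places[where f = "\<lambda>d. Gamma (real d * x / 2) * (pi * real d) powr (- (real d * x / 2))"]) (simp add: mult.commute)
 finally show ?thesis by (simp add: mult.assoc flip: ennreal_mult')
qed

text \<open>Only ideals containing 1 contribute, and these are the inverses of integral ideals;
  \<open>covol (iinv I) powr x\<close> is \<open>covol OK powr x\<close> times the term of the
  Dirichlet series at \<open>I\<close>.\<close>

lemma mellin_mu:
 assumes x: "x > 1"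
 shows "(\<integral>\<^sup>+u. ennreal (exp (x * u)) \<partial>mu) = ennreal (afactor powr x * Gamma (x / 2) ^ nf_r1 K * Gamma x ^ nf_r2 K * zreal x)"
proof -
 let ?g = "(Gamma (x / 2) * pi powr (- x / 2)) ^ nf_r1 K * (Gamma x * (2 * pi) powr (- x)) ^ nf_r2 K"
 have g: "?g \<ge> 0" using x by (intro mult_nonneg_nonneg zero_le_power) (auto intro!: Gamma_real_nonneg)
 have c: "covol OK > 0" by (rule lattice_covol_pos[OF OK_lattice])
 have m: "(\<lambda>z. ennreal (exp (x * logvol z)) * weight z) \<in> borel_measurable (count_space {a. frac a} \<Otimes>\<^sub>M log_space places)"
  unfolding metr_def[symmetric] by measurable
 have "(\<integral>\<^sup>+u. ennreal (exp (x * u)) \<partial>mu) = (\<integral>\<^sup>+z. ennreal (exp (x * logvol z)) * weight z \<partial>metr)"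
  by (rule nn_integral_mu) measurable
 also have "\<dots> = (\<integral>\<^sup>+a. \<integral>\<^sup>+u. ennreal (exp (x * logvol (a, u))) * weight (a, u) \<partial>log_space places \<partial>count_space {a. frac a})"
  unfolding metr_def by (rule nn_integral_pair_log_space[OF place(4) m])
 also have "\<dots> = (\<integral>\<^sup>+a. ennreal (covol a powr x * ?g) * indicator {a. 1 \<in> a} a \<partial>count_space {a. frac a})"
   proof (rule nn_integral_cong)
  fix a assume "a \<in> space (count_space {a. frac a})"
  thus "(\<integral>\<^sup>+u. ennreal (exp (x * logvol (a, u))) * weight (a, u) \<partial>log_space places) = ennreal (covol a powr x * ?g) * indicator {a. 1 \<in> a} a"
   using x by (subst mellin_fibre) (auto simp: mult.commute)
 qed
 also have "\<dots> = (\<integral>\<^sup>+a. ennreal (covol a powr x * ?g) \<partial>count_space ({a. frac a} \<inter> {a. 1 \<in> a}))"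
  by (subst nn_integral_restrict_space[symmetric]) (auto simp: restrict_count_space Int_commute)
 also have "{a. frac a} \<inter> {a. 1 \<in> a} = {c. frac c \<and> OK \<subseteq> c}"
  using frac_mult[of _ _ 1] OK_closed(2) by auto
 also have "(\<integral>\<^sup>+a. ennreal (covol a powr x * ?g) \<partial>count_space {c. frac c \<and> OK \<subseteq> c}) =
   (\<integral>\<^sup>+I. ennreal (covol (iinv I) powr x * ?g) \<partial>count_space Ids)"
  by (rule nn_integral_bij_count_space[OF iinv_bij, symmetric])
 also have "\<dots> = (\<integral>\<^sup>+I. ennreal (covol OK powr x * ?g * real (Nm I) powr (- x)) \<partial>count_space Ids)"
 proof (rule nn_integral_cong)
  fix I assume "I \<in> space (count_space Ids)"
  hence I: "I \<in> Ids" by simp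
  have "covol I * covol (iinv I) = covol OK * covol OK" "covol I = real (Nm I) * covol OK" "Nm I > 0"
   using ideal_invertible[OF I] ideal_norm_covol[OF I] by auto
  hence "covol (iinv I) = covol OK / real (Nm I)" using c by (simp add: field_simps)
  hence "covol (iinv I) powr x = covol OK powr x * real (Nm I) powr (- x)"
   using c by (simp add: powr_divide powr_minus_divide)
  thus "ennreal (covol (iinv I) powr x * ?g) = ennreal (covol OK powr x * ?g * real (Nm I) powr (- x))"
   by (simp add: mult_ac)
 qed
 also have "\<dots> = ennreal (\<Sum>\<^sub>\<infinity>I\<in>Ids. covol OK powr x * ?g * real (Nm I) powr (- x))"
  using zeta_summable[OF x] g by (intro nn_integral_count_space_infsum summable_on_cmult_right) auto
 also have "(\<Sum>\<^sub>\<infinity>I\<in>Ids. covol OK powr x * ?g * real (Nm I) powr (- x)) = covol OK powr x * ?g * zreal x"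
  unfolding zreal_def by (rule infsum_cmult_right) (use zeta_summable[OF x] in auto)
 also have "covol OK powr x * ?g = afactor powr x * Gamma (x / 2) ^ nf_r1 K * Gamma x ^ nf_r2 K"
 proof -
  have "((b powr y) ^ k) powr x = (b powr (y * x)) ^ k" if "b > 0" for b y :: real and k
   using that by (simp add: powr_powr powr_power mult_ac flip: powr_realpow)
  from this[of pi "- 1 / 2"] this[of "2 * pi" "- 1"]
  have "((pi powr (- 1 / 2)) ^ k) powr x = (pi powr (- x / 2)) ^ k" "(((2 * pi) powr (- 1)) ^ k) powr x = ((2 * pi) powr (- x)) ^ k" for k
   by simp_all
  hence "afactor powr x = covol OK powr x * (pi powr (- x / 2)) ^ nf_r1 K * ((2 * pi) powr (- x)) ^ nf_r2 K"
   by (simp only: afactor_def powr_mult[of "covol OK * (pi powr (- 1 / 2)) ^ nf_r1 K"] powr_mult[of "covol OK"])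
  thus ?thesis by (simp only: power_mult_distrib mult_ac)
 qed
 finally show ?thesis .
qed

lemma zreal_ge_1: "x > 1 \<Longrightarrow> zreal x \<ge> 1"
proof -
 assume x: "x > 1"
 have "sum (\<lambda>I. real (Nm I) powr (- x)) {OK} \<le> zreal x"
  unfolding zreal_def by (rule finite_sum_le_infsum[OF zeta_summable[OF x]]) (use frac_OK in \<open>auto simp: nonzero_ideals_iff\<close>)
 thus ?thesis by (simp add: ideal_norm_OK)
qed

lemma zreal_mono: "2 \<le> x \<Longrightarrow> zreal x \<le> zreal 2" unfolding zreal_def
proof (rule infsum_mono)
 assume x: "2 \<le> x"
 fix I assume "I \<in> Ids"
 from ideal_norm_covol(2)[OF this] x show "real (Nm I) powr (- x) \<le> real (Nm I) powr (- 2)"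
  by (intro powr_mono) auto
qed (use zeta_summable in auto)

definition Lam :: "real \<Rightarrow> real" where
 "Lam x = afactor powr x * Gamma (x / 2) ^ nf_r1 K * Gamma x ^ nf_r2 K * zreal x"

lemma Lam_pos: "x > 1 \<Longrightarrow> Lam x > 0"
 using afactor_pos zreal_ge_1[of x] by (simp add: Lam_def Gamma_real_pos)

theorem dedekind_mellin:
 obtains \<Psi> v where "v > 0" "\<Psi> holomorphic_on UNIV" "\<And>s. \<Psi> (1 - s) = \<Psi> s" "\<Psi> 0 = of_real v"
  "\<And>x. x > 1 \<Longrightarrow> \<Psi> (of_real x) = complex_of_real (x * (x - 1) * Lam x)"
  "\<And>s. norm (\<Psi> s) \<le> v + 3 * norm s * (norm s + 1) * Lam (2 + norm s)"
proof -
 have L: "(\<integral>\<^sup>+u. ennreal (exp (x * u)) \<partial>mu) = ennreal (Lam x)" if "x > 1" for x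
  using mellin_mu[OF that] by (simp add: Lam_def)
 have vol: "vol < \<infinity>" "vol > 0" using vol_finite vol_pos L[of 2] Lam_pos[of 2] by auto
 hence v: "enn2real vol > 0" "ennreal (enn2real vol) = vol" by (auto simp: enn2real_positive_iff less_top)
 show ?thesis
 proof (rule mellin_continuation[of mu "enn2real vol"])
  fix \<Psi> :: "complex \<Rightarrow> complex"
  assume \<Psi>: "\<Psi> holomorphic_on UNIV" "\<And>s. \<Psi> (1 - s) = \<Psi> s" "\<Psi> 0 = of_real (enn2real vol)"
   "\<And>x. 1 < x \<Longrightarrow> \<Psi> (of_real x) = complex_of_real (x * (x - 1) * enn2real (\<integral>\<^sup>+u. ennreal (exp (x * u)) \<partial>mu))"
   "\<And>s. norm (\<Psi> s) \<le> enn2real vol + 3 * norm s * (norm s + 1) * enn2real (\<integral>\<^sup>+u. ennreal (exp ((2 + norm s) * u)) \<partial>mu)"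
  show ?thesis
  proof (rule that[OF v(1) \<Psi>(1-3)])
   show "\<Psi> (of_real x) = complex_of_real (x * (x - 1) * Lam x)" if "x > 1" for x
    using \<Psi>(4)[OF that] L[OF that] Lam_pos[OF that] by simp
   show "norm (\<Psi> s) \<le> enn2real vol + 3 * norm s * (norm s + 1) * Lam (2 + norm s)" for s
   proof -
    have "1 < 2 + norm s" using norm_ge_zero[of s] by linarith
    thus ?thesis using \<Psi>(5)[of s] L[of "2 + norm s"] Lam_pos[of "2 + norm s"] by simp
   qed
  qed
 qed (use v L mu_reflection in auto)
qed

end

section \<open>Logarithmic derivatives of entire functions of finite order\<close>

text \<open>The map \<open>l / (2 * A - l)\<close> sends the half-plane \<open>Re l < A\<close> into
  the unit disc and 0 to 0, so Schwarz's lemma bounds it by \<open>cmod w \<le> 1/2\<close>; solving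
  for \<open>l\<close> gives the constant 2.\<close>

lemma borel_caratheodory:
 assumes L: "L holomorphic_on ball z0 R" "L z0 = 0" and R: "R > 0"
  and A: "\<And>z. z \<in> ball z0 R \<Longrightarrow> Re (L z) < A" and z: "dist z0 z \<le> R / 2"
 shows "cmod (L z) \<le> 2 * A"
proof -
 have A0: "A > 0" using A[of z0] L(2) R by simp
 define l where "l w = L (z0 + of_real R * w)" for w
 have inb: "z0 + of_real R * w \<in> ball z0 R" if "w \<in> ball 0 1" for w
  using that R by (simp add: dist_norm norm_mult)
 have less: "cmod (l w) < cmod (2 * A - l w)" if w: "w \<in> ball 0 1" for w
 proof -
  have "(cmod (2 * A - l w))\<^sup>2 - (cmod (l w))\<^sup>2 = 4 * A * (A - Re (l w))"
   unfolding cmod_power2 by (simp add: power2_eq_square algebra_simps)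
  also have "\<dots> > 0" using A[OF inb[OF w]] A0 by (simp add: l_def)
  finally show ?thesis by (auto intro: power2_less_imp_less)
 qed
 have holl: "l holomorphic_on ball 0 1"
  unfolding l_def using inb by (intro holomorphic_on_compose_gen[OF _ L(1), unfolded o_def] holomorphic_intros) auto
 have "2 * A - l w \<noteq> 0" if "w \<in> ball 0 1" for w using less[OF that] by (metis norm_not_less_zero norm_zero)
 hence hol: "(\<lambda>w. l w / (2 * A - l w)) holomorphic_on ball 0 1"
  by (intro holomorphic_on_divide holomorphic_on_diff holomorphic_on_const holl) auto
 define w where "w = (z - z0) / of_real R"
 have w: "cmod w \<le> 1 / 2" and lw: "l w = L z"
  using z R by (auto simp: w_def l_def norm_divide dist_norm norm_minus_commute field_simps)
 have w1: "w \<in> ball 0 1" using w by simp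
 have "cmod (l w / (2 * A - l w)) \<le> cmod w"
 proof (rule Schwarz_Lemma(1)[OF hol])
  show "l 0 / (2 * A - l 0) = 0" by (simp add: l_def L)
  show "cmod (l u / (2 * A - l u)) < 1" if "cmod u < 1" for u
  proof -
   have "cmod (l u) < cmod (2 * A - l u)" using less[of u] that by simp
   moreover from le_less_trans[OF norm_ge_zero this] have "0 < cmod (2 * A - l u)" .
   ultimately show ?thesis by (simp only: norm_divide divide_less_eq_1_pos)
  qed
 qed (use w in auto)
 hence "cmod (l w) \<le> cmod w * cmod (2 * A - l w)"
  using less[OF w1] le_less_trans[OF norm_ge_zero less[OF w1]] by (simp add: norm_divide divide_le_eq)
 also have "\<dots> \<le> 1 / 2 * (2 * A + cmod (l w))"
  using norm_triangle_ineq4[of "2 * A" "l w"] w A0 by (intro mult_mono) auto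
 finally show ?thesis by (simp add: lw)
qed

text \<open>The case of a point where \<open>f\<close> does not vanish is included with
  \<open>m = 0\<close>, so that orders can be compared at every point by exhibiting such a
  factorization.\<close>

lemma entire_factor_point:
 assumes f: "f holomorphic_on UNIV" and nz: "f z0 \<noteq> 0"
 obtains m h where "h holomorphic_on UNIV" "h \<rho> \<noteq> 0" "\<And>z. f z = (z - \<rho>) ^ m * h z" "zorder f \<rho> = int m"
proof -
 have ord: "zorder f \<rho> = int m" if "h holomorphic_on UNIV" "h \<rho> \<noteq> 0" "\<And>z. f z = (z - \<rho>) ^ m * h z" for m h
  using that by (intro zorder_eqI[of UNIV]) (auto simp: mult.commute)
 show thesis
 proof (cases "f \<rho> = 0")
  case False
  hence "zorder f \<rho> = int 0" by (intro ord[where h = f]) (use f in auto)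
  with False show thesis by (intro that[where m = 0 and h = f]) (use f in auto)
 next
  case True
  have "\<not> f constant_on UNIV" using True nz unfolding constant_on_def by (metis UNIV_I)
  from holomorphic_factor_zero_nonconstant[OF f open_UNIV connected_UNIV UNIV_I True this]
  obtain g r m where g: "0 < (m::nat)" "0 < r" "g holomorphic_on ball \<rho> r"
   "\<And>w. w \<in> ball \<rho> r \<Longrightarrow> f w = (w - \<rho>) ^ m * g w" "\<And>w. w \<in> ball \<rho> r \<Longrightarrow> g w \<noteq> 0" by metis
  define h where "h z = (if z \<in> ball \<rho> r then g z else f z / (z - \<rho>) ^ m)" for z
  have "h holomorphic_on ball \<rho> r" using g(3) by (rule holomorphic_transform) (simp add: h_def)
  moreover have "h holomorphic_on - {\<rho>}"
  proof (rule holomorphic_transform)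
   show "(\<lambda>z. f z / (z - \<rho>) ^ m) holomorphic_on - {\<rho>}"
    using holomorphic_on_subset[OF f] by (intro holomorphic_intros) auto
   show "f z / (z - \<rho>) ^ m = h z" if "z \<in> - {\<rho>}" for z using that g(4)[of z] by (auto simp: h_def)
  qed
  ultimately have "h holomorphic_on ball \<rho> r \<union> - {\<rho>}" by (intro holomorphic_on_Un) auto
  moreover have "ball \<rho> r \<union> - {\<rho>} = UNIV" using g(2) by auto
  ultimately have h: "h holomorphic_on UNIV" by simp
  have h0: "h \<rho> \<noteq> 0" using g(2,5) by (simp add: h_def)
  have fh: "f z = (z - \<rho>) ^ m * h z" for z
   using g(2) g(4)[of z] by (cases "z = \<rho>") (auto simp: h_def)
  show thesis by (rule that[OF h h0 fh ord[OF h h0 fh]])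
 qed
qed

lemma entire_factor:
 assumes f: "f holomorphic_on UNIV" "f z0 \<noteq> 0" and S: "finite S"
 shows "\<exists>g. g holomorphic_on UNIV \<and> (\<forall>z. f z = (\<Prod>\<rho>\<in>S. (z - \<rho>) ^ nat (zorder f \<rho>)) * g z) \<and> (\<forall>\<rho>\<in>S. g \<rho> \<noteq> 0)"
 using S
proof (induction S rule: finite_induct)
 case empty
 thus ?case using f by auto
next
 case (insert \<rho> S)
 then obtain g where g: "g holomorphic_on UNIV" "\<And>z. f z = (\<Prod>\<rho>\<in>S. (z - \<rho>) ^ nat (zorder f \<rho>)) * g z" "\<And>\<rho>. \<rho> \<in> S \<Longrightarrow> g \<rho> \<noteq> 0"
  by blast
 have "g z0 \<noteq> 0" using g(2)[of z0] f(2) by auto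
 from entire_factor_point[OF g(1) this, of \<rho>] obtain m h where
  h: "h holomorphic_on UNIV" "h \<rho> \<noteq> 0" "\<And>z. g z = (z - \<rho>) ^ m * h z" by metis
 have "zorder f \<rho> = int m"
 proof (rule zorder_eqI)
  show "(\<lambda>z. (\<Prod>\<rho>\<in>S. (z - \<rho>) ^ nat (zorder f \<rho>)) * h z) holomorphic_on UNIV" using h(1) by (intro holomorphic_intros) auto
  show "(\<Prod>\<rho>'\<in>S. (\<rho> - \<rho>') ^ nat (zorder f \<rho>')) * h \<rho> \<noteq> 0" using insert.hyps h(2) by auto
  show "f w = (\<Prod>\<rho>\<in>S. (w - \<rho>) ^ nat (zorder f \<rho>)) * h w * (w - \<rho>) powi int m" for w
   by (simp add: g(2)[of w] h(3)[of w])
 qed auto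
 moreover have "h \<rho>' \<noteq> 0" if "\<rho>' \<in> insert \<rho> S" for \<rho>' using that g(3) h(2,3) by auto
 moreover have "f z = (z - \<rho>) ^ m * (\<Prod>\<rho>\<in>S. (z - \<rho>) ^ nat (zorder f \<rho>)) * h z" for z
  by (simp add: g(2)[of z] h(3)[of z])
 moreover have "(\<Prod>\<rho>'\<in>insert \<rho> S. (z - \<rho>') ^ nat (zorder f \<rho>')) = (z - \<rho>) ^ m * (\<Prod>\<rho>\<in>S. (z - \<rho>) ^ nat (zorder f \<rho>))" for z
  using insert.hyps \<open>zorder f \<rho> = int m\<close> by simp
 ultimately show ?case using h(1) by metis
qed

lemma has_field_derivative_prod_powers:
 assumes "finite S" "z \<notin> S"
 shows "((\<lambda>z. \<Prod>\<rho>\<in>S. (z - \<rho>) ^ m \<rho>) has_field_derivative (\<Prod>\<rho>\<in>S. (z - \<rho>) ^ m \<rho>) * (\<Sum>\<rho>\<in>S. of_nat (m \<rho>) / (z - \<rho>))) (at (z :: complex))"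
 using assms
proof (induction S rule: finite_induct)
 case (insert \<rho> S)
 have "((\<lambda>z. (z - \<rho>) ^ m \<rho>) has_field_derivative (z - \<rho>) ^ m \<rho> * (of_nat (m \<rho>) / (z - \<rho>))) (at z)"
 proof -
  have "((\<lambda>z. (z - \<rho>) ^ m \<rho>) has_field_derivative of_nat (m \<rho>) * (z - \<rho>) ^ (m \<rho> - 1)) (at z)"
   by (auto intro!: derivative_eq_intros)
  thus ?thesis using insert.prems by (cases "m \<rho>") (simp_all add: mult_ac)
 qed
 from DERIV_mult[OF this insert.IH] insert show ?case by (simp add: algebra_simps)
qed simp

lemma higher_deriv_simple_fractions:
 assumes "finite S" "z \<notin> S"
 shows "(deriv ^^ k) (\<lambda>z. \<Sum>\<rho>\<in>S. c \<rho> / (z - \<rho>)) z = (\<Sum>\<rho>\<in>S. (- 1) ^ k * fact k * c \<rho> / (z - \<rho>) ^ (k + 1) :: complex)"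
 using assms(2)
proof (induction k arbitrary: z)
 case (Suc k)
 have "open (- S)" using assms(1) by (simp add: finite_imp_closed open_Compl)
 hence ev: "\<forall>\<^sub>F w in nhds z. (deriv ^^ k) (\<lambda>z. \<Sum>\<rho>\<in>S. c \<rho> / (z - \<rho>)) w = (\<Sum>\<rho>\<in>S. (- 1) ^ k * fact k * c \<rho> / (w - \<rho>) ^ (k + 1))"
  using Suc by (intro eventually_nhds_in_open[THEN eventually_mono]) auto
 have "((\<lambda>w. (- 1) ^ k * fact k * c \<rho> / (w - \<rho>) ^ (k + 1)) has_field_derivative (- 1) ^ Suc k * fact (Suc k) * c \<rho> / (z - \<rho>) ^ (Suc k + 1)) (at z)"
  if "\<rho> \<in> S" for \<rho>
 proof -
  define w where "w = z - \<rho>"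
  have w: "w \<noteq> 0" using that Suc.prems by (auto simp: w_def)
  have "((\<lambda>w. (w - \<rho>) ^ Suc k) has_field_derivative (1 + of_nat k) * (1 * w ^ k)) (at z)"
   unfolding w_def by (rule DERIV_power_Suc) (auto intro!: derivative_eq_intros)
  moreover have "w ^ Suc k \<noteq> 0" using w by simp
  ultimately have "((\<lambda>w. (- 1) ^ k * fact k * c \<rho> * inverse ((w - \<rho>) ^ Suc k)) has_field_derivative
    (- 1) ^ k * fact k * c \<rho> * - (inverse (w ^ Suc k) * ((1 + of_nat k) * (1 * w ^ k)) * inverse (w ^ Suc k))) (at z)"
   unfolding w_def by (intro DERIV_cmult DERIV_inverse')
  also have "(- 1) ^ k * fact k * c \<rho> * - (inverse (w ^ Suc k) * ((1 + of_nat k) * (1 * w ^ k)) * inverse (w ^ Suc k)) =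
    (- 1) ^ Suc k * fact (Suc k) * c \<rho> / w ^ (Suc k + 1)"
   using w by (simp add: field_simps)
  also have "(\<lambda>w. (- 1) ^ k * fact k * c \<rho> * inverse ((w - \<rho>) ^ Suc k)) = (\<lambda>w. (- 1) ^ k * fact k * c \<rho> / (w - \<rho>) ^ (k + 1))"
   by (simp add: divide_inverse)
  finally show ?thesis unfolding w_def .
 qed
 hence "((\<lambda>w. \<Sum>\<rho>\<in>S. (- 1) ^ k * fact k * c \<rho> / (w - \<rho>) ^ (k + 1)) has_field_derivative
   (\<Sum>\<rho>\<in>S. (- 1) ^ Suc k * fact (Suc k) * c \<rho> / (z - \<rho>) ^ (Suc k + 1))) (at z)" by (rule DERIV_sum)
 thus ?case using deriv_cong_ev[OF ev refl] by (simp add: DERIV_imp_deriv)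
qed simp

text \<open>The zeros within \<open>R\<close> are divided out. The maximum principle on radius
  \<open>4 * R\<close> bounds the quotient \<open>g\<close>, and this single bound yields both the
  zero count and an upper bound for the real part of \<open>ln (g / g z0)\<close>.
  Borel-Caratheodory and Cauchy's estimate on radius \<open>R / 2\<close> then bound the
  \<open>k\<close>-th derivative of the remaining logarithmic derivative.\<close>

lemma log_derivative_bound:
 assumes f: "f holomorphic_on UNIV" "f z0 \<noteq> 0"
  and growth: "\<And>z. cmod (f z) \<le> exp (C * (1 + dist z0 z)\<^sup>2)" and C: "C \<ge> 0" and R: "R > 0"
 defines "S \<equiv> {\<rho>. f \<rho> = 0} \<inter> cball z0 R" and "B \<equiv> C * (1 + 4 * R)\<^sup>2 - ln (cmod (f z0))"
 shows "finite S" "(\<Sum>\<rho>\<in>S. real (nat (zorder f \<rho>))) \<le> B"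
  "cmod ((deriv ^^ k) (\<lambda>s. deriv f s / f s) z0 - (- 1) ^ k * fact k * (\<Sum>\<rho>\<in>S. of_nat (nat (zorder f \<rho>)) / (z0 - \<rho>) ^ (k + 1)))
   \<le> fact (k + 1) * (2 * (B + 1)) / (R / 2) ^ (k + 1)"
proof -
 have "finite {\<rho> \<in> cball z0 R. f \<rho> = 0}"
 proof (cases "\<exists>\<rho>. f \<rho> = 0")
  case True
  hence "\<not> f constant_on UNIV" using f(2) unfolding constant_on_def by (metis UNIV_I)
  thus ?thesis by (intro holomorphic_compact_finite_zeros[OF f(1)]) auto
 qed simp
 thus fin: "finite S" by (rule rev_finite_subset) (auto simp: S_def)
 let ?m = "\<lambda>\<rho>. nat (zorder f \<rho>)"
 define p where "p z = (\<Prod>\<rho>\<in>S. (z - \<rho>) ^ ?m \<rho>)" for z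
 obtain g where g: "g holomorphic_on UNIV" "\<And>z. f z = p z * g z" "\<And>\<rho>. \<rho> \<in> S \<Longrightarrow> g \<rho> \<noteq> 0"
  using entire_factor[OF f fin] unfolding p_def by metis
 have g0: "g z \<noteq> 0" if "z \<in> cball z0 R" for z using that g(2)[of z] g(3)[of z] by (auto simp: S_def)
 have z0S: "z0 \<notin> S" using f(2) by (auto simp: S_def)
 have p0: "p z0 \<noteq> 0" using f(2) g(2)[of z0] by auto
 define M where "M = (\<Sum>\<rho>\<in>S. ?m \<rho>)"
 \<comment> \<open>On the circle of radius \<open>4 * R\<close> the distance to a zero is at least
   \<open>3 * R\<close>, hence at least three times its distance from \<open>z0\<close>. The factor
   \<open>3 ^ M\<close> gains the zero count because \<open>ln 3 > 1\<close>.\<close>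
 have p_ge: "3 ^ M * cmod (p z0) \<le> cmod (p z)" if z: "dist z0 z = 4 * R" for z
 proof -
  have "3 ^ M * cmod (p z0) = (\<Prod>\<rho>\<in>S. (3 * cmod (z0 - \<rho>)) ^ ?m \<rho>)"
   by (simp add: p_def M_def power_sum prod.distrib norm_power power_mult_distrib flip: prod_norm)
  also have "\<dots> \<le> (\<Prod>\<rho>\<in>S. cmod (z - \<rho>) ^ ?m \<rho>)"
  proof (intro prod_mono conjI power_mono)
   fix \<rho> assume "\<rho> \<in> S"
   hence "dist z0 \<rho> \<le> R" by (simp add: S_def)
   moreover have "dist z0 z \<le> dist z0 \<rho> + dist z \<rho>" by (metis dist_commute dist_triangle)
   ultimately show "3 * cmod (z0 - \<rho>) \<le> cmod (z - \<rho>)" using z by (simp add: dist_norm)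
  qed auto
  also have "\<dots> = cmod (p z)" by (simp add: p_def norm_power flip: prod_norm)
  finally show ?thesis .
 qed
 define E where "E = exp (C * (1 + 4 * R)\<^sup>2)"
 have g_le: "cmod (g z) \<le> E / (3 ^ M * cmod (p z0))" if "z \<in> cball z0 (4 * R)" for z
 proof (rule maximum_modulus_frontier[of g "cball z0 (4 * R)"])
  show "g holomorphic_on interior (cball z0 (4 * R))" "continuous_on (closure (cball z0 (4 * R))) g"
   using holomorphic_on_subset[OF g(1)] by (auto intro: holomorphic_on_imp_continuous_on)
  fix w assume "w \<in> frontier (cball z0 (4 * R))"
  hence w: "dist z0 w = 4 * R" using R by (simp add: frontier_cball)
  have "3 ^ M * cmod (p z0) * cmod (g w) \<le> cmod (p w) * cmod (g w)" using p_ge[OF w] by (rule mult_right_mono) simp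
  also have "\<dots> \<le> E" using growth[of w] w by (simp add: g(2) norm_mult E_def)
  finally show "cmod (g w) \<le> E / (3 ^ M * cmod (p z0))" using p0 by (simp add: field_simps)
 qed (use that in auto)
 have "cmod (f z0) * 3 ^ M \<le> E" using g_le[of z0] p0 R by (simp add: g(2) norm_mult field_simps)
 hence "ln (cmod (f z0) * 3 ^ M) \<le> ln E" using f(2) by (subst ln_le_cancel_iff) (auto simp: E_def)
 hence "real M * ln 3 \<le> B" using f(2) by (simp add: B_def E_def ln_mult ln_realpow)
 moreover have "real M * 1 \<le> real M * ln 3" using ln3_gt_1 by (intro mult_left_mono) auto
 ultimately show M: "(\<Sum>\<rho>\<in>S. real (?m \<rho>)) \<le> B" by (simp add: M_def)
 have sub: "ball z0 R \<subseteq> cball z0 R" "ball z0 R \<subseteq> cball z0 (4 * R)" using R by auto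
 have "\<exists>l. l holomorphic_on ball z0 R \<and> (\<forall>z\<in>ball z0 R. g z / g z0 = exp (l z))"
  using simply_connected_eq_holomorphic_log[of "ball z0 R"] convex_imp_simply_connected[OF convex_ball]
   holomorphic_on_subset[OF g(1)] g0 sub(1) R by (auto simp: holomorphic_on_divide)
 then obtain l where l: "l holomorphic_on ball z0 R" "\<And>z. z \<in> ball z0 R \<Longrightarrow> g z / g z0 = exp (l z)" by blast
 define L where "L z = l z - l z0" for z
 have gz0: "g z0 \<noteq> 0" using g0 R by simp
 have L: "L holomorphic_on ball z0 R" "L z0 = 0" using l(1) by (auto simp: L_def[abs_def] intro!: holomorphic_intros)
 have gL: "g z = g z0 * exp (L z)" if "z \<in> ball z0 R" for z
  using l(2)[OF that] l(2)[of z0] R gz0 by (simp add: L_def exp_diff field_simps)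
 \<comment> \<open>Borel-Caratheodory is stated with a strict bound, which is the reason for
   \<open>B + 1\<close>.\<close>
 have ReL: "Re (L z) < B + 1" if z: "z \<in> ball z0 R" for z
 proof -
  have "cmod (f z0) * exp (Re (L z)) = cmod (p z0) * cmod (g z)" by (simp add: g(2)[of z0] gL[OF z] norm_mult)
  also have "\<dots> \<le> cmod (p z0) * (E / (3 ^ M * cmod (p z0)))" using g_le z sub(2) by (intro mult_left_mono) auto
  also have "\<dots> = E / 3 ^ M" using p0 by simp
  also have "\<dots> \<le> E / 1" by (rule divide_left_mono) (auto simp: E_def)
  finally have "cmod (f z0) * exp (Re (L z)) \<le> E" by simp
  hence "ln (cmod (f z0) * exp (Re (L z))) \<le> ln E" using f(2) by (subst ln_le_cancel_iff) (auto simp: E_def)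
  thus ?thesis using f(2) by (simp add: B_def E_def ln_mult)
 qed
 have R2: "ball z0 (R / 2) \<subseteq> ball z0 R" "cball z0 (R / 2) \<subseteq> ball z0 R" using R by auto
 have Lb: "cmod ((deriv ^^ (k + 1)) L z0) \<le> fact (k + 1) * (2 * (B + 1)) / (R / 2) ^ (k + 1)"
 proof (rule Cauchy_inequality)
  show "L holomorphic_on ball z0 (R / 2)" by (rule holomorphic_on_subset[OF L(1) R2(1)])
  show "continuous_on (cball z0 (R / 2)) L" by (rule continuous_on_subset[OF holomorphic_on_imp_continuous_on[OF L(1)] R2(2)])
  show "cmod (L x) \<le> 2 * (B + 1)" if "cmod (z0 - x) = R / 2" for x
   using that by (intro borel_caratheodory[OF L R ReL]) (auto simp: dist_norm)
 qed (use R in auto)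
 let ?q = "\<lambda>z. \<Sum>\<rho>\<in>S. of_nat (?m \<rho>) / (z - \<rho>)"
 define U where "U = ball z0 R - S"
 have U: "open U" "z0 \<in> U" using fin z0S R by (auto simp: U_def finite_imp_closed)
 have logder: "deriv f z / f z = ?q z + deriv L z" if z: "z \<in> U" for z
 proof -
  have zb: "z \<in> ball z0 R" "z \<notin> S" using z by (auto simp: U_def)
  have "(L has_field_derivative deriv L z) (at z)" using holomorphic_derivI[OF L(1) open_ball zb(1)] .
  hence "((\<lambda>z. p z * (g z0 * exp (L z))) has_field_derivative p z * ?q z * (g z0 * exp (L z)) + (g z0 * (exp (L z) * deriv L z)) * p z) (at z)"
   unfolding p_def by (intro DERIV_mult has_field_derivative_prod_powers fin zb(2) DERIV_cmult DERIV_chain2[OF DERIV_exp])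
  moreover have "\<forall>\<^sub>F w in nhds z. f w = p w * (g z0 * exp (L w))"
   using eventually_nhds_in_open[OF open_ball zb(1)] by eventually_elim (simp add: g(2) gL)
  ultimately have "deriv f z = p z * ?q z * (g z0 * exp (L z)) + (g z0 * (exp (L z) * deriv L z)) * p z"
   using deriv_cong_ev[OF _ refl, of f "\<lambda>w. p w * (g z0 * exp (L w))" z] by (simp only: DERIV_imp_deriv)
  moreover have "f z = p z * (g z0 * exp (L z))" by (simp add: g(2) gL[OF zb(1)])
  moreover have "f z \<noteq> 0" using zb sub(1) by (auto simp: S_def)
  ultimately show ?thesis by (simp add: field_simps)
 qed
 have "(deriv ^^ k) (\<lambda>s. deriv f s / f s) z0 = (deriv ^^ k) (\<lambda>z. ?q z + deriv L z) z0"
  using eventually_nhds_in_open[OF U] by (intro higher_deriv_cong_ev) (auto elim!: eventually_mono simp: logder)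
 also have "\<dots> = (deriv ^^ k) ?q z0 + (deriv ^^ k) (deriv L) z0"
  using L(1) by (intro higher_deriv_add[OF _ _ U]) (use U in \<open>auto simp: U_def intro!: holomorphic_intros holomorphic_deriv holomorphic_on_subset[of L "ball z0 R"]\<close>)
 also have "(deriv ^^ k) ?q z0 = (- 1) ^ k * fact k * (\<Sum>\<rho>\<in>S. of_nat (?m \<rho>) / (z0 - \<rho>) ^ (k + 1))"
  by (subst higher_deriv_simple_fractions[OF fin z0S]) (simp add: sum_distrib_left)
 also have "(deriv ^^ k) (deriv L) = (deriv ^^ (k + 1)) L" by (simp add: funpow_swap1)
 finally show "cmod ((deriv ^^ k) (\<lambda>s. deriv f s / f s) z0 - (- 1) ^ k * fact k * (\<Sum>\<rho>\<in>S. of_nat (?m \<rho>) / (z0 - \<rho>) ^ (k + 1)))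
   \<le> fact (k + 1) * (2 * (B + 1)) / (R / 2) ^ (k + 1)" using Lb by simp
qed

text \<open>With at most \<open>D * (1 + R)^2\<close> zeros within \<open>R\<close>, the shell at
  distance \<open>j\<close> contributes at most a multiple of \<open>j^2 / j^4\<close>, which is
  summable; the error of the finite formula is of order \<open>R^2 / R^4\<close> and vanishes in the
  limit. Both estimates use \<open>k + 1 \<ge> 4\<close>.\<close>

theorem log_derivative_expansion:
 assumes f: "f holomorphic_on UNIV" "f z0 \<noteq> 0"
  and growth: "\<And>z. cmod (f z) \<le> exp (C * (1 + dist z0 z)\<^sup>2)" and k: "k \<ge> 3"
 shows "(\<lambda>\<rho>. real (nat (zorder f \<rho>)) / cmod (z0 - \<rho>) ^ (k + 1)) summable_on {\<rho>. f \<rho> = 0}"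
  "(deriv ^^ k) (\<lambda>s. deriv f s / f s) z0 = (- 1) ^ k * fact k * (\<Sum>\<^sub>\<infinity>\<rho>\<in>{\<rho>. f \<rho> = 0}. of_nat (nat (zorder f \<rho>)) / (z0 - \<rho>) ^ (k + 1))"
proof -
 let ?Z = "{\<rho>. f \<rho> = 0}" and ?m = "\<lambda>\<rho>. nat (zorder f \<rho>)"
 define C' where "C' = max C 0"
 have growth': "cmod (f z) \<le> exp (C' * (1 + dist z0 z)\<^sup>2)" for z
  using growth[of z] by (rule order.trans) (auto simp: C'_def intro!: mult_right_mono)
 define S where "S R = ?Z \<inter> cball z0 R" for R
 \<comment> \<open>The factor 16 comes from \<open>(1 + 4 * R)^2 \<le> 16 * (1 + R)^2\<close>; the
   logarithm of the value at the centre is absorbed as well.\<close>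
 define D where "D = 16 * C' + \<bar>ln (cmod (f z0))\<bar>"
 have B: "C' * (1 + 4 * R)\<^sup>2 - ln (cmod (f z0)) \<le> D * (1 + R)\<^sup>2" if "R > 0" for R
 proof -
  have "C' * (1 + 4 * R)\<^sup>2 \<le> C' * (4 * (1 + R))\<^sup>2" using that by (intro mult_left_mono power_mono) (auto simp: C'_def)
  moreover have "\<bar>ln (cmod (f z0))\<bar> * 1 \<le> \<bar>ln (cmod (f z0))\<bar> * (1 + R)\<^sup>2" using that by (intro mult_left_mono one_le_power) auto
  moreover have "- ln (cmod (f z0)) \<le> \<bar>ln (cmod (f z0))\<bar>" by simp
  moreover have "(4 * (1 + R))\<^sup>2 = 16 * (1 + R)\<^sup>2" unfolding power_mult_distrib by simp
  ultimately show ?thesis by (simp add: D_def algebra_simps)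
 qed
 have C'0: "C' \<ge> 0" by (simp add: C'_def)
 have fin: "finite (S R)" and M: "(\<Sum>\<rho>\<in>S R. real (?m \<rho>)) \<le> D * (1 + R)\<^sup>2" if "R > 0" for R
  using log_derivative_bound(1,2)[OF f growth' C'0 that] B[OF that] by (auto simp: S_def)
 let ?t = "\<lambda>\<rho>. real (?m \<rho>) / cmod (z0 - \<rho>) ^ (k + 1)"
 show sm: "?t summable_on ?Z"
 proof (rule nonneg_bounded_partial_sums_imp_summable_on)
  \<comment> \<open>Zeros at distance at most 1 are kept apart. For the others, sorted by the floor
    \<open>j \<ge> 1\<close> of the distance, the count within \<open>j + 1\<close> is at most
    \<open>D * (j + 2)^2 \<le> 9 * D * j^2\<close>.\<close>
  let ?b = "sum ?t (S 1) + 9 * D * (\<Sum>j. inverse ((real j)\<^sup>2))"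
  have D0: "D \<ge> 0" using C'0 by (simp add: D_def)
  show "\<forall>\<^sub>F F in finite_subsets_at_top ?Z. sum ?t F \<le> ?b"
  proof (rule eventually_finite_subsets_at_top_weakI)
   fix F assume F: "finite F" "F \<subseteq> ?Z"
   define F' where "F' = F - S 1"
   define d where "d \<rho> = nat \<lfloor>cmod (z0 - \<rho>)\<rfloor>" for \<rho>
   have F': "finite F'" and far: "d \<rho> \<ge> 1" "real (d \<rho>) \<le> cmod (z0 - \<rho>)" "cmod (z0 - \<rho>) \<le> real (d \<rho>) + 1" if "\<rho> \<in> F'" for \<rho>
   proof -
    have "cmod (z0 - \<rho>) > 1" using that F by (auto simp: F'_def S_def dist_norm)
    hence "real (nat \<lfloor>cmod (z0 - \<rho>)\<rfloor>) = of_int \<lfloor>cmod (z0 - \<rho>)\<rfloor>" "\<lfloor>cmod (z0 - \<rho>)\<rfloor> \<ge> 1" by simp_all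
    thus "d \<rho> \<ge> 1" "real (d \<rho>) \<le> cmod (z0 - \<rho>)" "cmod (z0 - \<rho>) \<le> real (d \<rho>) + 1"
     unfolding d_def using of_int_floor_le[of "cmod (z0 - \<rho>)"] floor_correct[of "cmod (z0 - \<rho>)"] by (simp_all add: le_nat_iff)
   qed (use F in \<open>simp add: F'_def\<close>)
   have F'fin: "finite F'" using F by (simp add: F'_def)
   have "sum ?t F' = (\<Sum>j\<in>d ` F'. \<Sum>\<rho> | \<rho> \<in> F' \<and> d \<rho> = j. ?t \<rho>)" by (rule sum.image_gen[OF F'fin])
   also have "\<dots> \<le> (\<Sum>j\<in>d ` F'. 9 * D * inverse ((real j)\<^sup>2))"
   proof (rule sum_mono)
    fix j assume "j \<in> d ` F'"
    hence j: "j \<ge> 1" using far(1) by auto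
    have "(\<Sum>\<rho> | \<rho> \<in> F' \<and> d \<rho> = j. ?t \<rho>) \<le> (\<Sum>\<rho> | \<rho> \<in> F' \<and> d \<rho> = j. real (?m \<rho>) / real j ^ 4)"
    proof (intro sum_mono divide_left_mono)
     fix \<rho> assume r: "\<rho> \<in> {\<rho> \<in> F'. d \<rho> = j}"
     hence "real j \<le> cmod (z0 - \<rho>)" using far(2)[of \<rho>] by auto
     hence "real j ^ (k + 1) \<le> cmod (z0 - \<rho>) ^ (k + 1)" by (intro power_mono) auto
     moreover have "real j ^ 4 \<le> real j ^ (k + 1)" using j k by (intro power_increasing) auto
     ultimately show "real j ^ 4 \<le> cmod (z0 - \<rho>) ^ (k + 1)" by linarith
     show "0 < cmod (z0 - \<rho>) ^ (k + 1) * real j ^ 4" using \<open>real j \<le> cmod (z0 - \<rho>)\<close> j by (intro mult_pos_pos zero_less_power) auto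
    qed auto
    also have "\<dots> = (\<Sum>\<rho> | \<rho> \<in> F' \<and> d \<rho> = j. real (?m \<rho>)) / real j ^ 4" by (simp add: sum_divide_distrib)
    also have "\<dots> \<le> (\<Sum>\<rho>\<in>S (real j + 1). real (?m \<rho>)) / real j ^ 4"
     using far(3) F by (intro divide_right_mono sum_mono2 fin) (auto simp: S_def F'_def dist_norm)
    also have "\<dots> \<le> D * (3 * real j)\<^sup>2 / real j ^ 4"
    proof (rule divide_right_mono)
     have "(\<Sum>\<rho>\<in>S (real j + 1). real (?m \<rho>)) \<le> D * (1 + (real j + 1))\<^sup>2" by (rule M) simp
     also have "\<dots> \<le> D * (3 * real j)\<^sup>2" using j D0 by (intro mult_left_mono power_mono) auto
     finally show "(\<Sum>\<rho>\<in>S (real j + 1). real (?m \<rho>)) \<le> D * (3 * real j)\<^sup>2" .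
    qed simp
    also have "\<dots> = 9 * D * inverse ((real j)\<^sup>2)" using j by (simp add: field_simps power2_eq_square power4_eq_xxxx)
    finally show "(\<Sum>\<rho> | \<rho> \<in> F' \<and> d \<rho> = j. ?t \<rho>) \<le> 9 * D * inverse ((real j)\<^sup>2)" .
   qed
   also have "\<dots> = 9 * D * (\<Sum>j\<in>d ` F'. inverse ((real j)\<^sup>2))" by (simp add: sum_distrib_left)
   also have "\<dots> \<le> 9 * D * (\<Sum>j. inverse ((real j)\<^sup>2))"
    using D0 F'fin inverse_power_summable[of 2, where 'a = real] by (intro mult_left_mono sum_le_suminf) auto
   finally have "sum ?t F' \<le> 9 * D * (\<Sum>j. inverse ((real j)\<^sup>2))" .
   moreover have "sum ?t (F \<inter> S 1) \<le> sum ?t (S 1)" by (intro sum_mono2 fin) auto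
   moreover have "sum ?t F = sum ?t (F \<inter> S 1) + sum ?t F'" using F(1) by (simp add: sum.Int_Diff F'_def)
   ultimately show "sum ?t F \<le> ?b" by linarith
  qed
 qed auto
 let ?u = "\<lambda>\<rho>. of_nat (?m \<rho>) / (z0 - \<rho>) ^ (k + 1)"
 have "(\<lambda>\<rho>. norm (?u \<rho>)) summable_on ?Z" using sm by (simp only: norm_divide norm_power norm_of_nat)
 hence "?u summable_on ?Z" by (rule abs_summable_summable)
 from has_sum_infsum[OF this] have "(sum ?u \<longlongrightarrow> infsum ?u ?Z) (finite_subsets_at_top ?Z)" unfolding has_sum_def .
 moreover have "filterlim (\<lambda>R. S (real R)) (finite_subsets_at_top ?Z) sequentially"
  unfolding filterlim_finite_subsets_at_top
 proof (intro allI impI)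
  fix X assume X: "finite X \<and> X \<subseteq> ?Z"
  then obtain b where b: "\<forall>x\<in>X. dist z0 x \<le> b" using finite_imp_bounded[of X] unfolding bounded_any_center[where a = z0] by blast
  show "\<forall>\<^sub>F R in sequentially. finite (S (real R)) \<and> X \<subseteq> S (real R) \<and> S (real R) \<subseteq> ?Z"
   using eventually_ge_at_top[of "nat \<lceil>b\<rceil> + 1"]
  proof eventually_elim
   case (elim R)
   have le: "nat \<lceil>b\<rceil> \<le> R" by (rule order_trans[OF le_add1 elim])
   have R: "real R > 0" using elim by (cases R) auto
   have "b \<le> real R" by (rule order_trans[OF real_nat_ceiling_ge]) (use le in \<open>simp only: of_nat_le_iff\<close>)
   have "dist z0 x \<le> real R" if "x \<in> X" for x using b that \<open>b \<le> real R\<close> by force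
   thus ?case using fin[OF R] X by (auto simp: S_def)
  qed
 qed
 ultimately have lim: "(\<lambda>R. sum ?u (S (real R))) \<longlonglongrightarrow> infsum ?u ?Z" by (rule filterlim_compose)
 let ?d = "(deriv ^^ k) (\<lambda>s. deriv f s / f s) z0"
 have "(\<lambda>R. ?d - (- 1) ^ k * fact k * sum ?u (S (real R))) \<longlonglongrightarrow> 0"
 proof (rule Lim_null_comparison)
  show "\<forall>\<^sub>F R in sequentially. norm (?d - (- 1) ^ k * fact k * sum ?u (S (real R)))
    \<le> fact (k + 1) * (2 * (D * (1 + real R)\<^sup>2 + 1)) * (2 / real R) ^ 4"
   using eventually_ge_at_top[of "2::nat"]
  proof eventually_elim
   case (elim R)
   hence R: "real R > 0" "R / 2 \<ge> 1" by auto
   have "norm (?d - (- 1) ^ k * fact k * sum ?u (S (real R))) \<le> fact (k + 1) * (2 * (C' * (1 + 4 * real R)\<^sup>2 - ln (cmod (f z0)) + 1)) / (real R / 2) ^ (k + 1)"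
    unfolding S_def by (rule log_derivative_bound(3)[OF f growth' C'0 R(1)])
   also have "\<dots> \<le> fact (k + 1) * (2 * (D * (1 + real R)\<^sup>2 + 1)) / (real R / 2) ^ (k + 1)"
    using B[OF R(1)] by (intro divide_right_mono mult_left_mono) auto
   also have "\<dots> \<le> fact (k + 1) * (2 * (D * (1 + real R)\<^sup>2 + 1)) / (real R / 2) ^ 4"
    using R k C'0 by (intro divide_left_mono power_increasing mult_nonneg_nonneg add_nonneg_nonneg mult_pos_pos zero_less_power) (auto simp: D_def)
   also have "\<dots> = fact (k + 1) * (2 * (D * (1 + real R)\<^sup>2 + 1)) * (2 / real R) ^ 4"
    using R by (simp add: power_divide)
   finally show ?case .
  qed
  show "(\<lambda>R. fact (k + 1) * (2 * (D * (1 + real R)\<^sup>2 + 1)) * (2 / real R) ^ 4) \<longlonglongrightarrow> 0"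
   by real_asymp
 qed
 moreover have "(\<lambda>R. ?d - (- 1) ^ k * fact k * sum ?u (S (real R))) \<longlonglongrightarrow> ?d - (- 1) ^ k * fact k * infsum ?u ?Z"
  by (intro tendsto_intros lim)
 ultimately have "?d - (- 1) ^ k * fact k * infsum ?u ?Z = 0" by (rule LIMSEQ_unique[symmetric])
 thus "?d = (- 1) ^ k * fact k * infsum ?u ?Z" by simp
qed

section \<open>The Dedekind zeta function\<close>

text \<open>A zero at \<open>1 + i \<tau>\<close> would contribute \<open>(\<sigma> - 1)^4\<close>
  to the product, against at most \<open>(\<sigma> - 1)^(-3)\<close> from the pole, so the product
  would tend to 0 as \<sigma> decreases to 1.\<close>

lemma nonvanishing_on_line:
 assumes W: "W holomorphic_on UNIV" and Z: "\<And>s. s \<noteq> 1 \<Longrightarrow> Z s = W s / (s - 1)"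
  and ineq: "\<And>\<sigma>. \<sigma> > 1 \<Longrightarrow> 1 \<le> cmod (Z (of_real \<sigma>)) ^ 3 * cmod (Z (Complex \<sigma> \<tau>)) ^ 4 * cmod (Z (Complex \<sigma> (2 * \<tau>)))"
  and \<tau>: "\<tau> \<noteq> 0"
 shows "Z (Complex 1 \<tau>) \<noteq> 0"
proof
 assume zero: "Z (Complex 1 \<tau>) = 0"
 let ?s = "Complex 1 \<tau>" and ?F = "at_right (1::real)"
 have s1: "?s \<noteq> 1" "Complex 1 (2 * \<tau>) \<noteq> 1" using \<tau> by (auto simp: complex_eq_iff)
 have W0: "W ?s = 0" using zero Z[OF s1(1)] s1 by simp
 have cont: "(W \<longlongrightarrow> W s) (at s)" for s
  using W by (auto simp: holomorphic_on_imp_continuous_on continuous_on_eq_continuous_at isCont_def[symmetric] dest: holomorphic_on_imp_continuous_on)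
 have path: "filterlim (\<lambda>\<sigma>. Complex \<sigma> y) (at (Complex 1 y)) ?F" for y
  unfolding filterlim_at
 proof
  have "((\<lambda>\<sigma>. Complex \<sigma> y) \<longlongrightarrow> Complex 1 y) ?F" by (intro tendsto_intros)
  thus "((\<lambda>\<sigma>. Complex \<sigma> y) \<longlongrightarrow> Complex 1 y) ?F" .
  show "\<forall>\<^sub>F \<sigma> in ?F. Complex \<sigma> y \<in> UNIV \<and> Complex \<sigma> y \<noteq> Complex 1 y"
   using eventually_at_right_less[of 1] by eventually_elim auto
 qed
 obtain D where "(W has_field_derivative D) (at ?s)"
  using holomorphic_on_imp_differentiable_at[OF W] by (auto simp: field_differentiable_def)
 hence "((\<lambda>w. W w / (w - ?s)) \<longlongrightarrow> D) (at ?s)" by (simp add: has_field_derivative_iff W0)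
 from filterlim_compose[OF this path] have lim1: "((\<lambda>\<sigma>. W (Complex \<sigma> \<tau>) / of_real (\<sigma> - 1)) \<longlongrightarrow> D) ?F"
  by (simp add: Complex_eq algebra_simps)
 \<comment> \<open>The product regrouped into factors with finite limits and a single surplus factor
   \<open>\<sigma> - 1\<close>, from exponent 4 minus 3.\<close>
 let ?P = "\<lambda>\<sigma>. cmod (W (Complex \<sigma> 0)) ^ 3 * (cmod (W (Complex \<sigma> \<tau>) / of_real (\<sigma> - 1)) / cmod (Complex \<sigma> \<tau> - 1)) ^ 4 * (\<sigma> - 1)
   * (cmod (W (Complex \<sigma> (2 * \<tau>))) / cmod (Complex \<sigma> (2 * \<tau>) - 1))"
 have "(?P \<longlongrightarrow> cmod (W (Complex 1 0)) ^ 3 * (cmod D / cmod (Complex 1 \<tau> - 1)) ^ 4 * (1 - 1)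
   * (cmod (W (Complex 1 (2 * \<tau>))) / cmod (Complex 1 (2 * \<tau>) - 1))) ?F"
  using s1 by (intro tendsto_intros lim1 filterlim_compose[OF cont path]) auto
 moreover have "\<forall>\<^sub>F \<sigma> in ?F. 1 \<le> ?P \<sigma>"
  using eventually_at_right_less[of 1]
 proof eventually_elim
  case (elim \<sigma>)
  hence ne: "Complex \<sigma> y \<noteq> 1" for y by (auto simp: complex_eq_iff)
  have "complex_of_real \<sigma> = Complex \<sigma> 0" by (simp add: complex_eq_iff)
  hence "1 \<le> cmod (Z (Complex \<sigma> 0)) ^ 3 * cmod (Z (Complex \<sigma> \<tau>)) ^ 4 * cmod (Z (Complex \<sigma> (2 * \<tau>)))" using ineq[OF elim] by simp
  moreover have "cmod (Complex \<sigma> 0 - 1) = \<sigma> - 1" using elim by (simp add: cmod_def)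
  moreover have "(a / e) ^ 3 * (b / d) ^ 4 * c = a ^ 3 * (b / e / d) ^ 4 * e * c" if "e \<noteq> 0" for a b c d e :: real
   using that by (simp add: power_divide field_simps eval_nat_numeral)
  moreover have "cmod (complex_of_real \<sigma> - 1) = \<sigma> - 1" using elim by (simp add: cmod_def)
  ultimately show ?case using elim by (simp add: Z[OF ne] norm_divide)
 qed
 ultimately have "1 \<le> cmod (W (Complex 1 0)) ^ 3 * (cmod D / cmod (Complex 1 \<tau> - 1)) ^ 4 * (1 - 1)
   * (cmod (W (Complex 1 (2 * \<tau>))) / cmod (Complex 1 (2 * \<tau>) - 1))"
  by (intro tendsto_lowerbound) auto
 thus False by simp
qed

text \<open>Compactness on the interval from 1 to 2, then the recursion: the factor
  \<open>x - 1\<close> is at most \<open>exp (x - 1)\<close>, and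
  \<open>(x - 1) + (x - 1)^2 \<le> x^2\<close>.\<close>

lemma Gamma_growth:
 obtains B :: real where "B \<ge> 1" "\<And>x. x \<ge> 1 \<Longrightarrow> Gamma x \<le> B * exp (x\<^sup>2)"
proof -
 have "continuous_on {1..2} (Gamma :: real \<Rightarrow> real)" by (intro continuous_on_Gamma) (auto elim!: nonpos_Ints_cases)
 hence "bounded ((Gamma :: real \<Rightarrow> real) ` {1..2})" by (intro compact_imp_bounded compact_continuous_image) auto
 then obtain B :: real where "\<forall>x\<in>(Gamma :: real \<Rightarrow> real) ` {1..2}. norm x \<le> B" unfolding bounded_iff by blast
 hence B: "\<bar>Gamma x\<bar> \<le> B" if "x \<in> {1..2}" for x using that by auto
 have B1: "B \<ge> 1" using B[of 1] by simp
 have "\<And>x. 1 \<le> x \<Longrightarrow> x \<le> real m + 2 \<Longrightarrow> Gamma x \<le> B * exp (x\<^sup>2)" for m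
 proof (induction m)
  case 0
  hence "Gamma x \<le> B * 1" using B[of x] by auto
  also have "\<dots> \<le> B * exp (x\<^sup>2)" using B1 by (intro mult_left_mono) auto
  finally show ?case .
 next
  case (Suc m)
  show ?case
  proof (cases "x \<le> real m + 2")
   case False
   hence x: "x - 1 \<ge> 1" "x - 1 \<le> real m + 2" using Suc.prems by auto
   have "x - 1 \<notin> \<int>\<^sub>\<le>\<^sub>0" using x(1) by (auto elim!: nonpos_Ints_cases)
   hence "Gamma x = (x - 1) * Gamma (x - 1)" using Gamma_plus1[of "x - 1"] by simp
   also have "\<dots> \<le> exp (x - 1) * (B * exp ((x - 1)\<^sup>2))"
    using exp_ge_add_one_self[of "x - 1"] x by (intro mult_mono Suc.IH) (auto intro: Gamma_real_nonneg)
   also have "\<dots> = B * exp ((x - 1) + (x - 1)\<^sup>2)" by (simp add: exp_add)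
   also have "\<dots> \<le> B * exp (x\<^sup>2)" using x B1 by (intro mult_left_mono) (auto simp: power2_eq_square algebra_simps)
   finally show ?thesis .
  qed (use Suc in auto)
 qed
 hence "Gamma x \<le> B * exp (x\<^sup>2)" if "x \<ge> 1" for x using that real_nat_ceiling_ge[of x] by (meson add_increasing2 zero_le_numeral)
 thus ?thesis using B1 that by blast
qed

context nfield
begin

text \<open>The value chosen in \<open>discriminant\<close> belongs to some integral basis and some
  order of the embeddings. The order affects only the sign before squaring, and an integral change
  of basis to one with nonzero determinant exists. A positive base is needed to write the power in
  \<open>completed_zeta\<close> as an exponential.\<close>

lemma discriminant_nonzero: "discriminant K \<noteq> 0"
proof -
 let ?P = "\<lambda>d. \<exists>bs \<sigma>s. integral_basis K bs \<and> distinct \<sigma>s \<and> set \<sigma>s = embeddings K \<and> length \<sigma>s = length bs \<and>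
    d = (det_fun (length bs) (\<lambda>i j. (\<sigma>s ! i) (bs ! j)))\<^sup>2"
 obtain b where b: "basis b" "OK = lat b" using OK_lattice by (auto simp: is_lattice_def)
 have ib: "integral_basis K (map b [0..<n])" unfolding integral_basis_def
 proof (intro conjI ballI allI impI)
  show "set (map b [0..<n]) \<subseteq> OK" using b(2) basis_in_lat by auto
  show "\<exists>c. x = (\<Sum>i<length (map b [0..<n]). of_int (c i) * map b [0..<n] ! i)" if "x \<in> OK" for x
   using that unfolding b(2) lat_def by simp
  show "c i = 0" if "(\<Sum>i<length (map b [0..<n]). of_int (c i) * map b [0..<n] ! i) = 0" "i < length (map b [0..<n])" for c i
   using lat_coeffs_unique[OF b(1), of c "\<lambda>_. 0" i] that by simp
 qed
 have "distinct (map emb [0..<n])" "set (map emb [0..<n]) = embeddings K"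
  using bij_emb by (auto simp: distinct_map bij_betw_def lessThan_atLeast0)
 hence "\<exists>d. ?P d" using ib by (intro exI[of _ "(det_fun n (\<lambda>i j. (map emb [0..<n] ! i) (map b [0..<n] ! j)))\<^sup>2"]
   exI[of _ "map b [0..<n]"] exI[of _ "map emb [0..<n]"]) auto
 from someI_ex[OF this] obtain bs \<sigma>s where h: "integral_basis K bs" "distinct \<sigma>s" "set \<sigma>s = embeddings K" "length \<sigma>s = length bs"
  "discriminant K = (det_fun (length bs) (\<lambda>i j. (\<sigma>s ! i) (bs ! j)))\<^sup>2" unfolding discriminant_def by blast
 have len: "length bs = n" using distinct_card[OF h(2)] h(3,4) bij_betw_same_card[OF bij_emb] by simp
 let ?b' = "\<lambda>j. bs ! j"
 have b'O: "?b' j \<in> OK" if "j < n" for j using h(1) that len by (auto simp: integral_basis_def)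
 have "\<exists>c :: nat \<Rightarrow> int. b j = (\<Sum>k<n. of_int (c k) * ?b' k)" if "j < n" for j
  using h(1) basis_in_lat[OF that, of b] b(2) len unfolding integral_basis_def by auto
 then obtain c :: "nat \<Rightarrow> nat \<Rightarrow> int" where "\<And>j. j < n \<Longrightarrow> b j = (\<Sum>k<n. of_int (c j k) * ?b' k)" by metis
 hence "disc_mat b = disc_mat ?b' * of_int (fdet n (\<lambda>k j. c j k))"
  using b'O OK_subset_K by (intro disc_change_int) auto
 hence nz: "disc_mat ?b' \<noteq> 0" using b(1) by (auto simp: basis_def)
 define \<pi> where "\<pi> i = (if i < n then inv_into {..<n} emb (\<sigma>s ! i) else i)" for i
 have emb_\<pi>: "\<pi> i < n" "emb (\<pi> i) = \<sigma>s ! i" if "i < n" for i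
 proof -
  have "\<sigma>s ! i \<in> emb ` {..<n}" using h(3,4) len that bij_emb nth_mem[of i \<sigma>s] by (auto simp: bij_betw_def)
  thus "\<pi> i < n" "emb (\<pi> i) = \<sigma>s ! i" using that inv_into_into[of "\<sigma>s ! i" emb "{..<n}"] by (auto simp: \<pi>_def f_inv_into_f)
 qed
 have "inj_on \<pi> {0..<n}"
  using emb_\<pi> h(2,4) len by (intro inj_onI) (metis atLeastLessThan_iff nth_eq_iff_index_eq)
 hence "bij_betw \<pi> {0..<n} {0..<n}" using emb_\<pi>(1) by (intro bij_betw_imageI endo_inj_surj) auto
 hence "\<pi> permutes {0..<n}" by (rule bij_imp_permutes) (simp add: \<pi>_def)
 from fdet_permute_rows[OF this, of "\<lambda>i j. emb i (?b' j)"]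
 have "fdet n (\<lambda>i j. (\<sigma>s ! i) (?b' j)) = of_int (sign \<pi>) * disc_mat ?b'"
  using emb_\<pi>(2) by (simp add: disc_mat_def cong: fdet_cong)
 thus ?thesis using nz by (simp add: h(5) len det_fun_eq_fdet sign_def)
qed

lemma Lam_growth:
 obtains C where "C \<ge> 0" "\<And>x. x \<ge> 2 \<Longrightarrow> Lam x \<le> exp (C * x\<^sup>2)"
proof -
 obtain B :: real where B: "B \<ge> 1" "\<And>x. x \<ge> 1 \<Longrightarrow> Gamma x \<le> B * exp (x\<^sup>2)" using Gamma_growth by blast
 define r where "r = real (nf_r1 K + nf_r2 K)"
 define C where "C = \<bar>ln afactor\<bar> + r * (ln B + 1) + \<bar>ln (zreal 2)\<bar>"
 have C: "C \<ge> 0" using B(1) by (simp add: C_def r_def)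
 moreover have "Lam x \<le> exp (C * x\<^sup>2)" if x: "x \<ge> 2" for x
 proof -
  have x2: "x \<le> x\<^sup>2" "1 \<le> x\<^sup>2" "(x / 2)\<^sup>2 \<le> x\<^sup>2" using x mult_mono[of 1 x 1 x] by (auto simp: power2_eq_square)
  have z: "zreal x \<ge> 1" "zreal 2 \<ge> 1" using x zreal_ge_1 by auto
  have G: "Gamma (x / 2) \<le> B * exp (x\<^sup>2)" "Gamma x \<le> B * exp (x\<^sup>2)"
  proof -
   have "Gamma (x / 2) \<le> B * exp ((x / 2)\<^sup>2)" using x by (intro B) simp
   also have "\<dots> \<le> B * exp (x\<^sup>2)" using x2(3) B(1) by (intro mult_left_mono) auto
   finally show "Gamma (x / 2) \<le> B * exp (x\<^sup>2)" .
  qed (use x B in auto)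
  have "Lam x \<le> afactor powr x * (B * exp (x\<^sup>2)) ^ nf_r1 K * (B * exp (x\<^sup>2)) ^ nf_r2 K * zreal 2"
   unfolding Lam_def using x G z zreal_mono[OF x] B(1) afactor_pos
   by (intro mult_mono power_mono mult_nonneg_nonneg zero_le_power) (auto intro: Gamma_real_nonneg)
  also have "\<dots> = exp (x * ln afactor + r * (ln B + x\<^sup>2) + ln (zreal 2))"
  proof -
   have "(B * exp (x\<^sup>2)) ^ k = exp (real k * (ln B + x\<^sup>2))" for k
    using B(1) by (simp add: exp_add exp_of_nat_mult)
   thus ?thesis using afactor_pos z by (simp add: powr_def exp_add r_def algebra_simps)
  qed
  also have "\<dots> \<le> exp (C * x\<^sup>2)"
  proof -
   have "x * ln afactor \<le> x\<^sup>2 * \<bar>ln afactor\<bar>"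
   proof -
    have "x * ln afactor \<le> x * \<bar>ln afactor\<bar>" using x by (intro mult_left_mono) auto
    also have "\<dots> \<le> x\<^sup>2 * \<bar>ln afactor\<bar>" using x2(1) by (rule mult_right_mono) simp
    finally show ?thesis .
   qed
   moreover have "r * (ln B + x\<^sup>2) \<le> r * (ln B * x\<^sup>2 + x\<^sup>2)"
    using B(1) x2(2) mult_left_mono[of 1 "x\<^sup>2" "ln B"] by (intro mult_left_mono) (auto simp: r_def)
   moreover have "ln (zreal 2) \<le> \<bar>ln (zreal 2)\<bar> * x\<^sup>2" using x2(2) z mult_left_mono[of 1 "x\<^sup>2" "\<bar>ln (zreal 2)\<bar>"] by auto
   ultimately show ?thesis by (simp add: C_def algebra_simps)
  qed
  finally show ?thesis .
 qed
 ultimately show ?thesis using that by blast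
qed

lemma dedekind_series_real:
 assumes "x > 1"
 shows "dedekind_series K (of_real x) = of_real (zreal x)"
proof -
 have "(of_nat m :: complex) powr (- of_real x) = of_real (real m powr (- x))" for m
  using powr_of_real[of "real m" "- x"] by simp
 thus ?thesis by (simp add: dedekind_series_def zreal_def infsum_complex_of_real)
qed

text \<open>\<open>\<Psi>\<close> is the entire function from the Mellin transform. The reciprocal
  of the archimedean factor continues zeta explicitly, and all remaining factors of
  \<open>completed_zeta\<close>, including discriminant, degree and powers of 2, combine to the
  exponential of a linear function. Both \<open>THE\<close> descriptions are then resolved by the
  identity theorem.\<close>

theorem zeta_structure:
 obtains \<Psi> c\<^sub>0 c\<^sub>1 C where
  "\<Psi> holomorphic_on UNIV" "\<Psi> 0 \<noteq> 0" "C \<ge> 0" "\<And>s. cmod (\<Psi> s) \<le> exp (C * (1 + cmod s)\<^sup>2)"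
  "completed_zeta K = (\<lambda>s. exp (c\<^sub>0 + c\<^sub>1 * s) * \<Psi> s)"
  "nontrivial_zeros K = {\<rho>. \<Psi> \<rho> = 0}"
  "\<And>\<rho>. 0 < Re \<rho> \<Longrightarrow> \<rho> \<noteq> 1 \<Longrightarrow> zorder (dedekind_zeta K) \<rho> = zorder \<Psi> \<rho>"
proof -
 obtain \<Psi> v where v: "v > 0" and \<Psi>: "\<Psi> holomorphic_on UNIV" "\<And>s. \<Psi> (1 - s) = \<Psi> s" "\<Psi> 0 = of_real v"
  "\<And>x. x > 1 \<Longrightarrow> \<Psi> (of_real x) = complex_of_real (x * (x - 1) * Lam x)"
  "\<And>s. cmod (\<Psi> s) \<le> v + 3 * cmod s * (cmod s + 1) * Lam (2 + cmod s)"
  using dedekind_mellin by metis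
 define r1 r2 where "r1 = nf_r1 K" and "r2 = nf_r2 K"
 define l where "l = ln afactor"
 \<comment> \<open>\<open>G\<close> is the reciprocal of the archimedean factor, entire through
   \<open>rGamma\<close>. In \<open>H\<close> the zero at 0 of each \<open>rGamma\<close> factor has
   been taken out by the recursion.\<close>
 define G :: "complex \<Rightarrow> complex" where "G s = exp (- s * of_real l) * rGamma (s / 2) ^ r1 * rGamma s ^ r2" for s
 define H :: "complex \<Rightarrow> complex" where "H s = exp (- s * of_real l) * (rGamma (s / 2 + 1) / 2) ^ r1 * rGamma (s + 1) ^ r2" for s
 \<comment> \<open>There is at least one archimedean place, so \<open>G\<close> vanishes at 0 and
   one factor \<open>s\<close> can be cancelled against \<open>s * (s - 1)\<close>. This leaves only
   the pole at 1 for \<open>Z\<close>.\<close>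
 define q where "q s = s ^ (r1 + r2 - 1) * H s" for s
 define W where "W s = \<Psi> s * q s" for s
 define Z where "Z s = (if s = 1 then 0 else W s / (s - 1))" for s
 have GH: "G s = s * q s" for s
 proof -
  have rg: "rGamma (s / 2) = s * (rGamma (s / 2 + 1) / 2)" "rGamma s = s * rGamma (s + 1)"
   using rGamma_plus1[of "s / 2"] rGamma_plus1[of s] by simp_all
  have "G s = exp (- s * of_real l) * (s * (rGamma (s / 2 + 1) / 2)) ^ r1 * (s * rGamma (s + 1)) ^ r2"
   unfolding G_def rg by (rule refl)
  hence "G s = s ^ (r1 + r2) * H s" by (simp only: H_def power_mult_distrib power_add mult_ac)
  moreover obtain m where "r1 + r2 = Suc m" using r1_r2_pos unfolding r1_def r2_def by (metis gr0_implies_Suc)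
  hence "s ^ (r1 + r2) = s * s ^ (r1 + r2 - 1)" by simp
  ultimately show ?thesis by (simp add: q_def)
 qed
 have q: "q holomorphic_on A" for A unfolding q_def H_def by (intro holomorphic_intros) auto
 have q_nz: "q s \<noteq> 0" if "Re s > 0" for s
 proof -
  have "s / 2 + 1 \<notin> \<int>\<^sub>\<le>\<^sub>0" "s + 1 \<notin> \<int>\<^sub>\<le>\<^sub>0" using that by (auto elim!: nonpos_Ints_cases simp: complex_eq_iff)
  moreover have "s \<noteq> 0" using that by auto
  ultimately show ?thesis by (simp add: q_def H_def rGamma_eq_zero_iff)
 qed
 have W: "W holomorphic_on UNIV" unfolding W_def by (intro holomorphic_intros \<Psi>(1) q)
 have Zhol: "Z holomorphic_on - {1}"
  by (rule holomorphic_transform[of "\<lambda>s. W s / (s - 1)"]) (use holomorphic_on_subset[OF W] in \<open>auto intro!: holomorphic_intros simp: Z_def\<close>)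
 have half: "open {s. Re s > 1}" "connected {s. Re s > 1}" "{s. Re s > 1} \<subseteq> - {1}" "{s. Re s > 1} \<noteq> {}"
  by (auto simp: open_halfspace_Re_gt intro!: convex_connected convex_halfspace_Re_gt exI[of _ 2])
 have Gam: "Gamma s * rGamma s = 1" if "Re s > 0" for s :: complex
 proof -
  have "s \<notin> \<int>\<^sub>\<le>\<^sub>0" using that by (auto elim!: nonpos_Ints_cases)
  thus ?thesis by (simp add: rGamma_inverse_Gamma Gamma_eq_zero_iff)
 qed
 have GamG: "Gamma (s / 2) ^ r1 * Gamma s ^ r2 * G s = exp (- s * of_real l)" if "Re s > 0" for s
 proof -
  have "Gamma (s / 2) ^ r1 * Gamma s ^ r2 * G s = exp (- s * of_real l) * (Gamma (s / 2) * rGamma (s / 2)) ^ r1 * (Gamma s * rGamma s) ^ r2"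
   by (simp add: G_def power_mult_distrib mult_ac)
  thus ?thesis using Gam[of s] Gam[of "s / 2"] that by simp
 qed
 have Zreal: "Z (of_real x) = dedekind_series K (of_real x)" if x: "x > 1" for x
 proof -
  let ?x = "complex_of_real x"
  have "Z ?x * (?x * (?x - 1)) = \<Psi> ?x * G ?x" using x by (simp add: Z_def W_def GH)
  also have "\<Psi> ?x = of_real (x * (x - 1)) * (exp (?x * of_real l) * Gamma (?x / 2) ^ r1 * Gamma ?x ^ r2 * of_real (zreal x))"
   using afactor_pos Gamma_complex_of_real[of "x / 2"]
   by (simp add: \<Psi>(4)[OF x] Lam_def r1_def r2_def powr_def l_def Gamma_complex_of_real flip: exp_of_real)
  also have "\<dots> * G ?x = of_real (x * (x - 1)) * (exp (?x * of_real l) * (Gamma (?x / 2) ^ r1 * Gamma ?x ^ r2 * G ?x)) * of_real (zreal x)"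
   by (simp add: mult_ac)
  also have "\<dots> = of_real (zreal x) * (?x * (?x - 1))" using x by (simp add: GamG flip: exp_add)
  finally have "Z ?x = of_real (zreal x)" using x by (simp add: mult_right_cancel)
  thus ?thesis by (simp add: dedekind_series_real[OF x])
 qed
 have Zser: "Z s = dedekind_series K s" if "Re s > 1" for s
 proof -
  have "Z s - dedekind_series K s = 0"
  proof (rule analytic_continuation[where f = "\<lambda>s. Z s - dedekind_series K s" and S = "{s. Re s > 1}" and U = "of_real ` {1<..}" and \<xi> = 2])
   show "(\<lambda>s. Z s - dedekind_series K s) holomorphic_on {s. Re s > 1}"
    by (intro holomorphic_intros holomorphic_on_subset[OF Zhol half(3)] dedekind_series_holomorphic)
   show "2 islimpt complex_of_real ` {1<..}" unfolding islimpt_approachable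
   proof (intro allI impI)
    fix e :: real assume "e > 0"
    thus "\<exists>x'\<in>complex_of_real ` {1<..}. x' \<noteq> 2 \<and> dist x' 2 < e"
     by (intro bexI[of _ "of_real (2 + e / 2)"] imageI) (auto simp: dist_norm)
   qed
  qed (use half that Zreal in auto)
  thus ?thesis by simp
 qed
 have zeta: "dedekind_zeta K = Z" unfolding dedekind_zeta_def
 proof (rule the_equality)
  show "Z holomorphic_on - {1} \<and> Z 1 = 0 \<and> (\<forall>s. 1 < Re s \<longrightarrow> Z s = dedekind_series K s)"
   using Zhol Zser by (simp add: Z_def)
  fix f assume f: "f holomorphic_on - {1} \<and> f 1 = 0 \<and> (\<forall>s. 1 < Re s \<longrightarrow> f s = dedekind_series K s)"
  have conn: "connected (- {1 :: complex})" by (intro path_connected_imp_connected path_connected_punctured_universe) simp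
  have "f s = Z s" if s: "s \<noteq> 1" for s
  proof (rule analytic_continuation_open[where f = f and g = Z, OF half(1) _ half(4) conn half(3)])
   show "f z = Z z" if "z \<in> {s. 1 < Re s}" for z using f Zser[of z] that by simp
  qed (use f Zhol s in auto)
  thus "f = Z" using f by (intro ext) (auto simp: Z_def)
 qed
 have ineq: "1 \<le> cmod (Z (of_real \<sigma>)) ^ 3 * cmod (Z (Complex \<sigma> \<tau>)) ^ 4 * cmod (Z (Complex \<sigma> (2 * \<tau>)))" if "\<sigma> > 1" for \<sigma> \<tau>
  using dedekind_series_3_4_1[OF that, of \<tau>] that by (simp add: Zser)
 have Z\<Psi>: "Z s = 0 \<longleftrightarrow> \<Psi> s = 0" if "Re s > 0" "s \<noteq> 1" for s using that q_nz[of s] by (simp add: Z_def W_def)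
 \<comment> \<open>At \<open>s = 1\<close> the functional equation gives
   \<open>\<Psi> 1 = \<Psi> 0 = v > 0\<close>; elsewhere on the line the 3-4-1 argument applies, and
   to the right of it the same inequality directly.\<close>
 have right: "\<Psi> s \<noteq> 0" if s: "Re s \<ge> 1" for s
 proof (cases "s = 1")
  case True
  thus ?thesis using \<Psi>(2)[of 0] \<Psi>(3) v by simp
 next
  case False
  obtain x y where xy: "s = Complex x y" by (cases s) blast
  have "Z s \<noteq> 0"
  proof (cases "x = 1")
   case True
   hence "y \<noteq> 0" using False xy by (auto simp: complex_eq_iff)
   thus ?thesis using nonvanishing_on_line[OF W _ ineq] True xy by (simp add: Z_def)
  next
   case False
   hence "x > 1" using s xy by simp
   from ineq[OF this, of y] show ?thesis unfolding xy by auto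
  qed
  thus ?thesis using Z\<Psi>[of s] s False by simp
 qed
 \<comment> \<open>The functional equation reflects the zero-free half-plane
   \<open>Re s \<ge> 1\<close> to \<open>Re s \<le> 0\<close>, so all zeros of \<open>\<Psi>\<close>
   lie in the open strip, where the other factors of \<open>Z\<close> do not vanish.\<close>
 have zeros: "nontrivial_zeros K = {\<rho>. \<Psi> \<rho> = 0}"
 proof -
  have "0 < Re \<rho> \<and> Re \<rho> < 1" if "\<Psi> \<rho> = 0" for \<rho>
   using right[of \<rho>] right[of "1 - \<rho>"] \<Psi>(2)[of \<rho>] that by force
  moreover have "Z \<rho> = 0 \<longleftrightarrow> \<Psi> \<rho> = 0" if "0 < Re \<rho>" "Re \<rho> < 1" for \<rho> using Z\<Psi>[of \<rho>] that by force
  ultimately show ?thesis unfolding nontrivial_zeros_def zeta by blast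
 qed
 have ord: "zorder (dedekind_zeta K) \<rho> = zorder \<Psi> \<rho>" if \<rho>: "0 < Re \<rho>" "\<rho> \<noteq> 1" for \<rho>
 proof -
  have "\<Psi> 0 \<noteq> 0" using \<Psi>(3) v by simp
  from entire_factor_point[OF \<Psi>(1) this] obtain m h where
   h: "h holomorphic_on UNIV" "h \<rho> \<noteq> 0" "\<And>z. \<Psi> z = (z - \<rho>) ^ m * h z" "zorder \<Psi> \<rho> = int m" by metis
  have "zorder Z \<rho> = int m"
  proof (rule zorder_eqI)
   show "(\<lambda>s. h s * q s / (s - 1)) holomorphic_on - {1}"
    using holomorphic_on_subset[OF h(1)] by (intro holomorphic_intros q) auto
   show "Z w = h w * q w / (w - 1) * (w - \<rho>) powi int m" if "w \<in> - {1}" for w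
    using that by (simp add: Z_def W_def h(3)[of w])
  qed (use \<rho> h(2) q_nz in auto)
  thus ?thesis by (simp add: zeta h(4))
 qed
 \<comment> \<open>All powers are exponentials of linear functions of \<open>s\<close>:
   \<open>c0\<close> collects 1/2 and the constant part of \<open>2 powr ((1 - s) * r2)\<close>, and
   \<open>c1\<close> collects the rest together with \<open>- l\<close> from the Mellin
   transform.\<close>
 define d where "d = ln (cmod (discriminant K))"
 define c0 c1 where "c0 = complex_of_real (ln (1 / 2) + r2 * ln 2)"
  and "c1 = complex_of_real (d / 2 - r2 * ln 2 - field_degree K * ln pi / 2 - l)"
 let ?E = "\<lambda>s. exp (c0 + c1 * s) * \<Psi> s"
 let ?R = "\<lambda>s. 1/2 * s * (s - 1) * (complex_of_real (cmod (discriminant K))) powr (s / 2)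
    * (2::complex) powr ((1 - s) * of_nat (nf_r2 K)) * (complex_of_real pi) powr (- of_nat (field_degree K) * s / 2)
    * Gamma (s / 2) ^ nf_r1 K * Gamma s ^ nf_r2 K * dedekind_zeta K s"
 have E: "?E holomorphic_on UNIV" by (intro holomorphic_intros \<Psi>(1))
 have ER: "?E s = ?R s" if s: "Re s > 1" for s
 proof -
  have s1: "s \<noteq> 1" using s by auto
  have pw: "complex_of_real a powr w = exp (w * of_real (ln a))" if "a > 0" for a w using that by (simp add: powr_def Ln_of_real)
  have "?R s = 1/2 * exp (s / 2 * of_real d) * exp ((1 - s) * r2 * of_real (ln 2)) * exp (- of_nat (field_degree K) * s / 2 * of_real (ln pi))
    * (Gamma (s / 2) ^ r1 * Gamma s ^ r2 * (s * ((s - 1) * Z s)))"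
   using discriminant_nonzero pw[of 2] by (simp add: pw d_def zeta r1_def r2_def mult_ac)
  also have "s * ((s - 1) * Z s) = \<Psi> s * G s" using s1 by (simp add: Z_def W_def GH)
  also have "Gamma (s / 2) ^ r1 * Gamma s ^ r2 * (\<Psi> s * G s) = exp (- s * of_real l) * \<Psi> s"
   using GamG[of s] s by (simp add: mult_ac)
  also have "1/2 * exp (s / 2 * of_real d) * exp ((1 - s) * r2 * of_real (ln 2)) * exp (- of_nat (field_degree K) * s / 2 * of_real (ln pi))
    * (exp (- s * of_real l) * \<Psi> s) = ?E s"
  proof -
   have "(1/2 :: complex) = exp (of_real (ln (1/2)))" by (subst exp_of_real) simp
   hence "1/2 * exp (s / 2 * of_real d) * exp ((1 - s) * r2 * of_real (ln 2)) * exp (- of_nat (field_degree K) * s / 2 * of_real (ln pi)) * exp (- s * of_real l)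
    = exp (of_real (ln (1/2)) + s / 2 * of_real d + (1 - s) * r2 * of_real (ln 2) + - of_nat (field_degree K) * s / 2 * of_real (ln pi) + - s * of_real l)"
    by (simp only: exp_add)
   also have "of_real (ln (1/2)) + s / 2 * of_real d + (1 - s) * r2 * of_real (ln 2) + - of_nat (field_degree K) * s / 2 * of_real (ln pi) + - s * of_real l = c0 + c1 * s"
    by (simp add: c0_def c1_def algebra_simps)
   finally show ?thesis by (simp only: mult.assoc[symmetric])
  qed
  finally show ?thesis ..
 qed
 have comp: "completed_zeta K = ?E" unfolding completed_zeta_def
 proof (rule the_equality)
  show "?E holomorphic_on UNIV \<and> (\<forall>s. 1 < Re s \<longrightarrow> ?E s = ?R s)" using E ER by blast
  fix f assume f: "f holomorphic_on UNIV \<and> (\<forall>s. 1 < Re s \<longrightarrow> f s = ?R s)"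
  have "f s = ?E s" for s
  proof (rule analytic_continuation_open[where f = f and g = ?E, OF half(1) open_UNIV half(4)])
   fix z assume z: "z \<in> {s. 1 < Re s}"
   have "f z = ?R z" using f z by blast
   also have "\<dots> = ?E z" by (rule ER[symmetric]) (use z in simp)
   finally show "f z = ?E z" .
  qed (use f E in auto)
  thus "f = ?E" by blast
 qed
 obtain C where C: "C \<ge> 0" "\<And>x. x \<ge> 2 \<Longrightarrow> Lam x \<le> exp (C * x\<^sup>2)" using Lam_growth by blast
 \<comment> \<open>The factor 4 comes from \<open>2 + cmod s \<le> 2 * (1 + cmod s)\<close>,
   squared.\<close>
 have growth: "cmod (\<Psi> s) \<le> exp (4 * (v + 3 + C) * (1 + cmod s)\<^sup>2)" for s
 proof -
  define x where "x = 2 + cmod s"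
  have x: "x \<ge> 2" "1 \<le> x\<^sup>2" using one_le_power[of x 2] by (auto simp: x_def)
  have "3 * cmod s * (cmod s + 1) \<le> 3 * x * x" by (intro mult_mono) (auto simp: x_def)
  also have "\<dots> \<le> exp (3 * x\<^sup>2)" using exp_ge_add_one_self[of "3 * x\<^sup>2"] unfolding power2_eq_square mult.assoc by linarith
  finally have "3 * cmod s * (cmod s + 1) * Lam x \<le> exp (3 * x\<^sup>2) * exp (C * x\<^sup>2)"
   using C(2)[OF x(1)] Lam_pos[of x] x by (intro mult_mono) auto
  also have "\<dots> = exp ((3 + C) * x\<^sup>2)" by (simp add: exp_add algebra_simps)
  finally have "cmod (\<Psi> s) \<le> v + exp ((3 + C) * x\<^sup>2)" using \<Psi>(5)[of s] by (simp add: x_def)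
  also have "\<dots> \<le> (1 + v) * exp ((3 + C) * x\<^sup>2)" using v C(1) mult_left_mono[of 1 "exp ((3 + C) * x\<^sup>2)" v] by (simp add: algebra_simps)
  also have "\<dots> \<le> exp (v * x\<^sup>2) * exp ((3 + C) * x\<^sup>2)"
  proof (rule mult_right_mono)
   have "1 + v \<le> exp v" by (rule exp_ge_add_one_self)
   also have "\<dots> \<le> exp (v * x\<^sup>2)" using v x(2) by simp
   finally show "1 + v \<le> exp (v * x\<^sup>2)" .
  qed simp
  also have "\<dots> = exp ((v + 3 + C) * x\<^sup>2)" by (simp add: exp_add algebra_simps)
  also have "\<dots> \<le> exp ((v + 3 + C) * (2 * (1 + cmod s))\<^sup>2)"
   using v C(1) by (simp add: x_def)
  also have "\<dots> = exp (4 * (v + 3 + C) * (1 + cmod s)\<^sup>2)" unfolding power_mult_distrib by (simp add: mult_ac)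
  finally show ?thesis .
 qed
 show ?thesis by (rule that[OF \<Psi>(1) _ _ growth comp zeros ord]) (use \<Psi>(3) v C in auto)
qed

end

section \<open>The criterion\<close>

text \<open>The hypothesis says that the argument of \<open>w\<close> is a multiple of \<open>2 * pi / k\<close>; the
 bounds on \<open>w\<close> leave only the multiple \<open>0\<close>.\<close>

lemma real_of_real_power:
 fixes w :: complex
 assumes k: "k \<ge> 4" and wk: "w ^ k = of_real (cmod w ^ k)"
  and w: "Re w > 0" "\<bar>Im w\<bar> < 1/2" "Re w > 1/2 * cot (2 * pi / real k)"
 shows "Im w = 0"
proof -
 define \<phi> where "\<phi> = 2 * pi / real k"
 have \<phi>: "0 < \<phi>" "\<phi> \<le> pi / 2" using k by (auto simp: \<phi>_def field_simps)
 define \<theta> r where "\<theta> = Arg w" and "r = cmod w"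
 have w0: "w \<noteq> 0" using w by auto
 hence r: "r > 0" by (simp add: r_def)
 have wr: "w = of_real r * cis \<theta>" using w0 rcis_cmod_Arg[of w] by (simp add: \<theta>_def r_def rcis_def)
 have re: "Re w = r * cos \<theta>" and im: "Im w = r * sin \<theta>" by (simp_all add: wr)
 have "w ^ k = of_real (r ^ k) * cis (real k * \<theta>)" using Complex.DeMoivre[of \<theta> k] by (simp add: wr power_mult_distrib)
 hence "of_real (r ^ k) * cis (real k * \<theta>) = of_real (r ^ k) * 1" using wk by (simp add: r_def)
 hence "cis (real k * \<theta>) = 1" using r by simp
 hence "cos (real k * \<theta>) = 1" by (metis cis.sel(1) one_complex.sel(1))
 then obtain j :: int where "real k * \<theta> = j * 2 * pi" using cos_one_2pi_int by auto
 hence \<theta>: "\<theta> = j * \<phi>" using k by (simp add: \<phi>_def field_simps)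
 have bd: "-pi < \<theta>" "\<theta> \<le> pi" using Arg_bounded[of w] by (auto simp: \<theta>_def)
 have "cos \<theta> > 0" using w(1) r by (simp add: re zero_less_mult_iff)
 have abs: "\<bar>\<theta>\<bar> < \<phi>"
 proof (rule ccontr)
  assume "\<not> \<bar>\<theta>\<bar> < \<phi>"
  hence ge: "\<phi> \<le> \<bar>\<theta>\<bar>" "\<bar>\<theta>\<bar> \<le> pi" using bd by auto
  have c: "cos \<theta> \<le> cos \<phi>" using cos_mono_le_eq[of "\<bar>\<theta>\<bar>" \<phi>] ge \<phi> by auto
  have "\<bar>\<theta>\<bar> \<le> pi / 2"
  proof (rule ccontr)
   assume "\<not> \<bar>\<theta>\<bar> \<le> pi / 2"
   hence "cos \<bar>\<theta>\<bar> \<le> 0" using ge(2) cos_monotone_0_pi_le[of "pi / 2" "\<bar>\<theta>\<bar>"] by simp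
   thus False using \<open>cos \<theta> > 0\<close> by simp
  qed
  hence "sin \<phi> \<le> sin \<bar>\<theta>\<bar>" using ge \<phi> by (intro sin_monotone_2pi_le) auto
  also have "sin \<bar>\<theta>\<bar> = \<bar>sin \<theta>\<bar>"
   using \<open>\<bar>\<theta>\<bar> \<le> pi / 2\<close> sin_ge_zero[of "\<bar>\<theta>\<bar>"] pi_gt_zero by (cases "\<theta> \<ge> 0") auto
  finally have s: "sin \<phi> \<le> \<bar>sin \<theta>\<bar>" .
  have s0: "sin \<phi> > 0" using \<phi> by (intro sin_gt_zero) auto
  have c0: "cos \<phi> > 0" using c \<open>cos \<theta> > 0\<close> by linarith
  \<comment> \<open>If the argument were at least \<phi> in modulus, then
    \<open>cos \<theta> \<le> cos \<phi>\<close> and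
    \<open>sin \<phi> \<le> \<bar>sin \<theta>\<bar>\<close>. This gives \<open>Re w * sin \<phi>
    \<le> \<bar>Im w\<bar> * cos \<phi> < 1/2 * cos \<phi>\<close>, against the lower bound on
    \<open>Re w\<close>.\<close>
  have "Re w * sin \<phi> \<le> r * cos \<phi> * \<bar>sin \<theta>\<bar>"
   unfolding re using c s s0 r c0 \<open>cos \<theta> > 0\<close> by (intro mult_mono) auto
  also have "\<dots> = \<bar>Im w\<bar> * cos \<phi>" using r by (simp add: im abs_mult)
  also have "\<dots> < 1/2 * cos \<phi>" using w(2) c0 by (rule mult_strict_right_mono)
  finally have "Re w < 1/2 * cos \<phi> / sin \<phi>" using s0 by (simp add: field_simps)
  thus False using w(3) by (simp add: cot_def \<phi>_def)
 qed
 have "\<bar>real_of_int j\<bar> * \<phi> < 1 * \<phi>" using abs \<phi>(1) by (simp add: \<theta> abs_mult)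
 hence "\<bar>real_of_int j\<bar> < 1" using \<phi>(1) by (subst (asm) mult_less_cancel_right_pos) auto
 hence "j = 0" by linarith
 thus ?thesis by (simp add: im \<theta>)
qed

text \<open>Taking real parts, the nonnegative terms \<open>m a * (cmod (x a) - Re (x a))\<close>
  have sum 0, so each of them vanishes; a number whose real part equals its modulus is real.\<close>

lemma zero_sum_defect:
 fixes m :: "'a \<Rightarrow> real" and x :: "'a \<Rightarrow> complex"
 assumes sm: "(\<lambda>a. m a * cmod (x a)) summable_on A" and m: "\<And>a. a \<in> A \<Longrightarrow> m a > 0"
  and eq: "(\<Sum>\<^sub>\<infinity>a\<in>A. of_real (m a) * x a) = of_real (\<Sum>\<^sub>\<infinity>a\<in>A. m a * cmod (x a))" and a: "a \<in> A"
 shows "x a = of_real (cmod (x a))"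
proof -
 have "(\<lambda>a. norm (of_real (m a) * x a)) summable_on A"
  by (rule summable_on_cong[THEN iffD1, OF _ sm]) (simp add: norm_mult m less_imp_le)
 hence sx: "(\<lambda>a. of_real (m a) * x a) summable_on A" by (rule abs_summable_summable)
 have sr: "(\<lambda>a. m a * Re (x a)) summable_on A" using summable_on_Re[OF sx] by simp
 have "(\<Sum>\<^sub>\<infinity>a\<in>A. m a * Re (x a)) = (\<Sum>\<^sub>\<infinity>a\<in>A. m a * cmod (x a))"
  using infsum_Re[OF sx] eq by simp
 moreover have hs: "((\<lambda>a. m a * cmod (x a) - m a * Re (x a)) has_sum (\<Sum>\<^sub>\<infinity>a\<in>A. m a * cmod (x a)) + - (\<Sum>\<^sub>\<infinity>a\<in>A. m a * Re (x a))) A"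
  using has_sum_add[OF has_sum_infsum[OF sm] has_sum_uminusI[OF has_sum_infsum[OF sr]]] by simp
 ultimately have "(\<Sum>\<^sub>\<infinity>a\<in>A. m a * cmod (x a) - m a * Re (x a)) \<le> 0" using infsumI[OF hs] by simp
 moreover have "(\<lambda>a. m a * cmod (x a) - m a * Re (x a)) summable_on A" by (rule has_sum_imp_summable[OF hs])
 moreover have "0 \<le> m a * cmod (x a) - m a * Re (x a)" if "a \<in> A" for a
  using m[OF that] complex_Re_le_cmod[of "x a"] by simp
 ultimately have "m a * cmod (x a) - m a * Re (x a) = 0" using a by (rule nonneg_infsum_le_0D)
 hence "Re (x a) = cmod (x a)" using m[OF a] by simp
 moreover from this have "Im (x a) = 0" using cmod_power2[of "x a"] by simp
 ultimately show ?thesis by (simp add: complex_eq_iff)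
qed

text \<open>Outside the unit disc around \<open>a\<close>, division by \<open>(z - a) ^ m\<close>
  does not increase the modulus; on the disc a compactness bound is added to the constant. The
  exponential of a linear function fits into the quadratic bound.\<close>

lemma entire_quotient_growth:
 assumes \<Psi>: "\<And>z. cmod (\<Psi> z) \<le> exp (C * (1 + cmod z)\<^sup>2)" "C \<ge> 0" and \<Phi>: "\<Phi> holomorphic_on UNIV" "\<And>z. \<Psi> z = (z - a) ^ m * \<Phi> z"
 obtains C' where "\<And>z. cmod (exp (c0 + c1 * z) * \<Phi> z) \<le> exp (C' * (1 + dist a z)\<^sup>2)"
proof -
 let ?X = "\<lambda>z. exp (c0 + c1 * z) * \<Phi> z"
 have "continuous_on (cball a 1) ?X"
  using holomorphic_on_subset[OF \<Phi>(1)] by (intro holomorphic_on_imp_continuous_on holomorphic_intros) auto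
 hence "bounded (?X ` cball a 1)" by (intro compact_imp_bounded compact_continuous_image) auto
 then obtain B where B: "\<forall>x\<in>?X ` cball a 1. norm x \<le> B" unfolding bounded_iff by blast
 define D where "D = cmod c0 + cmod c1 + C"
 define C' where "C' = D * (1 + cmod a)\<^sup>2 + \<bar>B\<bar>"
 have D: "D \<ge> 0" using \<Psi>(2) by (simp add: D_def)
 have "cmod (?X z) \<le> exp (C' * (1 + dist a z)\<^sup>2)" for z
 proof (cases "dist a z \<le> 1")
  case True
  hence "cmod (?X z) \<le> \<bar>B\<bar>" using B by force
  also have "\<dots> \<le> exp \<bar>B\<bar>" using exp_ge_add_one_self[of "\<bar>B\<bar>"] by linarith
  also have "\<dots> \<le> exp (C' * (1 + dist a z)\<^sup>2)"
  proof -
   have "\<bar>B\<bar> * 1 \<le> C' * (1 + dist a z)\<^sup>2" using D by (intro mult_mono one_le_power) (auto simp: C'_def)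
   thus ?thesis by simp
  qed
  finally show ?thesis .
 next
  case False
  hence "1 \<le> cmod (z - a) ^ m" by (intro one_le_power) (simp add: dist_norm norm_minus_commute)
  hence "cmod (\<Phi> z) \<le> cmod (\<Psi> z)" using mult_right_mono[of 1 "cmod (z - a) ^ m" "cmod (\<Phi> z)"] by (simp add: \<Phi>(2) norm_mult norm_power)
  hence "cmod (\<Phi> z) \<le> exp (C * (1 + cmod z)\<^sup>2)" using \<Psi>(1)[of z] by linarith
  moreover have "cmod (exp (c0 + c1 * z)) \<le> exp ((cmod c0 + cmod c1) * (1 + cmod z)\<^sup>2)"
  proof -
   have sq: "1 \<le> (1 + cmod z)\<^sup>2" "cmod z \<le> (1 + cmod z)\<^sup>2" by (auto simp: power2_eq_square algebra_simps)
   have "cmod (c0 + c1 * z) \<le> cmod c0 * 1 + cmod c1 * cmod z" using norm_triangle_ineq[of c0 "c1 * z"] by (simp add: norm_mult)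
   also have "\<dots> \<le> cmod c0 * (1 + cmod z)\<^sup>2 + cmod c1 * (1 + cmod z)\<^sup>2" using sq by (intro add_mono mult_left_mono) auto
   finally have "cmod (c0 + c1 * z) \<le> (cmod c0 + cmod c1) * (1 + cmod z)\<^sup>2" by (simp add: algebra_simps)
   hence "exp (cmod (c0 + c1 * z)) \<le> exp ((cmod c0 + cmod c1) * (1 + cmod z)\<^sup>2)" by simp
   thus ?thesis using norm_exp[of "c0 + c1 * z"] by linarith
  qed
  ultimately have "cmod (?X z) \<le> exp ((cmod c0 + cmod c1) * (1 + cmod z)\<^sup>2) * exp (C * (1 + cmod z)\<^sup>2)"
   unfolding norm_mult by (intro mult_mono) auto
  also have "\<dots> = exp (D * (1 + cmod z)\<^sup>2)" by (simp add: D_def exp_add[symmetric] algebra_simps)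
  also have "\<dots> \<le> exp (C' * (1 + dist a z)\<^sup>2)"
  proof -
   have "cmod z \<le> cmod a + dist a z" using norm_triangle_ineq4[of a "a - z"] by (simp add: dist_norm)
   hence "1 + cmod z \<le> (1 + cmod a) * (1 + dist a z)" using mult_nonneg_nonneg[OF norm_ge_zero[of a] zero_le_dist[of a z]] unfolding distrib_left distrib_right by linarith
   hence "D * (1 + cmod z)\<^sup>2 \<le> D * ((1 + cmod a) * (1 + dist a z))\<^sup>2" using D by (intro mult_left_mono power_mono) auto
   also have "\<dots> \<le> C' * (1 + dist a z)\<^sup>2" unfolding C'_def power_mult_distrib by (simp add: distrib_right[of "D * (1 + cmod a)\<^sup>2"] mult.assoc)
   finally show ?thesis by simp
  qed
  finally show ?thesis .
 qed
 thus ?thesis using that by blast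
qed

theorem mainTheorem1:
 fixes K :: "complex set" and k :: nat
 assumes "number_field K" and "odd k" and "k > 1"
 shows "(ERH K \<longrightarrow>
      (-1) ^ ((k - 1) div 2) / of_nat (fact k)
       * (deriv ^^ k) (\<lambda>s. deriv (Xi K) s / Xi K s) (1/2)
      = complex_of_real (\<Sum>\<^sub>\<infinity>\<rho>\<in>nontrivial_zeros K - {1/2}.
         real (nat (zorder (dedekind_zeta K) \<rho>)) / cmod (1/2 - \<rho>) ^ (k + 1)))
    \<and> ((-1) ^ ((k - 1) div 2) / of_nat (fact k)
       * (deriv ^^ k) (\<lambda>s. deriv (Xi K) s / Xi K s) (1/2)
      = complex_of_real (\<Sum>\<^sub>\<infinity>\<rho>\<in>nontrivial_zeros K - {1/2}.
         real (nat (zorder (dedekind_zeta K) \<rho>)) / cmod (1/2 - \<rho>) ^ (k + 1))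
     \<longrightarrow> (\<forall>\<rho>\<in>nontrivial_zeros K.
         \<bar>Im \<rho>\<bar> > 1/2 * cot (2 * pi / real (k + 1)) \<longrightarrow> Re \<rho> = 1/2))"
proof -
 obtain t p rs n where "nfield K t p rs n" using nfield_exists[OF assms(1)] .
 then interpret nfield K t p rs n .
 obtain \<Psi> c0 c1 C where \<Psi>: "\<Psi> holomorphic_on UNIV" "\<Psi> 0 \<noteq> 0" "C \<ge> 0" "\<And>s. cmod (\<Psi> s) \<le> exp (C * (1 + cmod s)\<^sup>2)"
  and comp: "completed_zeta K = (\<lambda>s. exp (c0 + c1 * s) * \<Psi> s)"
  and zeros: "nontrivial_zeros K = {\<rho>. \<Psi> \<rho> = 0}"
  and ord: "\<And>\<rho>. 0 < Re \<rho> \<Longrightarrow> \<rho> \<noteq> 1 \<Longrightarrow> zorder (dedekind_zeta K) \<rho> = zorder \<Psi> \<rho>"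
  by (rule zeta_structure) (rule that, assumption+)
 obtain m \<Phi> where \<Phi>: "\<Phi> holomorphic_on UNIV" "\<Phi> (1/2) \<noteq> 0" "\<And>z. \<Psi> z = (z - 1/2) ^ m * \<Phi> z" "zorder \<Psi> (1/2) = int m"
  using entire_factor_point[OF \<Psi>(1,2), of "1/2"] by metis
 have central: "central_order K = m" using ord[of "1/2"] \<Phi>(4) by (simp add: central_order_def)
 define X where "X s = exp (c0 + c1 * s) * \<Phi> s" for s
 have X: "X holomorphic_on UNIV" "X (1/2) \<noteq> 0" using \<Phi>(1,2) by (auto simp: X_def[abs_def] intro!: holomorphic_intros)
 have Xq: "X s = completed_zeta K s / (s - 1/2) ^ m" if "s \<noteq> 1/2" for s using that by (simp add: comp X_def \<Phi>(3))
 have Xi: "Xi K = X" unfolding Xi_def central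
 proof (rule the_equality)
  show "X holomorphic_on UNIV \<and> (\<forall>s. s \<noteq> 1/2 \<longrightarrow> X s = completed_zeta K s / (s - 1/2) ^ m)" using X(1) Xq by blast
  fix g assume g: "g holomorphic_on UNIV \<and> (\<forall>s. s \<noteq> 1/2 \<longrightarrow> g s = completed_zeta K s / (s - 1/2) ^ m)"
  have "0 \<in> - {1/2 :: complex}" by simp
  hence ne: "- {1/2 :: complex} \<noteq> {}" by blast
  have "g s = X s" for s
   by (rule analytic_continuation_open[where f = g and g = X and s = "- {1/2}", OF _ open_UNIV ne]) (use g X(1) Xq in auto)
  thus "g = X" by blast
 qed
 let ?A = "nontrivial_zeros K - {1/2}"
 have zX: "{\<rho>. X \<rho> = 0} = ?A" using \<Phi>(2) by (auto simp: zeros X_def \<Phi>(3))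
 have strip: "0 < Re \<rho>" "Re \<rho> < 1" if "\<rho> \<in> ?A" for \<rho> using that by (auto simp: nontrivial_zeros_def)
 \<comment> \<open>Near such a zero, zeta, \<open>\<Psi>\<close> and \<open>X\<close> differ by
   nonvanishing holomorphic factors, so multiplicities agree. Their positivity is what later allows
   individual terms to be recovered from a sum.\<close>
 have ordX: "zorder (dedekind_zeta K) \<rho> = zorder X \<rho>" "zorder X \<rho> > 0" if \<rho>: "\<rho> \<in> ?A" for \<rho>
 proof -
  obtain i h where h: "h holomorphic_on UNIV" "h \<rho> \<noteq> 0" "\<And>z. X z = (z - \<rho>) ^ i * h z" "zorder X \<rho> = int i"
   using entire_factor_point[OF X, of \<rho>] by metis
  have "X \<rho> = 0" using \<rho> zX by blast
  thus "zorder X \<rho> > 0" using h by (cases i) auto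
  have "zorder \<Psi> \<rho> = int i"
  proof (rule zorder_eqI)
   show "(\<lambda>z. (z - 1/2) ^ m * exp (- (c0 + c1 * z)) * h z) holomorphic_on UNIV" by (intro holomorphic_intros h(1))
   show "\<Psi> w = (w - 1/2) ^ m * exp (- (c0 + c1 * w)) * h w * (w - \<rho>) powi int i" for w
   proof -
    have e: "exp (- (c0 + c1 * w)) * exp (c0 + c1 * w) = 1" by (simp only: mult_exp_exp left_minus exp_zero)
    have "(w - 1/2) ^ m * exp (- (c0 + c1 * w)) * X w = (w - 1/2) ^ m * ((exp (- (c0 + c1 * w)) * exp (c0 + c1 * w)) * \<Phi> w)"
     unfolding X_def by (simp only: mult.assoc)
    hence "\<Psi> w = (w - 1/2) ^ m * exp (- (c0 + c1 * w)) * X w" by (simp only: e mult_1_left \<Phi>(3)[of w])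
    thus ?thesis by (simp add: h(3)[of w])
   qed
  qed (use \<rho> h(2) in auto)
  thus "zorder (dedekind_zeta K) \<rho> = zorder X \<rho>" using ord[of \<rho>] strip[OF \<rho>] h(4) by force
 qed
 obtain C' where growth: "\<And>z. cmod (X z) \<le> exp (C' * (1 + dist (1/2) z)\<^sup>2)"
  using entire_quotient_growth[OF \<Psi>(4,3) \<Phi>(1,3), of c0 c1] unfolding X_def by metis
 obtain j where j: "k = 2 * j + 1" using assms(2) by (elim oddE) blast
 have k: "k \<ge> 3" "k + 1 = 2 * (j + 1)" "(k - 1) div 2 = j" using assms(3) j by auto
 define \<mu> where "\<mu> \<rho> = real (nat (zorder (dedekind_zeta K) \<rho>))" for \<rho>
 \<comment> \<open>With \<open>k + 1 = 2 * (j + 1)\<close> the total sign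
   \<open>(-1)^j * (-1)^k = (-1)^(j + 1)\<close> is absorbed into the base
   \<open>- ((1/2 - \<rho>)^2)\<close>, which is a positive real for zeros on the critical line
   other than 1/2.\<close>
 define x where "x \<rho> = inverse ((- ((1/2 - \<rho>)\<^sup>2)) ^ (j + 1))" for \<rho> :: complex
 have \<mu>: "\<mu> \<rho> > 0" if "\<rho> \<in> ?A" for \<rho> using ordX[OF that] by (simp add: \<mu>_def)
 have pw: "(1/2 - \<rho>) ^ (k + 1) = (- 1) ^ (j + 1) * (- ((1/2 - \<rho>)\<^sup>2)) ^ (j + 1)" for \<rho> :: complex
  unfolding k(2) power_mult power_mult_distrib[symmetric] by simp
 have cx: "cmod (x \<rho>) = 1 / cmod (1/2 - \<rho>) ^ (k + 1)" for \<rho>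
  unfolding x_def norm_inverse norm_power norm_minus_cancel k(2) power_mult by (rule inverse_eq_divide)
 note exps = log_derivative_expansion[OF X growth k(1), unfolded zX]
 have sm: "(\<lambda>\<rho>. \<mu> \<rho> * cmod (x \<rho>)) summable_on ?A"
  by (rule summable_on_cong[THEN iffD1, OF _ exps(1)]) (simp add: \<mu>_def cx ordX)
 have lhs: "(-1) ^ ((k - 1) div 2) / of_nat (fact k) * (deriv ^^ k) (\<lambda>s. deriv (Xi K) s / Xi K s) (1/2) = (\<Sum>\<^sub>\<infinity>\<rho>\<in>?A. of_real (\<mu> \<rho>) * x \<rho>)"
 proof -
  have "(-1) ^ ((k - 1) div 2) / of_nat (fact k) * (deriv ^^ k) (\<lambda>s. deriv (Xi K) s / Xi K s) (1/2) =
    (-1) ^ (j + 1) * (\<Sum>\<^sub>\<infinity>\<rho>\<in>?A. of_nat (nat (zorder X \<rho>)) / (1/2 - \<rho>) ^ (k + 1))"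
  proof -
   have alg: "(-1) ^ j / F * ((-1) ^ k * F * T) = (-1) ^ (j + 1) * T" if "F \<noteq> 0" for F T :: complex
    using that by (simp add: j)
   show ?thesis unfolding Xi exps(2) k(3) of_nat_fact by (rule alg) simp
  qed
  also have "\<dots> = (\<Sum>\<^sub>\<infinity>\<rho>\<in>?A. (-1) ^ (j + 1) * (of_nat (nat (zorder X \<rho>)) / (1/2 - \<rho>) ^ (k + 1)))"
   by (rule infsum_cmult_right'[symmetric])
  also have "\<dots> = (\<Sum>\<^sub>\<infinity>\<rho>\<in>?A. of_real (\<mu> \<rho>) * x \<rho>)"
  proof (rule infsum_cong)
   fix \<rho> assume "\<rho> \<in> ?A"
   have "(-1 :: complex) ^ (j + 1) * (-1) ^ (j + 1) = 1" by (simp flip: power_add mult_2)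
   hence alg: "(-1) ^ (j + 1) * (c / ((-1) ^ (j + 1) * d)) = c * inverse d" for c d :: complex
    by (cases "even j") (auto simp: divide_inverse)
   show "(-1) ^ (j + 1) * (of_nat (nat (zorder X \<rho>)) / (1/2 - \<rho>) ^ (k + 1)) = of_real (\<mu> \<rho>) * x \<rho>"
    unfolding pw x_def \<mu>_def ordX(1)[OF \<open>\<rho> \<in> ?A\<close>] of_real_of_nat_eq by (rule alg)
  qed
  finally show ?thesis .
 qed
 have rhs: "(\<Sum>\<^sub>\<infinity>\<rho>\<in>?A. real (nat (zorder (dedekind_zeta K) \<rho>)) / cmod (1/2 - \<rho>) ^ (k + 1)) = (\<Sum>\<^sub>\<infinity>\<rho>\<in>?A. \<mu> \<rho> * cmod (x \<rho>))"
  by (simp add: \<mu>_def cx)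
 show ?thesis unfolding lhs rhs
 proof (intro conjI impI ballI)
  assume erh: "ERH K"
  have "of_real (\<mu> \<rho>) * x \<rho> = of_real (\<mu> \<rho> * cmod (x \<rho>))" if "\<rho> \<in> ?A" for \<rho>
  proof -
   have "Re \<rho> = 1/2" using erh that by (simp add: ERH_def)
   hence "- ((1/2 - \<rho>)\<^sup>2) = of_real ((Im \<rho>)\<^sup>2)" by (simp add: complex_eq_iff power2_eq_square)
   hence "x \<rho> = of_real (inverse (((Im \<rho>)\<^sup>2) ^ (j + 1)))" by (simp add: x_def)
   moreover have "inverse (((Im \<rho>)\<^sup>2) ^ (j + 1)) \<ge> 0" by simp
   ultimately show ?thesis by (simp only: norm_of_real abs_of_nonneg of_real_mult)
  qed
  thus "(\<Sum>\<^sub>\<infinity>\<rho>\<in>?A. of_real (\<mu> \<rho>) * x \<rho>) = complex_of_real (\<Sum>\<^sub>\<infinity>\<rho>\<in>?A. \<mu> \<rho> * cmod (x \<rho>))"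
   unfolding infsum_complex_of_real[symmetric] by (rule infsum_cong)
 next
  fix \<rho> assume eq: "(\<Sum>\<^sub>\<infinity>\<rho>\<in>?A. of_real (\<mu> \<rho>) * x \<rho>) = complex_of_real (\<Sum>\<^sub>\<infinity>\<rho>\<in>?A. \<mu> \<rho> * cmod (x \<rho>))"
   and \<rho>: "\<rho> \<in> nontrivial_zeros K" and large: "\<bar>Im \<rho>\<bar> > 1/2 * cot (2 * pi / real (k + 1))"
  define \<phi> where "\<phi> = 2 * pi / real (k + 1)"
  have \<phi>: "0 < \<phi>" "\<phi> \<le> pi / 2" using k(1) by (auto simp: \<phi>_def field_simps)
  have "cos \<phi> \<ge> 0" by (rule cos_ge_zero) (use \<phi> pi_gt_zero in linarith)+
  moreover have "sin \<phi> \<ge> 0" by (rule sin_ge_zero) (use \<phi> pi_gt_zero in linarith)+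
  ultimately have "cot \<phi> \<ge> 0" unfolding cot_def by (rule divide_nonneg_nonneg)
  \<comment> \<open>Since \<open>k + 1 \<ge> 4\<close>, the angle is at most \<open>pi / 2\<close>,
    the threshold is nonnegative, and the zero in question is not real.\<close>
  hence im: "\<bar>Im \<rho>\<bar> > 0" using large unfolding \<phi>_def by linarith
  hence "\<rho> \<noteq> 1/2" by (auto simp: complex_eq_iff)
  hence A: "\<rho> \<in> ?A" using \<rho> by simp
  \<comment> \<open>Rotation by a quarter turn, in the direction that makes the real part positive:
    it becomes the modulus of the ordinate, while the imaginary part measures the distance from the
    critical line. The square is the base used in \<open>x\<close>.\<close>
  define w where "w = (if Im \<rho> > 0 then \<i> else - \<i>) * (1/2 - \<rho>)"
  have w2: "w\<^sup>2 = - ((1/2 - \<rho>)\<^sup>2)" by (simp add: w_def power_mult_distrib)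
  have wk: "w ^ (k + 1) = (- ((1/2 - \<rho>)\<^sup>2)) ^ (j + 1)" unfolding k(2) power_mult w2 ..
  have rw: "Re w = \<bar>Im \<rho>\<bar>" "\<bar>Im w\<bar> = \<bar>1/2 - Re \<rho>\<bar>" using im by (auto simp: w_def)
  have "x \<rho> = of_real (cmod (x \<rho>))" by (rule zero_sum_defect[OF sm \<mu> eq A])
  hence "inverse (w ^ (k + 1)) = of_real (cmod (inverse (w ^ (k + 1))))" by (simp only: x_def wk)
  from arg_cong[OF this, of inverse] have "w ^ (k + 1) = inverse (of_real (cmod (inverse (w ^ (k + 1)))))" by (simp only: inverse_inverse_eq)
  also have "\<dots> = of_real (cmod w ^ (k + 1))" unfolding norm_inverse norm_power of_real_inverse by (rule inverse_inverse_eq)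
  finally have "w ^ (k + 1) = of_real (cmod w ^ (k + 1))" .
  moreover have "\<bar>1/2 - Re \<rho>\<bar> < 1/2" using strip[OF A] unfolding abs_less_iff by simp
  ultimately have "Im w = 0" using k(1) im large by (intro real_of_real_power[of "k + 1"]) (auto simp: rw)
  thus "Re \<rho> = 1/2" using rw(2) by simp
 qed
qed

end
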